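(* Let $n\geqslant 1$ be an integer, $\ell>-1$ and $\mu,\nu^2\geqslant 0$ real constants such that $\delta\doteq(\mu-1)^2-4\nu^2\geqslant 0$. Assume that $p=p_{\mathrm{Str}}\big(n+\tfrac{\mu}{\ell+1},\ell\big)$ (with $p>1$), i.e. $p$ is the larger root of the quadratic equation $$\left(\tfrac{n-1}{2}(\ell+1)+\tfrac{\ell+\mu}{2}\right)p^2-\left(\tfrac{n+1}{2}(\ell+1)+\tfrac{\mu-3\ell}{2}\right)p-(\ell+1)=0.$$ Let $(u_0,u_1)\in\mathcal{C}^2_0(\mathbb{R}^n)\times\mathcal{C}^1_0(\mathbb{R}^n)$ be nonnegative, nontrivial and compactly supported functions with supports contained in $B_R$ for some $R>0$, such that $u_1+\frac{\mu-1-\sqrt{\delta}}{2}u_0\geqslant 0$ and $$\int_{\mathbb{R}^n}\left(u_1(x)+\tfrac{\mu-1+\sqrt{\delta}}{2}u_0(x)\right)\mathrm{d}x>0.$$ For $\varepsilon>0$, let $u\in\mathcal{C}^2\big([1,T)\times\mathbb{R}^n\big)$ be a classical solution, with lifespan $T=T(\varepsilon)$, to the Cauchy problem $$\begin{cases}\partial_t^2u-t^{2\ell}\Delta u+\mu t^{-1}\partial_tu+\nu^2t^{-2}u=|u|^p, & x\in\mathbb{R}^n,\ t>1,\\ u(1,x)=\varepsilon u_0(x), & x\in\mathbb{R}^n,\\ \partial_tu(1,x)=\varepsilon u_1(x), & x\in\mathbb{R}^n.\end{cases}$$ Then there exists a positive constant $\varepsilon_0=\varepsilon_0(u_0,u_1,n,p,\ell,\mu,\nu^2,R)$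 such that for any $\varepsilon\in(0,\varepsilon_0]$ the solution $u$ blows up in finite time. Furthermore, the upper bound estimate for the lifespan $$T(\varepsilon)\leqslant\exp\left(E\varepsilon^{-p(p-1)}\right)$$ holds for any $\varepsilon\in(0,\varepsilon_0]$, where the positive constant $E$ is independent of $\varepsilon$.
   Context: $B_R$ is the ball in $\mathbb{R}^n$ around the origin with radius $R$. The symbol $\nu^2$ denotes a nonnegative real constant. Solutions are real-valued. The lifespan $T(\varepsilon)\in(1,\infty]$ of a solution is its maximal existence time, and "blows up in finite time" means $T(\varepsilon)<\infty$. The power $p$ in the nonlinearity is always assumed to satisfy $p>1$. $p_{\mathrm{Str}}(n,\ell)$ denotes the larger root of $\big(\tfrac{n-1}{2}+\tfrac{\ell}{2(\ell+1)}\big)p^2-\big(\tfrac{n+1}{2}-\tfrac{3\ell}{2(\ell+1)}\big)p-1=0$; replacing $n$ by $n+\tfrac{\mu}{\ell+1}$ and multiplying by $\ell+1$ gives the equation in the claim. *)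

theory Defs
  imports "HOL-Analysis.Analysis"
begin

text \<open>Larger root of the quadratic equation defining the Strauss-type exponent; the
  dimension parameter \<open>N\<close> is real because it gets shifted to a non-integer value.
  A predicate is used so that nothing is asserted when there is no real root.\<close>

definition strauss_poly :: "real \<Rightarrow> real \<Rightarrow> real \<Rightarrow> real" where
  "strauss_poly N l q =
     ((N - 1) / 2 + l / (2 * (l + 1))) * q^2 - ((N + 1) / 2 - 3 * l / (2 * (l + 1))) * q - 1"

definition is_p_Str :: "real \<Rightarrow> real \<Rightarrow> real \<Rightarrow> bool" where
  "is_p_Str N l p \<longleftrightarrow>
     strauss_poly N l p = 0 \<and> (\<forall>q. strauss_poly N l q = 0 \<longrightarrow> q \<le> p)"

lemma strauss_poly_shifted:
  fixes n l \<mu> q :: real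
  assumes "l > -1"
  shows "(l + 1) * strauss_poly (n + \<mu> / (l + 1)) l q =
    ((n - 1) / 2 * (l + 1) + (l + \<mu>) / 2) * q^2
      - ((n + 1) / 2 * (l + 1) + (\<mu> - 3 * l) / 2) * q - (l + 1)"
proof -
  have nz: "l + 1 \<noteq> 0" using assms by simp
  have A: "(l + 1) * ((n + \<mu> / (l + 1) - 1) / 2 + l / (2 * (l + 1)))
      = (n - 1) / 2 * (l + 1) + (l + \<mu>) / 2"
    using nz by (simp add: divide_simps) (simp add: algebra_simps)
  have B: "(l + 1) * ((n + \<mu> / (l + 1) + 1) / 2 - 3 * l / (2 * (l + 1)))
      = (n + 1) / 2 * (l + 1) + (\<mu> - 3 * l) / 2"
    using nz by (simp add: divide_simps) (simp add: algebra_simps)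
  have "c * (a * x - b * y - 1) = (c * a) * x - (c * b) * y - c" for a b c x y :: real
    by (simp add: algebra_simps)
  thus ?thesis unfolding strauss_poly_def by (simp only: A B)
qed

lemma is_p_Str_shifted_iff:
  fixes n l \<mu> p :: real
  assumes "l > -1"
  defines "Q \<equiv> \<lambda>q::real. ((n - 1) / 2 * (l + 1) + (l + \<mu>) / 2) * q^2
      - ((n + 1) / 2 * (l + 1) + (\<mu> - 3 * l) / 2) * q - (l + 1)"
  shows "is_p_Str (n + \<mu> / (l + 1)) l p \<longleftrightarrow> Q p = 0 \<and> (\<forall>q. Q q = 0 \<longrightarrow> q \<le> p)"
proof -
  have "Q q = (l + 1) * strauss_poly (n + \<mu> / (l + 1)) l q" for q
    using strauss_poly_shifted[OF assms(1)] by (simp add: Q_def)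
  hence "Q q = 0 \<longleftrightarrow> strauss_poly (n + \<mu> / (l + 1)) l q = 0" for q
    using assms(1) by simp
  thus ?thesis by (simp add: is_p_Str_def)
qed

text \<open>\<open>k\<close>-fold continuous differentiability of real-valued functions, by recursion on the
  partial derivatives. Derivatives are taken within \<open>S\<close>, so on \<open>[1,T) \<times> \<real>\<^sup>n\<close> they are
  one-sided in time at \<open>t = 1\<close>.\<close>

primrec Ck_on :: "nat \<Rightarrow> 'a::euclidean_space set \<Rightarrow> ('a \<Rightarrow> real) \<Rightarrow> bool" where
  "Ck_on 0 S f \<longleftrightarrow> continuous_on S f"
| "Ck_on (Suc k) S f \<longleftrightarrow>
     (\<exists>g::'a \<Rightarrow> 'a. (\<forall>x\<in>S. (f has_derivative (\<lambda>h. g x \<bullet> h)) (at x within S)) \<and>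
        (\<forall>b\<in>Basis. Ck_on k S (\<lambda>x. g x \<bullet> b)))"

definition supp :: "('a::euclidean_space \<Rightarrow> real) \<Rightarrow> 'a set" where
  "supp f = closure {x. f x \<noteq> 0}"

definition Ck0 :: "nat \<Rightarrow> ('a::euclidean_space \<Rightarrow> real) \<Rightarrow> bool" where
  "Ck0 k f \<longleftrightarrow> Ck_on k UNIV f \<and> compact (supp f)"

definition partial_deriv :: "'a::euclidean_space \<Rightarrow> ('a \<Rightarrow> real) \<Rightarrow> 'a \<Rightarrow> real" where
  "partial_deriv b f x = deriv (\<lambda>s. f (x + s *\<^sub>R b)) 0"

definition laplacian :: "('a::euclidean_space \<Rightarrow> real) \<Rightarrow> 'a \<Rightarrow> real" where
  "laplacian f x = (\<Sum>b\<in>Basis. partial_deriv b (partial_deriv b f) x)"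

definition time_interval :: "ereal \<Rightarrow> real set" where
  "time_interval T = {t. 1 \<le> t \<and> ereal t < T}"

text \<open>Classical solutions on \<open>[1,T)\<close> with \<open>1 < T \<le> \<infinity>\<close> and Cauchy data \<open>(f, g)\<close> at \<open>t = 1\<close>;
  the values of \<open>u\<close> outside \<open>[1,T)\<close> are irrelevant. The parameter \<open>nu2\<close> stands for the mass
  coefficient \<open>\<nu>\<^sup>2\<close>.\<close>

definition classical_solution ::
  "real \<Rightarrow> real \<Rightarrow> real \<Rightarrow> real \<Rightarrow> (real^'n \<Rightarrow> real) \<Rightarrow> (real^'n \<Rightarrow> real) \<Rightarrow>
     ereal \<Rightarrow> (real \<Rightarrow> real^'n \<Rightarrow> real) \<Rightarrow> bool" where
  "classical_solution l \<mu> nu2 p f g T u \<longleftrightarrow>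
     1 < T \<and>
     Ck_on 2 (time_interval T \<times> UNIV) (\<lambda>(t, x). u t x) \<and>
     (\<forall>t x. 1 < t \<and> ereal t < T \<longrightarrow>
        deriv (deriv (\<lambda>s. u s x)) t - t powr (2 * l) * laplacian (u t) x
          + \<mu> / t * deriv (\<lambda>s. u s x) t + nu2 / t^2 * u t x = \<bar>u t x\<bar> powr p) \<and>
     (\<forall>x. u 1 x = f x) \<and>
     (\<forall>x. ((\<lambda>s. u s x) has_real_derivative g x) (at 1 within time_interval T))"

text \<open>\<open>T\<close> is the maximal existence time (lifespan) of the classical solution \<open>u\<close>: it has no
  extension, as a classical solution, to a longer time interval.\<close>

definition solution_with_lifespan ::
  "real \<Rightarrow> real \<Rightarrow> real \<Rightarrow> real \<Rightarrow> (real^'n \<Rightarrow> real) \<Rightarrow> (real^'n \<Rightarrow> real) \<Rightarrow>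
     ereal \<Rightarrow> (real \<Rightarrow> real^'n \<Rightarrow> real) \<Rightarrow> bool" where
  "solution_with_lifespan l \<mu> nu2 p f g T u \<longleftrightarrow>
     classical_solution l \<mu> nu2 p f g T u \<and>
     (\<forall>T' v. classical_solution l \<mu> nu2 p f g T' v \<and> T \<le> T' \<and>
        (\<forall>t\<in>time_interval T. \<forall>x. v t x = u t x) \<longrightarrow> T' = T)"

end

theory Submission
  imports Defs "HOL-Real_Asymp.Real_Asymp"
begin

text \<open>Put \<open>\<phi>(t) = t\<^bsup>l+1\<^esup>/(l+1)\<close>, \<open>\<gamma> = \<surd>\<delta> / (2(l+1))\<close> and let
  \<open>\<Phi>\<close> be the radial solution of \<open>\<Delta>\<Phi> = \<Phi>\<close>. With \<open>y\<^sub>\<lambda>(t) =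
  t\<^bsup>(1-\<mu>)/2\<^esup>K\<^sub>\<gamma>(\<lambda>\<phi>(t))\<close>, the function
  \<open>t\<^sup>\<mu>y\<^sub>\<lambda>(t)\<Phi>(\<lambda>x)\<close> solves the adjoint linear equation for every \<open>\<lambda> > 0\<close>.
  Testing the equation with it times a cutoff in \<open>ln t\<close> between \<open>\<sigma>\<close> and \<open>\<sigma>'\<close>, and then averaging
  over \<open>0 < \<lambda> \<le> 1\<close> against \<open>\<lambda>\<^sup>\<beta>\<close> with \<open>\<beta> = (n-1)/2 - 1/2 - 1/p\<close>,
  Hoelder's inequality yields, for \<open>Y(\<sigma>)\<close> a weighted space-time integral of \<open>|u|\<^sup>p\<close> over times in \<open>[1,
  e\<^sup>\<sigma>]\<close>, \<open>Y(\<sigma>)\<^sup>p \<le> C (1+\<sigma>')\<^bsup>p-1\<^esup> (1/d + 1/d\<^sup>2)\<^sup>p d\<^bsup>p-1\<^esup>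
  (Y(\<sigma>') - Y(\<sigma>))\<close> with \<open>d = \<sigma>' - \<sigma>\<close>; the powers of \<open>t\<close> cancel exactly because
  \<open>p\<close> is critical. A single fixed \<open>\<lambda>\<close> gives \<open>Y(\<sigma>+1) - Y(\<sigma>) \<ge> c \<epsilon>\<^sup>p\<close>.
  Thus \<open>Y\<close> is of size \<open>\<epsilon>\<^sup>pS\<close> at \<open>S/2\<close>, and letting \<open>Y\<close> double over geometrically
  shrinking steps forces blow-up before time \<open>e\<^sup>S\<close> as soon as \<open>S\<close> is a large multiple of
  \<open>\<epsilon>\<^bsup>-p(p-1)\<^esup>\<close>. The average converges only for \<open>\<gamma> < \<beta> + 1\<close>; otherwise the
  \<open>x\<close>-independent adjoint solution \<open>t\<^bsup>\<mu>-\<kappa>\<^esup>\<close>, \<open>\<kappa> = (\<mu> - 1 +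
  \<surd>\<delta>)/2\<close>, suffices and even gives a smaller bound. Finite speed of propagation, needed to test with functions that are not
  compactly supported, comes from an energy with the weight \<open>((\<rho>\<^sup>2 - |x-x\<^sub>0|\<^sup>2)\<^sub>+)\<^sup>2\<close>.\<close>

subsection \<open>Integration on Euclidean space\<close>

text \<open>A test function of one fixed frequency is concentrated near the light cone: it shows
  that \<open>Y\<close> grows, but it gives no weight comparable to a power of t inside the cone, so
  it cannot bound \<open>Y\<close> by its own increments. The average has such weights on both
  sides. Frequencies below 1/\<phi>(t) supply the lower one; the value of \<beta> makes the upper
  one a power of t times (\<phi>(t) - |x| + R + 1)^(1/p - 1), and raising this to the conjugate
  exponent q = p/(p-1) gives exactly the power -1. Its integral over the cone is logarithmic in the
  radius, which is the source of the factor (1+\<sigma>')^(p-1). The exponent p(p-1) comes from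
  there too: from size \<epsilon>^p S, with a constant of order S^(p-1), the iteration needs a time
  of order S^(p-1) (\<epsilon>^p S)^(1-p) = \<epsilon>^(-p(p-1)), in which S cancels. The
  restriction on \<gamma> reflects the singularity z^(-\<gamma>) of the Macdonald function at 0. The
  data enter only through -y'(1) >= \<kappa> y(1), where the same \<kappa> = (\<mu> - 1 + sqrt
  \<delta>)/2 serves all frequencies.\<close>

lemma nn_integral_Holder:
  fixes f g :: "'a \<Rightarrow> real"
  assumes [measurable]: "f \<in> borel_measurable M" "g \<in> borel_measurable M"
    and f0: "\<And>x. f x \<ge> 0" and g0: "\<And>x. g x \<ge> 0"
    and p: "p > 1" and pq: "1/p + 1/q = 1"
    and X: "X \<ge> 0" "(\<integral>\<^sup>+x. ennreal (f x powr p) \<partial>M) \<le> ennreal X"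
    and Q: "Q > 0" "(\<integral>\<^sup>+x. ennreal (g x powr q) \<partial>M) \<le> ennreal Q"
  shows "(\<integral>\<^sup>+x. ennreal (f x * g x) \<partial>M) \<le> ennreal (X powr (1/p) * Q powr (1/q))"
\<comment> \<open>Young's inequality will be applied to f/a and g/b, where a and b are roots of the
  bounds \<open>X\<close> and \<open>Q\<close>. For \<open>X = 0\<close> this division is
  impossible, but then f vanishes almost everywhere.\<close>
proof (cases "X = 0")
  case True
  hence "AE x in M. ennreal (f x powr p) = 0"
    using X True by (subst nn_integral_0_iff_AE[symmetric]) auto
  hence "AE x in M. ennreal (f x * g x) = 0"
    by eventually_elim (use p f0 in auto)
  thus ?thesis by (subst nn_integral_cong_AE[where v="\<lambda>_. 0"]) auto
next
  case False
  hence X0: "X > 0" using X by simp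
  have q: "q > 1"
  proof -
    have "1/q = 1 - 1/p" using pq by simp
    moreover have "1/p < 1" "1/p > 0" using p by auto
    ultimately have "1/q > 0" "1/q < 1" by linarith+
    thus ?thesis by (simp add: divide_less_eq_1)
  qed
  define a where "a = X powr (1/p)"
  define b where "b = Q powr (1/q)"
  have a0: "a > 0" "a powr p = X" and b0: "b > 0" "b powr q = Q"
    using X0 Q p q by (auto simp: a_def b_def powr_powr)
  have young: "f x * g x \<le> a * b * (f x powr p / (p * X) + g x powr q / (q * Q))" for x
  proof -
    have "(f x / a) * (g x / b) \<le> (f x / a) powr p / p + (g x / b) powr q / q"
      using p q pq f0 g0 a0 b0 by (intro Youngs_inequality) auto
    also have "\<dots> = f x powr p / (p * X) + g x powr q / (q * Q)"
      using a0 b0 f0 g0 by (simp add: powr_divide field_simps)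
    finally show ?thesis using a0 b0 by (simp add: field_simps)
  qed
  have "(\<integral>\<^sup>+x. ennreal (f x * g x) \<partial>M) \<le>
     (\<integral>\<^sup>+x. ennreal (a*b/(p*X)) * ennreal (f x powr p) + ennreal (a*b/(q*Q)) * ennreal (g x powr q) \<partial>M)"
    using young a0 b0 p q X0 Q f0 g0
    by (intro nn_integral_mono)
       (auto simp: ennreal_mult[symmetric] ennreal_plus[symmetric] simp del: ennreal_plus intro!: ennreal_leI, simp add: algebra_simps)
  also have "\<dots> = ennreal (a*b/(p*X)) * (\<integral>\<^sup>+x. ennreal (f x powr p) \<partial>M)
      + ennreal (a*b/(q*Q)) * (\<integral>\<^sup>+x. ennreal (g x powr q) \<partial>M)"
    by (simp add: nn_integral_add nn_integral_cmult)
  also have "\<dots> \<le> ennreal (a*b/(p*X)) * ennreal X + ennreal (a*b/(q*Q)) * ennreal Q"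
    by (intro add_mono mult_left_mono X Q) auto
  also have "\<dots> = ennreal (a*b*(1/p + 1/q))"
    using a0 b0 p q X0 Q
    by (simp add: ennreal_mult[symmetric] ennreal_plus[symmetric] del: ennreal_plus, simp add: algebra_simps)
  finally show ?thesis using pq by (simp add: a_def b_def)
qed

text \<open>Polar coordinates for radial functions. Both measures agree on half-lines, where one
  gives the volume of a ball and the other the integral of its derivative; half-lines form an
  intersection-stable generator.\<close>

lemma distr_norm_lborel:
  "distr (lborel :: 'a::euclidean_space measure) borel norm =
     density lborel (\<lambda>r. ennreal (DIM('a) * unit_ball_vol DIM('a) * r^(DIM('a)-1)) * indicator {0..} r)"
  (is "?M = ?N")
proof (rule measure_eqI_generator_eq[where E="range atMost" and \<Omega>=UNIV and A="\<lambda>n. {..real n}"])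
  let ?d = "DIM('a)"
  let ?v = "unit_ball_vol ?d"
  have d: "?d > 0" by simp
  show eq: "emeasure ?M X = emeasure ?N X" if "X \<in> range atMost" for X
  proof -
    obtain r where r: "X = {..r}" using \<open>X \<in> range atMost\<close> by auto
    have "emeasure ?M X = emeasure (lborel :: 'a measure) (cball 0 r)"
      unfolding r by (subst emeasure_distr) (auto intro!: arg_cong[where f="emeasure lborel"])
    also have "\<dots> = (\<integral>\<^sup>+s. ennreal (?d * ?v * s^(?d-1)) * indicator {0..r} s \<partial>lborel)"
    proof (cases "r \<ge> 0")
      case True
      have "(\<integral>\<^sup>+s. ennreal (?d * ?v * s^(?d-1)) * indicator {0..r} s \<partial>lborel)
          = ennreal (?v * r^?d - ?v * 0^?d)"
        using True by (intro nn_integral_FTC_Icc) (auto intro!: derivative_eq_intros)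
      thus ?thesis using True d by (simp add: emeasure_cball)
    qed auto
    also have "\<dots> = emeasure ?N X"
      unfolding r by (subst emeasure_density) (auto intro!: nn_integral_cong simp: indicator_def)
    finally show ?thesis .
  qed
  show "emeasure ?M {..real n} \<noteq> \<infinity>" for n
  proof -
    have "emeasure ?M {..real n} = emeasure (lborel :: 'a measure) (cball 0 (real n))"
      by (subst emeasure_distr) (auto intro!: arg_cong[where f="emeasure lborel"])
    thus ?thesis by (simp add: emeasure_cball)
  qed
  show "sets ?M = sigma_sets UNIV (range atMost)" "sets ?N = sigma_sets UNIV (range atMost)"
    by (simp_all add: borel_eq_atMost)
  show "Int_stable (range atMost :: real set set)" by (auto simp: Int_stable_def)
  show "(\<Union>i. {..real i}) = UNIV" by (auto intro: real_arch_simple)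
qed auto

lemma nn_integral_radial:
  fixes f :: "real \<Rightarrow> ennreal"
  assumes [measurable]: "f \<in> borel_measurable borel"
  shows "(\<integral>\<^sup>+x. f (norm x) \<partial>(lborel :: 'a::euclidean_space measure)) =
    (\<integral>\<^sup>+r. ennreal (DIM('a) * unit_ball_vol DIM('a) * r^(DIM('a)-1)) * f r * indicator {0..} r \<partial>lborel)"
proof -
  have "(\<integral>\<^sup>+x. f (norm x) \<partial>(lborel :: 'a measure)) = (\<integral>\<^sup>+r. f r \<partial>distr (lborel :: 'a measure) borel norm)"
    by (subst nn_integral_distr) auto
  also have "\<dots> = (\<integral>\<^sup>+r. ennreal (DIM('a) * unit_ball_vol DIM('a) * r^(DIM('a)-1)) * indicator {0..} r * f r \<partial>lborel)"
    by (subst distr_norm_lborel, subst nn_integral_density) auto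
  finally show ?thesis by (simp add: mult_ac)
qed

text \<open>Bridge between gauge integrals over a box, for which the Leibniz rule is applied, and
  Lebesgue integrals over the whole space, which are translation invariant.\<close>

lemma
  fixes f :: "'a::euclidean_space \<Rightarrow> real"
  assumes f: "continuous_on UNIV f" and 0: "\<And>x. x \<notin> cbox a b \<Longrightarrow> f x = 0"
  shows integrable_compact_support: "integrable lborel f"
    and integral_cbox_compact_support: "integral (cbox a b) f = (LINT x|lborel. f x)"
proof -
  have eq: "f = (\<lambda>x. indicator (cbox a b) x *\<^sub>R f x)"
  proof
    show "f x = indicator (cbox a b) x *\<^sub>R f x" for x
      by (cases "x \<in> cbox a b") (simp_all add: 0)
  qed
  show 1: "integrable lborel f"
    by (subst eq) (intro borel_integrable_compact continuous_on_subset[OF f] compact_cbox subset_UNIV)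
  have "(f has_integral (LINT x|lborel. f x)) UNIV" by (rule has_integral_integral_lborel[OF 1])
  moreover have "(\<lambda>x. if x \<in> cbox a b then f x else 0) = f" by (rule ext) (simp add: 0)
  ultimately have "(f has_integral (LINT x|lborel. f x)) (cbox a b)"
    by (subst has_integral_restrict_UNIV[symmetric]) simp
  thus "integral (cbox a b) f = (LINT x|lborel. f x)" by blast
qed

lemma line_deriv_at:
  fixes f f' :: "'a::real_normed_vector \<Rightarrow> real"
  assumes "\<And>x. ((\<lambda>s. f (x + s *\<^sub>R b)) has_real_derivative f' x) (at 0)"
  shows "((\<lambda>s. f (x + s *\<^sub>R b)) has_real_derivative f' (x + s *\<^sub>R b)) (at s within A)"
proof -
  have "((\<lambda>h. f (x + s *\<^sub>R b + h *\<^sub>R b)) has_real_derivative f' (x + s *\<^sub>R b)) (at (s + (-s)))"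
    using assms[of "x + s *\<^sub>R b"] by simp
  hence "((\<lambda>t. f (x + s *\<^sub>R b + (t + (-s)) *\<^sub>R b)) has_real_derivative f' (x + s *\<^sub>R b)) (at s)"
    by (subst (asm) DERIV_shift)
  moreover have "(\<lambda>t. f (x + s *\<^sub>R b + (t + (-s)) *\<^sub>R b)) = (\<lambda>t. f (x + t *\<^sub>R b))"
    by (intro ext arg_cong[where f=f]) (simp add: scaleR_diff_left)
  ultimately show ?thesis by (simp add: has_field_derivative_at_within)
qed

text \<open>Substitute for the divergence theorem: the integral of f(x + s v) does not depend on s
  by translation invariance, and its derivative at s = 0 is the integral of f'.\<close>

lemma integral_directional_derivative_eq_0:
  fixes f f' :: "'a::euclidean_space \<Rightarrow> real"
  assumes f: "continuous_on UNIV f" and f': "continuous_on UNIV f'"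
    and D: "\<And>x. ((\<lambda>s. f (x + s *\<^sub>R v)) has_real_derivative f' x) (at 0)"
    and B: "bounded S" and f0: "\<And>x. x \<notin> S \<Longrightarrow> f x = 0" and f'0: "\<And>x. x \<notin> S \<Longrightarrow> f' x = 0"
  shows "(LINT x|lborel. f' x) = 0"
proof -
  from B obtain r where r: "r > 0" "\<And>x. x \<in> S \<Longrightarrow> norm x \<le> r" by (auto simp: bounded_pos)
  \<comment> \<open>The margin \<open>norm v\<close> keeps the supports of all translates with |s|
    <= 1 inside one box, since differentiation under the integral needs a fixed domain.\<close>
  have "bounded (cball (0::'a) (r + norm v))" by simp
  then obtain a b where ab: "cball (0::'a) (r + norm v) \<subseteq> cbox a b"
    using bounded_subset_cbox_symmetric by metis
  have out: "x + s *\<^sub>R v \<notin> S" if "x \<notin> cbox a b" "s \<in> {-1..1}" for x s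
  proof
    assume "x + s *\<^sub>R v \<in> S"
    hence "norm (x + s *\<^sub>R v) \<le> r" by (rule r)
    moreover have "norm (s *\<^sub>R v) \<le> norm v" using that by (auto simp: abs_le_iff mult_left_le_one_le)
    ultimately have "norm x \<le> r + norm v" using norm_triangle_ineq4[of "x + s *\<^sub>R v" "s *\<^sub>R v"] by simp
    thus False using ab that by auto
  qed
  have cs: "continuous_on UNIV (\<lambda>x. f (x + s *\<^sub>R v))" for s
    by (rule continuous_on_compose2[OF f]) (auto intro!: continuous_intros)
  have const: "integral (cbox a b) (\<lambda>x. f (x + s *\<^sub>R v)) = (LINT x|lborel. f x)" if "s \<in> {-1..1}" for s
  proof -
    have "integral (cbox a b) (\<lambda>x. f (x + s *\<^sub>R v)) = (LINT x|lborel. f (x + s *\<^sub>R v))"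
      by (rule integral_cbox_compact_support[OF cs]) (use f0 out that in blast)
    also have "\<dots> = (LINT x|distr lborel borel (\<lambda>x. s *\<^sub>R v + x). f x)"
      by (subst integral_distr) (auto simp: add.commute intro!: borel_measurable_continuous_onI f)
    finally show ?thesis by (simp add: lborel_distr_plus)
  qed
  have "((\<lambda>s. integral (cbox a b) (\<lambda>x. f (x + s *\<^sub>R v))) has_real_derivative
      integral (cbox a b) (\<lambda>x. f' (x + 0 *\<^sub>R v))) (at 0 within {-1..1})"
  proof (rule leibniz_rule_field_derivative)
    show "continuous_on ({-1..1} \<times> cbox a b) (\<lambda>(s, x). f' (x + s *\<^sub>R v))"
      unfolding split_beta by (rule continuous_on_compose2[OF f']) (auto intro!: continuous_intros)
  qed (auto intro!: line_deriv_at[OF D] integrable_continuous continuous_on_subset[OF cs])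
  moreover have "((\<lambda>s. integral (cbox a b) (\<lambda>x. f (x + s *\<^sub>R v))) has_real_derivative 0) (at 0 within {-1..1})"
    by (rule has_field_derivative_transform_within[OF DERIV_const zero_less_one]) (auto simp: const)
  moreover have "at (0::real) within {-1..1} \<noteq> bot" by (subst at_within_interior) auto
  ultimately have "integral (cbox a b) f' = 0"
    using has_field_derivative_unique by fastforce
  thus ?thesis using integral_cbox_compact_support[OF f', of a b] f'0 out[of _ 0] by auto
qed

subsection \<open>The Macdonald function\<close>

text \<open>The function x^a e^(-x) is largest at x = a; the factor e^(-a) of its maximum is
  discarded.\<close>

lemma exp_minus_le_powr:
  fixes x a :: real
  assumes "x > 0" "a > 0"
  shows "exp (-x) \<le> a powr a * x powr (-a)"
proof -
  have "a * ln (x / a) \<le> a * (x / a - 1)"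
    using assms by (intro mult_left_mono ln_le_minus_one) auto
  moreover have "a * (x / a - 1) = x - a" "a * ln (x / a) = a * ln x - a * ln a"
    using assms by (simp_all add: ln_div field_simps)
  ultimately have "-x \<le> a * ln a - a * ln x" using assms by linarith
  hence "exp (-x) \<le> exp (a * ln a - a * ln x)" by simp
  also have "\<dots> = a powr a * x powr (-a)" using assms by (simp add: powr_def exp_diff exp_minus divide_inverse)
  finally show ?thesis .
qed

lemma exp_abs_half_le_cosh: "exp \<bar>s\<bar> / 2 \<le> cosh (s::real)"
  by (cases "s \<ge> 0") (simp_all add: cosh_field_def)

lemma cosh_le_exp_abs: "cosh (s::real) \<le> exp \<bar>s\<bar>"
proof -
  have "exp s \<le> exp \<bar>s\<bar>" "exp (-s) \<le> exp \<bar>s\<bar>" by simp_all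
  hence "exp s + exp (-s) \<le> 2 * exp \<bar>s\<bar>" by linarith
  hence "(exp s + exp (-s)) / 2 \<le> exp \<bar>s\<bar>" by simp
  thus ?thesis unfolding cosh_field_def .
qed

text \<open>The exponent a is free: a larger one buys faster decay in s at the price of a stronger
  singularity at z = 0.\<close>

lemma exp_minus_cosh_le:
  fixes z a s :: real
  assumes "z > 0" "a > 0"
  shows "exp (- z * cosh s) \<le> a powr a * (z/2) powr (-a) * exp (-a * \<bar>s\<bar>)"
proof -
  have "z * cosh s \<ge> z * (exp \<bar>s\<bar> / 2)" using assms exp_abs_half_le_cosh[of s] by (intro mult_left_mono) auto
  hence "exp (- z * cosh s) \<le> exp (- (z/2 * exp \<bar>s\<bar>))" by simp
  also have "\<dots> \<le> a powr a * (z/2 * exp \<bar>s\<bar>) powr (-a)" using assms by (intro exp_minus_le_powr) auto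
  also have "\<dots> = a powr a * (z/2) powr (-a) * exp (-a * \<bar>s\<bar>)"
    unfolding powr_mult by (simp add: powr_def)
  finally show ?thesis .
qed

lemma integrable_exp_minus_abs:
  fixes a :: real
  assumes "a > 0"
  shows "integrable lborel (\<lambda>s::real. exp (- a * \<bar>s\<bar>))"
proof -
  have "(\<integral>\<^sup>+s. ennreal (exp (-a * s)) * indicator {0..} s \<partial>lborel) = ennreal (0 - (- exp (-a*0) / a))"
  proof (rule nn_integral_FTC_atLeast)
    show "((\<lambda>s. - exp (-a * s) / a) \<longlongrightarrow> 0) at_top" using assms
      by real_asymp
  qed (use assms in \<open>auto intro!: derivative_eq_intros\<close>)
  hence fin: "(\<integral>\<^sup>+s. ennreal (exp (-a * s)) * indicator {0..} s \<partial>lborel) < \<infinity>" by simp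
  have 1: "integrable lborel (\<lambda>s. exp (-a * s) * indicator {0..} s :: real)"
  proof (intro integrableI_bounded)
    have "(\<integral>\<^sup>+ s. ennreal (norm (exp (-a * s) * indicator {0..} s :: real)) \<partial>lborel)
       = (\<integral>\<^sup>+s. ennreal (exp (-a * s)) * indicator {0..} s \<partial>lborel)"
      by (intro nn_integral_cong) (auto simp: indicator_def)
    thus "(\<integral>\<^sup>+ s. ennreal (norm (exp (-a * s) * indicator {0..} s :: real)) \<partial>lborel) < \<infinity>"
      using fin by simp
  qed auto
  hence 2: "integrable lborel (\<lambda>s. exp (-a*(0 + (-1) * s)) * indicator {0..} (0 + (-1) * s) :: real)"
    by (subst lborel_integrable_real_affine_iff) auto
  show ?thesis
  proof (rule Bochner_Integration.integrable_bound[OF Bochner_Integration.integrable_add[OF 1 2]])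
    show "AE s in lborel. norm (exp (- a * \<bar>s\<bar>)) \<le> norm (exp (-a * s) * indicator {0..} s +
      exp (-a*(0 + (-1) * s)) * indicator {0..} (0 + (-1) * s) :: real)"
      by (intro always_eventually allI) (auto simp: indicator_def)
  qed auto
qed

text \<open>Differentiation under an integral over the whole line, by an explicit second-order
  Taylor remainder: for |h| < z/2 the factor exp(|h| c) is absorbed by half of the decay exp(-z
  c).\<close>

lemma laplace_transform_has_derivative:
  fixes c w :: "real \<Rightarrow> real"
  assumes [measurable]: "c \<in> borel_measurable borel" "w \<in> borel_measurable borel"
    and c0: "\<And>s. c s \<ge> 0"
    and int: "\<And>z j. z > 0 \<Longrightarrow> integrable lborel (\<lambda>s. w s * c s ^ j * exp (- z * c s))"
    and z: "z > 0"
  shows "((\<lambda>z. LINT s|lborel. w s * exp (- z * c s)) has_real_derivative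
    - (LINT s|lborel. w s * c s * exp (- z * c s))) (at z)"
proof -
  let ?G = "\<lambda>z. LINT s|lborel. w s * exp (- z * c s)"
  let ?G1 = "LINT s|lborel. w s * c s * exp (- z * c s)"
  define C where "C = (LINT s|lborel. \<bar>w s * c s ^ 2 * exp (- (z/2) * c s)\<bar>)"
  have taylor: "\<bar>exp y - 1 - y\<bar> \<le> y^2 * exp \<bar>y\<bar>" for y :: real
  proof -
    obtain t where t: "\<bar>t\<bar> \<le> \<bar>y\<bar>" "exp y = (\<Sum>m<2. y^m / fact m) + exp t / fact 2 * y^2"
      using Maclaurin_exp_le by blast
    have "exp y - 1 - y = exp t / 2 * y^2" using t(2) by (simp add: lessThan_Suc eval_nat_numeral)
    hence "\<bar>exp y - 1 - y\<bar> = exp t / 2 * y^2" by (simp only:) simp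
    also have "\<dots> \<le> exp \<bar>y\<bar> * y^2" using t(1) exp_gt_zero[of t] exp_le_cancel_iff[of t "\<bar>y\<bar>"]
      by (intro mult_right_mono) (linarith | simp)+
    finally show ?thesis by (simp add: mult.commute)
  qed
  have i0: "integrable lborel (\<lambda>s. w s * exp (- y * c s))" if "y > 0" for y
    using int[OF that, of 0] by simp
  have i1: "integrable lborel (\<lambda>s. w s * c s * exp (- z * c s))" using int[OF z, of 1] by simp
  have bound: "\<bar>(?G (z + h) - ?G z) / h - (- ?G1)\<bar> \<le> C * \<bar>h\<bar>" if h: "h \<noteq> 0" "\<bar>h\<bar> < z/2" for h
  proof -
    have zh: "z + h > 0" using h by linarith
    have eq: "?G (z+h) - ?G z + h * ?G1 = (LINT s|lborel. w s * exp (- (z+h) * c s) - w s * exp (- z * c s)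
        + h * (w s * c s * exp (- z * c s)))"
      using i0[OF zh] i0[OF z] i1 by simp
    have "\<bar>?G (z+h) - ?G z + h * ?G1\<bar> \<le> (LINT s|lborel. \<bar>w s * exp (- (z+h) * c s) - w s * exp (- z * c s)
        + h * (w s * c s * exp (- z * c s))\<bar>)"
      unfolding eq by (rule integral_abs_bound)
    also have "\<dots> \<le> (LINT s|lborel. h^2 * \<bar>w s * c s ^ 2 * exp (- (z/2) * c s)\<bar>)"
    proof (rule integral_mono)
      fix s
      have "\<bar>exp (-h * c s) - 1 - (-h * c s)\<bar> \<le> (-h * c s)^2 * exp \<bar>-h * c s\<bar>" by (rule taylor)
      also have "\<dots> \<le> (-h * c s)^2 * exp (z/2 * c s)"
      proof (intro mult_left_mono)
        have "\<bar>h\<bar> * c s \<le> z/2 * c s" using h c0[of s] by (intro mult_right_mono) auto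
        thus "exp \<bar>-h * c s\<bar> \<le> exp (z/2 * c s)" using c0[of s] by (simp add: abs_mult)
      qed auto
      finally have "\<bar>w s * exp (- z * c s)\<bar> * \<bar>exp (-h * c s) - 1 - (-h * c s)\<bar>
        \<le> \<bar>w s * exp (- z * c s)\<bar> * ((-h * c s)^2 * exp (z/2 * c s))" by (intro mult_left_mono) auto
      moreover have "w s * exp (- (z+h) * c s) - w s * exp (- z * c s) + h * (w s * c s * exp (- z * c s))
         = w s * exp (- z * c s) * (exp (-h * c s) - 1 - (-h * c s))"
        by (simp add: algebra_simps exp_add[symmetric])
      moreover have "\<bar>w s * exp (- z * c s)\<bar> * ((-h * c s)^2 * exp (z/2 * c s))
         = h^2 * \<bar>w s * c s ^ 2 * exp (- (z/2) * c s)\<bar>"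
      proof -
        have "exp (- z * c s) * exp (z/2 * c s) = exp (- (z/2) * c s)"
          by (simp add: exp_add[symmetric] algebra_simps)
        thus ?thesis by (simp add: abs_mult power_mult_distrib mult.left_commute mult.commute)
      qed
      ultimately show "\<bar>w s * exp (- (z+h) * c s) - w s * exp (- z * c s) + h * (w s * c s * exp (- z * c s))\<bar>
        \<le> h^2 * \<bar>w s * c s ^ 2 * exp (- (z/2) * c s)\<bar>" by (simp only: abs_mult)
    qed (use i0[OF zh] i0[OF z] i1 int[of "z/2" 2] z in auto)
    also have "\<dots> = h^2 * C" by (simp add: C_def)
    finally have "\<bar>?G (z+h) - ?G z + h * ?G1\<bar> / \<bar>h\<bar> \<le> h^2 * C / \<bar>h\<bar>"
      by (intro divide_right_mono) auto
    also have "\<bar>?G (z+h) - ?G z + h * ?G1\<bar> / \<bar>h\<bar> = \<bar>(?G (z + h) - ?G z) / h - (- ?G1)\<bar>"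
      using h by (simp add: abs_divide[symmetric] add_divide_distrib)
    also have "h^2 * C / \<bar>h\<bar> = C * \<bar>h\<bar>" using h by (simp add: field_simps power2_eq_square)
    finally show ?thesis .
  qed
  have "((\<lambda>h. (?G (z + h) - ?G z) / h - (- ?G1)) \<longlongrightarrow> 0) (at 0)"
  proof (rule Lim_null_comparison)
    show "\<forall>\<^sub>F h in at 0. norm ((?G (z + h) - ?G z) / h - (- ?G1)) \<le> C * \<bar>h\<bar>"
      unfolding eventually_at using bound z
      by (intro exI[of _ "z/2"]) (auto simp: dist_norm)
    show "((\<lambda>h. C * \<bar>h\<bar>) \<longlongrightarrow> 0) (at 0)" by (auto intro!: tendsto_eq_intros)
  qed
  thus ?thesis unfolding DERIV_def by (rule LIM_zero_cancel)
qed

text \<open>Twice the \<open>j\<close>-th derivative (up to sign) of the Macdonald function \<open>K\<^sub>g\<close>.\<close>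

definition macdonald :: "real \<Rightarrow> nat \<Rightarrow> real \<Rightarrow> real" where
  "macdonald g j z = (LINT s|lborel. cosh s ^ j * exp (- z * cosh s + g * s))"

lemma macdonald_kernel_bound:
  fixes z g :: real
  assumes z: "z > 0"
  obtains C where "\<And>s. cosh s ^ j * exp (- z * cosh s + g * s) \<le> C * exp (- \<bar>s\<bar>)"
proof
  \<comment> \<open>Chosen so that exactly one factor exp(-|s|) survives after
    \<open>cosh s ^ j\<close> and \<open>exp (g * s)\<close> have been absorbed.\<close>
  define a where "a = real j + \<bar>g\<bar> + 1"
  have a: "a > 0" unfolding a_def by linarith
  fix s :: real
  have "cosh s ^ j * exp (- z * cosh s + g * s) = cosh s ^ j * (exp (- z * cosh s) * exp (g * s))"
    unfolding exp_add by simp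
  also have "\<dots> \<le> exp \<bar>s\<bar> ^ j * (a powr a * (z/2) powr (-a) * exp (-a * \<bar>s\<bar>) * exp (\<bar>g\<bar> * \<bar>s\<bar>))"
    using z a by (intro mult_mono power_mono exp_minus_cosh_le cosh_le_exp_abs)
      (auto simp: abs_mult[symmetric])
  also have "\<dots> = (a powr a * (z/2) powr (-a)) * exp (real j * \<bar>s\<bar> + -a * \<bar>s\<bar> + \<bar>g\<bar> * \<bar>s\<bar>)"
    unfolding exp_add by (simp add: exp_of_nat_mult)
  also have "real j * \<bar>s\<bar> + -a * \<bar>s\<bar> + \<bar>g\<bar> * \<bar>s\<bar> = - \<bar>s\<bar>" by (simp add: a_def algebra_simps)
  finally show "cosh s ^ j * exp (- z * cosh s + g * s) \<le> (a powr a * (z/2) powr (-a)) * exp (- \<bar>s\<bar>)" .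
qed

lemma integrable_macdonald:
  assumes "z > 0"
  shows "integrable lborel (\<lambda>s. cosh s ^ j * exp (- z * cosh s + g * s) :: real)"
proof -
  obtain C where C: "\<And>s. cosh s ^ j * exp (- z * cosh s + g * s) \<le> C * exp (- \<bar>s\<bar>)"
    using macdonald_kernel_bound[OF assms] by blast
  have "integrable lborel (\<lambda>s::real. C * exp (- 1 * \<bar>s\<bar>))"
    by (intro integrable_mult_right integrable_exp_minus_abs) auto
  thus ?thesis
  proof (rule Bochner_Integration.integrable_bound)
    show "AE s in lborel. norm (cosh s ^ j * exp (- z * cosh s + g * s)) \<le> norm (C * exp (- 1 * \<bar>s\<bar>))"
    proof (intro always_eventually allI)
      fix s :: real
      have "norm (cosh s ^ j * exp (- z * cosh s + g * s)) = cosh s ^ j * exp (- z * cosh s + g * s)"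
        by (simp add: abs_mult)
      also have "\<dots> \<le> C * exp (- 1 * \<bar>s\<bar>)" using C[of s] by simp
      also have "\<dots> \<le> norm (C * exp (- 1 * \<bar>s\<bar>))" by simp
      finally show "norm (cosh s ^ j * exp (- z * cosh s + g * s)) \<le> norm (C * exp (- 1 * \<bar>s\<bar>))" .
    qed
    have "(\<lambda>s. cosh s ^ j * exp (- z * cosh s + g * s) :: real) \<in> borel_measurable borel"
      by (intro borel_measurable_continuous_onI) (auto intro!: continuous_intros)
    thus "(\<lambda>s. cosh s ^ j * exp (- z * cosh s + g * s) :: real) \<in> borel_measurable lborel" by simp
  qed
qed

lemma macdonald_pos:
  assumes "z > 0"
  shows "macdonald g j z > 0"
proof -
  have "macdonald g j z \<noteq> 0"
  proof
    assume "macdonald g j z = 0"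
    hence "AE s in lborel. cosh s ^ j * exp (- z * cosh s + g * s) = (0::real)"
      unfolding macdonald_def
      by (subst integral_nonneg_eq_0_iff_AE[OF integrable_macdonald[OF assms], symmetric]) simp_all
    hence "AE s in (lborel :: real measure). False" by simp
    thus False using ae_filter_eq_bot_iff[of "lborel :: real measure"] by (simp add: trivial_limit_def)
  qed
  moreover have "macdonald g j z \<ge> 0" unfolding macdonald_def by (intro Bochner_Integration.integral_nonneg) auto
  ultimately show ?thesis by simp
qed

lemma DERIV_macdonald:
  assumes "z > 0"
  shows "((macdonald g j) has_real_derivative - macdonald g (Suc j) z) (at z)"
proof -
  have "((\<lambda>z. LINT s|lborel. (cosh s ^ j * exp (g * s)) * exp (- z * cosh s)) has_real_derivative
    - (LINT s|lborel. (cosh s ^ j * exp (g * s)) * cosh s * exp (- z * cosh s))) (at z)"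
  proof (rule laplace_transform_has_derivative)
    show "cosh \<in> borel_measurable (borel :: real measure)"
      "(\<lambda>s::real. cosh s ^ j * exp (g * s)) \<in> borel_measurable borel"
      by (intro borel_measurable_continuous_onI; auto intro!: continuous_intros)+
    show "integrable lborel (\<lambda>s. cosh s ^ j * exp (g * s) * cosh s ^ i * exp (- y * cosh s))" if "y > 0" for y i
    proof -
      have "(\<lambda>s. cosh s ^ j * exp (g * s) * cosh s ^ i * exp (- y * cosh s)) =
         (\<lambda>s. cosh s ^ (j+i) * exp (- y * cosh s + g * s))"
        unfolding exp_add power_add by (simp add: mult_ac)
      thus ?thesis using integrable_macdonald[OF that, of "j + i" g] by simp
    qed
  qed (use assms in auto)
  thus ?thesis unfolding macdonald_def[abs_def] exp_add power_Suc by (simp add: mult_ac)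
qed

text \<open>Integration over the line of an exact derivative without boundary terms; the two
  Macdonald relations below come from suitable choices of \<open>F\<close>.\<close>

lemma integral_deriv_eq_0:
  fixes F f :: "real \<Rightarrow> real"
  assumes F: "\<And>x. (F has_real_derivative f x) (at x)" and f: "continuous_on UNIV f"
    and int: "integrable lborel f" and B: "\<And>x. \<bar>F x\<bar> \<le> C * exp (- \<bar>x\<bar>)"
  shows "(LINT x|lborel. f x) = 0"
proof -
  have lim: "((\<lambda>x::real. C * exp (- \<bar>x\<bar>)) \<longlongrightarrow> 0) at_top" "((\<lambda>x::real. C * exp (- \<bar>x\<bar>)) \<longlongrightarrow> 0) at_bot"
    by real_asymp+
  have "(LBINT x=-\<infinity>..\<infinity>. f x) = 0 - 0"
  proof (rule interval_integral_FTC_integrable[where F=F])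
    have "(F \<longlongrightarrow> 0) at_bot" "(F \<longlongrightarrow> 0) at_top"
      by (rule Lim_null_comparison[OF _ lim(2)] Lim_null_comparison[OF _ lim(1)]; simp add: B)+
    thus "((F \<circ> real_of_ereal) \<longlongrightarrow> 0) (at_right (-\<infinity>))" "((F \<circ> real_of_ereal) \<longlongrightarrow> 0) (at_left \<infinity>)"
      by (simp_all add: ereal_tendsto_simps)
    show "set_integrable lborel (einterval (- \<infinity>) \<infinity>) f" using int by (simp add: set_integrable_def)
  qed (use F f in \<open>auto simp: has_real_derivative_iff_has_vector_derivative[symmetric] continuous_on_eq_continuous_at\<close>)
  thus ?thesis by (simp add: interval_lebesgue_integral_def set_lebesgue_integral_def)
qed

text \<open>Modified Bessel equation z^2 K'' + z K' = (z^2 + g^2) K, where K' carries the minus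
  sign. The difference of the integrands is the derivative of (-z sinh s - g) exp(-z cosh s + g
  s).\<close>

lemma macdonald_ode:
  assumes z: "z > 0"
  shows "z^2 * macdonald g 2 z - z * macdonald g 1 z = (z^2 + g^2) * macdonald g 0 z"
proof -
  let ?e = "\<lambda>s. exp (- z * cosh s + g * s)"
  let ?f = "\<lambda>s. z^2 * (cosh s ^ 2 * ?e s) - z * (cosh s ^ 1 * ?e s) - (z^2 + g^2) * (cosh s ^ 0 * ?e s)"
  note int = integrable_macdonald[OF z, of _ g]
  obtain C0 where C0: "\<And>s. cosh s ^ 0 * ?e s \<le> C0 * exp (- \<bar>s\<bar>)"
    using macdonald_kernel_bound[OF z] by blast
  obtain C1 where C1: "\<And>s. cosh s ^ 1 * ?e s \<le> C1 * exp (- \<bar>s\<bar>)"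
    using macdonald_kernel_bound[OF z] by blast
  have "(LINT s|lborel. ?f s) = 0"
  proof (rule integral_deriv_eq_0[where F="\<lambda>s. (- z * sinh s - g) * ?e s" and C="z * C1 + \<bar>g\<bar> * C0"])
    fix s :: real
    have sq: "sinh s * sinh s = cosh s * cosh s - 1" using hyperbolic_pythagoras[of s] by (simp add: power2_eq_square algebra_simps)
    have "((\<lambda>s. (- z * sinh s - g) * ?e s) has_real_derivative
      (- z * cosh s) * ?e s + (- z * sinh s - g) * (?e s * (- z * sinh s + g))) (at s)"
      by (auto intro!: derivative_eq_intros)
    moreover have "(- z * cosh s) * ?e s + (- z * sinh s - g) * (?e s * (- z * sinh s + g)) = ?e s * (- z * cosh s + z^2 * (sinh s * sinh s) - g^2)"
      by (simp add: algebra_simps power2_eq_square)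
    moreover have "\<dots> = ?f s" unfolding sq by (simp add: algebra_simps power2_eq_square)
    ultimately show "((\<lambda>s. (- z * sinh s - g) * ?e s) has_real_derivative ?f s) (at s)" by simp
    have "\<bar>(- z * sinh s - g) * ?e s\<bar> \<le> (z * cosh s + \<bar>g\<bar>) * ?e s"
    proof -
      have "\<bar>sinh s\<bar> \<le> cosh s" by (auto simp: sinh_def cosh_def abs_le_iff)
      hence "\<bar>- z * sinh s - g\<bar> \<le> z * cosh s + \<bar>g\<bar>"
        using z abs_triangle_ineq4[of "- z * sinh s" g] by (simp add: abs_mult) (smt (verit) mult_left_mono)
      thus ?thesis by (simp add: abs_mult)
    qed
    also have "\<dots> = z * (cosh s ^ 1 * ?e s) + \<bar>g\<bar> * (cosh s ^ 0 * ?e s)" by (simp add: algebra_simps)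
    also have "\<dots> \<le> z * (C1 * exp (- \<bar>s\<bar>)) + \<bar>g\<bar> * (C0 * exp (- \<bar>s\<bar>))"
      using z C0[of s] C1[of s] by (intro add_mono mult_left_mono) auto
    finally show "\<bar>(- z * sinh s - g) * ?e s\<bar> \<le> (z * C1 + \<bar>g\<bar> * C0) * exp (- \<bar>s\<bar>)" by (simp add: algebra_simps)
  next
    show "continuous_on UNIV ?f" by (auto intro!: continuous_intros)
    show "integrable lborel ?f"
      by (intro Bochner_Integration.integrable_diff integrable_mult_right int)
  qed
  moreover have "(LINT s|lborel. ?f s) = z^2 * macdonald g 2 z - z * macdonald g 1 z - (z^2+g^2) * macdonald g 0 z"
    unfolding macdonald_def
    by (subst Bochner_Integration.integral_diff; (intro Bochner_Integration.integrable_diff integrable_mult_right int)?)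
       (subst Bochner_Integration.integral_diff; (intro integrable_mult_right int)?; simp)
  ultimately show ?thesis by simp
qed

text \<open>Integrating the derivative of the kernel in s gives equality with sinh in place of cosh,
  and sinh <= cosh. It is the source of the constant \<kappa> in the condition on the data.\<close>

lemma macdonald_log_deriv:
  assumes z: "z > 0"
  shows "g * macdonald g 0 z \<le> z * macdonald g 1 z"
proof -
  let ?e = "\<lambda>s. exp (- z * cosh s + g * s)"
  note int = integrable_macdonald[OF z, of _ g]
  have "(\<lambda>s. sinh s * ?e s) \<in> borel_measurable borel"
    by (intro borel_measurable_continuous_onI) (auto intro!: continuous_intros)
  hence ism: "(\<lambda>s. sinh s * ?e s) \<in> borel_measurable lborel" by simp
  have sc: "\<bar>sinh s\<bar> \<le> cosh s" for s :: real by (auto simp: sinh_def cosh_def abs_le_iff)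
  have ish: "integrable lborel (\<lambda>s. sinh s * ?e s)"
    by (rule Bochner_Integration.integrable_bound[OF int[of 1] ism])
       (use sc in \<open>auto simp: abs_mult intro!: always_eventually mult_right_mono\<close>)
  obtain C0 where C0: "\<And>s. cosh s ^ 0 * ?e s \<le> C0 * exp (- \<bar>s\<bar>)"
    using macdonald_kernel_bound[OF z] by blast
  have i0: "integrable lborel ?e" using int[of 0] by simp
  have "(LINT s|lborel. g * ?e s - z * (sinh s * ?e s)) = 0"
  proof (rule integral_deriv_eq_0[where F="?e" and C="C0"])
    show "(?e has_real_derivative g * ?e s - z * (sinh s * ?e s)) (at s)" for s
      by (auto intro!: derivative_eq_intros simp: algebra_simps)
    show "\<bar>?e s\<bar> \<le> C0 * exp (- \<bar>s\<bar>)" for s using C0[of s] by simp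
    show "integrable lborel (\<lambda>s. g * ?e s - z * (sinh s * ?e s))" using i0 ish by auto
  qed (auto intro!: continuous_intros)
  hence "g * macdonald g 0 z = z * (LINT s|lborel. sinh s * ?e s)" using i0 ish by (simp add: macdonald_def)
  also have "\<dots> \<le> z * macdonald g 1 z" unfolding macdonald_def
  proof (intro mult_left_mono integral_mono ish int)
    show "sinh s * ?e s \<le> cosh s ^ 1 * ?e s" for s using sc[of s] by (simp add: abs_le_iff)
  qed (use z in auto)
  finally show ?thesis .
qed

lemma macdonald_sum_le:
  assumes "z > 0" and int: "integrable lborel w"
    and le: "\<And>s. (1 + z * cosh s) * exp (- z * cosh s + g * s) \<le> c * w s"
  shows "macdonald g 0 z + z * macdonald g 1 z \<le> c * (LINT s|lborel. w s)"
proof -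
  note i = integrable_macdonald[OF \<open>z > 0\<close>, of _ g]
  have "macdonald g 0 z + z * macdonald g 1 z
      = (LINT s|lborel. cosh s ^ 0 * exp (- z * cosh s + g * s) + z * (cosh s ^ 1 * exp (- z * cosh s + g * s)))"
    unfolding macdonald_def
    by (subst Bochner_Integration.integral_add[OF i integrable_mult_right[OF i]]) simp
  also have "\<dots> \<le> (LINT s|lborel. c * w s)"
  proof (rule integral_mono)
    show "cosh s ^ 0 * exp (- z * cosh s + g * s) + z * (cosh s ^ 1 * exp (- z * cosh s + g * s)) \<le> c * w s" for s
      using le[of s] by (simp add: algebra_simps)
  qed (intro Bochner_Integration.integrable_add i integrable_mult_right int)+
  also have "\<dots> = c * (LINT s|lborel. w s)" by simp
  finally show ?thesis .
qed

text \<open>Behaviour near z = 0. Taking \<open>g'\<close> strictly above |g| leaves an integrable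
  factor exp(-(g' - |g|) |s|) and covers g = 0, where the true behaviour is logarithmic, without a
  separate case.\<close>

lemma macdonald_sum_le_powr:
  fixes g g' :: real
  assumes g': "\<bar>g\<bar> < g'"
  shows "\<exists>C>0. \<forall>z>0. macdonald g 0 z + z * macdonald g 1 z \<le> C * z powr (-g')"
proof -
  define w where "w s = exp (- (g' - \<bar>g\<bar>) * \<bar>s\<bar>)" for s :: real
  have int: "integrable lborel w" unfolding w_def[abs_def] using g' by (intro integrable_exp_minus_abs) simp
  define I where "I = (LINT s|lborel. w s)"
  have I: "I \<ge> 0" unfolding I_def w_def by (intro Bochner_Integration.integral_nonneg) simp
  define C where "C = 2 * g' powr g' * 4 powr g'"
  have C: "C > 0" unfolding C_def using g' by simp
  have "macdonald g 0 z + z * macdonald g 1 z \<le> (C * I + 1) * z powr (-g')" if z: "z > 0" for z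
  proof -
    have "macdonald g 0 z + z * macdonald g 1 z \<le> (C * z powr (-g')) * (LINT s|lborel. w s)"
    proof (rule macdonald_sum_le[OF z int])
      fix s :: real
      \<comment> \<open>Half of the exponential decay is given away to absorb the polynomial factor
        \<open>1 + z * cosh s\<close>.\<close>
      have "1 + z/2 * cosh s \<le> exp (z/2 * cosh s)" by (rule exp_ge_add_one_self)
      moreover have "1 \<le> exp (z/2 * cosh s)" using z by simp
      ultimately have "1 + 2 * (z/2 * cosh s) \<le> 2 * exp (z/2 * cosh s)" by linarith
      hence "1 + z * cosh s \<le> 2 * exp (z/2 * cosh s)" by simp
      hence "(1 + z * cosh s) * (exp (- z * cosh s) * exp (g * s))
          \<le> 2 * exp (z/2 * cosh s) * (exp (- z * cosh s) * exp (\<bar>g\<bar> * \<bar>s\<bar>))"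
        using z by (intro mult_mono) (auto simp: abs_mult[symmetric] cosh_real_nonneg)
      also have "\<dots> = 2 * (exp (z/2 * cosh s) * exp (- z * cosh s)) * exp (\<bar>g\<bar> * \<bar>s\<bar>)" by simp
      also have "exp (z/2 * cosh s) * exp (- z * cosh s) = exp (- (z/2) * cosh s)"
        by (simp add: exp_add[symmetric])
      also have "2 * exp (- (z/2) * cosh s) * exp (\<bar>g\<bar> * \<bar>s\<bar>)
         \<le> 2 * (g' powr g' * (z/2/2) powr (-g') * exp (-g' * \<bar>s\<bar>)) * exp (\<bar>g\<bar> * \<bar>s\<bar>)"
        using z g' by (intro mult_left_mono mult_right_mono exp_minus_cosh_le) auto
      also have "\<dots> = 2 * g' powr g' * (z/4) powr (-g') * (exp (-g' * \<bar>s\<bar>) * exp (\<bar>g\<bar> * \<bar>s\<bar>))" by simp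
      also have "exp (-g' * \<bar>s\<bar>) * exp (\<bar>g\<bar> * \<bar>s\<bar>) = w s"
        unfolding w_def by (simp add: exp_add[symmetric] algebra_simps)
      also have "(z/4) powr (-g') = z powr (-g') * 4 powr g'"
        using z by (simp add: powr_divide powr_minus field_simps)
      finally show "(1 + z * cosh s) * exp (- z * cosh s + g * s) \<le> (C * z powr (-g')) * w s"
        unfolding exp_add C_def by (simp add: mult_ac)
    qed
    also have "\<dots> = (C * I) * z powr (-g')" unfolding I_def by simp
    also have "\<dots> \<le> (C * I + 1) * z powr (-g')" by (intro mult_right_mono) auto
    finally show ?thesis .
  qed
  moreover have "C * I + 1 > 0" using C I by (intro add_nonneg_pos) auto
  ultimately show ?thesis by blast
qed

text \<open>Laplace's method for large z: cosh s >= 1 + s^2/2 leaves a Gaussian, rescaled by sqrt z.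
  The power is 1/2 and not the -1/2 of the Macdonald function itself, because the derivative term
  carries an additional factor z.\<close>

lemma macdonald_sum_le_exp:
  fixes g :: real
  shows "\<exists>C>0. \<forall>z\<ge>1. macdonald g 0 z + z * macdonald g 1 z \<le> C * z powr (1/2) * exp (-z)"
proof -
  define G where "G = \<bar>g\<bar> + 1"
  define v where "v x = exp (- (x^2) / 4)" for x :: real
  have vm: "v \<in> borel_measurable lborel" unfolding v_def[abs_def] by simp
  have vle: "v x \<le> exp 1 * exp (- 1 * \<bar>x\<bar>)" for x
  proof -
    have "0 \<le> (\<bar>x\<bar> / 2 - 1)^2" by simp
    hence "- (x^2) / 4 \<le> 1 + - 1 * \<bar>x\<bar>" by (simp add: power2_eq_square algebra_simps)
    thus ?thesis unfolding v_def exp_add[symmetric] by simp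
  qed
  have vint: "integrable lborel v"
  proof (rule Bochner_Integration.integrable_bound[OF _ vm])
    show "integrable lborel (\<lambda>x::real. exp 1 * exp (- 1 * \<bar>x\<bar>))"
      by (intro integrable_mult_right integrable_exp_minus_abs) auto
    show "AE x in lborel. norm (v x) \<le> norm (exp 1 * exp (- 1 * \<bar>x\<bar>))"
      using vle by (intro always_eventually allI) (auto simp: v_def)
  qed
  define I where "I = (LINT s|lborel. v s)"
  have I: "I \<ge> 0" unfolding I_def v_def by (intro Bochner_Integration.integral_nonneg) simp
  define C where "C = 2 * exp (G^2) * I + 1"
  have C: "C > 0" unfolding C_def using I by (intro add_nonneg_pos) auto
  have "macdonald g 0 z + z * macdonald g 1 z \<le> C * z powr (1/2) * exp (-z)" if z: "z \<ge> 1" for z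
  proof -
    define w where "w s = v (0 + sqrt z * s)" for s
    have z0: "z > 0" using z by simp
    have wint: "integrable lborel w" unfolding w_def[abs_def]
      using vint z by (subst lborel_integrable_real_affine_iff) auto
    have wI: "I = sqrt z * (LINT s|lborel. w s)"
      unfolding I_def w_def using z lborel_integral_real_affine[of "sqrt z" v 0] by simp
    have "macdonald g 0 z + z * macdonald g 1 z \<le> (2 * z * exp (-z) * exp (G^2)) * (LINT s|lborel. w s)"
    proof (rule macdonald_sum_le[OF z0 wint])
      fix s :: real
      have c1: "1 \<le> cosh s" by (rule cosh_real_ge_1)
      have c2: "1 + s^2 / 2 \<le> cosh s"
      proof -
        obtain t where t: "exp s = (\<Sum>m<4. s^m / fact m) + exp t / fact 4 * s^4"
          using Maclaurin_exp_le by blast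
        obtain t' where t': "exp (-s) = (\<Sum>m<4. (-s)^m / fact m) + exp t' / fact 4 * (-s)^4"
          using Maclaurin_exp_le by blast
        have "exp t / fact 4 * s^4 \<ge> 0" "exp t' / fact 4 * (-s)^4 \<ge> 0" by simp_all
        hence "(\<Sum>m<4. s^m / fact m) + (\<Sum>m<4. (-s)^m / fact m) \<le> exp s + exp (-s)" using t t' by linarith
        hence "2 * (1 + s^2/2) \<le> exp s + exp (-s)" by (simp add: lessThan_Suc eval_nat_numeral)
        also have "\<dots> = 2 * cosh s" by (simp add: cosh_field_def)
        finally show ?thesis by simp
      qed
      have "1 + z * cosh s \<le> 2 * z * cosh s" using z c1 mult_mono[of 1 z 1 "cosh s"] by simp
      also have "\<dots> \<le> 2 * z * exp \<bar>s\<bar>" using z cosh_le_exp_abs[of s] by (intro mult_left_mono) auto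
      finally have 1: "1 + z * cosh s \<le> 2 * z * exp \<bar>s\<bar>" .
      have "z * (1 + s^2/2) \<le> z * cosh s" using c2 z by (intro mult_left_mono) auto
      moreover have "g * s \<le> \<bar>g\<bar> * \<bar>s\<bar>" by (simp add: abs_mult[symmetric])
      \<comment> \<open>Half of the Gaussian exponent z s^2/2 pays for the linear terms in s; the
        other half is the exponent in \<open>v\<close>.\<close>
      moreover have "\<bar>s\<bar> + \<bar>g\<bar> * \<bar>s\<bar> \<le> G^2 + s^2 / 4"
      proof -
        have "0 \<le> (G - \<bar>s\<bar> / 2)^2" by simp
        thus ?thesis by (simp add: power2_diff power_divide G_def algebra_simps)
      qed
      moreover have "s^2/4 \<le> z * s^2 / 4" using z by (simp add: mult_le_cancel_right1)
      ultimately have 2: "\<bar>s\<bar> + (- z * cosh s + g * s) \<le> - z + G^2 + - ((sqrt z * s)^2) / 4"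
        using z by (simp add: power_mult_distrib algebra_simps)
      have "(1 + z * cosh s) * exp (- z * cosh s + g * s) \<le> 2 * z * exp \<bar>s\<bar> * exp (- z * cosh s + g * s)"
        using 1 by (intro mult_right_mono) auto
      also have "\<dots> = 2 * z * exp (\<bar>s\<bar> + (- z * cosh s + g * s))" unfolding exp_add by simp
      also have "\<dots> \<le> 2 * z * exp (- z + G^2 + - ((sqrt z * s)^2) / 4)" using 2 z by (intro mult_left_mono) auto
      also have "\<dots> = (2 * z * exp (-z) * exp (G^2)) * w s" unfolding exp_add w_def v_def by simp
      finally show "(1 + z * cosh s) * exp (- z * cosh s + g * s) \<le> (2 * z * exp (-z) * exp (G^2)) * w s" .
    qed
    also have "\<dots> = 2 * exp (G^2) * I * sqrt z * exp (-z)"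
    proof -
      have "z * I' = sqrt z * (sqrt z * I')" for I' using z by (simp add: mult.assoc[symmetric])
      from this[of "LINT s|lborel. w s"] show ?thesis unfolding wI by (simp add: mult_ac)
    qed
    also have "\<dots> \<le> C * sqrt z * exp (-z)" unfolding C_def using z by (intro mult_right_mono) auto
    finally show ?thesis using z by (simp add: powr_half_sqrt)
  qed
  thus ?thesis using C by blast
qed

subsection \<open>A radial eigenfunction of the Laplacian\<close>

text \<open>The radial solution of \<open>\<Delta>\<Phi> = \<Phi>\<close> on \<open>\<real>\<^sup>N\<close> with \<open>\<Phi>(0) = 1\<close>, written as a function of \<open>s = |x|\<^sup>2\<close>;
  the equation becomes \<open>4sF'' + 2NF' = F\<close>.\<close>

definition rad_coeff :: "real \<Rightarrow> nat \<Rightarrow> real" where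
  "rad_coeff N k = (\<Prod>i<k. 1 / (4 * (real i + 1) * (real i + N / 2)))"

definition rad :: "real \<Rightarrow> nat \<Rightarrow> real \<Rightarrow> real" where
  "rad N j s = (\<Sum>k. (diffs ^^ j) (rad_coeff N) k * s ^ k)"

lemma rad_coeff_bounds:
  assumes "N \<ge> 1"
  shows "rad_coeff N k > 0" "rad_coeff N k \<le> 1 / fact k"
proof -
  show p: "rad_coeff N k > 0" for k using assms unfolding rad_coeff_def by (intro prod_pos) auto
  show "rad_coeff N k \<le> 1 / fact k"
  proof (induction k)
    case (Suc k)
    have "1 \<le> 4 * (real k + N/2)" using assms by simp
    hence "(real k + 1) * 1 \<le> (real k + 1) * (4 * (real k + N/2))" by (intro mult_left_mono) auto
    also have "\<dots> = 4 * (real k + 1) * (real k + N / 2)" by (simp add: field_simps)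
    finally have "1 / (4 * (real k + 1) * (real k + N / 2)) \<le> 1 / (real k + 1)"
      by (intro frac_le) auto
    hence "rad_coeff N k * (1 / (4 * (real k + 1) * (real k + N / 2))) \<le> 1 / fact k * (1 / (real k + 1))"
      using Suc assms by (intro mult_mono) auto
    thus ?case by (simp add: rad_coeff_def mult_ac add_ac)
  qed (simp add: rad_coeff_def)
qed

lemma rad_coeff_Suc:
  assumes "N \<ge> 1"
  shows "4 * (real k + 1) * (real k + N / 2) * rad_coeff N (Suc k) = rad_coeff N k"
  using assms by (simp add: rad_coeff_def)

lemma diffs_rad_nonneg: "N \<ge> 1 \<Longrightarrow> (diffs ^^ j) (rad_coeff N) k \<ge> 0"
  by (induction j arbitrary: k) (auto simp: diffs_def less_imp_le rad_coeff_bounds)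

lemma summable_rad:
  assumes "N \<ge> 1"
  shows "summable (\<lambda>k. (diffs ^^ j) (rad_coeff N) k * s ^ k)"
proof (induction j arbitrary: s)
  case 0
  have "summable (\<lambda>k. \<bar>s\<bar> ^ k / fact k)" using summable_exp[of "\<bar>s\<bar>"] by (simp add: divide_inverse mult.commute)
  thus ?case
  proof (rule summable_comparison_test'[where N=0])
    fix k :: nat assume "k \<ge> 0"
    have "rad_coeff N k * \<bar>s\<bar> ^ k \<le> 1 / fact k * \<bar>s\<bar> ^ k"
      using rad_coeff_bounds[OF assms, of k] by (intro mult_right_mono) auto
    thus "norm ((diffs ^^ 0) (rad_coeff N) k * s ^ k) \<le> \<bar>s\<bar> ^ k / fact k"
      using rad_coeff_bounds(1)[OF assms, of k] by (simp add: abs_mult power_abs)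
  qed
next
  case (Suc j)
  thus ?case using termdiff_converges_all[of "(diffs ^^ j) (rad_coeff N)" s] by simp
qed

lemma DERIV_rad:
  assumes "N \<ge> 1"
  shows "(rad N j has_real_derivative rad N (Suc j) s) (at s)"
  using termdiffs_strong_converges_everywhere[OF summable_rad[OF assms], of j s]
  unfolding rad_def[abs_def] by simp

lemma rad_nonneg: "N \<ge> 1 \<Longrightarrow> s \<ge> 0 \<Longrightarrow> rad N j s \<ge> 0"
  unfolding rad_def by (intro suminf_nonneg summable_rad mult_nonneg_nonneg diffs_rad_nonneg zero_le_power)

lemma rad_mono:
  assumes "N \<ge> 1" "0 \<le> s" "s \<le> t"
  shows "rad N j s \<le> rad N j t"
  using assms DERIV_rad[OF assms(1)] rad_nonneg[OF assms(1)]
  by (intro DERIV_nonneg_imp_nondecreasing[OF assms(3)]) (meson order_trans)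

lemma rad_ge_1:
  assumes "N \<ge> 1" "s \<ge> 0"
  shows "rad N 0 s \<ge> 1"
proof -
  have "rad N 0 0 = 1" using powser_zero[of "rad_coeff N"] by (simp add: rad_def rad_coeff_def)
  thus ?thesis using rad_mono[OF assms(1) order_refl assms(2), of 0] by simp
qed

text \<open>Read coefficient by coefficient, this is the recursion
  \<open>rad_coeff_Suc\<close>.\<close>

lemma rad_ode:
  assumes N: "N \<ge> 1"
  shows "4 * s * rad N 2 s + 2 * N * rad N 1 s = rad N 0 s"
proof -
  let ?c = "rad_coeff N"
  have s0: "(\<lambda>k. ?c k * s^k) sums rad N 0 s" and s1: "(\<lambda>k. diffs ?c k * s^k) sums rad N 1 s"
    and s2: "(\<lambda>k. diffs (diffs ?c) k * s^k) sums rad N 2 s"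
    using summable_sums[OF summable_rad[OF N, of 0 s]] summable_sums[OF summable_rad[OF N, of 1 s]]
      summable_sums[OF summable_rad[OF N, of 2 s]] by (simp_all add: rad_def numeral_2_eq_2)
  have "(\<lambda>k. real (Suc k) * diffs ?c (Suc k) * s ^ Suc k) sums (s * rad N 2 s)"
    using sums_mult[OF s2, of s] by (simp add: diffs_def mult_ac)
  hence "(\<lambda>k. real k * diffs ?c k * s ^ k) sums (s * rad N 2 s)"
    by (subst (asm) sums_Suc_iff) simp
  hence "(\<lambda>k. 4 * (real k * diffs ?c k * s ^ k) + 2 * N * (diffs ?c k * s^k)) sums (4 * (s * rad N 2 s) + 2 * N * rad N 1 s)"
    by (intro sums_add sums_mult s1)
  moreover have "4 * (real k * diffs ?c k * s ^ k) + 2 * N * (diffs ?c k * s^k) = ?c k * s^k" for k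
    unfolding rad_coeff_Suc[OF N, of k, symmetric] by (simp add: diffs_def algebra_simps)
  ultimately have "(\<lambda>k. ?c k * s^k) sums (4 * (s * rad N 2 s) + 2 * N * rad N 1 s)" by simp
  with s0 show ?thesis using sums_unique2 by fastforce
qed

text \<open>In terms of r, f = \<open>rad\<close> at r^2 solves f'' + (N-1)/r f' = f. The factor r^m
  removes the first-order term: h = r^m f satisfies h'' = h + m(m-1)/r^2 h, a perturbation of h'' =
  h that is integrable at infinity. Hence h grows no faster than e^r, and f gains the decay
  r^(-m).\<close>

lemma rad_le_exp:
  assumes N: "N \<ge> 1" and m: "m = (N - 1) / 2"
  shows "\<exists>C>0. \<forall>r\<ge>0. rad N 0 (r^2) \<le> C * (1 + r) powr (-m) * exp r"
proof -
  define f where "f r = rad N 0 (r^2)" for r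
  define f' where "f' r = 2 * r * rad N 1 (r^2)" for r
  have f0: "f r \<ge> 0" "f' r \<ge> 0" if "r \<ge> 0" for r
    unfolding f_def f'_def using that N by (intro mult_nonneg_nonneg rad_nonneg; simp)+
  have Df: "(f has_real_derivative f' r) (at r)" for r
    unfolding f_def[abs_def] f'_def
    by (rule DERIV_chain2[OF DERIV_rad[OF N], THEN DERIV_cong]) (auto intro!: derivative_eq_intros)
  have Df': "(f' has_real_derivative f r - 2 * m / r * f' r) (at r)" if "r > 0" for r
  proof -
    have "((\<lambda>r. rad N 1 (r^2)) has_real_derivative rad N 2 (r^2) * (2 * r)) (at r)"
    proof (rule DERIV_chain2[where f="rad N 1" and g="\<lambda>r. r^2"])
      show "(rad N 1 has_real_derivative rad N 2 (r^2)) (at (r^2))"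
        using DERIV_rad[OF N, of 1 "r^2"] by (simp add: numeral_2_eq_2)
    qed (auto intro!: derivative_eq_intros)
    hence "(f' has_real_derivative 2 * rad N 1 (r^2) + 2 * r * (rad N 2 (r^2) * (2 * r))) (at r)"
      unfolding f'_def[abs_def] by (auto intro!: derivative_eq_intros)
    also have "2 * rad N 1 (r^2) + 2 * r * (rad N 2 (r^2) * (2 * r)) = f r - 2 * m / r * f' r"
    proof -
      have "2 * m / r * f' r = 2 * (N - 1) * rad N 1 (r^2)" using that by (simp add: f'_def m)
      moreover have "2 * r * (rad N 2 (r^2) * (2 * r)) = 4 * r^2 * rad N 2 (r^2)" by (simp add: power2_eq_square)
      moreover have "2 * (N - 1) * rad N 1 (r^2) = 2 * N * rad N 1 (r^2) - 2 * rad N 1 (r^2)"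
        by (simp add: algebra_simps)
      ultimately show ?thesis using rad_ode[OF N, of "r^2"] unfolding f_def by linarith
    qed
    finally show ?thesis .
  qed
  have m0: "m \<ge> 0" using N m by simp
  define h where "h r = r powr m * f r" for r
  define h' where "h' r = m * r powr (m - 1) * f r + r powr m * f' r" for r
  define c where "c = \<bar>m * (m - 1)\<bar>"
  define w where "w r = exp (-r) * (h' r + h r)" for r
  have h0: "h r \<ge> 0" "h' r \<ge> 0" if "r > 0" for r using f0[of r] that m0 by (auto simp: h_def h'_def)
  have Dh: "(h has_real_derivative h' r) (at r)" if "r > 0" for r
    unfolding h_def[abs_def] h'_def using that by (auto intro!: derivative_eq_intros Df)
  have Dh': "(h' has_real_derivative h r + m * (m - 1) / r^2 * h r) (at r)" if r: "r > 0" for r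
  proof -
    have 1: "r powr (m-1) = r powr m / r" "r powr (m-1-1) = r powr m / r^2"
      using r by (simp_all add: powr_diff power2_eq_square)
    have "(h' has_real_derivative m * ((m-1) * r powr (m-1-1)) * f r + m * r powr (m-1) * f' r
       + (m * r powr (m-1) * f' r + r powr m * (f r - 2 * m / r * f' r))) (at r)"
      unfolding h'_def[abs_def] using r by (auto intro!: derivative_eq_intros Df Df' simp: algebra_simps)
    also have "m * ((m-1) * r powr (m-1-1)) * f r + m * r powr (m-1) * f' r
       + (m * r powr (m-1) * f' r + r powr m * (f r - 2 * m / r * f' r)) = h r + m * (m - 1) / r^2 * h r"
      unfolding 1 h_def using r by (simp add: field_simps power2_eq_square)
    finally show ?thesis .
  qed
  \<comment> \<open>Since w' = e^(-r) m(m-1)/r^2 h <= (c/r^2) w, the integrating factor exp(c/r)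
    makes \<open>V\<close> nonincreasing; it stays between 1 and e^c for r >= 1, so \<open>w\<close>
    is bounded.\<close>
  define V where "V r = w r * exp (c / r)" for r
  have Vle: "V r \<le> V 1" if "r \<ge> 1" for r
  proof (rule DERIV_nonpos_imp_nonincreasing[OF that])
    fix x :: real assume x: "1 \<le> x" "x \<le> r"
    have Dw: "(w has_real_derivative exp (-x) * (m * (m - 1) / x^2 * h x)) (at x)"
      unfolding w_def[abs_def] using x
      by (auto intro!: derivative_eq_intros Dh Dh' simp: algebra_simps)
    have "(V has_real_derivative exp (-x) * (m * (m - 1) / x^2 * h x) * exp (c/x) + w x * (exp (c/x) * (- c / x^2))) (at x)"
      unfolding V_def[abs_def] using x
      by (auto intro!: derivative_eq_intros Dw simp: power2_eq_square)
    moreover have "exp (-x) * (m * (m - 1) / x^2 * h x) * exp (c/x) + w x * (exp (c/x) * (- c / x^2))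
       = exp (c/x) * exp (-x) / x^2 * (m * (m-1) * h x - c * (h' x + h x))"
      unfolding w_def by (simp add: algebra_simps diff_divide_distrib add_divide_distrib)
    moreover have "m * (m-1) * h x \<le> c * (h' x + h x)"
      using h0[of x] x by (intro mult_mono) (auto simp: c_def)
    hence "exp (c/x) * exp (-x) / x^2 * (m * (m-1) * h x - c * (h' x + h x)) \<le> 0"
      by (intro mult_nonneg_nonpos) auto
    ultimately show "\<exists>y. (V has_real_derivative y) (at x) \<and> y \<le> 0" by auto
  qed
  have V1: "V 1 \<ge> 0" using h0[of 1] by (simp add: V_def w_def)
  have wle: "w r \<le> V 1" if "r \<ge> 1" for r
  proof -
    have "w r * 1 \<le> V r" unfolding V_def
      using h0[of r] that by (intro mult_left_mono) (auto simp: w_def c_def)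
    thus ?thesis using Vle[OF that] by simp
  qed
  \<comment> \<open>The derivative of h e^r is e^(2r) w, hence at most
    \<open>V 1 * exp (2 * r)\<close>; subtracting a primitive of this bound gives a nonincreasing
    function.\<close>
  define g where "g r = h r * exp r - V 1 * exp (2 * r) / 2" for r
  have gle: "g r \<le> g 1" if "r \<ge> 1" for r
  proof (rule DERIV_nonpos_imp_nonincreasing[OF that])
    fix x :: real assume x: "1 \<le> x" "x \<le> r"
    have "(g has_real_derivative h' x * exp x + h x * exp x - V 1 * exp (2 * x)) (at x)"
      unfolding g_def[abs_def] using x by (auto intro!: derivative_eq_intros Dh)
    moreover have "h' x * exp x + h x * exp x - V 1 * exp (2 * x) = exp (2 * x) * (w x - V 1)"
    proof -
      have "exp (2*x) * exp (-x) = exp x" by (simp add: exp_add[symmetric])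
      thus ?thesis unfolding w_def by (simp add: algebra_simps mult.assoc[symmetric])
    qed
    moreover have "exp (2 * x) * (w x - V 1) \<le> 0" using wle[OF x(1)] by (intro mult_nonneg_nonpos) auto
    ultimately show "\<exists>y. (g has_real_derivative y) (at x) \<and> y \<le> 0" by auto
  qed
  define K where "K = h 1 + V 1"
  have K0: "K \<ge> 0" using h0[of 1] V1 by (simp add: K_def)
  have hle: "h r \<le> K * exp r" if "r \<ge> 1" for r
  proof -
    have "h r * exp r \<le> h 1 * exp 1 + V 1 * exp (2 * r) / 2"
    proof -
      have "0 \<le> V 1 * exp 2 / 2" using V1 by simp
      thus ?thesis using gle[OF that] by (simp add: g_def)
    qed
    also have "\<dots> \<le> h 1 * exp (2 * r) + V 1 * exp (2 * r)"
      using that h0[of 1] V1 by (intro add_mono mult_left_mono) auto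
    also have "exp (2 * r) = exp r * exp r" by (simp add: exp_add[symmetric])
    also have "h 1 * (exp r * exp r) + V 1 * (exp r * exp r) = (K * exp r) * exp r" by (simp add: K_def algebra_simps)
    finally show ?thesis by simp
  qed
  \<comment> \<open>The factor 2^m turns r^(-m) into (1 + r)^(-m) for r >= 1; the summand
    \<open>rad N 0 1\<close> takes care of r <= 1 by monotonicity.\<close>
  define C where "C = 2 powr m * (K + rad N 0 1)"
  have F1: "rad N 0 1 \<ge> 1" by (intro rad_ge_1 N) auto
  have C: "C > 0" unfolding C_def using K0 F1 by (intro mult_pos_pos) auto
  have "rad N 0 (r^2) \<le> C * (1 + r) powr (-m) * exp r" if r: "r \<ge> 0" for r
  proof (cases "r \<ge> 1")
    case True
    have "rad N 0 (r^2) = r powr (-m) * h r" using True by (simp add: h_def f_def powr_minus field_simps)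
    also have "\<dots> \<le> r powr (-m) * (K * exp r)" using hle[OF True] by (intro mult_left_mono) auto
    also have "r powr (-m) \<le> ((1 + r) / 2) powr (-m)" using True m0 by (intro powr_mono2') auto
    also have "((1 + r) / 2) powr (-m) = 2 powr m * (1 + r) powr (-m)"
      using r by (simp add: powr_divide powr_minus field_simps)
    finally have "rad N 0 (r^2) \<le> 2 powr m * (1 + r) powr (-m) * (K * exp r)"
      using K0 by (simp add: mult_right_mono)
    also have "\<dots> \<le> 2 powr m * (1 + r) powr (-m) * ((K + rad N 0 1) * exp r)"
      using F1 by (intro mult_left_mono mult_right_mono) auto
    finally show ?thesis by (simp add: C_def mult_ac)
  next
    case False
    have "rad N 0 (r^2) \<le> rad N 0 1" using False r by (intro rad_mono N) (auto simp: power_le_one)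
    also have "\<dots> \<le> (K + rad N 0 1) * 1" using K0 by simp
    also have "(K + rad N 0 1) * 1 = (K + rad N 0 1) * (2 powr m * 2 powr (-m))" by (simp add: powr_minus)
    also have "(K + rad N 0 1) * (2 powr m * 2 powr (-m)) \<le> (K + rad N 0 1) * (2 powr m * (1 + r) powr (-m))"
      using False r m0 K0 F1 by (intro mult_left_mono powr_mono2') auto
    also have "\<dots> = C * (1 + r) powr (-m) * 1" by (simp add: C_def)
    also have "\<dots> \<le> C * (1 + r) powr (-m) * exp r" using r C by (intro mult_left_mono) auto
    finally show ?thesis .
  qed
  thus ?thesis using C by blast
qed

text \<open>\<open>\<Phi>(\<lambda>x)\<close> and its first and second derivatives in the direction \<open>b\<close>.\<close>

definition eigf :: "real \<Rightarrow> 'a::euclidean_space \<Rightarrow> real" where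
  "eigf k x = rad DIM('a) 0 (k^2 * (x \<bullet> x))"

definition eigf1 :: "real \<Rightarrow> 'a::euclidean_space \<Rightarrow> 'a \<Rightarrow> real" where
  "eigf1 k b x = rad DIM('a) 1 (k^2 * (x \<bullet> x)) * (2 * k^2 * (x \<bullet> b))"

definition eigf2 :: "real \<Rightarrow> 'a::euclidean_space \<Rightarrow> 'a \<Rightarrow> real" where
  "eigf2 k b x = rad DIM('a) 2 (k^2 * (x \<bullet> x)) * (2 * k^2 * (x \<bullet> b))^2
     + rad DIM('a) 1 (k^2 * (x \<bullet> x)) * (2 * k^2 * (b \<bullet> b))"

lemma DIM_ge_1: "real DIM('a::euclidean_space) \<ge> 1"
  using DIM_positive[where 'a='a] by linarith

lemma rad_line_deriv:
  fixes x b :: "'a::euclidean_space"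
  shows "((\<lambda>s. rad DIM('a) j (k^2 * ((x + s *\<^sub>R b) \<bullet> (x + s *\<^sub>R b)))) has_real_derivative
    rad DIM('a) (Suc j) (k^2 * (x \<bullet> x)) * (2 * k^2 * (x \<bullet> b))) (at 0)"
proof -
  have "((\<lambda>s. k^2 * ((x + s *\<^sub>R b) \<bullet> (x + s *\<^sub>R b))) has_real_derivative 2 * k^2 * (x \<bullet> b)) (at 0)"
    unfolding inner_add_left inner_add_right inner_scaleR_left inner_scaleR_right
    by (auto intro!: derivative_eq_intros simp: inner_commute)
  from DERIV_chain2[OF _ this, of "rad DIM('a) j"] DERIV_rad[OF DIM_ge_1[where 'a='a], of j "k^2 * (x \<bullet> x)"]
  show ?thesis by simp
qed

lemma eigf_line_deriv:
  fixes x b :: "'a::euclidean_space"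
  shows "((\<lambda>s. eigf k (x + s *\<^sub>R b)) has_real_derivative eigf1 k b x) (at 0)"
    and "((\<lambda>s. eigf1 k b (x + s *\<^sub>R b)) has_real_derivative eigf2 k b x) (at 0)"
proof -
  show "((\<lambda>s. eigf k (x + s *\<^sub>R b)) has_real_derivative eigf1 k b x) (at 0)"
    unfolding eigf_def eigf1_def using rad_line_deriv[of 0] by simp
  have "((\<lambda>s. 2 * k^2 * ((x + s *\<^sub>R b) \<bullet> b)) has_real_derivative 2 * k^2 * (b \<bullet> b)) (at 0)"
    unfolding inner_add_left inner_scaleR_left by (auto intro!: derivative_eq_intros)
  from DERIV_mult[OF rad_line_deriv[of 1 k x b] this]
  show "((\<lambda>s. eigf1 k b (x + s *\<^sub>R b)) has_real_derivative eigf2 k b x) (at 0)"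
    unfolding eigf1_def eigf2_def by (simp add: power2_eq_square mult_ac numeral_2_eq_2)
qed

lemma continuous_rad: "N \<ge> 1 \<Longrightarrow> continuous_on S (rad N j)"
  by (intro continuous_at_imp_continuous_on ballI DERIV_isCont) (rule DERIV_rad)

lemma continuous_on_rad:
  "N \<ge> 1 \<Longrightarrow> continuous_on S g \<Longrightarrow> continuous_on S (\<lambda>x. rad N j (g x))"
  by (rule continuous_on_compose2[OF continuous_rad[of N UNIV]]) auto

lemma continuous_eigf:
  fixes b :: "'a::euclidean_space"
  shows "continuous_on S (\<lambda>(k, x::'a). eigf k x)" "continuous_on S' (eigf k :: 'a \<Rightarrow> real)"
    "continuous_on S' (eigf1 k b)" "continuous_on S' (eigf2 k b)"
  unfolding eigf_def[abs_def] eigf1_def[abs_def] eigf2_def[abs_def] split_beta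
  by (intro continuous_intros continuous_on_rad DIM_ge_1)+

lemma eigf_laplacian:
  fixes x :: "'a::euclidean_space"
  shows "(\<Sum>b\<in>Basis. eigf2 k b x) = k^2 * eigf k x"
proof -
  let ?N = "real DIM('a)"
  have "(\<Sum>b\<in>Basis. eigf2 k b x) = (\<Sum>b\<in>Basis. 4 * k^2 * k^2 * rad ?N 2 (k^2 * (x \<bullet> x)) * ((x \<bullet> b) * (x \<bullet> b))
     + rad ?N 1 (k^2 * (x \<bullet> x)) * (2 * k^2))"
    unfolding eigf2_def by (intro sum.cong) (auto simp: power2_eq_square inner_Basis)
  also have "\<dots> = 4 * k^2 * k^2 * rad ?N 2 (k^2 * (x \<bullet> x)) * (x \<bullet> x) + ?N * (rad ?N 1 (k^2 * (x \<bullet> x)) * (2 * k^2))"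
    by (simp add: sum.distrib sum_distrib_left[symmetric] euclidean_inner[of x x])
  also have "\<dots> = k^2 * (4 * (k^2 * (x \<bullet> x)) * rad ?N 2 (k^2 * (x \<bullet> x)) + 2 * ?N * rad ?N 1 (k^2 * (x \<bullet> x)))"
    by (simp add: algebra_simps)
  finally show ?thesis unfolding rad_ode[OF DIM_ge_1] eigf_def .
qed

text \<open>Allows the spatial factor to be dropped from the nonlinear term and the data term of the
  tested equation.\<close>

lemma eigf_ge_1: "eigf k x \<ge> 1"
  unfolding eigf_def by (intro rad_ge_1 DIM_ge_1) auto

lemma eigf_nonneg [simp]: "eigf k x \<ge> 0"
  by (rule order_trans[OF zero_le_one eigf_ge_1])

lemma eigf_le_exp:
  "\<exists>C>0. \<forall>k\<ge>0. \<forall>x::'a::euclidean_space.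
     eigf k x \<le> C * (1 + k * norm x) powr (- ((real DIM('a) - 1) / 2)) * exp (k * norm x)"
proof -
  obtain C where C: "C > 0" "\<And>r. r \<ge> 0 \<Longrightarrow>
      rad DIM('a) 0 (r^2) \<le> C * (1 + r) powr (- ((real DIM('a) - 1) / 2)) * exp r"
    using rad_le_exp[OF DIM_ge_1[where 'a='a] refl] by blast
  show ?thesis
  proof (intro exI[of _ C] conjI allI impI C(1))
    fix k :: real and x :: 'a assume "k \<ge> 0"
    thus "eigf k x \<le> C * (1 + k * norm x) powr (- ((real DIM('a) - 1) / 2)) * exp (k * norm x)"
      using C(2)[of "k * norm x"] by (simp add: eigf_def power_mult_distrib power2_norm_eq_inner)
  qed
qed

subsection \<open>Classical solutions\<close>

lemma ereal_le_less_trans: "a \<le> b \<Longrightarrow> ereal b < T \<Longrightarrow> ereal a < T"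
  by (rule le_less_trans[of _ "ereal b"]) auto

lemma at_within_time_interval_neq_bot:
  assumes "t \<in> time_interval T"
  shows "at t within time_interval T \<noteq> bot"
proof -
  from assms have t: "1 \<le> t" "ereal t < T" by (auto simp: time_interval_def)
  then obtain r where r: "t < r" "ereal r < T" using ereal_dense2[of "ereal t" T] by auto
  hence "{t..r} \<subseteq> time_interval T" using t by (auto simp: time_interval_def intro: ereal_le_less_trans)
  hence "at t within {t..r} \<le> at t within time_interval T" by (rule at_le)
  moreover have "at t within {t..r} \<noteq> bot" using r by (simp add: at_within_Icc_at_right)
  ultimately show ?thesis by (auto simp: le_bot)
qed

lemma convex_time_interval: "convex (time_interval T)"
  unfolding is_interval_convex_1[symmetric] is_interval_1 time_interval_def
  by (auto intro: ereal_le_less_trans)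

lemma time_interval_Icc: "b \<in> time_interval T \<Longrightarrow> {1..b} \<subseteq> time_interval T"
  unfolding time_interval_def by (auto intro: ereal_le_less_trans)

lemma at_within_time_interval: "1 < t \<Longrightarrow> t \<in> time_interval T \<Longrightarrow> at t within time_interval T = at t"
proof -
  assume t: "1 < t" "t \<in> time_interval T"
  have "{1<..} \<inter> {t. ereal t < T} \<subseteq> time_interval T" by (auto simp: time_interval_def)
  moreover have "open ({1<..} \<inter> {t. ereal t < T})"
    by (intro open_Int open_Collect_less continuous_intros)
  ultimately show ?thesis using t
    by (intro at_within_interior) (auto simp: time_interval_def interior_def)
qed

text \<open>A classical solution together with its partial derivatives up to order two: \<open>ud b\<close>, \<open>udd b\<close> are the
  first and second derivatives in the spatial direction \<open>b\<close>, and \<open>udt b\<close> is the mixed one.\<close>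

locale damped_wave =
  fixes l \<mu> nu2 p R :: real and T :: ereal
    and u ut utt :: "real \<Rightarrow> real^'n \<Rightarrow> real"
    and ud udt udd :: "real^'n \<Rightarrow> real \<Rightarrow> real^'n \<Rightarrow> real"
    and f g :: "real^'n \<Rightarrow> real"
  assumes l: "l > -1" and p: "p > 1" and R: "R > 0" and T: "1 < T"
    and cont: "continuous_on (time_interval T \<times> UNIV) (\<lambda>(t, x). u t x)"
      "continuous_on (time_interval T \<times> UNIV) (\<lambda>(t, x). ut t x)"
      "continuous_on (time_interval T \<times> UNIV) (\<lambda>(t, x). utt t x)"
      "\<And>b. b \<in> Basis \<Longrightarrow> continuous_on (time_interval T \<times> UNIV) (\<lambda>(t, x). ud b t x)"
      "\<And>b. b \<in> Basis \<Longrightarrow> continuous_on (time_interval T \<times> UNIV) (\<lambda>(t, x). udt b t x)"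
      "\<And>b. b \<in> Basis \<Longrightarrow> continuous_on (time_interval T \<times> UNIV) (\<lambda>(t, x). udd b t x)"
    and time_deriv: "\<And>t x. t \<in> time_interval T \<Longrightarrow> ((\<lambda>s. u s x) has_real_derivative ut t x) (at t within time_interval T)"
      "\<And>t x. t \<in> time_interval T \<Longrightarrow> ((\<lambda>s. ut s x) has_real_derivative utt t x) (at t within time_interval T)"
      "\<And>b t x. b \<in> Basis \<Longrightarrow> t \<in> time_interval T \<Longrightarrow>
         ((\<lambda>s. ud b s x) has_real_derivative udt b t x) (at t within time_interval T)"
    and space_deriv: "\<And>b t x. b \<in> Basis \<Longrightarrow> t \<in> time_interval T \<Longrightarrow>
         ((\<lambda>s. u t (x + s *\<^sub>R b)) has_real_derivative ud b t x) (at 0)"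
      "\<And>b t x. b \<in> Basis \<Longrightarrow> t \<in> time_interval T \<Longrightarrow>
         ((\<lambda>s. ut t (x + s *\<^sub>R b)) has_real_derivative udt b t x) (at 0)"
      "\<And>b t x. b \<in> Basis \<Longrightarrow> t \<in> time_interval T \<Longrightarrow>
         ((\<lambda>s. ud b t (x + s *\<^sub>R b)) has_real_derivative udd b t x) (at 0)"
    and pde: "\<And>t x. 1 < t \<Longrightarrow> t \<in> time_interval T \<Longrightarrow>
         utt t x - t powr (2 * l) * (\<Sum>b\<in>Basis. udd b t x) + \<mu> / t * ut t x + nu2 / t^2 * u t x = \<bar>u t x\<bar> powr p"
    and init: "\<And>x. u 1 x = f x" "\<And>x. ut 1 x = g x"
    and data_supp: "\<And>x. norm x \<ge> R \<Longrightarrow> f x = 0" "\<And>x. norm x \<ge> R \<Longrightarrow> g x = 0"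
    and cont_data: "continuous_on UNIV f" "continuous_on UNIV g"

text \<open>Partial derivatives are obtained by composing the total derivative with coordinate
  lines. The two mixed derivatives \<open>udt\<close> and \<open>utd\<close> are kept apart; their
  equality is a separate matter.\<close>

lemma Ck_on_2_partials:
  fixes u :: "real \<Rightarrow> 'a::euclidean_space \<Rightarrow> real"
  assumes "Ck_on 2 (I \<times> UNIV) (\<lambda>(t, x). u t x)"
  obtains ut utt ud udt utd udd where
    "continuous_on (I \<times> UNIV) (\<lambda>(t, x). u t x)"
    "continuous_on (I \<times> UNIV) (\<lambda>(t, x). ut t x)"
    "continuous_on (I \<times> UNIV) (\<lambda>(t, x). utt t x)"
    "\<And>b. b \<in> Basis \<Longrightarrow> continuous_on (I \<times> UNIV) (\<lambda>(t, x). ud b t x)"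
    "\<And>b. b \<in> Basis \<Longrightarrow> continuous_on (I \<times> UNIV) (\<lambda>(t, x). udt b t x)"
    "\<And>b. b \<in> Basis \<Longrightarrow> continuous_on (I \<times> UNIV) (\<lambda>(t, x). utd b t x)"
    "\<And>b. b \<in> Basis \<Longrightarrow> continuous_on (I \<times> UNIV) (\<lambda>(t, x). udd b t x)"
    "\<And>t x. t \<in> I \<Longrightarrow> ((\<lambda>s. u s x) has_real_derivative ut t x) (at t within I)"
    "\<And>t x. t \<in> I \<Longrightarrow> ((\<lambda>s. ut s x) has_real_derivative utt t x) (at t within I)"
    "\<And>b t x. b \<in> Basis \<Longrightarrow> t \<in> I \<Longrightarrow> ((\<lambda>s. ud b s x) has_real_derivative udt b t x) (at t within I)"
    "\<And>b t x. b \<in> Basis \<Longrightarrow> t \<in> I \<Longrightarrow> ((\<lambda>s. u t (x + s *\<^sub>R b)) has_real_derivative ud b t x) (at 0)"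
    "\<And>b t x. b \<in> Basis \<Longrightarrow> t \<in> I \<Longrightarrow> ((\<lambda>s. ut t (x + s *\<^sub>R b)) has_real_derivative utd b t x) (at 0)"
    "\<And>b t x. b \<in> Basis \<Longrightarrow> t \<in> I \<Longrightarrow> ((\<lambda>s. ud b t (x + s *\<^sub>R b)) has_real_derivative udd b t x) (at 0)"
proof -
  let ?S = "I \<times> (UNIV :: 'a set)"
  let ?u = "\<lambda>(t, x). u t x"
  have line_t: "((\<lambda>s. F (s, x)) has_real_derivative G (t, x) \<bullet> (1, 0)) (at t within I)"
    if D: "\<And>z. z \<in> ?S \<Longrightarrow> (F has_derivative (\<lambda>h. G z \<bullet> h)) (at z within ?S)" and t: "t \<in> I"
    for F :: "real \<times> 'a \<Rightarrow> real" and G t x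
  proof -
    have "((\<lambda>s. (s, x)) has_derivative (\<lambda>h. (h, 0))) (at t within I)"
      by (auto intro!: derivative_eq_intros)
    from has_derivative_in_compose2[OF D _ t this]
    have "((\<lambda>s. F (s, x)) has_derivative (\<lambda>y. G (t, x) \<bullet> (y, 0))) (at t within I)" by auto
    moreover have "(\<lambda>y. G (t, x) \<bullet> (y, 0)) = (*) (G (t, x) \<bullet> (1, 0))"
      by (auto simp: inner_prod_def)
    ultimately show ?thesis by (simp add: has_field_derivative_def)
  qed
  have line_x: "((\<lambda>s. F (t, x + s *\<^sub>R b)) has_real_derivative G (t, x) \<bullet> (0, b)) (at 0)"
    if D: "\<And>z. z \<in> ?S \<Longrightarrow> (F has_derivative (\<lambda>h. G z \<bullet> h)) (at z within ?S)" and t: "t \<in> I"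
    for F :: "real \<times> 'a \<Rightarrow> real" and G t x b
  proof -
    have "((\<lambda>s. (t, x + s *\<^sub>R b)) has_derivative (\<lambda>h. (0, h *\<^sub>R b))) (at 0 within UNIV)"
      by (auto intro!: derivative_eq_intros)
    from has_derivative_in_compose2[OF D _ _ this] t
    have "((\<lambda>s. F (t, x + s *\<^sub>R b)) has_derivative (\<lambda>y. G (t, x) \<bullet> (0, y *\<^sub>R b))) (at 0)" by auto
    moreover have "(\<lambda>y. G (t, x) \<bullet> (0, y *\<^sub>R b)) = (*) (G (t, x) \<bullet> (0, b))"
      by (auto simp: inner_prod_def)
    ultimately show ?thesis by (simp add: has_field_derivative_def)
  qed
  have "\<exists>G. (\<forall>z\<in>?S. (?u has_derivative (\<lambda>h. G z \<bullet> h)) (at z within ?S)) \<and>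
      (\<forall>c\<in>Basis. Ck_on (Suc 0) ?S (\<lambda>z. G z \<bullet> c))"
    using assms unfolding numeral_2_eq_2 by (subst (asm) Ck_on.simps(2))
  then obtain G where G: "\<And>z. z \<in> ?S \<Longrightarrow> (?u has_derivative (\<lambda>h. G z \<bullet> h)) (at z within ?S)"
    and G1: "\<And>c. c \<in> Basis \<Longrightarrow> Ck_on (Suc 0) ?S (\<lambda>z. G z \<bullet> c)"
    by blast
  have "\<forall>c\<in>Basis. \<exists>H. (\<forall>z\<in>?S. ((\<lambda>z. G z \<bullet> c) has_derivative (\<lambda>h. H z \<bullet> h)) (at z within ?S)) \<and>
      (\<forall>d\<in>Basis. continuous_on ?S (\<lambda>z. H z \<bullet> d))"
    using G1 by simp
  then obtain H where H: "\<And>c z. c \<in> Basis \<Longrightarrow> z \<in> ?S \<Longrightarrow> ((\<lambda>z. G z \<bullet> c) has_derivative (\<lambda>h. H c z \<bullet> h)) (at z within ?S)"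
    and Hc: "\<And>c d. c \<in> Basis \<Longrightarrow> d \<in> Basis \<Longrightarrow> continuous_on ?S (\<lambda>z. H c z \<bullet> d)"
    by metis
  have B: "(1, 0) \<in> (Basis :: (real \<times> 'a) set)" "\<And>b. b \<in> Basis \<Longrightarrow> (0, b) \<in> (Basis :: (real \<times> 'a) set)"
    by (auto simp: Basis_prod_def)
  have Gc: "continuous_on ?S (\<lambda>z. G z \<bullet> c)" if "c \<in> Basis" for c
    using H[OF that] by (intro has_derivative_continuous_on) auto
  have uc: "continuous_on ?S ?u" using G by (intro has_derivative_continuous_on) auto
  show thesis
    by (rule that[of "\<lambda>t x. G (t, x) \<bullet> (1, 0)" "\<lambda>t x. H (1, 0) (t, x) \<bullet> (1, 0)"
        "\<lambda>b t x. G (t, x) \<bullet> (0, b)" "\<lambda>b t x. H (0, b) (t, x) \<bullet> (1, 0)" "\<lambda>b t x. H (1, 0) (t, x) \<bullet> (0, b)"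
        "\<lambda>b t x. H (0, b) (t, x) \<bullet> (0, b)"])
      (use line_t[OF G] line_x[OF G] line_t[OF H[OF B(1)]] line_t[OF H[OF B(2)]]
         line_x[OF H[OF B(1)]] line_x[OF H[OF B(2)]] uc Gc Hc B in \<open>simp_all add: split_beta'\<close>)
qed

text \<open>Symmetry also at t = 1, where only one-sided time derivatives exist. The increment u(t,
  x + s b) - u(t, x) is the integral of \<open>ux\<close>; differentiating it in t under the
  integral and then in s at 0 produces both mixed derivatives.\<close>

lemma mixed_partials_eq:
  fixes u :: "real \<Rightarrow> 'a::euclidean_space \<Rightarrow> real"
  assumes I: "convex I" "\<And>t. t \<in> I \<Longrightarrow> at t within I \<noteq> bot"
    and dt: "\<And>t x. t \<in> I \<Longrightarrow> ((\<lambda>s. u s x) has_real_derivative ut t x) (at t within I)"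
    and dx: "\<And>t x. t \<in> I \<Longrightarrow> ((\<lambda>s. u t (x + s *\<^sub>R b)) has_real_derivative ux t x) (at 0)"
    and dtx: "\<And>t x. t \<in> I \<Longrightarrow> ((\<lambda>s. ut t (x + s *\<^sub>R b)) has_real_derivative utx t x) (at 0)"
    and dxt: "\<And>t x. t \<in> I \<Longrightarrow> ((\<lambda>s. ux s x) has_real_derivative uxt t x) (at t within I)"
    and cx: "continuous_on (I \<times> UNIV) (\<lambda>(t, x). ux t x)"
    and cxt: "continuous_on (I \<times> UNIV) (\<lambda>(t, x). uxt t x)"
    and t: "t \<in> I"
  shows "utx t x = uxt t x"
proof -
  have cxl: "continuous_on {0..s} (\<lambda>\<sigma>. ux t (x + \<sigma> *\<^sub>R b))" if "t \<in> I" for t s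
  proof -
    have "continuous_on {0..s} (\<lambda>\<sigma>. (\<lambda>(t, x). ux t x) (t, x + \<sigma> *\<^sub>R b))"
      by (rule continuous_on_compose2[OF cx]) (auto intro!: continuous_intros that)
    thus ?thesis by simp
  qed
  have cxtl: "continuous_on (I \<times> {0..s}) (\<lambda>(t, \<sigma>). uxt t (x + \<sigma> *\<^sub>R b))" for s
  proof -
    have "continuous_on (I \<times> {0..s}) (\<lambda>z. (\<lambda>(t, x). uxt t x) (fst z, x + snd z *\<^sub>R b))"
      by (rule continuous_on_compose2[OF cxt]) (auto intro!: continuous_intros)
    thus ?thesis by (simp add: split_beta')
  qed
  have int: "u t (x + s *\<^sub>R b) - u t x = integral {0..s} (\<lambda>\<sigma>. ux t (x + \<sigma> *\<^sub>R b))" if "t \<in> I" "s \<ge> 0" for t s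
  proof -
    have "((\<lambda>\<sigma>. ux t (x + \<sigma> *\<^sub>R b)) has_integral u t (x + s *\<^sub>R b) - u t (x + 0 *\<^sub>R b)) {0..s}"
      using that line_deriv_at[OF dx[OF that(1)]]
      by (intro fundamental_theorem_of_calculus) (auto simp: has_real_derivative_iff_has_vector_derivative[symmetric])
    thus ?thesis by (simp add: integral_unique)
  qed
  have key: "ut t (x + s *\<^sub>R b) - ut t x = integral {0..s} (\<lambda>\<sigma>. uxt t (x + \<sigma> *\<^sub>R b))" if "s \<ge> 0" for s
  proof -
    have "((\<lambda>t. integral (cbox 0 s) (\<lambda>\<sigma>. ux t (x + \<sigma> *\<^sub>R b))) has_real_derivative
        integral (cbox 0 s) (\<lambda>\<sigma>. uxt t (x + \<sigma> *\<^sub>R b))) (at t within I)"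
      by (rule leibniz_rule_field_derivative) (use dxt cxl cxtl t I in \<open>auto intro!: integrable_continuous_real\<close>)
    from this[unfolded cbox_interval] have "((\<lambda>t. u t (x + s *\<^sub>R b) - u t x) has_real_derivative
        integral {0..s} (\<lambda>\<sigma>. uxt t (x + \<sigma> *\<^sub>R b))) (at t within I)"
      by (rule has_field_derivative_transform_within[OF _ zero_less_one t]) (use int that in auto)
    moreover have "((\<lambda>t. u t (x + s *\<^sub>R b) - u t x) has_real_derivative ut t (x + s *\<^sub>R b) - ut t x) (at t within I)"
      by (intro DERIV_diff dt t)
    ultimately show ?thesis using has_field_derivative_unique I(2)[OF t] by blast
  qed
  have "continuous_on {0..1} (\<lambda>\<sigma>. uxt t (x + \<sigma> *\<^sub>R b))"
  proof -
    have "continuous_on {0..1} (\<lambda>\<sigma>. (\<lambda>(t, \<sigma>). uxt t (x + \<sigma> *\<^sub>R b)) (t, \<sigma>))"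
      by (rule continuous_on_compose2[OF cxtl[of 1]]) (auto intro!: continuous_intros t)
    thus ?thesis by simp
  qed
  from integral_has_real_derivative[OF this, of 0]
  have "((\<lambda>s. integral {0..s} (\<lambda>\<sigma>. uxt t (x + \<sigma> *\<^sub>R b))) has_real_derivative uxt t x) (at 0 within {0..1})" by simp
  hence "((\<lambda>s. ut t (x + s *\<^sub>R b) - ut t x) has_real_derivative uxt t x) (at 0 within {0..1})"
    by (rule has_field_derivative_transform_within[OF _ zero_less_one]) (use key in auto)
  moreover have "((\<lambda>s. ut t (x + s *\<^sub>R b) - ut t x) has_real_derivative utx t x - 0) (at 0 within {0..1})"
    by (intro DERIV_diff DERIV_const has_field_derivative_at_within[OF dtx[OF t]])
  moreover have "at (0::real) within {0..1} \<noteq> bot" by (simp add: at_within_Icc_at_right)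
  ultimately have "uxt t x = utx t x - 0" by (rule has_field_derivative_unique)
  thus ?thesis by simp
qed

text \<open>The equation is formulated with two-sided \<open>deriv\<close>, which for t > 1 agrees
  with the derivative within the time interval; \<open>ut 1\<close> equals the prescribed velocity
  by uniqueness of the one-sided derivative.\<close>

lemma classical_solution_damped_wave:
  fixes f g :: "real^'n \<Rightarrow> real"
  assumes sol: "classical_solution l \<mu> nu2 p f g T u"
    and l: "l > -1" and p: "p > 1" and R: "R > 0"
    and "\<And>x. norm x \<ge> R \<Longrightarrow> f x = 0" "\<And>x. norm x \<ge> R \<Longrightarrow> g x = 0"
      "continuous_on UNIV f" "continuous_on UNIV g"
  shows "\<exists>ut utt ud udt udd. damped_wave l \<mu> nu2 p R T u ut utt ud udt udd f g"
proof -
  let ?I = "time_interval T"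
  from sol have T: "1 < T" and C2: "Ck_on 2 (?I \<times> UNIV) (\<lambda>(t, x). u t x)"
    and init: "\<And>x. u 1 x = f x" "\<And>x. ((\<lambda>s. u s x) has_real_derivative g x) (at 1 within ?I)"
    and eq: "\<And>t x. 1 < t \<Longrightarrow> ereal t < T \<Longrightarrow>
        deriv (deriv (\<lambda>s. u s x)) t - t powr (2 * l) * laplacian (u t) x
          + \<mu> / t * deriv (\<lambda>s. u s x) t + nu2 / t^2 * u t x = \<bar>u t x\<bar> powr p"
    unfolding classical_solution_def by auto
  obtain ut utt ud udt utd udd where P:
    "continuous_on (?I \<times> UNIV) (\<lambda>(t, x). u t x)"
    "continuous_on (?I \<times> UNIV) (\<lambda>(t, x). ut t x)"
    "continuous_on (?I \<times> UNIV) (\<lambda>(t, x). utt t x)"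
    "\<And>b. b \<in> Basis \<Longrightarrow> continuous_on (?I \<times> UNIV) (\<lambda>(t, x). ud b t x)"
    "\<And>b. b \<in> Basis \<Longrightarrow> continuous_on (?I \<times> UNIV) (\<lambda>(t, x). udt b t x)"
    "\<And>b. b \<in> Basis \<Longrightarrow> continuous_on (?I \<times> UNIV) (\<lambda>(t, x). utd b t x)"
    "\<And>b. b \<in> Basis \<Longrightarrow> continuous_on (?I \<times> UNIV) (\<lambda>(t, x). udd b t x)"
    "\<And>t x. t \<in> ?I \<Longrightarrow> ((\<lambda>s. u s x) has_real_derivative ut t x) (at t within ?I)"
    "\<And>t x. t \<in> ?I \<Longrightarrow> ((\<lambda>s. ut s x) has_real_derivative utt t x) (at t within ?I)"
    "\<And>b t x. b \<in> Basis \<Longrightarrow> t \<in> ?I \<Longrightarrow> ((\<lambda>s. ud b s x) has_real_derivative udt b t x) (at t within ?I)"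
    "\<And>b t x. b \<in> Basis \<Longrightarrow> t \<in> ?I \<Longrightarrow> ((\<lambda>s. u t (x + s *\<^sub>R b)) has_real_derivative ud b t x) (at 0)"
    "\<And>b t x. b \<in> Basis \<Longrightarrow> t \<in> ?I \<Longrightarrow> ((\<lambda>s. ut t (x + s *\<^sub>R b)) has_real_derivative utd b t x) (at 0)"
    "\<And>b t x. b \<in> Basis \<Longrightarrow> t \<in> ?I \<Longrightarrow> ((\<lambda>s. ud b t (x + s *\<^sub>R b)) has_real_derivative udd b t x) (at 0)"
    using Ck_on_2_partials[OF C2] by blast
  have sym: "utd b t x = udt b t x" if "b \<in> Basis" "t \<in> ?I" for b t x
    using mixed_partials_eq[OF convex_time_interval at_within_time_interval_neq_bot P(8) P(11)[OF that(1)]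
        P(12)[OF that(1)] P(10)[OF that(1)] P(4)[OF that(1)] P(5)[OF that(1)] that(2)] .
  have one: "1 \<in> ?I" using T by (auto simp: time_interval_def one_ereal_def)
  have init2: "ut 1 x = g x" for x
    using has_field_derivative_unique[OF P(8)[OF one] init(2) at_within_time_interval_neq_bot[OF one]] .
  have eq': "utt t x - t powr (2 * l) * (\<Sum>b\<in>Basis. udd b t x) + \<mu> / t * ut t x + nu2 / t^2 * u t x = \<bar>u t x\<bar> powr p"
    if t: "1 < t" "t \<in> ?I" for t x
  proof -
    have d1: "deriv (\<lambda>s. u s x) s = ut s x" if "s \<in> ?I" "1 < s" for s
      using P(8)[OF that(1)] at_within_time_interval[OF that(2,1)] by (auto intro: DERIV_imp_deriv)
    have op: "open ({1<..} \<inter> {t. ereal t < T})" by (intro open_Int open_Collect_less continuous_intros)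
    have "((\<lambda>s. ut s x) has_real_derivative utt t x) (at t)"
      using P(9)[OF t(2)] at_within_time_interval[OF t] by simp
    hence "(deriv (\<lambda>s. u s x) has_real_derivative utt t x) (at t)"
      by (rule has_field_derivative_transform_within_open[OF _ op])
         (use t d1 in \<open>auto simp: time_interval_def\<close>)
    hence d2: "deriv (deriv (\<lambda>s. u s x)) t = utt t x" by (rule DERIV_imp_deriv)
    have "partial_deriv b (u t) y = ud b t y" if "b \<in> Basis" for b y
      unfolding partial_deriv_def using P(11)[OF that t(2)] by (rule DERIV_imp_deriv)
    hence "partial_deriv b (partial_deriv b (u t)) x = udd b t x" if "b \<in> Basis" for b
      unfolding partial_deriv_def[of b "partial_deriv b (u t)"]
      using P(13)[OF that t(2)] that by (auto intro!: DERIV_imp_deriv)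
    hence d3: "laplacian (u t) x = (\<Sum>b\<in>Basis. udd b t x)" unfolding laplacian_def by simp
    show ?thesis using eq[of t x] t d1[of t] d2 d3 by (auto simp: time_interval_def)
  qed
  have "damped_wave l \<mu> nu2 p R T u ut utt ud udt udd f g"
  proof
    show "((\<lambda>s. ut t (x + s *\<^sub>R b)) has_real_derivative udt b t x) (at 0)" if "b \<in> Basis" "t \<in> ?I" for b t x
      using P(12)[OF that, of x] sym[OF that, of x] by simp
  qed (rule l p R T P init(1) init2 assms(5-8) eq'; assumption)+
  thus ?thesis by blast
qed

subsection \<open>Finite speed of propagation\<close>

text \<open>Squaring smooths the corner of the positive part, so the energy weight is differentiable
  in time and space.\<close>

lemma DERIV_pos_part_square:
  fixes h :: "real \<Rightarrow> real"
  assumes "(h has_real_derivative D) (at x within S)"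
  shows "((\<lambda>x. (max 0 (h x))\<^sup>2) has_real_derivative 2 * max 0 (h x) * D) (at x within S)"
proof -
  have "((\<lambda>z. (max 0 z)\<^sup>2) has_real_derivative 2 * max 0 z) (at z)" for z :: real
  proof (cases "z = 0")
    case True
    have "((\<lambda>h. (max 0 (0 + h))\<^sup>2 / h) \<longlongrightarrow> 0) (at (0::real))"
    proof (rule Lim_null_comparison)
      show "\<forall>\<^sub>F h in at (0::real). norm ((max 0 (0 + h))\<^sup>2 / h) \<le> \<bar>h\<bar>"
        by (intro always_eventually allI) (auto simp: max_def power2_eq_square)
      show "((\<lambda>h::real. \<bar>h\<bar>) \<longlongrightarrow> 0) (at 0)" by (auto intro!: tendsto_eq_intros)
    qed
    thus ?thesis using True by (simp add: DERIV_def)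
  next
    case False
    consider "z > 0" | "z < 0" using False by linarith
    thus ?thesis
    proof cases
      case 1
      have "((\<lambda>z. z\<^sup>2) has_real_derivative 2 * max 0 z) (at z)"
        using 1 by (auto intro!: derivative_eq_intros)
      thus ?thesis by (rule has_field_derivative_transform_within_open[of _ _ _ "{0<..}"]) (use 1 in auto)
    next
      case 2
      have "((\<lambda>z. 0) has_real_derivative 2 * max 0 z) (at z)" using 2 by simp
      thus ?thesis by (rule has_field_derivative_transform_within_open[of _ _ _ "{..<0}"]) (use 2 in auto)
    qed
  qed
  from DERIV_chain2[OF this assms] show ?thesis .
qed

text \<open>With \<open>M = (\<rho>\<^sup>2 - |d|\<^sup>2)\<^sub>+\<close>, \<open>d = y - x\<^sub>0\<close>, the boundary flux through the weight is nonpositive because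
  \<open>|d| \<le> \<rho>\<close> where \<open>M > 0\<close>; the remaining terms are of lower order.\<close>

lemma energy_density_le:
  fixes w d :: "'a::euclidean_space" and a v s l \<rho> M :: real
  assumes s: "s \<ge> 1" and L0: "L \<ge> 0" and M: "M \<ge> 0" "M > 0 \<Longrightarrow> norm d \<le> \<rho>" and L: "\<bar>F\<bar> \<le> L * \<bar>v\<bar>"
  defines "e \<equiv> (a^2 + s powr (2*l) * (w \<bullet> w) + v^2) / 2"
  shows "2 * M * (2 * \<rho> * (- (s powr l))) * e + s powr (2*l) * a * (4 * M * (d \<bullet> w))
     + M^2 * (a * (F - \<mu> / s * a - nu2 / s^2 * v) + l * s powr (2*l - 1) * (w \<bullet> w) + v * a)
     \<le> (L + 2 * \<bar>\<mu>\<bar> + \<bar>nu2\<bar> + 2 * \<bar>l\<bar> + 1) * (M^2 * e)"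
proof -
  define q where "q = s powr l"
  have q: "q > 0" "s powr (2*l) = q^2" using s by (auto simp: q_def powr_realpow[symmetric] powr_powr mult.commute)
  have s2: "s powr (2*l - 1) = q^2 / s" using s q(2) by (simp add: powr_diff)
  have e: "e = (a^2 + q^2 * (w \<bullet> w) + v^2) / 2" unfolding e_def q(2) ..
  have ww: "w \<bullet> w \<ge> 0" by simp
  have half: "x \<le> (A + B) / 2" if "2 * x \<le> A" "0 \<le> B" for x A B :: real using that by simp
  have flux: "q^2 * a * (4 * M * (d \<bullet> w)) \<le> 4 * M * \<rho> * q * e"
  proof (cases "M > 0")
    case True
    have "q * a * (d \<bullet> w) \<le> q * \<bar>a\<bar> * (norm d * norm w)"
    proof -
      have "a * (d \<bullet> w) \<le> \<bar>a\<bar> * \<bar>d \<bullet> w\<bar>" by (simp add: abs_mult[symmetric])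
      also have "\<dots> \<le> \<bar>a\<bar> * (norm d * norm w)" by (intro mult_left_mono Cauchy_Schwarz_ineq2) auto
      finally show ?thesis using q by (simp add: mult.assoc)
    qed
    also have "\<dots> \<le> q * \<bar>a\<bar> * (\<rho> * norm w)"
      using M(2)[OF True] q by (intro mult_left_mono mult_right_mono) auto
    also have "\<dots> = \<rho> * (\<bar>a\<bar> * (q * norm w))" by simp
    also have "\<dots> \<le> \<rho> * e"
    proof (intro mult_left_mono)
      have "0 \<le> (\<bar>a\<bar> - q * norm w)^2" by simp
      hence "2 * (\<bar>a\<bar> * (q * norm w)) \<le> a^2 + q^2 * (w \<bullet> w)"
        by (simp add: power2_diff power_mult_distrib power2_norm_eq_inner mult_ac)
      thus "\<bar>a\<bar> * (q * norm w) \<le> e" unfolding e by (intro half[OF _ zero_le_power2])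
      show "0 \<le> \<rho>" using M(2)[OF True] norm_ge_zero[of d] by linarith
    qed
    finally have "(4 * M * q) * (q * a * (d \<bullet> w)) \<le> (4 * M * q) * (\<rho> * e)"
      using True q by (intro mult_left_mono) auto
    thus ?thesis by (simp add: power2_eq_square mult_ac)
  qed (use M(1) in simp)
  have av: "\<bar>a\<bar> * \<bar>v\<bar> \<le> e"
  proof -
    have "0 \<le> (\<bar>a\<bar> - \<bar>v\<bar>)^2" by simp
    hence "2 * (\<bar>a\<bar> * \<bar>v\<bar>) \<le> a^2 + v^2" by (simp add: power2_diff)
    from half[OF this mult_nonneg_nonneg[OF zero_le_power2[of q] ww]]
    show ?thesis unfolding e by (simp add: add_ac)
  qed
  have aa: "a^2 \<le> 2 * e" unfolding e using mult_nonneg_nonneg[OF zero_le_power2[of q] ww] by simp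
  have wwe: "q^2 * (w \<bullet> w) \<le> 2 * e" unfolding e by simp
  have t1: "a * F \<le> L * e"
  proof -
    have "a * F \<le> \<bar>a\<bar> * \<bar>F\<bar>" by (simp add: abs_mult[symmetric])
    also have "\<dots> \<le> \<bar>a\<bar> * (L * \<bar>v\<bar>)" using L by (intro mult_left_mono) auto
    also have "\<dots> = L * (\<bar>a\<bar> * \<bar>v\<bar>)" by simp
    also have "\<dots> \<le> L * e" using av L0 by (intro mult_left_mono)
    finally show ?thesis .
  qed
  have t2: "- (\<mu> / s * a * a) \<le> 2 * \<bar>\<mu>\<bar> * e"
  proof -
    have "- (\<mu> / s * a * a) = (- \<mu> / s) * a^2" by (simp add: power2_eq_square)
    also have "\<dots> \<le> \<bar>\<mu>\<bar> * a^2"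
    proof (intro mult_right_mono)
      have "- \<mu> / s \<le> \<bar>\<mu>\<bar> / s" using s by (intro divide_right_mono) auto
      also have "\<dots> \<le> \<bar>\<mu>\<bar>" using s by (simp add: divide_le_eq mult_le_cancel_left1)
      finally show "- \<mu> / s \<le> \<bar>\<mu>\<bar>" .
    qed auto
    also have "\<dots> \<le> \<bar>\<mu>\<bar> * (2 * e)" using aa by (intro mult_left_mono) auto
    finally show ?thesis by simp
  qed
  have t3: "- (nu2 / s^2 * v * a) \<le> \<bar>nu2\<bar> * e"
  proof -
    have "- (nu2 / s^2 * v * a) \<le> \<bar>nu2 / s^2 * v * a\<bar>" by (rule abs_ge_minus_self)
    also have "\<dots> = \<bar>nu2\<bar> / s^2 * (\<bar>a\<bar> * \<bar>v\<bar>)" by (simp add: abs_mult)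
    also have "\<dots> \<le> \<bar>nu2\<bar> * e"
    proof (intro mult_mono av)
      have "s^2 \<ge> 1" using s by simp
      thus "\<bar>nu2\<bar> / s^2 \<le> \<bar>nu2\<bar>" using s by (simp add: divide_le_eq mult_le_cancel_left1)
    qed auto
    finally show ?thesis .
  qed
  have t4: "l * s powr (2*l - 1) * (w \<bullet> w) \<le> 2 * \<bar>l\<bar> * e"
  proof -
    have "l * s powr (2*l - 1) * (w \<bullet> w) = l / s * (q^2 * (w \<bullet> w))" unfolding s2 by simp
    also have "\<dots> \<le> \<bar>l\<bar> * (2 * e)"
    proof (rule mult_mono[OF _ wwe])
      have "l / s \<le> \<bar>l\<bar> / s" using s by (intro divide_right_mono) auto
      also have "\<dots> \<le> \<bar>l\<bar>" using s by (simp add: divide_le_eq mult_le_cancel_left1)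
      finally show "l / s \<le> \<bar>l\<bar>" .
    qed (use ww in auto)
    finally show ?thesis by simp
  qed
  have t5: "v * a \<le> e" using av abs_ge_self[of "v * a"] by (simp add: abs_mult mult.commute)
  have "a * (F - \<mu> / s * a - nu2 / s^2 * v) + l * s powr (2*l - 1) * (w \<bullet> w) + v * a
     = a * F + - (\<mu> / s * a * a) + - (nu2 / s^2 * v * a) + l * s powr (2*l - 1) * (w \<bullet> w) + v * a"
    by (simp add: algebra_simps)
  also have "\<dots> \<le> L * e + 2 * \<bar>\<mu>\<bar> * e + \<bar>nu2\<bar> * e + 2 * \<bar>l\<bar> * e + e"
    by (intro add_mono t1 t2 t3 t4 t5)
  also have "\<dots> = (L + 2 * \<bar>\<mu>\<bar> + \<bar>nu2\<bar> + 2 * \<bar>l\<bar> + 1) * e" by (simp add: algebra_simps)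
  finally have "M^2 * (a * (F - \<mu> / s * a - nu2 / s^2 * v) + l * s powr (2*l - 1) * (w \<bullet> w) + v * a)
     \<le> M^2 * ((L + 2 * \<bar>\<mu>\<bar> + \<bar>nu2\<bar> + 2 * \<bar>l\<bar> + 1) * e)" by (intro mult_left_mono) auto
  moreover have "2 * M * (2 * \<rho> * (- (s powr l))) * e + s powr (2*l) * a * (4 * M * (d \<bullet> w)) \<le> 0"
  proof -
    have "2 * M * (2 * \<rho> * (- (s powr l))) * e = - (4 * M * \<rho> * q * e)" by (simp add: q_def)
    thus ?thesis using flux unfolding q(2) by linarith
  qed
  ultimately have "2 * M * (2 * \<rho> * (- (s powr l))) * e + s powr (2*l) * a * (4 * M * (d \<bullet> w))
     + M^2 * (a * (F - \<mu> / s * a - nu2 / s^2 * v) + l * s powr (2*l - 1) * (w \<bullet> w) + v * a)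
     \<le> 0 + M^2 * ((L + 2 * \<bar>\<mu>\<bar> + \<bar>nu2\<bar> + 2 * \<bar>l\<bar> + 1) * e)" by (intro add_mono)
  also have "\<dots> = (L + 2 * \<bar>\<mu>\<bar> + \<bar>nu2\<bar> + 2 * \<bar>l\<bar> + 1) * (M^2 * e)" by simp
  finally show ?thesis .
qed

section \<open>Energy on a backward light cone\<close>

context damped_wave
begin

abbreviation I where "I \<equiv> time_interval T"

text \<open>A primitive of the propagation speed t^l: a signal travels the distance \<phi>(t) -
  \<phi>(1) between the times 1 and t.\<close>

definition \<phi> where "\<phi> t = t powr (l + 1) / (l + 1)"

lemma one_in_I: "1 \<in> I" using T by (auto simp: time_interval_def one_ereal_def)

lemma I_ge_1: "t \<in> I \<Longrightarrow> 1 \<le> t" by (auto simp: time_interval_def)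

lemma I_down: "b \<in> I \<Longrightarrow> 1 \<le> t \<Longrightarrow> t \<le> b \<Longrightarrow> t \<in> I"
  using time_interval_Icc by (meson atLeastAtMost_iff subsetD)

lemma cont_comp:
  fixes h1 :: "'b::topological_space \<Rightarrow> real" and h2 :: "'b \<Rightarrow> real^'n"
  assumes "continuous_on S h1" "continuous_on S h2" "h1 ` S \<subseteq> I"
  shows "continuous_on S (\<lambda>z. u (h1 z) (h2 z))" "continuous_on S (\<lambda>z. ut (h1 z) (h2 z))"
    "continuous_on S (\<lambda>z. utt (h1 z) (h2 z))"
    "b \<in> Basis \<Longrightarrow> continuous_on S (\<lambda>z. ud b (h1 z) (h2 z))"
    "b \<in> Basis \<Longrightarrow> continuous_on S (\<lambda>z. udt b (h1 z) (h2 z))"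
    "b \<in> Basis \<Longrightarrow> continuous_on S (\<lambda>z. udd b (h1 z) (h2 z))"
proof -
  have *: "continuous_on S (\<lambda>z. F (h1 z) (h2 z))" if "continuous_on (I \<times> UNIV) (\<lambda>(t, x). F t x)"
    for F :: "real \<Rightarrow> real^'n \<Rightarrow> real"
  proof -
    have "continuous_on S (\<lambda>z. (\<lambda>(t, x). F t x) (h1 z, h2 z))"
      by (rule continuous_on_compose2[OF that]) (use assms in \<open>auto intro!: continuous_intros\<close>)
    thus ?thesis by simp
  qed
  show "continuous_on S (\<lambda>z. u (h1 z) (h2 z))" "continuous_on S (\<lambda>z. ut (h1 z) (h2 z))"
    "continuous_on S (\<lambda>z. utt (h1 z) (h2 z))"
    "b \<in> Basis \<Longrightarrow> continuous_on S (\<lambda>z. ud b (h1 z) (h2 z))"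
    "b \<in> Basis \<Longrightarrow> continuous_on S (\<lambda>z. udt b (h1 z) (h2 z))"
    "b \<in> Basis \<Longrightarrow> continuous_on S (\<lambda>z. udd b (h1 z) (h2 z))"
    using cont by (auto intro!: *)
qed

lemma DERIV_\<phi>: "t > 0 \<Longrightarrow> (\<phi> has_real_derivative t powr l) (at t within A)"
  unfolding \<phi>_def[abs_def] using l
  by (auto intro!: derivative_eq_intros)

lemma \<phi>_mono: "0 \<le> s \<Longrightarrow> s \<le> t \<Longrightarrow> \<phi> s \<le> \<phi> t"
  unfolding \<phi>_def using l by (intro divide_right_mono powr_mono2) auto

lemma \<phi>_strict_mono: "0 \<le> s \<Longrightarrow> s < t \<Longrightarrow> \<phi> s < \<phi> t"
  unfolding \<phi>_def using l by (intro divide_strict_right_mono powr_less_mono2) auto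

text \<open>With a strict inequality the data vanish in a neighbourhood, so the spatial derivatives
  vanish as well.\<close>

lemma initial_zero:
  assumes "R < norm y"
  shows "u 1 y = 0" "ut 1 y = 0" "b \<in> Basis \<Longrightarrow> ud b 1 y = 0"
proof -
  show "u 1 y = 0" "ut 1 y = 0" using assms data_supp init by auto
  assume b: "b \<in> Basis"
  have op: "open {s::real. R < norm (y + s *\<^sub>R b)}" by (intro open_Collect_less continuous_intros)
  have "((\<lambda>s::real. 0::real) has_real_derivative ud b 1 y) (at 0)"
    by (rule has_field_derivative_transform_within_open[OF space_deriv(1)[OF b one_in_I] op])
      (use assms data_supp(1) init in auto)
  thus "ud b 1 y = 0" using DERIV_unique[OF DERIV_const] by fastforce
qed

context
  fixes t0 :: real and x0 :: "real^'n"
  assumes t0: "t0 \<in> I" "t0 > 1" and x0: "norm x0 \<ge> R + \<phi> t0 - \<phi> 1"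
begin

text \<open>Radius at time s of the backward light cone with apex (t0, x0). The assumption on
  \<open>x0\<close> says that the open base of this cone at time 1 lies outside the ball of radius
  R.\<close>

definition \<rho> where "\<rho> s = \<phi> t0 - \<phi> s"
definition M where "M s y = max 0 ((\<rho> s)\<^sup>2 - (y - x0) \<bullet> (y - x0))"
definition w where "w s y = (\<Sum>b\<in>Basis. ud b s y *\<^sub>R b)"
definition e where "e s y = ((ut s y)\<^sup>2 + s powr (2*l) * (w s y \<bullet> w s y) + (u s y)\<^sup>2) / 2"
definition wt where "wt s y = (\<Sum>b\<in>Basis. ud b s y * udt b s y)"
text \<open>The time derivative of the weighted energy density
  \<open>(M s y)\<^sup>2 * e s y\<close>, with \<open>utt\<close> not yet replaced through the
  equation.\<close>

definition dens where "dens s y = 2 * M s y * (2 * \<rho> s * (- (s powr l))) * e s y +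
   (M s y)\<^sup>2 * (ut s y * utt s y + l * s powr (2*l-1) * (w s y \<bullet> w s y) + s powr (2*l) * wt s y + u s y * ut s y)"
text \<open>The derivative in direction b of \<open>(M s y)\<^sup>2 * (ut s y * ud b s y)\<close>;
  summed over b it is a divergence.\<close>

definition flux where "flux b s y = 2 * M s y * (-2 * ((y - x0) \<bullet> b)) * (ut s y * ud b s y)
   + (M s y)\<^sup>2 * (udt b s y * ud b s y + ut s y * udd b s y)"

lemma w_inner: "w s y \<bullet> w s y = (\<Sum>b\<in>Basis. (ud b s y)\<^sup>2)" "v \<bullet> w s y = (\<Sum>b\<in>Basis. (v \<bullet> b) * ud b s y)"
proof -
  have 1: "w s y \<bullet> b = ud b s y" if "b \<in> Basis" for b unfolding w_def using that by (simp add: inner_sum_left_Basis)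
  show "w s y \<bullet> w s y = (\<Sum>b\<in>Basis. (ud b s y)\<^sup>2)" "v \<bullet> w s y = (\<Sum>b\<in>Basis. (v \<bullet> b) * ud b s y)"
    using 1 by (simp_all add: euclidean_inner[of _ "w s y"] power2_eq_square)
qed

lemma \<rho>_nonneg: "s \<in> {1..t0} \<Longrightarrow> \<rho> s \<ge> 0" "s \<in> {1..t0} \<Longrightarrow> \<rho> s \<le> \<rho> 1"
  unfolding \<rho>_def using \<phi>_mono[of s t0] \<phi>_mono[of 1 s] by auto

lemma J_I: "s \<in> {1..t0} \<Longrightarrow> s \<in> I" using I_down[OF t0(1)] by auto

lemma M_pos: "s \<in> {1..t0} \<Longrightarrow> M s y > 0 \<Longrightarrow> norm (y - x0) < \<rho> s"
proof -
  assume s: "s \<in> {1..t0}" "M s y > 0"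
  hence "(norm (y - x0))\<^sup>2 < (\<rho> s)\<^sup>2" unfolding M_def by (simp add: power2_norm_eq_inner)
  thus "norm (y - x0) < \<rho> s" using \<rho>_nonneg(1)[OF s(1)] by (rule power_less_imp_less_base)
qed

lemma M_nonneg: "M s y \<ge> 0" by (simp add: M_def)

lemma M_zero: "s \<in> {1..t0} \<Longrightarrow> y \<notin> cball x0 (\<rho> 1) \<Longrightarrow> M s y = 0"
  using M_pos[of s y] M_nonneg[of s y] \<rho>_nonneg(2)[of s] by (force simp: dist_norm norm_minus_commute)

lemma continuous_energy_terms:
  assumes h: "continuous_on S h1" "continuous_on S h2" "h1 ` S \<subseteq> {1..t0}"
  shows "continuous_on S (\<lambda>z. M (h1 z) (h2 z))" "continuous_on S (\<lambda>z. e (h1 z) (h2 z))"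
    "continuous_on S (\<lambda>z. dens (h1 z) (h2 z))" "b \<in> Basis \<Longrightarrow> continuous_on S (\<lambda>z. flux b (h1 z) (h2 z))"
proof -
  have hI: "h1 ` S \<subseteq> I" using h(3) J_I by auto
  have pos: "h1 z \<noteq> 0" if "z \<in> S" for z using h(3) that by fastforce
  note cc = cont_comp[OF h(1,2) hI]
  have r: "continuous_on S (\<lambda>z. \<rho> (h1 z))" unfolding \<rho>_def \<phi>_def
    using pos l by (intro continuous_intros h) auto
  have w: "continuous_on S (\<lambda>z. w (h1 z) (h2 z))" "continuous_on S (\<lambda>z. wt (h1 z) (h2 z))"
    unfolding w_def wt_def by (intro continuous_intros cc; assumption)+
  show M: "continuous_on S (\<lambda>z. M (h1 z) (h2 z))" unfolding M_def by (intro continuous_intros r h)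
  show e: "continuous_on S (\<lambda>z. e (h1 z) (h2 z))" unfolding e_def
    using pos by (intro continuous_intros h cc w) auto
  show "continuous_on S (\<lambda>z. dens (h1 z) (h2 z))" unfolding dens_def
    using pos by (intro continuous_intros h cc w M e r) auto
  show "continuous_on S (\<lambda>z. flux b (h1 z) (h2 z))" if "b \<in> Basis" unfolding flux_def
    using pos that by (intro continuous_intros h cc w M e r) auto
qed

lemma DERIV_energy_density:
  assumes s: "s \<in> {1..t0}"
  shows "((\<lambda>s. (M s y)\<^sup>2 * e s y) has_real_derivative dens s y) (at s within {1..t0})"
proof -
  have s0: "s > 0" and sI: "s \<in> I" using s J_I by auto
  have sub: "{1..t0} \<subseteq> I" using J_I by auto
  note td = time_deriv(1)[OF sI, of y, THEN DERIV_subset, OF sub] time_deriv(2)[OF sI, of y, THEN DERIV_subset, OF sub]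
  note td3 = time_deriv(3)[OF _ sI, THEN DERIV_subset, OF _ sub]
  have r: "(\<rho> has_real_derivative - (s powr l)) (at s within {1..t0})" unfolding \<rho>_def[abs_def]
    using DERIV_diff[OF DERIV_const DERIV_\<phi>[OF s0]] by simp
  have "((\<lambda>s. (\<rho> s)\<^sup>2 - (y - x0) \<bullet> (y - x0)) has_real_derivative 2 * \<rho> s * (- (s powr l))) (at s within {1..t0})"
    by (auto intro!: derivative_eq_intros r)
  from DERIV_pos_part_square[OF this]
  have 1: "((\<lambda>s. (M s y)\<^sup>2) has_real_derivative 2 * M s y * (2 * \<rho> s * (- (s powr l)))) (at s within {1..t0})"
    unfolding M_def .
  have 2: "((\<lambda>s. w s y \<bullet> w s y) has_real_derivative 2 * wt s y) (at s within {1..t0})"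
    unfolding w_inner(1) wt_def sum_distrib_left
    by (rule DERIV_sum) (auto intro!: derivative_eq_intros td3)
  have 3: "((\<lambda>s. e s y) has_real_derivative (2 * ut s y * utt s y + (s powr (2*l) * (2 * wt s y) + 2 * l * s powr (2*l-1) * (w s y \<bullet> w s y))
     + 2 * u s y * ut s y) / 2) (at s within {1..t0})"
    unfolding e_def using s0
    by (auto intro!: derivative_eq_intros td 2)
  show ?thesis using DERIV_mult[OF 1 3] unfolding dens_def
    by (rule DERIV_cong) (simp add: algebra_simps)
qed

lemma integral_flux:
  assumes s: "s \<in> {1..t0}" and b: "b \<in> Basis" and ab: "cball x0 (\<rho> 1) \<subseteq> cbox a c"
  shows "integral (cbox a c) (flux b s) = 0"
proof -
  have sI: "s \<in> I" using s J_I by auto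
  have cM: "continuous_on UNIV (\<lambda>y. M s y)" "continuous_on UNIV (flux b s)"
    using continuous_energy_terms(1)[of UNIV "\<lambda>_. s" "\<lambda>y. y"] continuous_energy_terms(4)[of UNIV "\<lambda>_. s" "\<lambda>y. y", OF _ _ _ b] s
    by (auto intro!: continuous_intros)
  have cu: "continuous_on UNIV (ut s)" "continuous_on UNIV (ud b s)"
    using cont_comp(2)[where S=UNIV and ?h1.0="\<lambda>_. s" and ?h2.0="\<lambda>y. y"]
      cont_comp(4)[where S=UNIV and ?h1.0="\<lambda>_. s" and ?h2.0="\<lambda>y. y" and b=b] sI b
    by (auto intro!: continuous_intros)
  have out: "M s y = 0" if "y \<notin> cball x0 (\<rho> 1)" for y using M_zero[OF s that] .
  have "(LINT y|lborel. flux b s y) = 0"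
  proof (rule integral_directional_derivative_eq_0[where f="\<lambda>y. (M s y)\<^sup>2 * (ut s y * ud b s y)" and v=b and S="cball x0 (\<rho> 1)"])
    fix y
    have "((\<lambda>h. (\<rho> s)\<^sup>2 - (y + h *\<^sub>R b - x0) \<bullet> (y + h *\<^sub>R b - x0)) has_real_derivative - 2 * ((y - x0) \<bullet> b)) (at 0)"
    proof -
      have "(\<lambda>h. (\<rho> s)\<^sup>2 - (y + h *\<^sub>R b - x0) \<bullet> (y + h *\<^sub>R b - x0)) =
        (\<lambda>h. (\<rho> s)\<^sup>2 - ((y - x0) \<bullet> (y - x0) + 2 * h * ((y - x0) \<bullet> b) + h * h * (b \<bullet> b)))"
        by (rule ext) (simp add: inner_add_left inner_add_right inner_diff_left inner_diff_right inner_commute algebra_simps)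
      thus ?thesis by (auto intro!: derivative_eq_intros)
    qed
    from DERIV_pos_part_square[OF this]
    have 1: "((\<lambda>h. (M s (y + h *\<^sub>R b))\<^sup>2) has_real_derivative 2 * M s y * (- 2 * ((y - x0) \<bullet> b))) (at 0)"
      unfolding M_def by simp
    have 2: "((\<lambda>h. ut s (y + h *\<^sub>R b) * ud b s (y + h *\<^sub>R b)) has_real_derivative udt b s y * ud b s y + ut s y * udd b s y) (at 0)"
      using DERIV_mult[OF space_deriv(2)[OF b sI, of y] space_deriv(3)[OF b sI, of y]] by (simp add: mult.commute add.commute)
    show "((\<lambda>h. (M s (y + h *\<^sub>R b))\<^sup>2 * (ut s (y + h *\<^sub>R b) * ud b s (y + h *\<^sub>R b))) has_real_derivative flux b s y) (at 0)"
      using DERIV_mult[OF 1 2] unfolding flux_def by (rule DERIV_cong) (simp add: algebra_simps)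
  qed (use cM cu out in \<open>auto intro!: continuous_intros simp: flux_def\<close>)
  moreover have "flux b s y = 0" if "y \<notin> cbox a c" for y
  proof -
    have "M s y = 0" using out[of y] ab that by blast
    thus ?thesis by (simp add: flux_def)
  qed
  ultimately show ?thesis using integral_cbox_compact_support[OF cM(2), of a c] by simp
qed

text \<open>Gronwall's inequality for the weighted energy, which is zero at time 1. The energy
  includes u^2, so it controls u itself at the centre of the cone.\<close>

lemma energy_zero:
  assumes s: "s \<in> {1..<t0}"
  shows "u s x0 = 0"
proof -
  obtain a c where ab: "cball x0 (\<rho> 1) \<subseteq> cbox a c"
    using bounded_subset_cbox_symmetric[OF bounded_cball[of x0 "\<rho> 1"]] by metis
  define E where "E s = integral (cbox a c) (\<lambda>y. (M s y)\<^sup>2 * e s y)" for s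
  have cE: "continuous_on ({1..t0} \<times> cbox a c) (\<lambda>(s, y). (M s y)\<^sup>2 * e s y)"
    "continuous_on ({1..t0} \<times> cbox a c) (\<lambda>(s, y). dens s y)"
    unfolding split_beta' by (intro continuous_intros continuous_energy_terms; force)+
  have cEs: "continuous_on (cbox a c) (\<lambda>y. (M s y)\<^sup>2 * e s y)" "continuous_on (cbox a c) (\<lambda>y. dens s y)"
    if "s \<in> {1..t0}" for s
    using that by (intro continuous_intros continuous_energy_terms; force)+
  have DE: "(E has_real_derivative integral (cbox a c) (dens s)) (at s within {1..t0})" if "s \<in> {1..t0}" for s
    unfolding E_def[abs_def]
  proof (rule leibniz_rule_field_derivative)
    show "(\<lambda>y. (M x y)\<^sup>2 * e x y) integrable_on cbox a c" if "x \<in> {1..t0}" for x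
      by (intro integrable_continuous cEs that)
  qed (use DERIV_energy_density cE(2) that in auto)
  \<comment> \<open>On a compact piece of space-time u is bounded, and there the nonlinearity
    satisfies |u|^p <= L |u|, hence behaves like a linear lower-order term.\<close>
  have "compact ((\<lambda>(s, y). u s y) ` ({1..t0} \<times> cbox a c))"
    by (intro compact_continuous_image compact_Times compact_Icc compact_cbox)
      (auto simp: split_beta' intro!: cont_comp continuous_intros dest: J_I)
  hence "bounded ((\<lambda>(s, y). u s y) ` ({1..t0} \<times> cbox a c))" by (rule compact_imp_bounded)
  then obtain B where B0: "B > 0" "\<forall>v\<in>(\<lambda>(s, y). u s y) ` ({1..t0} \<times> cbox a c). norm v \<le> B"
    unfolding bounded_pos by blast
  have B: "\<bar>u s y\<bar> \<le> B" if "s \<in> {1..t0}" "y \<in> cbox a c" for s y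
    using bspec[OF B0(2), of "u s y"] that by force
  define L where "L = B powr (p - 1)"
  define C where "C = L + 2 * \<bar>\<mu>\<bar> + \<bar>nu2\<bar> + 2 * \<bar>l\<bar> + 1"
  have dE_le: "integral (cbox a c) (dens s) \<le> C * E s" if s: "s \<in> {1<..<t0}" for s
  proof -
    have sJ: "s \<in> {1..t0}" using s by auto
    have cf: "continuous_on (cbox a c) (flux b s)" if "b \<in> Basis" for b
      by (rule continuous_energy_terms(4)[where ?h1.0="\<lambda>_. s" and ?h2.0="\<lambda>y. y"])
        (use that sJ in \<open>auto intro!: continuous_intros\<close>)
    \<comment> \<open>Subtracting a divergence of integral zero cancels the terms with
      \<open>udt\<close> and \<open>udd\<close>, which the energy cannot control.\<close>
    have "integral (cbox a c) (dens s) = integral (cbox a c) (dens s) - s powr (2*l) * (\<Sum>b\<in>Basis. integral (cbox a c) (flux b s))"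
      using integral_flux[OF sJ _ ab] by simp
    also have "\<dots> = integral (cbox a c) (\<lambda>y. dens s y - s powr (2*l) * (\<Sum>b\<in>Basis. flux b s y))"
    proof -
      have "integral (cbox a c) (\<lambda>y. \<Sum>b\<in>Basis. flux b s y) = (\<Sum>b\<in>Basis. integral (cbox a c) (flux b s))"
        by (intro integral_sum integrable_continuous cf) auto
      moreover have "(\<lambda>y. s powr (2*l) * (\<Sum>b\<in>Basis. flux b s y)) integrable_on cbox a c"
        by (intro integrable_continuous continuous_intros cf)
      moreover have "dens s integrable_on cbox a c" by (intro integrable_continuous cEs sJ)
      ultimately show ?thesis by (simp add: integral_diff)
    qed
    also have "\<dots> \<le> integral (cbox a c) (\<lambda>y. C * ((M s y)\<^sup>2 * e s y))"
    proof (rule integral_le)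
      fix y assume y: "y \<in> cbox a c"
      let ?F = "\<bar>u s y\<bar> powr p"
      have L: "\<bar>?F\<bar> \<le> L * \<bar>u s y\<bar>"
      proof -
        have "?F = \<bar>u s y\<bar> powr (p - 1) * \<bar>u s y\<bar>" by (simp add: powr_mult_base[symmetric] powr_diff divide_simps) 
        also have "\<dots> \<le> L * \<bar>u s y\<bar>" unfolding L_def using B[OF sJ y] p
          by (intro mult_right_mono powr_mono2) auto
        finally show ?thesis by simp
      qed
      have eq: "utt s y = s powr (2*l) * (\<Sum>b\<in>Basis. udd b s y) + (?F - \<mu> / s * ut s y - nu2 / s\<^sup>2 * u s y)"
        using pde[of s y] s J_I[OF sJ] by simp
      have fl: "(\<Sum>b\<in>Basis. flux b s y) = - 4 * M s y * ut s y * ((y - x0) \<bullet> w s y)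
         + (M s y)\<^sup>2 * (wt s y + ut s y * (\<Sum>b\<in>Basis. udd b s y))"
      proof -
        have "flux b s y = (- 4 * M s y * ut s y) * (((y - x0) \<bullet> b) * ud b s y)
            + (M s y)\<^sup>2 * (ud b s y * udt b s y) + (M s y)\<^sup>2 * ut s y * udd b s y" for b
          by (simp add: flux_def algebra_simps)
        hence "(\<Sum>b\<in>Basis. flux b s y) = (- 4 * M s y * ut s y) * ((y - x0) \<bullet> w s y)
            + (M s y)\<^sup>2 * wt s y + (M s y)\<^sup>2 * ut s y * (\<Sum>b\<in>Basis. udd b s y)"
          unfolding w_inner(2) wt_def by (simp only: sum.distrib sum_distrib_left[symmetric])
        thus ?thesis by (simp add: algebra_simps)
      qed
      have "dens s y - s powr (2*l) * (\<Sum>b\<in>Basis. flux b s y) =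
         2 * M s y * (2 * \<rho> s * (- (s powr l))) * e s y + s powr (2*l) * ut s y * (4 * M s y * ((y - x0) \<bullet> w s y))
         + (M s y)\<^sup>2 * (ut s y * (?F - \<mu> / s * ut s y - nu2 / s\<^sup>2 * u s y) + l * s powr (2*l-1) * (w s y \<bullet> w s y) + u s y * ut s y)"
        unfolding dens_def fl eq by (simp add: algebra_simps)
      also have "\<dots> \<le> C * ((M s y)\<^sup>2 * e s y)"
        unfolding C_def e_def
        by (rule energy_density_le) (use s L M_nonneg M_pos[OF sJ, of y] in \<open>auto simp: L_def\<close>)
      finally show "dens s y - s powr (2*l) * (\<Sum>b\<in>Basis. flux b s y) \<le> C * ((M s y)\<^sup>2 * e s y)" .
    qed (use cEs[OF sJ] cf in \<open>auto intro!: integrable_continuous continuous_intros\<close>)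
    also have "\<dots> = C * E s" by (simp add: E_def)
    finally show ?thesis .
  qed
  have E_1: "E 1 = 0"
  proof -
    have "(M 1 y)\<^sup>2 * e 1 y = 0" for y
    proof (cases "M 1 y > 0")
      case True
      have "norm (y - x0) < \<rho> 1" using M_pos[OF _ True] t0 by simp
      hence "R < norm y" using x0 norm_triangle_ineq2[of x0 y] unfolding \<rho>_def by (simp add: norm_minus_commute)
      hence "e 1 y = 0" using initial_zero[of y] by (simp add: e_def w_inner(1))
      thus ?thesis by simp
    qed (use M_nonneg[of 1 y] in simp)
    hence "(\<lambda>y. (M 1 y)\<^sup>2 * e 1 y) = (\<lambda>_. 0)" by (intro ext)
    thus ?thesis unfolding E_def by simp
  qed
  have e0: "e s y \<ge> 0" for s y unfolding e_def by (intro divide_nonneg_pos add_nonneg_nonneg mult_nonneg_nonneg) auto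
  have E0: "E s \<ge> 0" if "s \<in> {1..t0}" for s unfolding E_def
    by (intro integral_nonneg integrable_continuous cEs that) (auto simp: e0)
  have E_zero: "E s = 0"
  proof (cases "s = 1")
    case False
    \<comment> \<open>Integrating factor for E' <= C E. Only interior times are differentiated,
      since the equation is assumed for t > 1 only.\<close>
    have "E s * exp (- C * s) \<le> E 1 * exp (- C * 1)"
    proof (rule DERIV_nonpos_imp_decreasing_open[where f="\<lambda>s. E s * exp (- C * s)"])
      show "1 \<le> s" using s by simp
      show "continuous_on {1..s} (\<lambda>s. E s * exp (- C * s))"
      proof (intro continuous_intros)
        have "continuous_on {1..t0} E" using DE by (meson DERIV_continuous continuous_on_eq_continuous_within)
        thus "continuous_on {1..s} E" by (rule continuous_on_subset) (use s in auto)
      qed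
      fix x assume x: "1 < x" "x < s"
      hence xJ: "x \<in> {1..t0}" "x \<in> {1<..<t0}" using s by auto
      have "(E has_real_derivative integral (cbox a c) (dens x)) (at x)"
        using DE[OF xJ(1)] at_within_interior[of x "{1..t0}"] xJ(2) by simp
      hence "((\<lambda>s. E s * exp (- C * s)) has_real_derivative
         (integral (cbox a c) (dens x) - C * E x) * exp (- C * x)) (at x)"
        by (auto intro!: derivative_eq_intros simp: algebra_simps)
      moreover have "(integral (cbox a c) (dens x) - C * E x) * exp (- C * x) \<le> 0"
        using dE_le[OF xJ(2)] by (intro mult_nonpos_nonneg) auto
      ultimately show "\<exists>y. ((\<lambda>s. E s * exp (- C * s)) has_real_derivative y) (at x) \<and> y \<le> 0" by auto
    qed
    hence "E s \<le> 0" using E_1 by (simp add: mult_le_0_iff)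
    thus ?thesis using E0[of s] s by simp
  qed (use E_1 in simp)
  have sJ: "s \<in> {1..t0}" using s by auto
  have rpos: "\<rho> s > 0" using \<phi>_strict_mono[of s t0] s by (simp add: \<rho>_def)
  have "ball x0 (\<rho> s) \<subseteq> box a c"
  proof -
    have "ball x0 (\<rho> s) \<subseteq> cbox a c" using ab \<rho>_nonneg(2)[OF sJ] by auto
    hence "ball x0 (\<rho> s) \<subseteq> interior (cbox a c)" by (rule interior_maximal) simp
    thus ?thesis by (simp add: interior_cbox)
  qed
  hence x0b: "x0 \<in> box a c" using rpos by auto
  \<comment> \<open>A nonnegative continuous function with integral zero vanishes at interior
    points; the weight is positive at \<open>x0\<close> because s < t0.\<close>
  have "(M s x0)\<^sup>2 * e s x0 = 0"
  proof (rule has_integral_0_cbox_imp_0[OF cEs(1)[OF sJ]])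
    show "((\<lambda>y. (M s y)\<^sup>2 * e s y) has_integral 0) (cbox a c)"
      using integrable_integral[OF integrable_continuous[OF cEs(1)[OF sJ]]] E_zero unfolding E_def by simp
  qed (use x0b box_subset_cbox e0 in auto)
  moreover have "M s x0 > 0" using rpos by (simp add: M_def)
  ultimately have "e s x0 = 0" by simp
  hence "(ut s x0)\<^sup>2 + s powr (2*l) * (w s x0 \<bullet> w s x0) + (u s x0)\<^sup>2 = 0" by (simp add: e_def)
  moreover have "(ut s x0)\<^sup>2 + s powr (2*l) * (w s x0 \<bullet> w s x0) \<ge> 0" by simp
  ultimately show "u s x0 = 0" using zero_le_power2[of "u s x0"] by (smt (verit) power_eq_0_iff)
qed

end

lemma finite_speed:
  assumes t: "t \<in> I" and x: "norm x \<ge> R + \<phi> t - \<phi> 1"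
  shows "u t x = 0"
proof (cases "t = 1")
  case True
  thus ?thesis using init(1) data_supp(1) x by simp
next
  case False
  hence t1: "t > 1" using I_ge_1[OF t] by simp
  \<comment> \<open>The cone has radius 0 at its apex, so the energy argument gives u = 0 at earlier
    times and continuity gives it at time t.\<close>
  have "continuous_on {1..t} (\<lambda>s. u s x)" by (rule cont_comp) (auto intro!: continuous_intros I_down[OF t])
  hence "continuous_on (closure {1..<t}) (\<lambda>s. u s x)" using t1 by simp
  moreover have "u s x = 0" if "s \<in> {1..<t}" for s using energy_zero[OF t t1 x that] .
  ultimately show ?thesis using continuous_constant_on_closure[of "{1..<t}" "\<lambda>s. u s x" 0 t] t1 by auto
qed

end

subsection \<open>Test functions with a logarithmic cutoff\<close>

text \<open>The cutoff profile 1 - 3 s^2 + 2 s^3 falls from 1 to 0 with zero slope at both ends; the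
  other two bounds concern its first and second derivatives.\<close>

lemma smoothstep_bounds:
  fixes s :: real
  assumes "0 \<le> s" "s \<le> 1"
  shows "0 \<le> 1 - 3 * s^2 + 2 * s^3" "\<bar>6 * s^2 - 6 * s\<bar> \<le> 6" "\<bar>12 * s - 6\<bar> \<le> 6"
proof -
  have "1 - 3 * s^2 + 2 * s^3 = (1 - s)^2 * (1 + 2 * s)" by (simp add: power2_eq_square power3_eq_cube algebra_simps)
  thus "0 \<le> 1 - 3 * s^2 + 2 * s^3" using assms by simp
  have "6 * s^2 - 6 * s = - 6 * (s * (1 - s))" by (simp add: power2_eq_square algebra_simps)
  moreover have "0 \<le> s * (1 - s)" "s * (1 - s) \<le> 1" using assms by (auto intro: mult_le_one)
  ultimately show "\<bar>6 * s^2 - 6 * s\<bar> \<le> 6" by simp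
  show "\<bar>12 * s - 6\<bar> \<le> 6" using assms by simp
qed

context damped_wave
begin

lemma cont_slice:
  assumes "t \<in> I"
  shows "continuous_on S (u t)" "continuous_on S (ut t)" "continuous_on S (utt t)"
    "b \<in> Basis \<Longrightarrow> continuous_on S (ud b t)" "b \<in> Basis \<Longrightarrow> continuous_on S (udd b t)"
proof -
  have "(\<lambda>_. t) ` S \<subseteq> I" using assms by auto
  note cont_comp[OF continuous_on_const continuous_on_id this]
  thus "continuous_on S (u t)" "continuous_on S (ut t)" "continuous_on S (utt t)"
    "b \<in> Basis \<Longrightarrow> continuous_on S (ud b t)" "b \<in> Basis \<Longrightarrow> continuous_on S (udd b t)" by auto
qed

lemma outside_zero:
  assumes t2: "t2 \<in> I" and t: "t \<in> {1..t2}" and x: "norm x > R + \<phi> t2 - \<phi> 1"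
  shows "u t x = 0" "b \<in> Basis \<Longrightarrow> ud b t x = 0" "b \<in> Basis \<Longrightarrow> udd b t x = 0"
proof -
  have u0: "u s y = 0" if "s \<in> {1..t2}" "norm y > R + \<phi> t2 - \<phi> 1" for s y
    using finite_speed[of s y] I_down[OF t2, of s] \<phi>_mono[of s t2] that by auto
  show "u t x = 0" using u0 t x by blast
  have op: "open {s::real. R + \<phi> t2 - \<phi> 1 < norm (y + s *\<^sub>R b)}" for y b
    by (intro open_Collect_less continuous_intros)
  have tI: "t \<in> I" using t I_down[OF t2] by auto
  have ud0: "ud b t y = 0" if b: "b \<in> Basis" and y: "norm y > R + \<phi> t2 - \<phi> 1" for b y
  proof -
    have "((\<lambda>s::real. 0::real) has_real_derivative ud b t y) (at 0)"
      by (rule has_field_derivative_transform_within_open[OF space_deriv(1)[OF b tI] op])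
        (use u0 t y in auto)
    thus ?thesis using DERIV_unique[OF DERIV_const] by fastforce
  qed
  show "b \<in> Basis \<Longrightarrow> ud b t x = 0" using ud0 x by blast
  show "udd b t x = 0" if b: "b \<in> Basis"
  proof -
    have "((\<lambda>s::real. 0::real) has_real_derivative udd b t x) (at 0)"
      by (rule has_field_derivative_transform_within_open[OF space_deriv(3)[OF b tI] op])
        (use ud0[OF b] x in auto)
    thus ?thesis using DERIV_unique[OF DERIV_const] by fastforce
  qed
qed

text \<open>Green's identity in each coordinate direction: u_bb \<Phi> - u \<Phi>_bb is the
  derivative of u_b \<Phi> - u \<Phi>_b, which vanishes outside the box; then \<Delta>\<Phi> = k^2
  \<Phi>.\<close>

lemma integral_laplacian:
  assumes t2: "t2 \<in> I" and t: "t \<in> {1..t2}" and ac: "cball 0 (R + \<phi> t2 - \<phi> 1) \<subseteq> cbox a c"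
  shows "integral (cbox a c) (\<lambda>x. (\<Sum>b\<in>Basis. udd b t x) * eigf k x) = k\<^sup>2 * integral (cbox a c) (\<lambda>x. u t x * eigf k x)"
proof -
  have tI: "t \<in> I" using t I_down[OF t2] by auto
  have out: "u t x = 0" "b \<in> Basis \<Longrightarrow> ud b t x = 0" "b \<in> Basis \<Longrightarrow> udd b t x = 0" if "x \<notin> cbox a c" for x b
  proof -
    have "norm x > R + \<phi> t2 - \<phi> 1" using that ac by (force simp: subset_iff)
    from outside_zero[OF t2 t this] show "u t x = 0" "b \<in> Basis \<Longrightarrow> ud b t x = 0" "b \<in> Basis \<Longrightarrow> udd b t x = 0" by auto
  qed
  note c = cont_slice[OF tI]
  have ibp: "integral (cbox a c) (\<lambda>x. udd b t x * eigf k x - u t x * eigf2 k b x) = 0" if b: "b \<in> Basis" for b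
  proof -
    have cc: "continuous_on UNIV (\<lambda>x. udd b t x * eigf k x - u t x * eigf2 k b x)"
      by (intro continuous_intros c continuous_eigf b)
    have "(LINT x|lborel. udd b t x * eigf k x - u t x * eigf2 k b x) = 0"
    proof (rule integral_directional_derivative_eq_0[where v=b and S="cbox a c" and f="\<lambda>x. ud b t x * eigf k x - u t x * eigf1 k b x"])
      show "continuous_on UNIV (\<lambda>x. ud b t x * eigf k x - u t x * eigf1 k b x)"
        by (intro continuous_intros c continuous_eigf b)
      fix x
      have "((\<lambda>s. ud b t (x + s *\<^sub>R b) * eigf k (x + s *\<^sub>R b) - u t (x + s *\<^sub>R b) * eigf1 k b (x + s *\<^sub>R b)) has_real_derivative
         (udd b t x * eigf k (x + 0 *\<^sub>R b) + eigf1 k b x * ud b t (x + 0 *\<^sub>R b))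
         - (ud b t x * eigf1 k b (x + 0 *\<^sub>R b) + eigf2 k b x * u t (x + 0 *\<^sub>R b))) (at 0)"
        by (intro DERIV_diff DERIV_mult space_deriv b tI eigf_line_deriv)
      thus "((\<lambda>s. ud b t (x + s *\<^sub>R b) * eigf k (x + s *\<^sub>R b) - u t (x + s *\<^sub>R b) * eigf1 k b (x + s *\<^sub>R b)) has_real_derivative
         udd b t x * eigf k x - u t x * eigf2 k b x) (at 0)" by (rule DERIV_cong) simp
    qed (use cc out b in auto)
    thus ?thesis using integral_cbox_compact_support[OF cc, of a c] out b by simp
  qed
  have "(\<lambda>x. (\<Sum>b\<in>Basis. udd b t x) * eigf k x) = (\<lambda>x. k\<^sup>2 * (u t x * eigf k x) + (\<Sum>b\<in>Basis. udd b t x * eigf k x - u t x * eigf2 k b x))"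
  proof
    fix x
    have "(\<Sum>b\<in>Basis. udd b t x * eigf k x - u t x * eigf2 k b x) = (\<Sum>b\<in>Basis. udd b t x) * eigf k x - u t x * (k\<^sup>2 * eigf k x)"
      unfolding eigf_laplacian[symmetric] by (simp add: sum_subtractf sum_distrib_left sum_distrib_right)
    thus "(\<Sum>b\<in>Basis. udd b t x) * eigf k x = k\<^sup>2 * (u t x * eigf k x) + (\<Sum>b\<in>Basis. udd b t x * eigf k x - u t x * eigf2 k b x)"
      by simp
  qed
  hence "integral (cbox a c) (\<lambda>x. (\<Sum>b\<in>Basis. udd b t x) * eigf k x) =
     integral (cbox a c) (\<lambda>x. k\<^sup>2 * (u t x * eigf k x)) + integral (cbox a c) (\<lambda>x. \<Sum>b\<in>Basis. udd b t x * eigf k x - u t x * eigf2 k b x)"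
    by (simp only:) (intro integral_add integrable_continuous continuous_intros c continuous_eigf; assumption)
  also have "integral (cbox a c) (\<lambda>x. \<Sum>b\<in>Basis. udd b t x * eigf k x - u t x * eigf2 k b x) = (\<Sum>b\<in>Basis. 0)"
    by (subst integral_sum) (auto intro!: integrable_continuous continuous_intros c continuous_eigf sum.neutral simp: ibp)
  finally show ?thesis by simp
qed

text \<open>The second assumption on \<open>y'\<close> is the ordinary differential equation that
  makes t^\<mu> y \<Phi> a solution of the adjoint equation. Testing on [1, t1] without cutoff gives
  the left side; switching the test function off on [t1, t2] leaves only terms with derivatives of
  the cutoff.\<close>

lemma weak_inequality:
  assumes t2: "t2 \<in> I" and t1: "1 \<le> t1" "t1 < t2" and ac: "cball 0 (R + \<phi> t2 - \<phi> 1) \<subseteq> cbox a c"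
    and y: "\<And>t. t \<ge> 1 \<Longrightarrow> (y has_real_derivative y' t) (at t)"
    and y': "\<And>t. t \<ge> 1 \<Longrightarrow> (y' has_real_derivative - \<mu> / t * y' t - (nu2 / t^2 - k^2 * t powr (2*l)) * y t) (at t)"
    and y0: "\<And>t. t \<ge> 1 \<Longrightarrow> y t \<ge> 0"
  defines "d \<equiv> ln t2 - ln t1"
  shows "integral (cbox a c) (\<lambda>x. (g x * y 1 - f x * y' 1) * eigf k x)
      + integral {1..t1} (\<lambda>t. t powr \<mu> * y t * integral (cbox a c) (\<lambda>x. \<bar>u t x\<bar> powr p * eigf k x))
    \<le> 6 * (\<bar>\<mu>\<bar> + 2) * (1/d + 1/d^2) * integral {t1..t2} (\<lambda>t. t powr (\<mu>-2) * (y t + t * \<bar>y' t\<bar>)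
          * integral (cbox a c) (\<lambda>x. \<bar>u t x\<bar> * eigf k x))"
proof -
  define A where "A t = integral (cbox a c) (\<lambda>x. u t x * eigf k x)" for t
  define A1 where "A1 t = integral (cbox a c) (\<lambda>x. ut t x * eigf k x)" for t
  define A2 where "A2 t = integral (cbox a c) (\<lambda>x. utt t x * eigf k x)" for t
  define B where "B t = integral (cbox a c) (\<lambda>x. \<bar>u t x\<bar> powr p * eigf k x)" for t
  define D where "D t = integral (cbox a c) (\<lambda>x. \<bar>u t x\<bar> * eigf k x)" for t
  have sub: "{1..t2} \<subseteq> I" using I_down[OF t2] by auto
  have d: "d > 0" unfolding d_def using t1 by simp
  have c2: "continuous_on ({1..t2} \<times> cbox a c) (\<lambda>(t, x). u t x)"
    "continuous_on ({1..t2} \<times> cbox a c) (\<lambda>(t, x). ut t x)"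
    "continuous_on ({1..t2} \<times> cbox a c) (\<lambda>(t, x). utt t x)"
    using sub by (auto intro!: continuous_on_subset[OF cont(1)] continuous_on_subset[OF cont(2)] continuous_on_subset[OF cont(3)])
  have ce: "continuous_on S (\<lambda>z. eigf k (snd z))" for S :: "(real \<times> (real^'n)) set"
    by (rule continuous_on_compose2[OF continuous_eigf(2)[of UNIV k]]) (auto intro!: continuous_intros)
  have c1: "continuous_on (cbox a c) (\<lambda>x. u t x * eigf k x)" "continuous_on (cbox a c) (\<lambda>x. ut t x * eigf k x)"
    "continuous_on (cbox a c) (\<lambda>x. utt t x * eigf k x)" "continuous_on (cbox a c) (\<lambda>x. \<bar>u t x\<bar> powr p * eigf k x)"
    "continuous_on (cbox a c) (\<lambda>x. \<bar>u t x\<bar> * eigf k x)" if t: "t \<in> {1..t2}" for t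
  proof -
    have "t \<in> I" using sub t by auto
    note cont_slice(1)[OF this, of "cbox a c"] cont_slice(2)[OF this, of "cbox a c"] cont_slice(3)[OF this, of "cbox a c"]
    thus "continuous_on (cbox a c) (\<lambda>x. u t x * eigf k x)" "continuous_on (cbox a c) (\<lambda>x. ut t x * eigf k x)"
      "continuous_on (cbox a c) (\<lambda>x. utt t x * eigf k x)" "continuous_on (cbox a c) (\<lambda>x. \<bar>u t x\<bar> powr p * eigf k x)"
      "continuous_on (cbox a c) (\<lambda>x. \<bar>u t x\<bar> * eigf k x)"
      using p by (auto intro!: continuous_intros continuous_eigf continuous_on_powr')
  qed
  have contp: "continuous_on {1..t2} (\<lambda>t. integral (cbox a c) (\<lambda>x. F t x * eigf k x))"
    if "continuous_on ({1..t2} \<times> cbox a c) (\<lambda>(t, x). F t x)" for F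
    by (rule integral_continuous_on_param)
       (use that ce in \<open>auto intro!: continuous_intros simp: split_beta'\<close>)
  have cA: "continuous_on {1..t2} A" "continuous_on {1..t2} A1" "continuous_on {1..t2} B" "continuous_on {1..t2} D"
    unfolding A_def A1_def B_def D_def using c2 p
    by (auto intro!: contp continuous_intros continuous_on_powr' simp: split_beta')
  have DA: "(A has_real_derivative A1 t) (at t within {1..t2})" "(A1 has_real_derivative A2 t) (at t within {1..t2})"
    if t: "t \<in> {1..t2}" for t
  proof -
    have d1: "((\<lambda>t. u t x * eigf k x) has_real_derivative ut t x * eigf k x) (at t within {1..t2})"
       "((\<lambda>t. ut t x * eigf k x) has_real_derivative utt t x * eigf k x) (at t within {1..t2})" if "t \<in> {1..t2}" for t x
      using time_deriv(1,2)[of t x, THEN DERIV_subset, OF _ sub] sub that by (auto intro!: DERIV_cmult_right)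
    show "(A has_real_derivative A1 t) (at t within {1..t2})" unfolding A_def[abs_def] A1_def
    proof (rule leibniz_rule_field_derivative)
      show "(\<lambda>x. u t x * eigf k x) integrable_on cbox a c" if "t \<in> {1..t2}" for t
        by (intro integrable_continuous c1 that)
      show "continuous_on ({1..t2} \<times> cbox a c) (\<lambda>(t, x). ut t x * eigf k x)"
        using c2(2) ce by (auto intro!: continuous_intros simp: split_beta')
    qed (use d1 t in auto)
    show "(A1 has_real_derivative A2 t) (at t within {1..t2})" unfolding A1_def[abs_def] A2_def
    proof (rule leibniz_rule_field_derivative)
      show "(\<lambda>x. ut t x * eigf k x) integrable_on cbox a c" if "t \<in> {1..t2}" for t
        by (intro integrable_continuous c1 that)
      show "continuous_on ({1..t2} \<times> cbox a c) (\<lambda>(t, x). utt t x * eigf k x)"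
        using c2(3) ce by (auto intro!: continuous_intros simp: split_beta')
    qed (use d1 t in auto)
  qed
  have A2_eq: "A2 t = t powr (2*l) * (k\<^sup>2 * A t) - \<mu> / t * A1 t - nu2 / t^2 * A t + B t" if t: "t \<in> {1<..t2}" for t
  proof -
    have t': "t \<in> {1..t2}" and tI: "t \<in> I" using t sub by auto
    have cudd: "continuous_on (cbox a c) (\<lambda>x. (\<Sum>b\<in>Basis. udd b t x) * eigf k x)"
      by (intro continuous_intros continuous_eigf cont_slice(5)[OF tI])
    have "(\<lambda>x. utt t x * eigf k x) = (\<lambda>x. t powr (2*l) * ((\<Sum>b\<in>Basis. udd b t x) * eigf k x) - \<mu> / t * (ut t x * eigf k x)
       - nu2 / t^2 * (u t x * eigf k x) + \<bar>u t x\<bar> powr p * eigf k x)"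
    proof
      fix x
      have eq: "utt t x = t powr (2*l) * (\<Sum>b\<in>Basis. udd b t x) - \<mu> / t * ut t x - nu2 / t^2 * u t x + \<bar>u t x\<bar> powr p"
        using pde[of t x] t tI by simp
      show "utt t x * eigf k x = t powr (2*l) * ((\<Sum>b\<in>Basis. udd b t x) * eigf k x) - \<mu> / t * (ut t x * eigf k x)
       - nu2 / t^2 * (u t x * eigf k x) + \<bar>u t x\<bar> powr p * eigf k x" unfolding eq by (simp add: algebra_simps)
    qed
    hence "A2 t = integral (cbox a c) (\<lambda>x. t powr (2*l) * ((\<Sum>b\<in>Basis. udd b t x) * eigf k x) - \<mu> / t * (ut t x * eigf k x)
       - nu2 / t^2 * (u t x * eigf k x) + \<bar>u t x\<bar> powr p * eigf k x)" unfolding A2_def by (simp only:)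
    also have "\<dots> = t powr (2*l) * integral (cbox a c) (\<lambda>x. (\<Sum>b\<in>Basis. udd b t x) * eigf k x) - \<mu> / t * A1 t - nu2 / t^2 * A t + B t"
    proof -
      note i = integrable_continuous[OF cudd] integrable_continuous[OF c1(1)[OF t']] integrable_continuous[OF c1(2)[OF t']]
        integrable_continuous[OF c1(4)[OF t']]
      note h = integrable_integral[OF i(1)] integrable_integral[OF i(2)] integrable_integral[OF i(3)] integrable_integral[OF i(4)]
      show ?thesis unfolding A_def A1_def B_def
        by (rule integral_unique) (intro has_integral_add has_integral_diff has_integral_mult_right h)
    qed
    finally show ?thesis unfolding integral_laplacian[OF t2 t' ac] A_def .
  qed
  \<comment> \<open>Wronskian of the spatial average \<open>A\<close> and \<open>y\<close>, with the
    weight t^\<mu> that absorbs the damping term; the source \<open>B\<close> alone remains in its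
    derivative.\<close>
  define W where "W t = t powr \<mu> * (A1 t * y t - A t * y' t)" for t
  have cy: "continuous_on {1..t2} y" "continuous_on {1..t2} y'"
    using y y' by (auto intro!: continuous_at_imp_continuous_on DERIV_isCont)
  have cW: "continuous_on {1..t2} W" unfolding W_def by (intro continuous_intros cA cy) auto
  have at: "at t within {1..t2} = at t" if "t \<in> {1<..<t2}" for t using that by (intro at_within_interior) auto
  have DW: "(W has_real_derivative t powr \<mu> * y t * B t) (at t)" if t: "t \<in> {1<..<t2}" for t
  proof -
    have t': "t \<in> {1..t2}" "t \<in> {1<..t2}" "t > 0" "t \<ge> 1" using t by auto
    have "(W has_real_derivative (\<mu> * t powr (\<mu> - 1)) * (A1 t * y t - A t * y' t)
       + ((A2 t * y t + y' t * A1 t) - (A1 t * y' t + (- \<mu> / t * y' t - (nu2 / t^2 - k^2 * t powr (2*l)) * y t) * A t)) * t powr \<mu>) (at t)"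
      unfolding W_def[abs_def]
      using DA[OF t'(1)] unfolding at[OF t]
      by (intro DERIV_mult DERIV_diff y y' t') (use t'(3) in \<open>auto intro!: derivative_eq_intros\<close>)
    thus ?thesis
    proof (rule DERIV_cong)
      have pw: "t powr (\<mu> - 1) = t powr \<mu> / t" using t'(3) by (simp add: powr_diff)
      show "(\<mu> * t powr (\<mu> - 1)) * (A1 t * y t - A t * y' t)
       + ((A2 t * y t + y' t * A1 t) - (A1 t * y' t + (- \<mu> / t * y' t - (nu2 / t^2 - k^2 * t powr (2*l)) * y t) * A t)) * t powr \<mu>
         = t powr \<mu> * y t * B t"
        unfolding A2_eq[OF t'(2)] pw by (simp add: algebra_simps)
    qed
  qed
  have W1: "W 1 = integral (cbox a c) (\<lambda>x. (g x * y 1 - f x * y' 1) * eigf k x)"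
  proof -
    have one: "1 \<in> {1..t2}" using t1 by auto
    have "((\<lambda>x. (ut 1 x * eigf k x) * y 1 - (u 1 x * eigf k x) * y' 1) has_integral A1 1 * y 1 - A 1 * y' 1) (cbox a c)"
      unfolding A_def A1_def
      by (intro has_integral_diff has_integral_mult_left integrable_integral integrable_continuous c1 one)
    moreover have "(\<lambda>x. (ut 1 x * eigf k x) * y 1 - (u 1 x * eigf k x) * y' 1) = (\<lambda>x. (g x * y 1 - f x * y' 1) * eigf k x)"
      by (simp add: init fun_eq_iff algebra_simps)
    ultimately show ?thesis unfolding W_def by (simp add: integral_unique)
  qed
  have Wt1: "((\<lambda>t. t powr \<mu> * y t * B t) has_integral W t1 - W 1) {1..t1}"
    by (rule fundamental_theorem_of_calculus_interior)
       (use t1 DW in \<open>auto intro!: continuous_on_subset[OF cW] simp: has_real_derivative_iff_has_vector_derivative[symmetric]\<close>)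
  \<comment> \<open>With ln t as variable, each derivative of the cutoff costs a factor 1/(d t),
    which fits the scaling of the damping and mass coefficients.\<close>
  define s where "s t = (ln t - ln t1) / d" for t
  define \<eta> where "\<eta> t = 1 - 3 * (s t)^2 + 2 * (s t)^3" for t
  define \<eta>1 where "\<eta>1 t = (6 * (s t)^2 - 6 * s t) / (d * t)" for t
  define \<eta>2 where "\<eta>2 t = (12 * s t - 6) / (d * t)^2 - (6 * (s t)^2 - 6 * s t) / (d * t^2)" for t
  have Ds: "(s has_real_derivative 1 / (d * t)) (at t)" if "t > 0" for t
    unfolding s_def[abs_def] using that d by (auto intro!: derivative_eq_intros simp: field_simps)
  have D\<eta>: "(\<eta> has_real_derivative \<eta>1 t) (at t)" if "t > 0" for t
    unfolding \<eta>_def[abs_def] \<eta>1_def using that d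
    by (auto intro!: derivative_eq_intros Ds simp: field_simps power2_eq_square)
  have D\<eta>1: "(\<eta>1 has_real_derivative \<eta>2 t) (at t)" if t: "t > 0" for t
  proof -
    have "(\<eta>1 has_real_derivative ((12 * s t * (1/(d*t)) - 6 * (1/(d*t))) * (d * t) - (6 * (s t)^2 - 6 * s t) * d) / ((d * t) * (d * t))) (at t)"
      unfolding \<eta>1_def[abs_def] using t d by (auto intro!: derivative_eq_intros Ds)
    thus ?thesis
      by (rule DERIV_cong) (use t d in \<open>simp add: \<eta>2_def field_simps power2_eq_square\<close>)
  qed
  have s01: "0 \<le> s t" "s t \<le> 1" if "t \<in> {t1..t2}" for t
    using that t1 d unfolding s_def by (auto simp: divide_le_eq_1 d_def)
  \<comment> \<open>The correction by the second term cancels the derivative \<open>A1\<close> in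
    G', so the error \<open>Z\<close> involves \<open>A\<close> only, which is bounded by the
    integral of |u| \<Phi>.\<close>
  define G where "G t = \<eta> t * W t - \<eta>1 t * (t powr \<mu> * y t * A t)" for t
  define Z where "Z t = t powr \<mu> * (\<eta>2 t * y t + \<mu> * \<eta>1 t * y t / t + 2 * \<eta>1 t * y' t) * A t" for t
  have subt: "{t1..t2} \<subseteq> {1..t2}" using t1 by auto
  note cA' = cA[THEN continuous_on_subset, OF subt] and cy' = cy[THEN continuous_on_subset, OF subt]
  have cs: "continuous_on {t1..t2} s" "continuous_on {t1..t2} \<eta>" "continuous_on {t1..t2} \<eta>1" "continuous_on {t1..t2} \<eta>2"
  proof -
    show cs: "continuous_on {t1..t2} s" unfolding s_def[abs_def] using t1 d by (intro continuous_intros) auto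
    show "continuous_on {t1..t2} \<eta>" "continuous_on {t1..t2} \<eta>1" "continuous_on {t1..t2} \<eta>2"
      unfolding \<eta>_def[abs_def] \<eta>1_def[abs_def] \<eta>2_def[abs_def] using t1 d by (intro continuous_intros cs; auto)+
  qed
  have cG: "continuous_on {t1..t2} G" unfolding G_def
    using t1 by (intro continuous_intros cA' cy' cs continuous_on_subset[OF cW subt]) auto
  have GI0: "((\<lambda>t. \<eta> t * (t powr \<mu> * y t * B t) - Z t) has_integral G t2 - G t1) {t1..t2}"
  proof (rule fundamental_theorem_of_calculus_interior)
    fix t assume t: "t \<in> {t1<..<t2}"
    hence t': "t \<in> {1<..<t2}" "t \<in> {1..t2}" "t > 0" "t \<ge> 1" using t1 by auto
    have "(G has_real_derivative (\<eta>1 t * W t + (t powr \<mu> * y t * B t) * \<eta> t)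
       - (\<eta>2 t * (t powr \<mu> * y t * A t) + (((\<mu> * t powr (\<mu> - 1)) * y t + y' t * t powr \<mu>) * A t + A1 t * (t powr \<mu> * y t)) * \<eta>1 t)) (at t)"
      unfolding G_def[abs_def] using DA[OF t'(2)] unfolding at[OF t'(1)]
      by (intro DERIV_mult DERIV_diff D\<eta> D\<eta>1 DW y t') (use t'(3) in \<open>auto intro!: derivative_eq_intros\<close>)
    moreover have "(\<eta>1 t * W t + (t powr \<mu> * y t * B t) * \<eta> t)
       - (\<eta>2 t * (t powr \<mu> * y t * A t) + (((\<mu> * t powr (\<mu> - 1)) * y t + y' t * t powr \<mu>) * A t + A1 t * (t powr \<mu> * y t)) * \<eta>1 t)
       = \<eta> t * (t powr \<mu> * y t * B t) - Z t"
    proof -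
      have pw: "t powr (\<mu> - 1) = t powr \<mu> / t" using t'(3) by (simp add: powr_diff)
      show ?thesis unfolding Z_def W_def pw by (simp add: algebra_simps)
    qed
    ultimately show "(G has_vector_derivative \<eta> t * (t powr \<mu> * y t * B t) - Z t) (at t)"
      by (simp add: has_real_derivative_iff_has_vector_derivative)
  qed (use t1 cG in auto)
  \<comment> \<open>The zero slope of the cutoff at both ends enters here; its second derivative may
    jump there without harm.\<close>
  have G12: "G t2 = 0" "G t1 = W t1"
    using d by (simp_all add: G_def \<eta>_def \<eta>1_def s_def d_def)
  have GI: "((\<lambda>t. Z t - \<eta> t * (t powr \<mu> * y t * B t)) has_integral W t1) {t1..t2}"
    using has_integral_neg[OF GI0] by (simp add: G12)
  let ?C = "6 * (\<bar>\<mu>\<bar> + 2) * (1/d + 1/d^2)"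
  have cR: "continuous_on {t1..t2} (\<lambda>t. t powr (\<mu>-2) * (y t + t * \<bar>y' t\<bar>) * D t)"
    using t1 by (intro continuous_intros cA' cy') auto
  have "W t1 \<le> integral {t1..t2} (\<lambda>t. ?C * (t powr (\<mu>-2) * (y t + t * \<bar>y' t\<bar>) * D t))"
  proof (rule has_integral_le[OF GI])
    show "((\<lambda>t. ?C * (t powr (\<mu>-2) * (y t + t * \<bar>y' t\<bar>) * D t)) has_integral
       integral {t1..t2} (\<lambda>t. ?C * (t powr (\<mu>-2) * (y t + t * \<bar>y' t\<bar>) * D t))) {t1..t2}"
      by (intro integrable_integral integrable_continuous_real continuous_intros cR)
    fix t assume t: "t \<in> {t1..t2}"
    hence t': "t \<in> {1..t2}" "t \<ge> 1" "t > 0" using t1 by auto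
    note sb = smoothstep_bounds[OF s01[OF t]]
    have yt: "y t \<ge> 0" using y0 t' by auto
    have B0: "B t \<ge> 0" unfolding B_def
      by (intro integral_nonneg integrable_continuous c1 t') simp
    have AD: "\<bar>A t\<bar> \<le> D t"
    proof -
      have "norm (A t) \<le> D t" unfolding A_def D_def
        by (rule integral_norm_bound_integral)
           (auto intro!: integrable_continuous c1 t' simp: abs_mult)
      thus ?thesis by simp
    qed
    let ?e = "1/d + 1/d^2"
    have e1: "\<bar>\<eta>1 t\<bar> \<le> 6 * ?e / t"
    proof -
      have "\<bar>\<eta>1 t\<bar> = \<bar>6 * (s t)^2 - 6 * s t\<bar> * (1/d) / t" unfolding \<eta>1_def using d t' by (simp add: abs_mult)
      also have "\<dots> \<le> 6 * ?e / t" using sb(2) d t' by (intro divide_right_mono mult_mono) auto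
      finally show ?thesis .
    qed
    have e2: "\<bar>\<eta>2 t\<bar> \<le> 6 * ?e / t^2"
    proof -
      have "\<bar>\<eta>2 t\<bar> \<le> \<bar>(12 * s t - 6) / (d * t)^2\<bar> + \<bar>(6 * (s t)^2 - 6 * s t) / (d * t^2)\<bar>"
        unfolding \<eta>2_def by (rule abs_triangle_ineq4)
      also have "\<dots> = (\<bar>12 * s t - 6\<bar> * (1/d^2) + \<bar>6 * (s t)^2 - 6 * s t\<bar> * (1/d)) / t^2"
        using d t' by (simp add: abs_mult power_mult_distrib add_divide_distrib)
      also have "\<dots> \<le> (6 * (1/d^2) + 6 * (1/d)) / t^2"
        using sb d t' by (intro divide_right_mono add_mono mult_right_mono) auto
      finally show ?thesis by (simp add: algebra_simps)
    qed
    have "\<bar>\<eta>2 t * y t + \<mu> * \<eta>1 t * y t / t + 2 * \<eta>1 t * y' t\<bar> \<le> \<bar>\<eta>2 t\<bar> * y t + \<bar>\<mu>\<bar> * \<bar>\<eta>1 t\<bar> * y t / t + 2 * \<bar>\<eta>1 t\<bar> * \<bar>y' t\<bar>"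
    proof -
      have "\<bar>\<eta>2 t * y t + \<mu> * \<eta>1 t * y t / t + 2 * \<eta>1 t * y' t\<bar> \<le> \<bar>\<eta>2 t * y t\<bar> + \<bar>\<mu> * \<eta>1 t * y t / t\<bar> + \<bar>2 * \<eta>1 t * y' t\<bar>"
        by (intro order_trans[OF abs_triangle_ineq] add_mono abs_triangle_ineq order_refl)
      thus ?thesis using yt t' by (simp add: abs_mult)
    qed
    also have "\<dots> \<le> 6 * ?e / t^2 * y t + \<bar>\<mu>\<bar> * (6 * ?e / t) * y t / t + 2 * (6 * ?e / t) * \<bar>y' t\<bar>"
      using e1 e2 yt t' by (intro add_mono mult_right_mono mult_left_mono divide_right_mono) auto
    also have "\<dots> = 6 * ?e / t^2 * ((1 + \<bar>\<mu>\<bar>) * y t + 2 * (t * \<bar>y' t\<bar>))"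
    proof -
      have "6 * E / t^2 * Y + m * (6 * E / t) * Y / t + 2 * (6 * E / t) * Y' = 6 * E / t^2 * ((1 + m) * Y + 2 * (t * Y'))"
        for E m Y Y' :: real
        using t' by (simp add: power2_eq_square field_simps)
      thus ?thesis .
    qed
    also have "\<dots> \<le> 6 * ?e / t^2 * ((\<bar>\<mu>\<bar> + 2) * (y t + t * \<bar>y' t\<bar>))"
    proof (intro mult_left_mono)
      have "(1 + \<bar>\<mu>\<bar>) * y t \<le> (\<bar>\<mu>\<bar> + 2) * y t" "2 * (t * \<bar>y' t\<bar>) \<le> (\<bar>\<mu>\<bar> + 2) * (t * \<bar>y' t\<bar>)"
        using yt t' by (intro mult_right_mono; simp)+
      thus "(1 + \<bar>\<mu>\<bar>) * y t + 2 * (t * \<bar>y' t\<bar>) \<le> (\<bar>\<mu>\<bar> + 2) * (y t + t * \<bar>y' t\<bar>)"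
        by (simp only: distrib_left add_mono)
    qed (use d in auto)
    finally have Q: "\<bar>\<eta>2 t * y t + \<mu> * \<eta>1 t * y t / t + 2 * \<eta>1 t * y' t\<bar> \<le> 6 * ?e / t^2 * ((\<bar>\<mu>\<bar> + 2) * (y t + t * \<bar>y' t\<bar>))" .
    \<comment> \<open>On the switching interval the source term has a favourable sign and is
      discarded.\<close>
    have "Z t - \<eta> t * (t powr \<mu> * y t * B t) \<le> \<bar>Z t\<bar>"
      using sb(1) yt B0 unfolding \<eta>_def by (smt (verit) mult_nonneg_nonneg powr_ge_zero)
    also have "\<bar>Z t\<bar> = t powr \<mu> * \<bar>\<eta>2 t * y t + \<mu> * \<eta>1 t * y t / t + 2 * \<eta>1 t * y' t\<bar> * \<bar>A t\<bar>"
      unfolding Z_def by (simp add: abs_mult)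
    also have "\<dots> \<le> t powr \<mu> * (6 * ?e / t^2 * ((\<bar>\<mu>\<bar> + 2) * (y t + t * \<bar>y' t\<bar>))) * D t"
      using Q AD by (intro mult_mono mult_left_mono mult_nonneg_nonneg) (auto simp: yt t' d less_imp_le intro!: add_nonneg_nonneg mult_nonneg_nonneg)
    also have "\<dots> = ?C * (t powr \<mu> / t^2 * (y t + t * \<bar>y' t\<bar>) * D t)"
    proof -
      have "P * (6 * E / t^2 * (m * Y)) * X = 6 * m * E * (P / t^2 * Y * X)" for P E m Y X :: real by simp
      thus ?thesis .
    qed
    also have "t powr \<mu> / t^2 = t powr (\<mu> - 2)" using t' by (simp add: powr_diff)
    finally show "Z t - \<eta> t * (t powr \<mu> * y t * B t) \<le> ?C * (t powr (\<mu>-2) * (y t + t * \<bar>y' t\<bar>) * D t)" .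
  qed
  also have "\<dots> = ?C * integral {t1..t2} (\<lambda>t. t powr (\<mu>-2) * (y t + t * \<bar>y' t\<bar>) * D t)" by simp
  finally have "W t1 \<le> ?C * integral {t1..t2} (\<lambda>t. t powr (\<mu>-2) * (y t + t * \<bar>y' t\<bar>) * D t)" .
  moreover have "W t1 = integral (cbox a c) (\<lambda>x. (g x * y 1 - f x * y' 1) * eigf k x) + integral {1..t1} (\<lambda>t. t powr \<mu> * y t * B t)"
    using integral_unique[OF Wt1] W1 by simp
  ultimately show ?thesis unfolding B_def D_def by simp
qed

end

subsection \<open>The time-dependent solutions\<close>

definition ysol :: "real \<Rightarrow> real \<Rightarrow> real \<Rightarrow> real \<Rightarrow> real \<Rightarrow> real" where
  "ysol l \<mu> \<gamma> k t = t powr ((1-\<mu>)/2) * macdonald \<gamma> 0 (k * (t powr (l+1) / (l+1)))"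

definition ysol1 :: "real \<Rightarrow> real \<Rightarrow> real \<Rightarrow> real \<Rightarrow> real \<Rightarrow> real" where
  "ysol1 l \<mu> \<gamma> k t = (1-\<mu>)/2 * t powr ((1-\<mu>)/2 - 1) * macdonald \<gamma> 0 (k * (t powr (l+1) / (l+1)))
     - t powr ((1-\<mu>)/2) * (k * t powr l) * macdonald \<gamma> 1 (k * (t powr (l+1) / (l+1)))"

lemma DERIV_macdonald_comp:
  assumes "l > -1" "k > 0" "t > 0"
  shows "((\<lambda>t. macdonald g j (k * (t powr (l+1) / (l+1)))) has_real_derivative
     - macdonald g (Suc j) (k * (t powr (l+1) / (l+1))) * (k * t powr l)) (at t)"
proof (rule DERIV_chain2[where f="macdonald g j"])
  show "(macdonald g j has_real_derivative - macdonald g (Suc j) (k * (t powr (l+1) / (l+1)))) (at (k * (t powr (l+1) / (l+1))))"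
    by (rule DERIV_macdonald) (use assms in auto)
  show "((\<lambda>t. k * (t powr (l+1) / (l+1))) has_real_derivative k * t powr l) (at t)"
    using assms by (auto intro!: derivative_eq_intros)
qed

lemma DERIV_ysol:
  assumes "l > -1" "k > 0" "t > 0"
  shows "(ysol l \<mu> \<gamma> k has_real_derivative ysol1 l \<mu> \<gamma> k t) (at t)"
proof -
  have "((\<lambda>t. t powr ((1-\<mu>)/2)) has_real_derivative (1-\<mu>)/2 * t powr ((1-\<mu>)/2 - 1)) (at t)"
    using assms by (auto intro!: derivative_eq_intros)
  from DERIV_mult[OF this DERIV_macdonald_comp[OF assms, of \<gamma> 0]]
  show ?thesis unfolding ysol_def[abs_def] ysol1_def by (rule DERIV_cong) (simp add: algebra_simps)
qed

text \<open>With z = k t^(l+1)/(l+1) and the prefactor t^((1-\<mu>)/2), the time equation becomes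
  the modified Bessel equation of order \<gamma>. The assumption on \<gamma> is equivalent to ((l+1)
  \<gamma>)^2 = ((1-\<mu>)/2)^2 - nu2, the condition matching the terms without k.\<close>

lemma DERIV_ysol1:
  assumes l: "l > -1" and k: "k > 0" and t: "t > 0" and \<gamma>: "(2 * (l + 1) * \<gamma>)^2 = (\<mu> - 1)^2 - 4 * nu2"
  shows "(ysol1 l \<mu> \<gamma> k has_real_derivative
     - \<mu> / t * ysol1 l \<mu> \<gamma> k t - (nu2 / t^2 - k^2 * t powr (2*l)) * ysol l \<mu> \<gamma> k t) (at t)"
proof -
  define \<alpha> where "\<alpha> = (1 - \<mu>) / 2"
  define P where "P = t powr \<alpha>"
  define Q where "Q = k * t powr (l+1)"
  define z where "z = k * (t powr (l+1) / (l+1))"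
  define K0 where "K0 = macdonald \<gamma> 0 z"
  define K1 where "K1 = macdonald \<gamma> 1 z"
  define K2 where "K2 = macdonald \<gamma> 2 z"
  have z: "z > 0" "Q = (l + 1) * z" unfolding z_def Q_def using l k t by auto
  have tl: "t powr (l+1) = t powr l * t" using t by (simp add: powr_add)
  have Qt: "Q = k * t powr l * t" unfolding Q_def tl by simp
  have t1: "t powr (\<alpha> - 1) = P / t" "t powr (\<alpha> - 1 - 1) = P / t^2" "k * t powr l = Q / t"
    using t by (simp_all add: P_def Qt powr_diff power2_eq_square)
  have "t powr (2*l) = (t powr l)^2" using powr_add[of t l l] by (simp add: power2_eq_square)
  hence t2: "k^2 * t powr (2*l) = Q^2 / t^2" using t by (simp add: Qt power_mult_distrib)
  have D0: "((\<lambda>t. macdonald \<gamma> 0 (k * (t powr (l+1) / (l+1)))) has_real_derivative - K1 * (k * t powr l)) (at t)"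
    "((\<lambda>t. macdonald \<gamma> 1 (k * (t powr (l+1) / (l+1)))) has_real_derivative - K2 * (k * t powr l)) (at t)"
    using DERIV_macdonald_comp[OF l k t, of \<gamma> 0] DERIV_macdonald_comp[OF l k t, of \<gamma> 1]
    by (simp_all add: K1_def K2_def z_def numeral_2_eq_2)
  have "(ysol1 l \<mu> \<gamma> k has_real_derivative
      (\<alpha> * ((\<alpha> - 1) * t powr (\<alpha> - 1 - 1)) * K0 + (- K1 * (k * t powr l)) * (\<alpha> * t powr (\<alpha> - 1)))
      - ((\<alpha> * t powr (\<alpha> - 1) * (k * t powr l) + k * (l * t powr (l - 1)) * t powr \<alpha>) * K1
          + (- K2 * (k * t powr l)) * (t powr \<alpha> * (k * t powr l)))) (at t)"
    unfolding ysol1_def[abs_def] \<alpha>_def[symmetric] K0_def K1_def K2_def z_def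
    by (intro DERIV_diff DERIV_mult D0[unfolded K1_def K2_def z_def])
       (use t in \<open>auto intro!: derivative_eq_intros\<close>)
  thus ?thesis
  proof (rule DERIV_cong)
    have ode: "z^2 * K2 = z * K1 + (z^2 + \<gamma>^2) * K0"
      using macdonald_ode[OF z(1), of \<gamma>] by (simp add: K0_def K1_def K2_def)
    have "Q^2 * K2 = (l+1)^2 * (z^2 * K2)" by (simp add: z power_mult_distrib)
    also have "\<dots> = (l+1) * Q * K1 + Q^2 * K0 + ((l+1) * \<gamma>)^2 * K0"
      unfolding ode by (simp add: z power_mult_distrib algebra_simps power2_eq_square)
    also have "((l+1) * \<gamma>)^2 = \<alpha>^2 - nu2"
      using \<gamma> by (simp add: \<alpha>_def power2_eq_square field_simps)
    finally have QK: "Q^2 * K2 = (l+1) * Q * K1 + Q^2 * K0 + (\<alpha>^2 - nu2) * K0" .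
    have mu: "\<mu> = 1 - 2 * \<alpha>" by (simp add: \<alpha>_def field_simps)
    have kl: "k * (l * t powr (l - 1)) = l * Q / t^2" using t by (simp add: Qt powr_diff power2_eq_square)
    have "(\<alpha> * ((\<alpha> - 1) * t powr (\<alpha> - 1 - 1)) * K0 + (- K1 * (k * t powr l)) * (\<alpha> * t powr (\<alpha> - 1)))
      - ((\<alpha> * t powr (\<alpha> - 1) * (k * t powr l) + k * (l * t powr (l - 1)) * t powr \<alpha>) * K1
          + (- K2 * (k * t powr l)) * (t powr \<alpha> * (k * t powr l)))
      = P / t^2 * (\<alpha> * (\<alpha> - 1) * K0 - (2 * \<alpha> + l) * Q * K1 + Q^2 * K2)"
      unfolding t1 kl P_def[symmetric] using t by (simp add: field_simps power2_eq_square)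
    also have "\<dots> = P / t^2 * (- \<mu> * (\<alpha> * K0 - Q * K1) - nu2 * K0 + Q^2 * K0)"
      unfolding QK mu by (simp add: algebra_simps power2_eq_square)
    also have "\<dots> = - \<mu> / t * ysol1 l \<mu> \<gamma> k t - (nu2 / t^2 - k^2 * t powr (2*l)) * ysol l \<mu> \<gamma> k t"
      unfolding ysol1_def ysol_def \<alpha>_def[symmetric] K0_def[unfolded z_def, symmetric] K1_def[unfolded z_def, symmetric]
        t1 t2 P_def[symmetric] using t by (simp add: field_simps power2_eq_square)
    finally show "(\<alpha> * ((\<alpha> - 1) * t powr (\<alpha> - 1 - 1)) * K0 + (- K1 * (k * t powr l)) * (\<alpha> * t powr (\<alpha> - 1)))
      - ((\<alpha> * t powr (\<alpha> - 1) * (k * t powr l) + k * (l * t powr (l - 1)) * t powr \<alpha>) * K1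
          + (- K2 * (k * t powr l)) * (t powr \<alpha> * (k * t powr l)))
      = - \<mu> / t * ysol1 l \<mu> \<gamma> k t - (nu2 / t^2 - k^2 * t powr (2*l)) * ysol l \<mu> \<gamma> k t" .
  qed
qed

lemma ysol_pos: "l > -1 \<Longrightarrow> k > 0 \<Longrightarrow> t > 0 \<Longrightarrow> ysol l \<mu> \<gamma> k t > 0"
  unfolding ysol_def by (intro mult_pos_pos macdonald_pos) auto

text \<open>The factor on the right is \<kappa> and does not depend on k, so one condition on the
  data serves all frequencies at once.\<close>

lemma ysol1_at_1:
  assumes "l > -1" "k > 0"
  shows "- ysol1 l \<mu> \<gamma> k 1 \<ge> ((\<mu> - 1) / 2 + (l + 1) * \<gamma>) * ysol l \<mu> \<gamma> k 1"
proof -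
  have "(l+1) * (\<gamma> * macdonald \<gamma> 0 (k / (l+1))) \<le> (l+1) * (k / (l+1) * macdonald \<gamma> 1 (k / (l+1)))"
    using assms by (intro mult_left_mono macdonald_log_deriv) auto
  also have "\<dots> = k * macdonald \<gamma> 1 (k / (l+1))" using assms by simp
  finally show ?thesis by (simp add: ysol_def ysol1_def field_simps)
qed

definition macdonald_sum :: "real \<Rightarrow> real \<Rightarrow> real" where
  "macdonald_sum g z = macdonald g 0 z + z * macdonald g 1 z"

text \<open>Bounds the time factor that the derivatives of the cutoff produce in
  \<open>weak_inequality\<close>.\<close>

lemma ysol_weight_le:
  assumes "l > -1" "k > 0" "t > 0"
  shows "ysol l \<mu> \<gamma> k t + t * \<bar>ysol1 l \<mu> \<gamma> k t\<bar>
    \<le> (\<bar>1-\<mu>\<bar> + l + 2) * t powr ((1-\<mu>)/2) * macdonald_sum \<gamma> (k * (t powr (l+1) / (l+1)))"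
proof -
  define z where "z = k * (t powr (l+1) / (l+1))"
  define P where "P = t powr ((1-\<mu>)/2)"
  have z: "z > 0" using assms by (simp add: z_def)
  have K: "macdonald \<gamma> 0 z > 0" "macdonald \<gamma> 1 z > 0" using macdonald_pos[OF z] by auto
  have P: "P > 0" using assms by (simp add: P_def)
  have "t * ysol1 l \<mu> \<gamma> k t = P * ((1-\<mu>)/2 * macdonald \<gamma> 0 z - (l+1) * (z * macdonald \<gamma> 1 z))"
  proof -
    have pw: "t powr ((1-\<mu>)/2 - 1) = P / t" using assms by (simp add: P_def powr_diff)
    have kz: "(l+1) * z = k * t powr l * t" using assms by (simp add: z_def powr_add)
    have "t * (a * (P / t) * A - P * b * B) = P * (a * A - (b * t) * B)" for a A b B
      using assms by (simp add: algebra_simps)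
    from this[of "(1-\<mu>)/2" "macdonald \<gamma> 0 z" "k * t powr l" "macdonald \<gamma> 1 z"]
    show ?thesis unfolding ysol1_def z_def[symmetric] pw P_def[symmetric] kz[symmetric] by (simp only: mult.assoc)
  qed
  hence "t * \<bar>ysol1 l \<mu> \<gamma> k t\<bar> = P * \<bar>(1-\<mu>)/2 * macdonald \<gamma> 0 z - (l+1) * (z * macdonald \<gamma> 1 z)\<bar>"
    using assms P by (metis abs_mult abs_of_pos)
  also have "\<dots> \<le> P * (\<bar>(1-\<mu>)/2 * macdonald \<gamma> 0 z\<bar> + \<bar>(l+1) * (z * macdonald \<gamma> 1 z)\<bar>)"
    using P by (intro mult_left_mono abs_triangle_ineq4) auto
  also have "\<dots> = P * (\<bar>1-\<mu>\<bar>/2 * macdonald \<gamma> 0 z + (l+1) * (z * macdonald \<gamma> 1 z))"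
    using K z assms by (simp add: abs_mult)
  finally have "ysol l \<mu> \<gamma> k t + t * \<bar>ysol1 l \<mu> \<gamma> k t\<bar>
     \<le> P * ((1 + \<bar>1-\<mu>\<bar>/2) * macdonald \<gamma> 0 z + (l+1) * (z * macdonald \<gamma> 1 z))"
    unfolding ysol_def z_def[symmetric] P_def[symmetric] by (simp add: algebra_simps)
  also have "\<dots> \<le> P * ((\<bar>1-\<mu>\<bar> + l + 2) * macdonald \<gamma> 0 z + (\<bar>1-\<mu>\<bar> + l + 2) * (z * macdonald \<gamma> 1 z))"
  proof -
    have c: "1 + \<bar>1-\<mu>\<bar>/2 \<le> \<bar>1-\<mu>\<bar> + l + 2" "l + 1 \<le> \<bar>1-\<mu>\<bar> + l + 2"
      using assms abs_ge_zero[of "1-\<mu>"] by simp_all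
    show ?thesis
      by (rule mult_left_mono[OF add_mono[OF mult_right_mono[OF c(1)] mult_right_mono[OF c(2)]]])
         (use K z P in auto)
  qed
  finally show ?thesis unfolding macdonald_sum_def z_def[symmetric] P_def[symmetric] by (simp add: algebra_simps)
qed

lemma macdonald_antimono:
  assumes "0 < a" "a \<le> b"
  shows "macdonald g 0 b \<le> macdonald g 0 a"
proof (rule DERIV_nonpos_imp_nonincreasing[OF assms(2)])
  fix x assume "a \<le> x" "x \<le> b"
  thus "\<exists>y. ((macdonald g 0) has_real_derivative y) (at x) \<and> y \<le> 0"
    using DERIV_macdonald[of x g 0] macdonald_pos[of x g 1] assms by (intro exI[of _ "- macdonald g 1 x"]) auto
qed

subsection \<open>Integration in the frequency\<close>

lemma nn_integral_powr_0:
  assumes "e > -1" "b \<ge> 0"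
  shows "(\<integral>\<^sup>+k. ennreal (k powr e) * indicator {0..b} k \<partial>lborel) = ennreal (b powr (e+1) / (e+1))"
  by (rule nn_integral_has_integral_lebesgue'[OF _ has_integral_powr_from_0[OF assms]]) auto

text \<open>Split at k = 1/c: below, the exponential is at most 1; above, exp(-c k) <= 1/(c k). Both
  parts scale as c^(-(e+1)).\<close>

lemma nn_integral_powr_exp_le:
  assumes e: "-1 < e" "e < 0" and c: "c > 0"
  shows "(\<integral>\<^sup>+k. ennreal (k powr e * exp (-c * k)) * indicator {0..} k \<partial>lborel) \<le> ennreal ((1 / (e+1) - 1/e) * c powr (-(e+1)))"
proof -
  have "(\<integral>\<^sup>+k. ennreal (k powr e * exp (-c * k)) * indicator {0..} k \<partial>lborel)
     \<le> (\<integral>\<^sup>+k. ennreal (k powr e) * indicator {0..1/c} k + ennreal (1/c) * (ennreal (k powr (e-1)) * indicator {1/c..} k) \<partial>lborel)"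
  proof (rule nn_integral_mono)
    fix k :: real
    show "ennreal (k powr e * exp (-c * k)) * indicator {0..} k
      \<le> ennreal (k powr e) * indicator {0..1/c} k + ennreal (1/c) * (ennreal (k powr (e-1)) * indicator {1/c..} k)"
    proof (cases "k \<le> 1/c")
      case True
      show ?thesis
      proof (cases "k \<ge> 0")
        case True
        hence "k powr e * exp (-c * k) \<le> k powr e" using c by (simp add: mult_left_le)
        hence "ennreal (k powr e * exp (-c * k)) \<le> ennreal (k powr e)" by (rule ennreal_leI)
        also have "\<dots> \<le> ennreal (k powr e) * indicator {0..1/c} k + ennreal (1/c) * (ennreal (k powr (e-1)) * indicator {1/c..} k)"
          using True \<open>k \<le> 1/c\<close> by simp
        finally show ?thesis using True by simp
      qed simp
    next
      case False
      hence k: "k > 1/c" by simp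
      moreover have "1/c > 0" using c by simp
      ultimately have k0: "k > 0" by linarith
      have "c * k * exp (-(c * k)) \<le> 1"
      proof -
        have "c * k \<le> exp (c * k)" using exp_ge_add_one_self[of "c * k"] by linarith
        thus ?thesis by (simp add: exp_minus field_simps)
      qed
      hence "exp (-c * k) \<le> 1 / (c * k)" using c k0 by (simp add: field_simps)
      hence "k powr e * exp (-c * k) \<le> k powr e * (1 / (c * k))" by (intro mult_left_mono) auto
      also have "\<dots> = (1/c) * k powr (e-1)" using k0 by (simp add: powr_diff)
      finally have "ennreal (k powr e * exp (-c * k)) \<le> ennreal ((1/c) * k powr (e-1))" by (rule ennreal_leI)
      also have "\<dots> = ennreal (1/c) * ennreal (k powr (e-1))" using c by (intro ennreal_mult) auto
      finally show ?thesis using k k0 by (simp add: indicator_def)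
    qed
  qed
  also have "\<dots> = (\<integral>\<^sup>+k. ennreal (k powr e) * indicator {0..1/c} k \<partial>lborel)
      + ennreal (1/c) * (\<integral>\<^sup>+k. ennreal (k powr (e-1)) * indicator {1/c..} k \<partial>lborel)"
    by (subst nn_integral_add, simp_all add: nn_integral_cmult)
  also have "(\<integral>\<^sup>+k. ennreal (k powr e) * indicator {0..1/c} k \<partial>lborel) = ennreal ((1/c) powr (e+1) / (e+1))"
    using e c by (intro nn_integral_powr_0) auto
  also have "(\<integral>\<^sup>+k. ennreal (k powr (e-1)) * indicator {1/c..} k \<partial>lborel) = ennreal (- ((1/c) powr (e-1+1)) / (e-1+1))"
    by (rule nn_integral_has_integral_lebesgue'[OF _ has_integral_powr_to_inf]) (use e c in auto)
  also have "ennreal ((1/c) powr (e+1) / (e+1)) + ennreal (1/c) * ennreal (- ((1/c) powr (e-1+1)) / (e-1+1))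
     = ennreal ((1/c) powr (e+1) / (e+1) + (1/c) * (- ((1/c) powr (e-1+1)) / (e-1+1)))"
  proof -
    have B: "- ((1/c) powr (e-1+1)) / (e-1+1) \<ge> 0" using e by (intro divide_nonpos_neg) auto
    have "ennreal (1/c) * ennreal (- ((1/c) powr (e-1+1)) / (e-1+1)) = ennreal ((1/c) * (- ((1/c) powr (e-1+1)) / (e-1+1)))"
      using c B by (intro ennreal_mult[symmetric]) auto
    moreover have "ennreal ((1/c) powr (e+1) / (e+1)) + ennreal ((1/c) * (- ((1/c) powr (e-1+1)) / (e-1+1)))
       = ennreal ((1/c) powr (e+1) / (e+1) + (1/c) * (- ((1/c) powr (e-1+1)) / (e-1+1)))"
      using c e B by (intro ennreal_plus[symmetric] mult_nonneg_nonneg) auto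
    ultimately show ?thesis by simp
  qed
  also have "(1/c) powr (e+1) / (e+1) + (1/c) * (- ((1/c) powr (e-1+1)) / (e-1+1)) = (1 / (e+1) - 1/e) * c powr (-(e+1))"
  proof -
    have "(1/c) * (1/c) powr e = (1/c) powr (e+1)" using c by (simp add: powr_add)
    moreover have "(1/c) powr (e+1) = c powr (-(e+1))" by (simp only: powr_divide powr_minus_divide powr_one_eq_one)
    ultimately show ?thesis by (simp add: algebra_simps)
  qed
  finally show ?thesis .
qed

text \<open>Only frequencies k <= b are kept, where b F <= 1 and the Macdonald function is at least
  its value at 1 by monotonicity. As b is at least a multiple of t^(-(l+1)), integrating k^\<beta>
  yields the stated power.\<close>

lemma frequency_integral_lower:
  assumes l: "l > -1" and \<beta>: "\<beta> > -1"
  shows "\<exists>c>0. \<forall>t\<ge>1. ennreal (c * t powr ((1-\<mu>)/2 - (l+1)*(\<beta>+1)))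
     \<le> (\<integral>\<^sup>+k. ennreal (k powr \<beta> * ysol l \<mu> \<gamma> k t) * indicator {0<..1} k \<partial>lborel)"
proof -
  define K where "K = macdonald \<gamma> 0 1"
  have K: "K > 0" unfolding K_def by (rule macdonald_pos) simp
  define C where "C = 1 + 1 / (l+1)"
  have C: "C > 0" unfolding C_def using l by (intro add_pos_pos) auto
  define c where "c = K * C powr (-(\<beta>+1)) / (\<beta>+1)"
  have c: "c > 0" unfolding c_def using K C \<beta> by simp
  have "ennreal (c * t powr ((1-\<mu>)/2 - (l+1)*(\<beta>+1)))
     \<le> (\<integral>\<^sup>+k. ennreal (k powr \<beta> * ysol l \<mu> \<gamma> k t) * indicator {0<..1} k \<partial>lborel)" if t: "t \<ge> 1" for t
  proof -
    define F where "F = t powr (l+1) / (l+1)"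
    define b where "b = 1 / (1 + F)"
    define P where "P = t powr ((1-\<mu>)/2)"
    have tL: "t powr (l+1) \<ge> 1" using t l ge_one_powr_ge_zero[of t "l+1"] by simp
    have F: "F > 0" using l t by (simp add: F_def)
    have b: "0 < b" "b \<le> 1" "b * F \<le> 1" using F by (auto simp: b_def field_simps)
    have P: "P > 0" using t by (simp add: P_def)
    have "1 + F \<le> C * t powr (l+1)" using tL unfolding C_def F_def by (simp add: distrib_right)
    hence bC: "b \<ge> 1 / (C * t powr (l+1))" unfolding b_def using F C t by (intro divide_left_mono) auto
    have "c * t powr ((1-\<mu>)/2 - (l+1)*(\<beta>+1)) = P * K * (1 / (C * t powr (l+1))) powr (\<beta>+1) / (\<beta>+1)"
    proof -
      have "(1 / (C * t powr (l+1))) powr (\<beta>+1) = C powr (-(\<beta>+1)) * t powr (-(l+1)*(\<beta>+1))"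
      proof -
        have a: "C powr (-(\<beta>+1)) = 1 / C powr (\<beta>+1)" by (rule powr_minus_divide)
        have b: "t powr (-(l+1)*(\<beta>+1)) = 1 / t powr ((l+1)*(\<beta>+1))"
          using powr_minus_divide[of t "(l+1)*(\<beta>+1)"] by (simp only: minus_mult_left)
        show ?thesis unfolding a b by (simp add: powr_divide powr_mult powr_powr)
      qed
      moreover have "t powr ((1-\<mu>)/2 - (l+1)*(\<beta>+1)) = P * t powr (-(l+1)*(\<beta>+1))"
        unfolding P_def powr_add[symmetric] by (simp add: algebra_simps)
      ultimately show ?thesis by (simp add: c_def)
    qed
    also have "\<dots> \<le> P * K * (b powr (\<beta>+1) / (\<beta>+1))"
      using bC P K C t \<beta> by (simp add: divide_right_mono mult_left_mono powr_mono2)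
    finally have "ennreal (c * t powr ((1-\<mu>)/2 - (l+1)*(\<beta>+1))) \<le> ennreal (P * K * (b powr (\<beta>+1) / (\<beta>+1)))"
      by (rule ennreal_leI)
    also have "\<dots> = ennreal (P * K) * (\<integral>\<^sup>+k. ennreal (k powr \<beta>) * indicator {0..b} k \<partial>lborel)"
      using P K b \<beta> by (subst nn_integral_powr_0) (auto simp: ennreal_mult[symmetric])
    also have "\<dots> = (\<integral>\<^sup>+k. ennreal (P * K) * (ennreal (k powr \<beta>) * indicator {0..b} k) \<partial>lborel)"
      by (rule nn_integral_cmult[symmetric]) auto
    also have "\<dots> \<le> (\<integral>\<^sup>+k. ennreal (k powr \<beta> * ysol l \<mu> \<gamma> k t) * indicator {0<..1} k \<partial>lborel)"
    proof (rule nn_integral_mono)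
      fix k :: real
      show "ennreal (P * K) * (ennreal (k powr \<beta>) * indicator {0..b} k) \<le> ennreal (k powr \<beta> * ysol l \<mu> \<gamma> k t) * indicator {0<..1} k"
      proof (cases "k \<in> {0<..b}")
        case True
        hence "k * F \<le> 1" using b F by (meson greaterThanAtMost_iff less_imp_le mult_right_mono order_trans)
        hence "K \<le> macdonald \<gamma> 0 (k * F)" unfolding K_def using True F by (intro macdonald_antimono) auto
        hence "P * K \<le> ysol l \<mu> \<gamma> k t" unfolding ysol_def P_def F_def by (intro mult_left_mono) auto
        hence "ennreal (P * K * k powr \<beta>) \<le> ennreal (k powr \<beta> * ysol l \<mu> \<gamma> k t)"
          by (subst mult.commute) (intro ennreal_leI mult_left_mono, auto)
        thus ?thesis using True b P K by (simp add: ennreal_mult)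
      next
        case False
        thus ?thesis by (cases "k = 0") (auto simp: indicator_def)
      qed
    qed
    finally show ?thesis .
  qed
  thus ?thesis using c by blast
qed

text \<open>Half of the exponential pays for replacing (1+a)^(-m) by (1+z)^(-m): near the cone a and
  z are comparable, and far inside it the exponential dominates any power of z - a. It will be used
  with a = k |x| and z = k \<phi>(t).\<close>

lemma light_cone_exp_bound:
  fixes m R :: real
  assumes m: "m \<ge> 0"
  shows "\<exists>C>0. \<forall>a\<ge>0. \<forall>z\<ge>0. a \<le> z + R \<longrightarrow> (1+a) powr (-m) * exp (-(z-a)) \<le> C * (1+z) powr (-m) * exp (-(z-a)/2)"
proof -
  \<comment> \<open>The summand 1 covers m = 0, that is dimension one, where \<open>m powr m\<close>
    is 0 by the convention for \<open>powr\<close>.\<close>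
  define D where "D = exp (1/2) * m powr m * 2 powr m + 1"
  define C where "C = D + exp (R/2)"
  have D: "D > 0" unfolding D_def by (intro add_nonneg_pos) auto
  have C: "C > 0" unfolding C_def using D by (intro add_pos_pos) auto
  have Dm: "(1+w) powr m * exp (-w/2) \<le> D" if w: "w \<ge> 0" for w
  proof (cases "m = 0")
    case True
    thus ?thesis using w by (simp add: D_def add_nonneg_pos)
  next
    case False
    have "exp (-w/2) = exp (1/2) * exp (-((1+w)/2))" by (simp add: exp_add[symmetric] add_divide_distrib)
    also have "\<dots> \<le> exp (1/2) * (m powr m * ((1+w)/2) powr (-m))"
      using w m False by (intro mult_left_mono exp_minus_le_powr) auto
    finally have "(1+w) powr m * exp (-w/2) \<le> (1+w) powr m * (exp (1/2) * (m powr m * ((1+w)/2) powr (-m)))"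
      by (intro mult_left_mono) auto
    also have "((1+w)/2) powr (-m) = 2 powr m / (1+w) powr m"
      by (simp add: powr_divide powr_minus field_simps)
    also have "(1+w) powr m * (exp (1/2) * (m powr m * (2 powr m / (1+w) powr m))) = exp (1/2) * m powr m * 2 powr m"
      using w by simp
    finally show ?thesis by (simp add: D_def)
  qed
  have "(1+a) powr (-m) * exp (-(z-a)) \<le> C * (1+z) powr (-m) * exp (-(z-a)/2)"
    if a: "a \<ge> 0" and z: "z \<ge> 0" and az: "a \<le> z + R" for a z
  proof -
    have e: "exp (-(z-a)) = exp (-(z-a)/2) * exp (-(z-a)/2)" by (simp add: exp_add[symmetric])
    have "(1+a) powr (-m) * exp (-(z-a)/2) \<le> C * (1+z) powr (-m)"
    proof (cases "z \<ge> a")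
      case True
      \<comment> \<open>Peetre-type inequality, which transfers the power from a to z at the cost of
        a power of z - a.\<close>
      have "1 + z \<le> (1 + a) * (1 + (z - a))" using True a z by (simp add: algebra_simps mult_left_mono)
      hence "(1+z) powr m \<le> (1+a) powr m * (1+(z-a)) powr m"
        using m z by (subst powr_mult[symmetric]) (intro powr_mono2, auto)
      hence "(1+a) powr (-m) \<le> (1+z) powr (-m) * (1+(z-a)) powr m"
        using a z by (simp add: powr_minus field_simps)
      hence "(1+a) powr (-m) * exp (-(z-a)/2) \<le> (1+z) powr (-m) * ((1+(z-a)) powr m * exp (-(z-a)/2))"
        by (simp add: mult.assoc[symmetric] mult_right_mono)
      also have "\<dots> \<le> (1+z) powr (-m) * D" using Dm[of "z-a"] True by (intro mult_left_mono) auto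
      also have "\<dots> \<le> (1+z) powr (-m) * C" unfolding C_def by (intro mult_left_mono) auto
      finally show ?thesis by (simp add: mult.commute)
    next
      case False
      have "(1+a) powr (-m) * exp (-(z-a)/2) \<le> (1+z) powr (-m) * exp (R/2)"
        using False a z az m by (intro mult_mono powr_mono2') auto
      also have "\<dots> \<le> (1+z) powr (-m) * C" unfolding C_def using D by (intro mult_left_mono) auto
      finally show ?thesis by (simp add: mult.commute)
    qed
    hence "(1+a) powr (-m) * exp (-(z-a)/2) * exp (-(z-a)/2) \<le> C * (1+z) powr (-m) * exp (-(z-a)/2)"
      by (rule mult_right_mono) simp
    thus ?thesis unfolding e by (simp only: mult.assoc)
  qed
  thus ?thesis using C by blast
qed

text \<open>The decay e^(-kF) of the Macdonald function meets the growth e^(k|x|) of the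
  eigenfunction, so the product is large only near the light cone. The bound \<open>K\<close> on the
  frequency makes the overshoot k (|x| - F) at most \<open>K * R\<close>.\<close>

lemma macdonald_sum_eigf_le:
  fixes R g K :: real
  assumes m: "m = (real DIM('a::euclidean_space) - 1) / 2"
  shows "\<exists>C>0. \<forall>k x F. 0 < k \<longrightarrow> k \<le> K \<longrightarrow> 0 < F \<longrightarrow> norm x \<le> R + F \<longrightarrow> 0 \<le> R \<longrightarrow> 1 \<le> k * F \<longrightarrow>
     macdonald_sum g (k * F) * eigf k (x::'a) \<le> C * (k * F) powr (1/2 - m) * exp (- k * (F - norm x) / 2)"
proof -
  have m0: "m \<ge> 0" unfolding m using DIM_ge_1[where 'a='a] by simp
  obtain C2 where C2: "C2 > 0" "\<And>z. z \<ge> 1 \<Longrightarrow> macdonald_sum g z \<le> C2 * z powr (1/2) * exp (-z)"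
    using macdonald_sum_le_exp[of g] unfolding macdonald_sum_def by blast
  obtain CF where CF: "CF > 0" "\<And>k x. k \<ge> 0 \<Longrightarrow> eigf k (x::'a) \<le> CF * (1 + k * norm x) powr (-m) * exp (k * norm x)"
    using eigf_le_exp[where 'a='a] unfolding m by blast
  obtain Cr where Cr: "Cr > 0" "\<And>a z. a \<ge> 0 \<Longrightarrow> z \<ge> 0 \<Longrightarrow> a \<le> z + K * R \<Longrightarrow>
      (1+a) powr (-m) * exp (-(z-a)) \<le> Cr * (1+z) powr (-m) * exp (-(z-a)/2)"
    using light_cone_exp_bound[OF m0, of "K * R"] by blast
  have "macdonald_sum g (k * F) * eigf k x \<le> (C2 * CF * Cr) * (k * F) powr (1/2 - m) * exp (- k * (F - norm x) / 2)"
    if k: "0 < k" "k \<le> K" and F: "0 < F" and x: "norm x \<le> R + F" and R: "0 \<le> R" and kF: "1 \<le> k * F" for k F and x :: 'a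
  proof -
    define z where "z = k * F"
    define a where "a = k * norm x"
    have a0: "a \<ge> 0" using k by (simp add: a_def)
    have z1: "z \<ge> 1" using kF by (simp add: z_def)
    have "a \<le> k * (R + F)" unfolding a_def using x k by (intro mult_left_mono) auto
    also have "\<dots> \<le> z + K * R" using mult_right_mono[OF k(2) R] by (simp add: z_def distrib_left)
    finally have az: "a \<le> z + K * R" .
    have "macdonald_sum g z * eigf k x \<le> (C2 * z powr (1/2) * exp (-z)) * (CF * (1 + a) powr (-m) * exp a)"
      using C2 CF z1 k unfolding a_def by (intro mult_mono) (auto simp: less_imp_le)
    also have "\<dots> = C2 * CF * z powr (1/2) * ((1+a) powr (-m) * (exp (-z) * exp a))" by simp
    also have "exp (-z) * exp a = exp (-(z-a))" by (simp add: exp_add[symmetric])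
    also have "C2 * CF * z powr (1/2) * ((1+a) powr (-m) * exp (-(z-a)))
      \<le> C2 * CF * z powr (1/2) * (Cr * (1+z) powr (-m) * exp (-(z-a)/2))"
      using Cr(2)[OF a0 _ az] z1 C2 CF by (intro mult_left_mono) auto
    also have "\<dots> \<le> C2 * CF * z powr (1/2) * (Cr * z powr (-m) * exp (-(z-a)/2))"
      using z1 C2 CF Cr m0 by (intro mult_left_mono mult_right_mono powr_mono2') auto
    also have "\<dots> = (C2 * CF * Cr) * z powr (1/2 - m) * exp (-(z-a)/2)"
    proof -
      have "z powr (1/2) * z powr (-m) = z powr (1/2 - m)" by (simp add: powr_add[symmetric])
      thus ?thesis by (simp add: mult_ac)
    qed
    also have "-(z-a)/2 = - k * (F - norm x) / 2" by (simp add: z_def a_def algebra_simps)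
    finally show ?thesis unfolding z_def .
  qed
  thus ?thesis using C2 CF Cr by (intro exI[of _ "C2 * CF * Cr"]) auto
qed

text \<open>Split at k F = 1. Low frequencies contribute F^(-\<beta>-1), which is F^(1/2-m)
  F^(1/p-1); high frequencies contribute F^(1/2-m) times the integral of k^(-1/p) exp(-\<zeta> k/2).
  Both are bounded by F^(1/2-m) \<zeta>^(1/p-1).\<close>

lemma frequency_integral_upper:
  fixes R l \<mu> \<gamma> p :: real
  assumes l: "l > -1" and m: "m = (real DIM('a::euclidean_space) - 1) / 2" and p: "p > 1"
    and \<beta>: "\<beta> = m - 1/2 - 1/p" and \<gamma>: "\<bar>\<gamma>\<bar> < \<beta> + 1" and R: "R > 0"
  shows "\<exists>C>0. \<forall>t\<ge>1. \<forall>x::'a. norm x \<le> R + t powr (l+1) / (l+1) \<longrightarrow>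
    (\<integral>\<^sup>+k. ennreal (k powr \<beta> * ((ysol l \<mu> \<gamma> k t + t * \<bar>ysol1 l \<mu> \<gamma> k t\<bar>) * eigf k x)) * indicator {0<..1} k \<partial>lborel)
    \<le> ennreal (C * t powr ((1-\<mu>)/2 + (l+1)*(1/2-m)) * (t powr (l+1) / (l+1) - norm x + R + 1) powr (1/p - 1))"
proof -
  have m0: "m \<ge> 0" unfolding m using DIM_ge_1[where 'a='a] by simp
  \<comment> \<open>Strictly above |\<gamma>| for the Macdonald bound near 0, strictly below \<beta>
    + 1 so that k^(\<beta> - g') is integrable at 0.\<close>
  define g' where "g' = (\<bar>\<gamma>\<bar> + \<beta> + 1) / 2"
  have g': "\<bar>\<gamma>\<bar> < g'" "g' < \<beta> + 1" using \<gamma> by (auto simp: g'_def)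
  obtain C1 where C1: "C1 > 0" "\<And>z. z > 0 \<Longrightarrow> macdonald_sum \<gamma> z \<le> C1 * z powr (-g')"
    using macdonald_sum_le_powr[OF g'(1)] unfolding macdonald_sum_def by blast
  obtain CF where CF: "CF > 0" "\<And>k x. k \<ge> 0 \<Longrightarrow> eigf k (x::'a) \<le> CF * (1 + k * norm x) powr (-m) * exp (k * norm x)"
    using eigf_le_exp[where 'a='a] unfolding m by blast
  obtain C2 where C2: "C2 > 0" "\<And>k x F. 0 < k \<Longrightarrow> k \<le> 1 \<Longrightarrow> 0 < F \<Longrightarrow> norm x \<le> R + F \<Longrightarrow> 1 \<le> k * F \<Longrightarrow>
     macdonald_sum \<gamma> (k * F) * eigf k (x::'a) \<le> C2 * (k * F) powr (1/2 - m) * exp (- k * (F - norm x) / 2)"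
    using macdonald_sum_eigf_le[OF m, of 1 R \<gamma>] R by (metis less_imp_le)
  define D0 where "D0 = \<bar>1-\<mu>\<bar> + l + 2"
  define D1 where "D1 = C1 * CF * exp (1 + R)"
  define D2 where "D2 = C2 * exp ((R+1)/2)"
  \<comment> \<open>Gives \<zeta> <= C3 F, because (l+1) F >= 1 for t >= 1. Hence the low-frequency
    term is not larger than the other one even near the light cone, up to a constant.\<close>
  define C3 where "C3 = 1 + (R + 1) * (l + 1)"
  define E1 where "E1 = D1 * C3 powr (1 - 1/p) / (\<beta> - g' + 1)"
  define E2 where "E2 = D2 * ((1 / (1 - 1/p) + p) * 2 powr (1 - 1/p))"
  define C where "C = D0 * (l+1) powr (m - 1/2) * (E1 + E2)"
  have D0: "D0 > 0" using l abs_ge_zero[of "1-\<mu>"] unfolding D0_def by linarith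
  have D12: "D1 > 0" "D2 > 0" using C1 C2 CF by (auto simp: D1_def D2_def)
  have C3: "C3 \<ge> 1" using R l by (simp add: C3_def)
  have pp: "0 < 1/p" "1/p < 1" using p by auto
  have E12: "E1 > 0" "E2 > 0" unfolding E1_def E2_def using D12 C3 g' pp p by (auto intro!: mult_pos_pos add_pos_pos divide_pos_pos)
  have C: "C > 0" unfolding C_def using D0 E12 l by (intro mult_pos_pos add_pos_pos) auto
  have "(\<integral>\<^sup>+k. ennreal (k powr \<beta> * ((ysol l \<mu> \<gamma> k t + t * \<bar>ysol1 l \<mu> \<gamma> k t\<bar>) * eigf k x)) * indicator {0<..1} k \<partial>lborel)
    \<le> ennreal (C * t powr ((1-\<mu>)/2 + (l+1)*(1/2-m)) * (t powr (l+1) / (l+1) - norm x + R + 1) powr (1/p - 1))"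
    if t: "t \<ge> 1" and x: "norm x \<le> R + t powr (l+1) / (l+1)" for t and x :: 'a
  proof -
    define F where "F = t powr (l+1) / (l+1)"
    define \<zeta> where "\<zeta> = F - norm x + R + 1"
    define P where "P = t powr ((1-\<mu>)/2)"
    have tL: "t powr (l+1) \<ge> 1" using t l ge_one_powr_ge_zero[of t "l+1"] by simp
    have F: "F > 0" "F \<ge> 1 / (l+1)" using l t tL by (auto simp: F_def divide_right_mono)
    have \<zeta>: "\<zeta> \<ge> 1" using x by (simp add: \<zeta>_def F_def)
    have \<zeta>F: "\<zeta> \<le> C3 * F"
    proof -
      have "\<zeta> \<le> F + (R + 1) * 1" by (simp add: \<zeta>_def)
      also have "1 \<le> (l+1) * F" using F(2) l by (simp add: field_simps)
      hence "F + (R + 1) * 1 \<le> F + (R + 1) * ((l+1) * F)" using R by (intro add_left_mono mult_left_mono) auto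
      finally show ?thesis by (simp add: C3_def algebra_simps)
    qed
    have P: "P > 0" using t by (simp add: P_def)
    have ptw: "k powr \<beta> * ((ysol l \<mu> \<gamma> k t + t * \<bar>ysol1 l \<mu> \<gamma> k t\<bar>) * eigf k x)
      \<le> D0 * P * (D1 * F powr (-g') * (k powr (\<beta> - g') * indicator {0..1/F} k) + D2 * F powr (1/2-m) * (k powr (-1/p) * exp (- (\<zeta>/2) * k)))"
      if k: "k \<in> {0<..1}" for k
    proof -
      have k0: "k > 0" "k \<le> 1" using k by auto
      have kF: "k * F > 0" using k0 F by simp
      have "(ysol l \<mu> \<gamma> k t + t * \<bar>ysol1 l \<mu> \<gamma> k t\<bar>) * eigf k x \<le> (D0 * P * macdonald_sum \<gamma> (k * F)) * eigf k x"
        unfolding D0_def P_def F_def using ysol_weight_le[OF l k0(1), of t \<mu> \<gamma>] t by (intro mult_right_mono) auto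
      also have "\<dots> = D0 * P * (macdonald_sum \<gamma> (k * F) * eigf k x)" by simp
      finally have 1: "k powr \<beta> * ((ysol l \<mu> \<gamma> k t + t * \<bar>ysol1 l \<mu> \<gamma> k t\<bar>) * eigf k x)
         \<le> k powr \<beta> * (D0 * P * (macdonald_sum \<gamma> (k * F) * eigf k x))" by (intro mult_left_mono) auto
      have "k powr \<beta> * (macdonald_sum \<gamma> (k * F) * eigf k x) \<le>
         D1 * F powr (-g') * (k powr (\<beta> - g') * indicator {0..1/F} k) + D2 * F powr (1/2-m) * (k powr (-1/p) * exp (- (\<zeta>/2) * k))"
      proof (cases "k * F \<le> 1")
        case True
        hence kin: "k \<in> {0..1/F}" using k0 F by (simp add: field_simps)
        have "k * norm x \<le> k * (R + F)" using x k0 by (intro mult_left_mono) (auto simp: F_def)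
        also have "\<dots> \<le> 1 + R"
        proof -
          have "k * R \<le> 1 * R" using k0 R by (intro mult_right_mono) auto
          thus ?thesis using True by (simp add: distrib_left)
        qed
        finally have kx: "k * norm x \<le> 1 + R" .
        have "eigf k x \<le> CF * (1 + k * norm x) powr (-m) * exp (k * norm x)" using CF(2) k0 by simp
        also have "\<dots> \<le> CF * 1 * exp (1 + R)"
          using CF kx k0 m0 powr_mono2'[of "-m" 1 "1 + k * norm x"] by (intro mult_mono) auto
        finally have e: "eigf k x \<le> CF * exp (1 + R)" by simp
        have "k powr \<beta> * (macdonald_sum \<gamma> (k * F) * eigf k x) \<le> k powr \<beta> * ((C1 * (k * F) powr (-g')) * (CF * exp (1 + R)))"
          using C1 e kF by (intro mult_left_mono mult_mono) auto
        also have "\<dots> = D1 * (k powr \<beta> * (k * F) powr (-g'))" by (simp add: D1_def)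
        also have "k powr \<beta> * (k * F) powr (-g') = F powr (-g') * k powr (\<beta> - g')"
          using k0 by (simp add: powr_mult powr_diff powr_minus field_simps)
        finally have "k powr \<beta> * (macdonald_sum \<gamma> (k * F) * eigf k x) \<le> D1 * F powr (-g') * (k powr (\<beta> - g') * indicator {0..1/F} k)"
          using kin by simp
        moreover have "0 \<le> D2 * F powr (1/2-m) * (k powr (-1/p) * exp (- (\<zeta>/2) * k))" using D12 by simp
        ultimately show ?thesis by linarith
      next
        case False
        have "macdonald_sum \<gamma> (k * F) * eigf k x \<le> C2 * (k * F) powr (1/2 - m) * exp (- k * (F - norm x) / 2)"
          using False x by (intro C2(2) k0 F) (auto simp: F_def)
        \<comment> \<open>Passing from F - |x|, which may be negative, to \<zeta> >= 1 costs only a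
          constant since k <= 1.\<close>
        also have "exp (- k * (F - norm x) / 2) = exp (k * (R+1)/2) * exp (- (\<zeta>/2) * k)"
          unfolding \<zeta>_def by (simp add: exp_add[symmetric] algebra_simps add_divide_distrib diff_divide_distrib)
        also have "C2 * (k * F) powr (1/2 - m) * (exp (k * (R+1)/2) * exp (- (\<zeta>/2) * k))
           \<le> C2 * (k * F) powr (1/2 - m) * (exp ((R+1)/2) * exp (- (\<zeta>/2) * k))"
        proof -
          have "k * (R+1) \<le> 1 * (R+1)" using k0 R by (intro mult_right_mono) auto
          thus ?thesis using C2 by (intro mult_left_mono mult_right_mono) auto
        qed
        finally have "k powr \<beta> * (macdonald_sum \<gamma> (k * F) * eigf k x)
           \<le> k powr \<beta> * (C2 * (k * F) powr (1/2 - m) * (exp ((R+1)/2) * exp (- (\<zeta>/2) * k)))"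
          by (intro mult_left_mono) auto
        also have "\<dots> = D2 * ((k powr \<beta> * (k * F) powr (1/2 - m)) * exp (- (\<zeta>/2) * k))" by (simp add: D2_def)
        also have "k powr \<beta> * (k * F) powr (1/2 - m) = F powr (1/2-m) * k powr (-1/p)"
        proof -
          \<comment> \<open>The value of \<beta> is chosen for this exponent: the integral over k
            then has the power 1/p - 1, whose product with the conjugate exponent is -1.\<close>
          have "k powr \<beta> * k powr (1/2 - m) = k powr (-1/p)" unfolding powr_add[symmetric] \<beta> by simp
          thus ?thesis by (simp add: powr_mult mult_ac)
        qed
        finally have "k powr \<beta> * (macdonald_sum \<gamma> (k * F) * eigf k x) \<le> D2 * F powr (1/2-m) * (k powr (-1/p) * exp (- (\<zeta>/2) * k))"
          by (simp add: mult_ac)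
        moreover have "0 \<le> D1 * F powr (-g') * (k powr (\<beta> - g') * indicator {0..1/F} k)" using D12 by (simp add: indicator_def)
        ultimately show ?thesis by linarith
      qed
      hence "D0 * P * (k powr \<beta> * (macdonald_sum \<gamma> (k * F) * eigf k x)) \<le> D0 * P *
         (D1 * F powr (-g') * (k powr (\<beta> - g') * indicator {0..1/F} k) + D2 * F powr (1/2-m) * (k powr (-1/p) * exp (- (\<zeta>/2) * k)))"
        using D0 P by (intro mult_left_mono) auto
      thus ?thesis using 1 by (simp add: mult_ac)
    qed
    let ?A = "D0 * P * D1 * F powr (-g')"
    let ?B = "D0 * P * D2 * F powr (1/2-m)"
    have A0: "?A \<ge> 0" and B0: "?B \<ge> 0" using D0 D12 P by auto
    have "(\<integral>\<^sup>+k. ennreal (k powr \<beta> * ((ysol l \<mu> \<gamma> k t + t * \<bar>ysol1 l \<mu> \<gamma> k t\<bar>) * eigf k x)) * indicator {0<..1} k \<partial>lborel)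
      \<le> (\<integral>\<^sup>+k. ennreal ?A * (ennreal (k powr (\<beta> - g')) * indicator {0..1/F} k)
            + ennreal ?B * (ennreal (k powr (-1/p) * exp (- (\<zeta>/2) * k)) * indicator {0..} k) \<partial>lborel)"
    proof (rule nn_integral_mono)
      fix k :: real
      show "ennreal (k powr \<beta> * ((ysol l \<mu> \<gamma> k t + t * \<bar>ysol1 l \<mu> \<gamma> k t\<bar>) * eigf k x)) * indicator {0<..1} k
        \<le> ennreal ?A * (ennreal (k powr (\<beta> - g')) * indicator {0..1/F} k)
            + ennreal ?B * (ennreal (k powr (-1/p) * exp (- (\<zeta>/2) * k)) * indicator {0..} k)"
      proof (cases "k \<in> {0<..1}")
        case True
        let ?a = "k powr (\<beta> - g') * indicator {0..1/F} k" and ?b = "k powr (-1/p) * exp (- (\<zeta>/2) * k)"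
        have "ennreal (k powr \<beta> * ((ysol l \<mu> \<gamma> k t + t * \<bar>ysol1 l \<mu> \<gamma> k t\<bar>) * eigf k x)) \<le> ennreal (?A * ?a + ?B * ?b)"
          using ptw[OF True] by (intro ennreal_leI) (simp add: algebra_simps)
        also have "\<dots> = ennreal ?A * ennreal ?a + ennreal ?B * ennreal ?b"
          using A0 B0 by (subst ennreal_plus) (auto simp: ennreal_mult indicator_def)
        also have "ennreal ?a = ennreal (k powr (\<beta> - g')) * indicator {0..1/F} k" by (simp add: indicator_def)
        finally show ?thesis using True by simp
      qed simp
    qed
    also have "\<dots> = ennreal ?A * (\<integral>\<^sup>+k. ennreal (k powr (\<beta> - g')) * indicator {0..1/F} k \<partial>lborel)
         + ennreal ?B * (\<integral>\<^sup>+k. ennreal (k powr (-1/p) * exp (- (\<zeta>/2) * k)) * indicator {0..} k \<partial>lborel)"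
      by (subst nn_integral_add, simp_all add: nn_integral_cmult)
    also have "\<dots> \<le> ennreal ?A * ennreal ((1/F) powr (\<beta> - g' + 1) / (\<beta> - g' + 1))
         + ennreal ?B * ennreal ((1 / (-1/p+1) - 1/(-1/p)) * (\<zeta>/2) powr (-(-1/p+1)))"
      using g' F pp \<zeta> p
      by (intro add_mono mult_left_mono nn_integral_powr_exp_le) (auto simp: nn_integral_powr_0)
    also have "\<dots> = ennreal (?A * ((1/F) powr (\<beta> - g' + 1) / (\<beta> - g' + 1)) + ?B * ((1 / (1 - 1/p) + p) * (\<zeta>/2) powr (1/p - 1)))"
    proof -
      have "0 \<le> (1/F) powr (\<beta> - g' + 1) / (\<beta> - g' + 1)" using g' by simp
      moreover have "0 \<le> (1 / (1 - 1/p) + p) * (\<zeta>/2) powr (1/p - 1)" using pp p by (intro mult_nonneg_nonneg add_nonneg_nonneg) auto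
      moreover have "(1 / (-1/p+1) - 1/(-1/p)) * (\<zeta>/2) powr (-(-1/p+1)) = (1 / (1 - 1/p) + p) * (\<zeta>/2) powr (1/p - 1)"
        using p by simp
      ultimately show ?thesis using A0 B0 by (simp only: ennreal_mult ennreal_plus mult_nonneg_nonneg)
    qed
    also have "?A * ((1/F) powr (\<beta> - g' + 1) / (\<beta> - g' + 1)) + ?B * ((1 / (1 - 1/p) + p) * (\<zeta>/2) powr (1/p - 1))
        \<le> C * t powr ((1-\<mu>)/2 + (l+1)*(1/2-m)) * \<zeta> powr (1/p - 1)"
    proof -
      have "F powr (-g') * (1/F) powr (\<beta> - g' + 1) = F powr (-\<beta>-1)"
      proof -
        have "(1/F) powr (\<beta> - g' + 1) = F powr (-(\<beta> - g' + 1))" by (simp only: powr_divide powr_minus_divide powr_one_eq_one)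
        thus ?thesis by (simp add: powr_add[symmetric])
      qed
      also have "\<dots> = F powr (1/2-m) * F powr (1/p-1)" unfolding powr_add[symmetric] \<beta> by (simp add: algebra_simps)
      also have "F powr (1/p-1) \<le> (\<zeta>/C3) powr (1/p-1)"
        using \<zeta>F \<zeta> C3 pp by (intro powr_mono2') (auto simp: field_simps)
      also have "(\<zeta>/C3) powr (1/p-1) = C3 powr (1-1/p) * \<zeta> powr (1/p-1)"
      proof -
        have "C3 powr (1-1/p) = 1 / C3 powr (1/p-1)" using powr_minus_divide[of C3 "1/p-1"] by simp
        thus ?thesis by (simp add: powr_divide)
      qed
      finally have 1: "F powr (-g') * (1/F) powr (\<beta> - g' + 1) \<le> F powr (1/2-m) * (C3 powr (1-1/p) * \<zeta> powr (1/p-1))"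
        by (simp add: mult_left_mono)
      have 2: "(\<zeta>/2) powr (1/p - 1) = 2 powr (1-1/p) * \<zeta> powr (1/p-1)"
      proof -
        have "(2::real) powr (1-1/p) = 1 / 2 powr (1/p-1)" using powr_minus_divide[of 2 "1/p-1"] by simp
        thus ?thesis by (simp add: powr_divide)
      qed
      have "?A * ((1/F) powr (\<beta> - g' + 1) / (\<beta> - g' + 1)) = D0 * P * D1 / (\<beta> - g' + 1) * (F powr (-g') * (1/F) powr (\<beta> - g' + 1))"
        by simp
      also have "\<dots> \<le> D0 * P * D1 / (\<beta> - g' + 1) * (F powr (1/2-m) * (C3 powr (1-1/p) * \<zeta> powr (1/p-1)))"
        using 1 D0 P D12 g' by (intro mult_left_mono) auto
      also have "\<dots> = D0 * P * F powr (1/2-m) * E1 * \<zeta> powr (1/p-1)" by (simp add: E1_def)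
      finally have 3: "?A * ((1/F) powr (\<beta> - g' + 1) / (\<beta> - g' + 1)) \<le> D0 * P * F powr (1/2-m) * E1 * \<zeta> powr (1/p-1)" .
      have 4: "?B * ((1 / (1 - 1/p) + p) * (\<zeta>/2) powr (1/p - 1)) = D0 * P * F powr (1/2-m) * E2 * \<zeta> powr (1/p-1)"
        unfolding 2 E2_def by simp
      have "?A * ((1/F) powr (\<beta> - g' + 1) / (\<beta> - g' + 1)) + ?B * ((1 / (1 - 1/p) + p) * (\<zeta>/2) powr (1/p - 1))
         \<le> D0 * P * F powr (1/2-m) * E1 * \<zeta> powr (1/p-1) + D0 * P * F powr (1/2-m) * E2 * \<zeta> powr (1/p-1)"
        using 3 4 by linarith
      also have "D0 * P * F powr (1/2-m) * E1 * \<zeta> powr (1/p-1) + D0 * P * F powr (1/2-m) * E2 * \<zeta> powr (1/p-1)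
         = D0 * (E1 + E2) * (P * F powr (1/2-m)) * \<zeta> powr (1/p-1)" by (simp add: algebra_simps)
      also have "P * F powr (1/2-m) = (l+1) powr (m-1/2) * t powr ((1-\<mu>)/2 + (l+1)*(1/2-m))"
      proof -
        have "F powr (1/2-m) = t powr ((l+1)*(1/2-m)) / (l+1) powr (1/2-m)" unfolding F_def powr_divide powr_powr ..
        also have "\<dots> = t powr ((l+1)*(1/2-m)) * (l+1) powr (m-1/2)"
          using powr_minus_divide[of "l+1" "1/2-m"] by simp
        finally show ?thesis unfolding P_def powr_add by simp
      qed
      also have "D0 * (E1 + E2) * ((l+1) powr (m-1/2) * t powr ((1-\<mu>)/2 + (l+1)*(1/2-m))) * \<zeta> powr (1/p-1)
         = C * t powr ((1-\<mu>)/2 + (l+1)*(1/2-m)) * \<zeta> powr (1/p - 1)" by (simp add: C_def mult_ac)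
      finally show ?thesis .
    qed
    finally show ?thesis unfolding \<zeta>_def F_def by (simp add: ennreal_leI)
  qed
  thus ?thesis using C by blast
qed

subsection \<open>Space-time integrals\<close>

lemma measurable_fst_borel [measurable]: "fst \<in> borel_measurable (borel :: ('a::euclidean_space \<times> 'b::euclidean_space) measure)"
  and measurable_snd_borel [measurable]: "snd \<in> borel_measurable (borel :: ('a \<times> 'b) measure)"
  by (intro borel_measurable_continuous_onI continuous_intros)+

lemma slab_borel [measurable]: "{a..b} \<times> UNIV \<in> sets (borel :: (real \<times> 'a::euclidean_space) measure)"
  by (intro borel_closed closed_Times) auto

lemma nn_integral_norm_le:
  fixes h :: "real \<Rightarrow> real" and \<rho> :: real
  assumes [measurable]: "h \<in> borel_measurable borel"
  shows "(\<integral>\<^sup>+x. ennreal (h (norm x)) * indicator {x. norm x \<le> \<rho>} x \<partial>(lborel :: 'a::euclidean_space measure))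
    \<le> ennreal (DIM('a) * unit_ball_vol DIM('a) * \<rho>^(DIM('a)-1)) * (\<integral>\<^sup>+r. ennreal (h r) * indicator {0..\<rho>} r \<partial>lborel)"
proof -
  let ?V = "DIM('a) * unit_ball_vol DIM('a)"
  have V: "?V \<ge> 0" by simp
  have "(\<integral>\<^sup>+x. ennreal (h (norm x)) * indicator {x. norm x \<le> \<rho>} x \<partial>(lborel :: 'a measure))
     = (\<integral>\<^sup>+x. (\<lambda>r. ennreal (h r) * indicator {..\<rho>} r) (norm x) \<partial>(lborel :: 'a measure))"
    by (intro nn_integral_cong) (auto simp: indicator_def)
  also have "\<dots> = (\<integral>\<^sup>+r. ennreal (?V * r^(DIM('a)-1)) * (ennreal (h r) * indicator {..\<rho>} r) * indicator {0..} r \<partial>lborel)"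
    by (subst nn_integral_radial) auto
  also have "\<dots> \<le> (\<integral>\<^sup>+r. ennreal (?V * \<rho>^(DIM('a)-1)) * (ennreal (h r) * indicator {0..\<rho>} r) \<partial>lborel)"
  proof (rule nn_integral_mono)
    fix r :: real
    show "ennreal (?V * r^(DIM('a)-1)) * (ennreal (h r) * indicator {..\<rho>} r) * indicator {0..} r
      \<le> ennreal (?V * \<rho>^(DIM('a)-1)) * (ennreal (h r) * indicator {0..\<rho>} r)"
      by (cases "r \<in> {0..\<rho>}") (auto simp: indicator_def intro!: mult_right_mono ennreal_leI mult_left_mono power_mono)
  qed
  also have "\<dots> = ennreal (?V * \<rho>^(DIM('a)-1)) * (\<integral>\<^sup>+r. ennreal (h r) * indicator {0..\<rho>} r \<partial>lborel)"
    by (rule nn_integral_cmult) auto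
  finally show ?thesis .
qed

text \<open>The power -1 is the borderline case that produces a logarithm. Since \<rho> is
  comparable to a power of t, it is linear in ln t and becomes the factor 1 + \<sigma>' of the
  iteration.\<close>

lemma nn_integral_cone_log:
  assumes \<rho>: "\<rho> > 0"
  shows "(\<integral>\<^sup>+x. ennreal ((\<rho> - norm x + 1) powr (-1)) * indicator {x. norm x \<le> \<rho>} x \<partial>(lborel :: 'a::euclidean_space measure))
    \<le> ennreal (DIM('a) * unit_ball_vol DIM('a) * \<rho>^(DIM('a)-1) * ln (\<rho> + 1))"
proof -
  have "(\<integral>\<^sup>+r. ennreal ((\<rho> - r + 1) powr (-1)) * indicator {0..\<rho>} r \<partial>lborel)
      = (\<integral>\<^sup>+r. ennreal (1 / (\<rho> - r + 1)) * indicator {0..\<rho>} r \<partial>lborel)"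
    by (intro nn_integral_cong) (auto simp: indicator_def powr_minus_divide)
  also have "\<dots> = ennreal (- ln (\<rho> - \<rho> + 1) - (- ln (\<rho> - 0 + 1)))"
    using \<rho> by (intro nn_integral_FTC_Icc) (auto intro!: derivative_eq_intros simp: divide_simps)
  finally have "(\<integral>\<^sup>+r. ennreal ((\<rho> - r + 1) powr (-1)) * indicator {0..\<rho>} r \<partial>lborel) = ennreal (ln (\<rho> + 1))" by simp
  moreover have "(\<integral>\<^sup>+x. ennreal ((\<lambda>r. (\<rho> - r + 1) powr (-1)) (norm x)) * indicator {x. norm x \<le> \<rho>} x \<partial>(lborel :: 'a measure))
    \<le> ennreal (DIM('a) * unit_ball_vol DIM('a) * \<rho>^(DIM('a)-1)) * (\<integral>\<^sup>+r. ennreal ((\<rho> - r + 1) powr (-1)) * indicator {0..\<rho>} r \<partial>lborel)"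
    by (rule nn_integral_norm_le) measurable
  ultimately show ?thesis using \<rho> by (simp add: ennreal_mult)
qed

text \<open>Counterpart for a single frequency: a weight concentrated near the cone loses one power
  of the radius compared with the volume of the ball, without a logarithm.\<close>

lemma nn_integral_cone_exp:
  assumes F: "F > 0" and R: "R \<ge> 0" and q: "q > 0"
  shows "(\<integral>\<^sup>+x. ennreal (exp (- q * (F - norm x))) * indicator {x. norm x \<le> R + F} x \<partial>(lborel :: 'a::euclidean_space measure))
    \<le> ennreal (DIM('a) * unit_ball_vol DIM('a) * (R + F)^(DIM('a)-1) * (exp (q * R) / q))"
proof -
  have "(\<integral>\<^sup>+r. ennreal (exp (- q * (F - r))) * indicator {0..R + F} r \<partial>lborel)
      = ennreal (exp (- q * (F - (R + F))) / q - exp (- q * (F - 0)) / q)"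
    using F R q by (intro nn_integral_FTC_Icc) (auto intro!: derivative_eq_intros)
  also have "\<dots> \<le> ennreal (exp (q * R) / q)" using q by (intro ennreal_leI) simp
  finally have 1: "(\<integral>\<^sup>+r. ennreal (exp (- q * (F - r))) * indicator {0..R + F} r \<partial>lborel) \<le> ennreal (exp (q * R) / q)" .
  have "(\<integral>\<^sup>+x. ennreal ((\<lambda>r. exp (- q * (F - r))) (norm x)) * indicator {x. norm x \<le> R + F} x \<partial>(lborel :: 'a measure))
    \<le> ennreal (DIM('a) * unit_ball_vol DIM('a) * (R + F)^(DIM('a)-1)) * (\<integral>\<^sup>+r. ennreal (exp (- q * (F - r))) * indicator {0..R + F} r \<partial>lborel)"
    by (rule nn_integral_norm_le) measurable
  also have "\<dots> \<le> ennreal (DIM('a) * unit_ball_vol DIM('a) * (R + F)^(DIM('a)-1)) * ennreal (exp (q * R) / q)"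
    by (intro mult_left_mono 1) simp
  also have "\<dots> = ennreal (DIM('a) * unit_ball_vol DIM('a) * (R + F)^(DIM('a)-1) * (exp (q * R) / q))"
    using F R q by (intro ennreal_mult[symmetric]) auto
  finally show ?thesis by simp
qed

text \<open>Spatial integrals of order 1/t make the space-time integral proportional to the
  logarithmic length of the time interval.\<close>

lemma nn_integral_slab_le:
  fixes H :: "real \<times> 'a::euclidean_space \<Rightarrow> ennreal"
  assumes [measurable]: "H \<in> borel_measurable borel"
    and t: "1 \<le> t1" "t1 \<le> t2" and B: "B \<ge> 0"
    and le: "\<And>t. t \<in> {t1..t2} \<Longrightarrow> (\<integral>\<^sup>+x. H (t, x) \<partial>lborel) \<le> ennreal (B / t)"
  shows "(\<integral>\<^sup>+z. H z * indicator ({t1..t2} \<times> UNIV) z \<partial>lborel) \<le> ennreal (B * (ln t2 - ln t1))"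
proof -
  have "(\<integral>\<^sup>+z. H z * indicator ({t1..t2} \<times> UNIV) z \<partial>lborel)
     = (\<integral>\<^sup>+z. H z * indicator ({t1..t2} \<times> UNIV) z \<partial>(lborel \<Otimes>\<^sub>M lborel))" by (simp add: lborel_prod)
  also have "\<dots> = (\<integral>\<^sup>+t. \<integral>\<^sup>+x. H (t, x) * indicator ({t1..t2} \<times> UNIV) (t, x) \<partial>lborel \<partial>lborel)"
    by (subst lborel.nn_integral_fst[symmetric]) (auto simp: lborel_prod)
  also have "\<dots> \<le> (\<integral>\<^sup>+t. ennreal (B / t) * indicator {t1..t2} t \<partial>lborel)"
  proof (rule nn_integral_mono)
    fix t :: real
    show "(\<integral>\<^sup>+x. H (t, x) * indicator ({t1..t2} \<times> UNIV) (t, x) \<partial>lborel) \<le> ennreal (B / t) * indicator {t1..t2} t"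
      using le[of t] by (cases "t \<in> {t1..t2}") auto
  qed
  also have "\<dots> = ennreal (B * ln t2 - B * ln t1)"
    using t B by (intro nn_integral_FTC_Icc) (auto intro!: derivative_eq_intros)
  finally show ?thesis by (simp add: right_diff_distrib)
qed

context damped_wave
begin

definition mass :: "real \<Rightarrow> real" where "mass t = (LINT x|lborel. \<bar>u t x\<bar> powr p)"

definition Y :: "real \<Rightarrow> real \<Rightarrow> real" where "Y \<theta> t = integral {1..t} (\<lambda>s. s powr \<theta> * mass s)"

text \<open>Extension by zero beyond the time interval: u is arbitrary there, whereas
  \<open>um\<close> is Borel on all of space-time, as the interchange of integrals requires.\<close>

definition um :: "real \<times> (real^'n) \<Rightarrow> real" where "um z = indicator (I \<times> UNIV) z * \<bar>u (fst z) (snd z)\<bar>"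

lemma um_measurable [measurable]: "um \<in> borel_measurable borel"
proof -
  have "I = {1..} \<inter> {t. ereal t < T}" by (auto simp: time_interval_def)
  moreover have "open {t. ereal t < T}" by (intro open_Collect_less continuous_intros)
  ultimately have "I \<in> sets borel" by simp
  hence "I \<times> UNIV \<in> sets (borel :: (real \<times> (real^'n)) measure)"
    unfolding borel_prod[symmetric] by (intro pair_measureI) auto
  moreover have "continuous_on (I \<times> UNIV) (\<lambda>z. \<bar>u (fst z) (snd z)\<bar>)"
    by (intro continuous_intros cont_comp) auto
  ultimately have "(\<lambda>z. indicator (I \<times> UNIV) z *\<^sub>R \<bar>u (fst z) (snd z)\<bar>) \<in> borel_measurable borel"
    by (rule borel_measurable_continuous_on_indicator)
  thus ?thesis unfolding um_def[abs_def] by simp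
qed

lemma um_nonneg [simp]: "um z \<ge> 0" by (simp add: um_def indicator_def)

lemma um_eq: "t \<in> I \<Longrightarrow> um (t, x) = \<bar>u t x\<bar>" by (simp add: um_def)

lemma um_outside: "norm (snd z) > R + \<phi> (fst z) \<Longrightarrow> um z = 0"
proof (cases "fst z \<in> I")
  case True
  assume "norm (snd z) > R + \<phi> (fst z)"
  moreover have "\<phi> 1 \<ge> 0" using l by (simp add: \<phi>_def)
  ultimately have "u (fst z) (snd z) = 0" using finite_speed[OF True] by simp
  thus ?thesis by (simp add: um_def)
qed (simp add: um_def indicator_def mem_Times_iff)

lemma nn_integral_slab:
  fixes F :: "real \<Rightarrow> real^'n \<Rightarrow> real"
  assumes cF: "continuous_on ({a..b} \<times> UNIV) (\<lambda>(t, x). F t x)"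
    and F0: "\<And>t x. t \<in> {a..b} \<Longrightarrow> F t x \<ge> 0" and out: "\<And>t x. t \<in> {a..b} \<Longrightarrow> x \<notin> cbox c d \<Longrightarrow> F t x = 0"
  shows "(\<integral>\<^sup>+z. ennreal (F (fst z) (snd z)) * indicator ({a..b} \<times> UNIV) z \<partial>lborel)
     = ennreal (integral {a..b} (\<lambda>t. integral (cbox c d) (F t)))"
proof -
  have "(\<lambda>z. indicator ({a..b} \<times> UNIV) z *\<^sub>R F (fst z) (snd z)) \<in> borel_measurable borel"
    by (rule borel_measurable_continuous_on_indicator[OF slab_borel]) (use cF in \<open>simp add: split_beta'\<close>)
  hence "(\<lambda>z. ennreal (indicator ({a..b} \<times> UNIV) z *\<^sub>R F (fst z) (snd z))) \<in> borel_measurable borel" by measurable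
  moreover have "(\<lambda>z. ennreal (indicator ({a..b} \<times> UNIV) z *\<^sub>R F (fst z) (snd z)))
     = (\<lambda>z. ennreal (F (fst z) (snd z)) * indicator ({a..b} \<times> UNIV) z)"
    by (auto simp: indicator_def)
  ultimately have m: "(\<lambda>z. ennreal (F (fst z) (snd z)) * indicator ({a..b} \<times> UNIV) z) \<in> borel_measurable (lborel \<Otimes>\<^sub>M lborel)"
    by (simp add: lborel_prod)
  have Ft: "continuous_on S (F t)" if "t \<in> {a..b}" for t S
  proof -
    have "continuous_on S (\<lambda>x. (\<lambda>(t, x). F t x) (t, x))"
      by (rule continuous_on_compose2[OF cF]) (use that in \<open>auto intro!: continuous_intros\<close>)
    thus ?thesis by simp
  qed
  have inner: "(\<integral>\<^sup>+x. ennreal (F t x) \<partial>lborel) = ennreal (integral (cbox c d) (F t))" if t: "t \<in> {a..b}" for t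
  proof -
    have "(\<integral>\<^sup>+x. ennreal (F t x) \<partial>lborel) = (\<integral>\<^sup>+x. ennreal (F t x) * indicator (cbox c d) x \<partial>lborel)"
      using out[OF t] by (intro nn_integral_cong) (auto simp: indicator_def)
    also have "\<dots> = ennreal (integral (cbox c d) (F t))"
      by (intro nn_integral_has_integral_lebesgue' integrable_integral integrable_continuous Ft t F0)
    finally show ?thesis .
  qed
  have cI: "continuous_on {a..b} (\<lambda>t. integral (cbox c d) (F t))"
    by (rule integral_continuous_on_param) (use cF in \<open>auto elim: continuous_on_subset\<close>)
  have "(\<integral>\<^sup>+z. ennreal (F (fst z) (snd z)) * indicator ({a..b} \<times> UNIV) z \<partial>lborel)
     = (\<integral>\<^sup>+z. ennreal (F (fst z) (snd z)) * indicator ({a..b} \<times> UNIV) z \<partial>(lborel \<Otimes>\<^sub>M lborel))" by (simp add: lborel_prod)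
  also have "\<dots> = (\<integral>\<^sup>+t. \<integral>\<^sup>+x. ennreal (F t x) * indicator ({a..b} \<times> UNIV) (t, x) \<partial>lborel \<partial>lborel)"
    by (subst lborel.nn_integral_fst[OF m, symmetric]) simp
  also have "\<dots> = (\<integral>\<^sup>+t. ennreal (integral (cbox c d) (F t)) * indicator {a..b} t \<partial>lborel)"
  proof (rule nn_integral_cong)
    fix t :: real
    show "(\<integral>\<^sup>+x. ennreal (F t x) * indicator ({a..b} \<times> UNIV) (t, x) \<partial>lborel) = ennreal (integral (cbox c d) (F t)) * indicator {a..b} t"
      using inner[of t] by (cases "t \<in> {a..b}") auto
  qed
  also have "\<dots> = ennreal (integral {a..b} (\<lambda>t. integral (cbox c d) (F t)))"
    by (intro nn_integral_has_integral_lebesgue' integrable_integral integrable_continuous_real cI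
        integral_nonneg integrable_continuous Ft F0)
  finally show ?thesis .
qed

lemma support_cbox:
  assumes "t2 \<in> I"
  shows "\<exists>a c. cball (0::real^'n) (R + \<phi> t2 - \<phi> 1) \<subseteq> cbox a c \<and>
    (\<forall>t\<in>{1..t2}. \<forall>x. x \<notin> cbox a c \<longrightarrow> u t x = 0)"
proof -
  obtain a where a: "cball (0::real^'n) (R + \<phi> t2 - \<phi> 1) \<subseteq> cbox (-a) a"
    using bounded_subset_cbox_symmetric[OF bounded_cball[of 0 "R + \<phi> t2 - \<phi> 1"]] by metis
  have "u t x = 0" if "t \<in> {1..t2}" "x \<notin> cbox (-a) a" for t x
    using outside_zero(1)[OF assms, of t x] a that by (force simp: subset_iff)
  with a show ?thesis by blast
qed

lemma cont_u_slab: "t2 \<in> I \<Longrightarrow> continuous_on ({1..t2} \<times> UNIV) (\<lambda>(t, x). u t x)"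
  by (rule continuous_on_subset[OF cont(1)]) (auto intro: I_down)

lemma nn_integral_Y:
  assumes t2: "t2 \<in> I" and t1: "1 \<le> t1" "t1 \<le> t2"
  shows "(\<integral>\<^sup>+z. ennreal (fst z powr \<theta> * um z powr p) * indicator ({t1..t2} \<times> UNIV) z \<partial>lborel) = ennreal (Y \<theta> t2 - Y \<theta> t1)"
    and "Y \<theta> t1 \<le> Y \<theta> t2" "Y \<theta> 1 = 0"
proof -
  obtain a c where ac: "\<And>t x. t \<in> {1..t2} \<Longrightarrow> x \<notin> cbox a c \<Longrightarrow> u t x = 0"
    using support_cbox[OF t2] by blast
  let ?F = "\<lambda>t x. t powr \<theta> * \<bar>u t x\<bar> powr p"
  have cu: "continuous_on ({1..t2} \<times> UNIV) (\<lambda>z. u (fst z) (snd z))" using cont_u_slab[OF t2] by (simp add: split_beta')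
  have cF: "continuous_on ({1..t2} \<times> UNIV) (\<lambda>(t, x). ?F t x)"
    unfolding split_beta' using p by (intro continuous_intros continuous_on_powr' cu) auto
  have mass: "integral (cbox a c) (?F t) = t powr \<theta> * mass t" if t: "t \<in> {1..t2}" for t
  proof -
    have "t \<in> I" using I_down[OF t2] t by auto
    hence c: "continuous_on UNIV (\<lambda>x. \<bar>u t x\<bar> powr p)"
      using p by (intro continuous_intros continuous_on_powr' cont_slice) auto
    have "integral (cbox a c) (\<lambda>x. \<bar>u t x\<bar> powr p) = mass t"
      unfolding mass_def by (rule integral_cbox_compact_support[OF c]) (use ac t in simp)
    thus ?thesis by simp
  qed
  have m0: "mass t \<ge> 0" for t unfolding mass_def by (intro Bochner_Integration.integral_nonneg) simp
  have int: "(\<lambda>s. s powr \<theta> * mass s) integrable_on {1..t2}"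
  proof -
    have "continuous_on {1..t2} (\<lambda>t. integral (cbox a c) (?F t))"
      by (rule integral_continuous_on_param) (use cF in \<open>auto elim: continuous_on_subset\<close>)
    hence "continuous_on {1..t2} (\<lambda>s. s powr \<theta> * mass s)" by (rule continuous_on_eq) (rule mass)
    thus ?thesis by (rule integrable_continuous_real)
  qed
  have diff: "Y \<theta> t2 - Y \<theta> t1 = integral {t1..t2} (\<lambda>s. s powr \<theta> * mass s)"
    unfolding Y_def using Henstock_Kurzweil_Integration.integral_combine[OF t1 int] by simp
  have "(\<integral>\<^sup>+z. ennreal (fst z powr \<theta> * um z powr p) * indicator ({t1..t2} \<times> UNIV) z \<partial>lborel)
     = (\<integral>\<^sup>+z. ennreal (?F (fst z) (snd z)) * indicator ({t1..t2} \<times> UNIV) z \<partial>lborel)"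
  proof (rule nn_integral_cong)
    fix z :: "real \<times> (real^'n)"
    show "ennreal (fst z powr \<theta> * um z powr p) * indicator ({t1..t2} \<times> UNIV) z = ennreal (?F (fst z) (snd z)) * indicator ({t1..t2} \<times> UNIV) z"
      using I_down[OF t2, of "fst z"] t1 um_eq[of "fst z" "snd z"] by (auto simp: indicator_def)
  qed
  also have "\<dots> = ennreal (integral {t1..t2} (\<lambda>t. integral (cbox a c) (?F t)))"
  proof (rule nn_integral_slab)
    show "continuous_on ({t1..t2} \<times> UNIV) (\<lambda>(t, x). ?F t x)" by (rule continuous_on_subset[OF cF]) (use t1 in auto)
  qed (use ac t1 p in auto)
  also have "integral {t1..t2} (\<lambda>t. integral (cbox a c) (?F t)) = Y \<theta> t2 - Y \<theta> t1"
    unfolding diff using mass t1 by (intro integral_cong) auto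
  finally show "(\<integral>\<^sup>+z. ennreal (fst z powr \<theta> * um z powr p) * indicator ({t1..t2} \<times> UNIV) z \<partial>lborel) = ennreal (Y \<theta> t2 - Y \<theta> t1)" .
  have "0 \<le> integral {t1..t2} (\<lambda>s. s powr \<theta> * mass s)"
    using integrable_subinterval_real[OF int, of t1 t2] t1 m0 by (intro integral_nonneg) auto
  thus "Y \<theta> t1 \<le> Y \<theta> t2" using diff by simp
  show "Y \<theta> 1 = 0" by (simp add: Y_def)
qed

text \<open>Form of \<open>weak_inequality\<close> with nonnegative integrals, so that it can be
  integrated over frequencies without checking integrability.\<close>

lemma nn_integral_weak:
  assumes t2: "t2 \<in> I" and t1: "1 \<le> t1" "t1 < t2"
    and y: "\<And>t. t \<ge> 1 \<Longrightarrow> (y has_real_derivative y' t) (at t)"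
    and y': "\<And>t. t \<ge> 1 \<Longrightarrow> (y' has_real_derivative - \<mu> / t * y' t - (nu2 / t^2 - k^2 * t powr (2*l)) * y t) (at t)"
    and y0: "\<And>t. t \<ge> 1 \<Longrightarrow> y t \<ge> 0" and \<kappa>: "- y' 1 \<ge> \<kappa> * y 1"
    and data: "\<And>x. f x \<ge> 0" "\<And>x. g x + \<kappa> * f x \<ge> 0"
  defines "d \<equiv> ln t2 - ln t1"
  shows "ennreal (y 1 * (LINT x|lborel. g x + \<kappa> * f x))
      + (\<integral>\<^sup>+z. ennreal (fst z powr \<mu> * y (fst z) * um z powr p) * indicator ({1..t1} \<times> UNIV) z \<partial>lborel)
    \<le> ennreal (6 * (\<bar>\<mu>\<bar> + 2) * (1/d + 1/d^2)) *
       (\<integral>\<^sup>+z. ennreal (um z * (fst z powr (\<mu>-2) * (y (fst z) + fst z * \<bar>y' (fst z)\<bar>) * eigf k (snd z))) * indicator ({t1..t2} \<times> UNIV) z \<partial>lborel)"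
proof -
  obtain a c where ac: "cball 0 (R + \<phi> t2 - \<phi> 1) \<subseteq> cbox a c" "\<And>t x. t \<in> {1..t2} \<Longrightarrow> x \<notin> cbox a c \<Longrightarrow> u t x = 0"
    using support_cbox[OF t2] by blast
  have d: "d > 0" unfolding d_def using t1 by simp
  let ?D = "LINT x|lborel. g x + \<kappa> * f x"
  let ?F = "\<lambda>t x. t powr \<mu> * y t * (\<bar>u t x\<bar> powr p * eigf k x)"
  let ?G = "\<lambda>t x. t powr (\<mu>-2) * (y t + t * \<bar>y' t\<bar>) * (\<bar>u t x\<bar> * eigf k x)"
  have cu: "continuous_on ({1..t2} \<times> UNIV) (\<lambda>z. u (fst z) (snd z))" using cont_u_slab[OF t2] by (simp add: split_beta')
  have cy: "continuous_on S (\<lambda>z. y (fst z))" "continuous_on S (\<lambda>z. y' (fst z))" if "S \<subseteq> {1..} \<times> UNIV" for S :: "(real \<times> (real^'n)) set"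
  proof -
    have "continuous_on {1..} y" "continuous_on {1..} y'"
      using y y' by (auto intro!: continuous_at_imp_continuous_on DERIV_isCont)
    thus "continuous_on S (\<lambda>z. y (fst z))" "continuous_on S (\<lambda>z. y' (fst z))"
      using that by (auto intro!: continuous_on_compose2[where f=fst and s=S] continuous_intros)
  qed
  have ce: "continuous_on S (\<lambda>z. eigf k (snd z))" for S :: "(real \<times> (real^'n)) set"
    by (rule continuous_on_compose2[OF continuous_eigf(2)[of UNIV k]]) (auto intro!: continuous_intros)
  have cF: "continuous_on ({1..t2} \<times> UNIV) (\<lambda>(t, x). ?F t x)"
    unfolding split_beta' using p by (intro continuous_intros continuous_on_powr' cu cy ce) auto
  have cG: "continuous_on ({1..t2} \<times> UNIV) (\<lambda>(t, x). ?G t x)"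
    unfolding split_beta' using p by (intro continuous_intros cu cy ce) auto
  have ineq: "integral (cbox a c) (\<lambda>x. (g x * y 1 - f x * y' 1) * eigf k x)
      + integral {1..t1} (\<lambda>t. integral (cbox a c) (?F t))
    \<le> 6 * (\<bar>\<mu>\<bar> + 2) * (1/d + 1/d^2) * integral {t1..t2} (\<lambda>t. integral (cbox a c) (?G t))"
    using weak_inequality[OF t2 t1 ac(1) y y' y0] unfolding d_def by simp
  have y1: "y 1 \<ge> 0" using y0[of 1] by simp
  have data_le: "y 1 * ?D \<le> integral (cbox a c) (\<lambda>x. (g x * y 1 - f x * y' 1) * eigf k x)"
  proof -
    have cfg: "continuous_on UNIV (\<lambda>x. g x + \<kappa> * f x)" by (intro continuous_intros cont_data)
    have "x \<notin> cbox a c \<Longrightarrow> R \<le> norm x" for x using ac(1) \<phi>_mono[of 1 t2] t1 by (force simp: subset_iff)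
    hence "integral (cbox a c) (\<lambda>x. g x + \<kappa> * f x) = ?D"
      by (intro integral_cbox_compact_support[OF cfg]) (simp add: data_supp)
    hence "y 1 * ?D = integral (cbox a c) (\<lambda>x. y 1 * (g x + \<kappa> * f x))" by simp
    also have "\<dots> \<le> integral (cbox a c) (\<lambda>x. (g x * y 1 - f x * y' 1) * eigf k x)"
    proof (rule integral_le)
      show "(\<lambda>x. y 1 * (g x + \<kappa> * f x)) integrable_on cbox a c"
        by (intro integrable_continuous continuous_intros continuous_on_subset[OF cont_data(1)] continuous_on_subset[OF cont_data(2)]) auto
      show "(\<lambda>x. (g x * y 1 - f x * y' 1) * eigf k x) integrable_on cbox a c"
        by (intro integrable_continuous continuous_intros continuous_on_subset[OF cont_data(1)] continuous_on_subset[OF cont_data(2)] continuous_eigf) auto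
      fix x
      \<comment> \<open>The boundary term g y(1) - f y'(1) is thereby at least y(1) (g + \<kappa>
        f), which is nonnegative, so that \<Phi> >= 1 may be used pointwise.\<close>
      have "f x * (\<kappa> * y 1) \<le> f x * (- y' 1)" using \<kappa> data(1) by (intro mult_left_mono) auto
      hence "y 1 * (g x + \<kappa> * f x) \<le> g x * y 1 - f x * y' 1" by (simp add: algebra_simps)
      also have "\<dots> \<le> (g x * y 1 - f x * y' 1) * eigf k x"
      proof -
        have "0 \<le> y 1 * (g x + \<kappa> * f x)" using y1 data(2) by (intro mult_nonneg_nonneg) auto
        hence "0 \<le> g x * y 1 - f x * y' 1" using \<open>y 1 * (g x + \<kappa> * f x) \<le> g x * y 1 - f x * y' 1\<close> by linarith
        thus ?thesis using mult_left_mono[OF eigf_ge_1[of k x]] by fastforce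
      qed
      finally show "y 1 * (g x + \<kappa> * f x) \<le> (g x * y 1 - f x * y' 1) * eigf k x" .
    qed
    finally show ?thesis .
  qed
  have umI: "um z = \<bar>u (fst z) (snd z)\<bar>" if "fst z \<in> {1..t2}" for z
    using um_eq[of "fst z" "snd z"] I_down[OF t2, of "fst z"] that by simp
  have F0: "0 \<le> ?F t x" if "t \<ge> 1" for t x using y0[OF that] by simp
  have D0: "0 \<le> y 1 * ?D" using y1 data by (intro mult_nonneg_nonneg Bochner_Integration.integral_nonneg) auto
  have IF0: "0 \<le> integral {1..t1} (\<lambda>t. integral (cbox a c) (?F t))"
  proof -
    have sub: "{1..t1} \<subseteq> {1..t2}" using t1 by auto
    have c1: "continuous_on ({1..t1} \<times> cbox a c) (\<lambda>(t, x). ?F t x)"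
      by (rule continuous_on_subset[OF cF]) (use sub in auto)
    have "continuous_on (cbox a c) (?F t)" if "t \<in> {1..t1}" for t
    proof -
      have "continuous_on (cbox a c) (\<lambda>x. (\<lambda>(t, x). ?F t x) (t, x))"
        by (rule continuous_on_compose2[OF c1]) (use that in \<open>auto intro!: continuous_intros\<close>)
      thus ?thesis by simp
    qed
    moreover have "continuous_on {1..t1} (\<lambda>t. integral (cbox a c) (?F t))"
      by (rule integral_continuous_on_param[OF c1])
    ultimately show ?thesis
      by (intro integral_nonneg integrable_continuous_real integrable_continuous) (auto simp: F0)
  qed
  have "(\<integral>\<^sup>+z. ennreal (fst z powr \<mu> * y (fst z) * um z powr p) * indicator ({1..t1} \<times> UNIV) z \<partial>lborel)
     \<le> (\<integral>\<^sup>+z. ennreal (?F (fst z) (snd z)) * indicator ({1..t1} \<times> UNIV) z \<partial>lborel)"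
  proof (rule nn_integral_mono)
    fix z :: "real \<times> (real^'n)"
    show "ennreal (fst z powr \<mu> * y (fst z) * um z powr p) * indicator ({1..t1} \<times> UNIV) z \<le> ennreal (?F (fst z) (snd z)) * indicator ({1..t1} \<times> UNIV) z"
    proof (cases "fst z \<in> {1..t1}")
      case True
      hence "um z = \<bar>u (fst z) (snd z)\<bar>" using t1 by (intro umI) auto
      moreover have "fst z powr \<mu> * y (fst z) * \<bar>u (fst z) (snd z)\<bar> powr p * 1 \<le> fst z powr \<mu> * y (fst z) * \<bar>u (fst z) (snd z)\<bar> powr p * eigf k (snd z)"
        using y0[of "fst z"] True by (intro mult_left_mono eigf_ge_1) auto
      ultimately show ?thesis by (auto simp: indicator_def mult.assoc intro!: ennreal_leI)
    qed (auto simp: indicator_def)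
  qed
  also have "\<dots> = ennreal (integral {1..t1} (\<lambda>t. integral (cbox a c) (?F t)))"
  proof (rule nn_integral_slab)
    show "continuous_on ({1..t1} \<times> UNIV) (\<lambda>(t, x). ?F t x)" by (rule continuous_on_subset[OF cF]) (use t1 in auto)
  qed (use ac(2) t1 F0 p in auto)
  finally have "ennreal (y 1 * ?D) + (\<integral>\<^sup>+z. ennreal (fst z powr \<mu> * y (fst z) * um z powr p) * indicator ({1..t1} \<times> UNIV) z \<partial>lborel)
     \<le> ennreal (y 1 * ?D) + ennreal (integral {1..t1} (\<lambda>t. integral (cbox a c) (?F t)))" by (intro add_left_mono)
  also have "\<dots> = ennreal (y 1 * ?D + integral {1..t1} (\<lambda>t. integral (cbox a c) (?F t)))"
    using D0 IF0 by (intro ennreal_plus[symmetric])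
  also have "\<dots> \<le> ennreal (6 * (\<bar>\<mu>\<bar> + 2) * (1/d + 1/d^2) * integral {t1..t2} (\<lambda>t. integral (cbox a c) (?G t)))"
    using ineq data_le by (intro ennreal_leI) linarith
  also have "\<dots> = ennreal (6 * (\<bar>\<mu>\<bar> + 2) * (1/d + 1/d^2)) * ennreal (integral {t1..t2} (\<lambda>t. integral (cbox a c) (?G t)))"
    using d by (intro ennreal_mult') auto
  also have "ennreal (integral {t1..t2} (\<lambda>t. integral (cbox a c) (?G t)))
     = (\<integral>\<^sup>+z. ennreal (?G (fst z) (snd z)) * indicator ({t1..t2} \<times> UNIV) z \<partial>lborel)"
  proof (rule nn_integral_slab[symmetric])
    show "continuous_on ({t1..t2} \<times> UNIV) (\<lambda>(t, x). ?G t x)" by (rule continuous_on_subset[OF cG]) (use t1 in auto)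
    show "0 \<le> ?G t x" if "t \<in> {t1..t2}" for t x
      using y0[of t] that t1 by (intro mult_nonneg_nonneg add_nonneg_nonneg) auto
  qed (use ac(2) t1 in auto)
  also have "\<dots> = (\<integral>\<^sup>+z. ennreal (um z * (fst z powr (\<mu>-2) * (y (fst z) + fst z * \<bar>y' (fst z)\<bar>) * eigf k (snd z))) * indicator ({t1..t2} \<times> UNIV) z \<partial>lborel)"
  proof (rule nn_integral_cong)
    fix z :: "real \<times> (real^'n)"
    show "ennreal (?G (fst z) (snd z)) * indicator ({t1..t2} \<times> UNIV) z =
      ennreal (um z * (fst z powr (\<mu>-2) * (y (fst z) + fst z * \<bar>y' (fst z)\<bar>) * eigf k (snd z))) * indicator ({t1..t2} \<times> UNIV) z"
      using umI[of z] t1 by (auto simp: indicator_def mult_ac)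
  qed
  finally show ?thesis .
qed

text \<open>The weight t^\<theta> is split as t^(\<theta>/p) t^(-\<theta>/p), which puts the
  increment of \<open>Y\<close> into one factor. The cone may be inserted into the other because
  \<open>um\<close> vanishes outside it.\<close>

lemma nn_integral_um_Holder:
  assumes t2: "t2 \<in> I" and t1: "1 \<le> t1" "t1 \<le> t2" and pq: "1/p + 1/q = 1"
    and [measurable]: "\<Gamma> \<in> borel_measurable borel" and \<Gamma>0: "\<And>z. \<Gamma> z \<ge> 0"
    and Q: "Q > 0" "(\<integral>\<^sup>+z. (ennreal ((fst z powr (-\<theta>/p) * \<Gamma> z) powr q) * indicator {z. norm (snd z) \<le> R + \<phi> (fst z)} z)
        * indicator ({t1..t2} \<times> UNIV) z \<partial>lborel) \<le> ennreal Q"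
  shows "(\<integral>\<^sup>+z. ennreal (um z * \<Gamma> z) * indicator ({t1..t2} \<times> UNIV) z \<partial>lborel)
     \<le> ennreal ((Y \<theta> t2 - Y \<theta> t1) powr (1/p) * Q powr (1/q))"
proof -
  let ?S = "{t1..t2} \<times> (UNIV :: (real^'n) set)" and ?K = "{z :: real \<times> (real^'n). norm (snd z) \<le> R + \<phi> (fst z)}"
  have "{z \<in> space borel. norm (snd z) \<le> R + \<phi> (fst z)} \<in> sets (borel :: (real \<times> (real^'n)) measure)"
    unfolding \<phi>_def by measurable
  hence [measurable]: "?K \<in> sets borel" by simp
  let ?f = "\<lambda>z. fst z powr (\<theta>/p) * um z * indicator ?S z"
  let ?g = "\<lambda>z. fst z powr (-\<theta>/p) * \<Gamma> z * indicator ?K z * indicator ?S z"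
  have mf: "?f \<in> borel_measurable lborel" and mg: "?g \<in> borel_measurable lborel" by measurable
  have "ennreal (um z * \<Gamma> z) * indicator ?S z = ennreal (?f z * ?g z)" for z
  proof (cases "z \<in> ?S \<and> z \<in> ?K")
    case True
    hence "fst z > 0" using t1 by auto
    hence "fst z powr (\<theta>/p) * fst z powr (-\<theta>/p) = 1" by (simp add: powr_add[symmetric])
    hence "um z * \<Gamma> z = (fst z powr (\<theta>/p) * fst z powr (-\<theta>/p)) * (um z * \<Gamma> z)" by (simp only: mult_1)
    also have "\<dots> = (fst z powr (\<theta>/p) * um z) * (fst z powr (-\<theta>/p) * \<Gamma> z)" by (simp only: mult_ac)
    also have "\<dots> = ?f z * ?g z" using True by simp
    finally have eq: "um z * \<Gamma> z = ?f z * ?g z" .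
    have "ennreal (um z * \<Gamma> z) * indicator ?S z = ennreal (um z * \<Gamma> z)" using True by simp
    thus ?thesis unfolding eq .
  next
    case False
    thus ?thesis using um_outside[of z] by (auto simp: indicator_def)
  qed
  hence "(\<integral>\<^sup>+z. ennreal (um z * \<Gamma> z) * indicator ?S z \<partial>lborel) = (\<integral>\<^sup>+z. ennreal (?f z * ?g z) \<partial>lborel)" by simp
  also have "\<dots> \<le> ennreal ((Y \<theta> t2 - Y \<theta> t1) powr (1/p) * Q powr (1/q))"
  proof (rule nn_integral_Holder[OF mf mg _ _ p pq _ _ Q(1)])
    show "0 \<le> Y \<theta> t2 - Y \<theta> t1" using nn_integral_Y(2)[OF t2 t1, of \<theta>] by simp
    have "ennreal (?f z powr p) = ennreal (fst z powr \<theta> * um z powr p) * indicator ?S z" for z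
      using p by (cases "z \<in> ?S") (auto simp: powr_mult powr_powr)
    thus "(\<integral>\<^sup>+z. ennreal (?f z powr p) \<partial>lborel) \<le> ennreal (Y \<theta> t2 - Y \<theta> t1)"
      using nn_integral_Y(1)[OF t2 t1, of \<theta>] by simp
    have "ennreal (?g z powr q) = (ennreal ((fst z powr (-\<theta>/p) * \<Gamma> z) powr q) * indicator ?K z) * indicator ?S z" for z
      by (auto simp: indicator_def)
    thus "(\<integral>\<^sup>+z. ennreal (?g z powr q) \<partial>lborel) \<le> ennreal Q" using Q(2) by simp
    show "0 \<le> ?f z" "0 \<le> ?g z" for z using \<Gamma>0 by (auto simp: indicator_def)
  qed
  finally show ?thesis .
qed

end

text \<open>The condition \<open>q * e0 + s = -1\<close> expresses that the powers of t combine to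
  1/t, so only the logarithmic length remains.\<close>

lemma nn_integral_weighted_slab:
  fixes v W :: "real \<times> 'a::euclidean_space \<Rightarrow> real"
  assumes [measurable]: "v \<in> borel_measurable borel" "F \<in> borel_measurable borel" and A: "A > 0"
    and t: "1 \<le> t1" "t1 \<le> t2" and B: "B \<ge> 0" and es: "q * e0 + s = -1"
    and inner: "\<And>t. t \<in> {t1..t2} \<Longrightarrow>
      (\<integral>\<^sup>+x. ennreal (v (t, x) powr q) * indicator {x. norm x \<le> F t} x \<partial>lborel) \<le> ennreal (B * t powr s)"
    and W: "\<And>z. z \<in> {t1..t2} \<times> UNIV \<Longrightarrow> W z = A * fst z powr e0 * v z"
  shows "(\<integral>\<^sup>+z. (ennreal (W z powr q) * indicator {z. norm (snd z) \<le> F (fst z)} z) * indicator ({t1..t2} \<times> UNIV) z \<partial>lborel)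
    \<le> ennreal (A powr q * B * (ln t2 - ln t1))"
proof -
  let ?K = "{z :: real \<times> 'a. norm (snd z) \<le> F (fst z)}"
  have "{z \<in> space borel. norm (snd z) \<le> F (fst z)} \<in> sets (borel :: (real \<times> 'a) measure)" by measurable
  hence K [measurable]: "?K \<in> sets borel" by simp
  let ?H = "\<lambda>z. ennreal (A powr q * fst z powr (q * e0)) * (ennreal (v z powr q) * indicator ?K z)"
  have "(\<integral>\<^sup>+z. (ennreal (W z powr q) * indicator ?K z) * indicator ({t1..t2} \<times> UNIV) z \<partial>lborel)
     = (\<integral>\<^sup>+z. ?H z * indicator ({t1..t2} \<times> UNIV) z \<partial>lborel)"
  proof (rule nn_integral_cong)
    fix z :: "real \<times> 'a"
    show "(ennreal (W z powr q) * indicator ?K z) * indicator ({t1..t2} \<times> UNIV) z = ?H z * indicator ({t1..t2} \<times> UNIV) z"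
    proof (cases "z \<in> {t1..t2} \<times> UNIV")
      case True
      have "W z powr q = A powr q * fst z powr (q * e0) * v z powr q"
        unfolding W[OF True] by (simp add: powr_mult powr_powr mult.commute)
      thus ?thesis by (simp add: ennreal_mult mult.assoc)
    qed simp
  qed
  also have "\<dots> \<le> ennreal (A powr q * B * (ln t2 - ln t1))"
  proof (rule nn_integral_slab_le)
    fix t assume tt: "t \<in> {t1..t2}"
    have t0: "t > 0" using tt t by auto
    have "(\<integral>\<^sup>+x. ?H (t, x) \<partial>lborel)
      = ennreal (A powr q * t powr (q * e0)) * (\<integral>\<^sup>+x. ennreal (v (t, x) powr q) * indicator {x. norm x \<le> F t} x \<partial>lborel)"
    proof -
      have "(\<integral>\<^sup>+x. ?H (t, x) \<partial>lborel) = (\<integral>\<^sup>+x. ennreal (A powr q * t powr (q * e0)) * (ennreal (v (t, x) powr q) * indicator {x. norm x \<le> F t} x) \<partial>lborel)"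
        by (intro nn_integral_cong) (simp add: indicator_def)
      also have "\<dots> = ennreal (A powr q * t powr (q * e0)) * (\<integral>\<^sup>+x. ennreal (v (t, x) powr q) * indicator {x. norm x \<le> F t} x \<partial>lborel)"
      proof (rule nn_integral_cmult)
        have "(\<lambda>x. v (t, x)) \<in> borel_measurable borel"
          by (rule measurable_compose[OF _ assms(1)]) (simp add: borel_prod[symmetric])
        thus "(\<lambda>x. ennreal (v (t, x) powr q) * indicator {x. norm x \<le> F t} x) \<in> borel_measurable lborel" by simp
      qed
      finally show ?thesis .
    qed
    also have "\<dots> \<le> ennreal (A powr q * t powr (q * e0)) * ennreal (B * t powr s)"
      by (intro mult_left_mono inner tt) auto
    also have "\<dots> = ennreal (A powr q * B * (t powr (q * e0) * t powr s))"
      using B by (subst ennreal_mult[symmetric]) (auto simp: mult_ac)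
    also have "t powr (q * e0) * t powr s = 1 / t"
      unfolding powr_add[symmetric] es using t0 by (simp add: powr_minus_divide)
    finally show "(\<integral>\<^sup>+x. ?H (t, x) \<partial>lborel) \<le> ennreal (A powr q * B / t)" by simp
  qed (use t B in auto)
  finally show ?thesis .
qed

section \<open>The tested inequality averaged over frequencies\<close>

lemma measurable_cosh [measurable]: "cosh \<in> borel_measurable (borel :: real measure)"
  by (intro borel_measurable_continuous_onI continuous_intros)

lemma measurable_macdonald [measurable]: "macdonald g j \<in> borel_measurable borel"
  unfolding macdonald_def[abs_def]
  by (rule lborel.borel_measurable_lebesgue_integral) measurable

lemma measurable_ysol [measurable (raw)]:
  assumes [measurable]: "k \<in> borel_measurable M" "t \<in> borel_measurable M"
  shows "(\<lambda>w. ysol l \<mu> \<gamma> (k w) (t w)) \<in> borel_measurable M" "(\<lambda>w. ysol1 l \<mu> \<gamma> (k w) (t w)) \<in> borel_measurable M"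
  unfolding ysol_def ysol1_def by measurable

lemma measurable_eigf [measurable (raw)]:
  fixes x :: "'b \<Rightarrow> 'a::euclidean_space"
  assumes [measurable]: "k \<in> borel_measurable M" "x \<in> borel_measurable M"
  shows "(\<lambda>w. eigf (k w) (x w)) \<in> borel_measurable M"
proof -
  have "(\<lambda>(k, x::'a). eigf k x) \<in> borel_measurable borel"
    by (intro borel_measurable_continuous_onI continuous_eigf)
  hence "(\<lambda>(k, x::'a). eigf k x) \<in> borel_measurable (borel \<Otimes>\<^sub>M borel)" by (simp add: borel_prod)
  from measurable_compose[OF measurable_Pair[OF assms] this] show ?thesis by simp
qed

context damped_wave
begin

text \<open>The inequality for fixed k is multiplied by k^\<beta>, integrated over 0 < k <= 1, and
  the order of integration is exchanged on both sides. The data term is nonnegative and dropped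
  here; the data act later through the fixed-frequency inequality.\<close>

lemma frequency_averaged_weak:
  assumes t2: "t2 \<in> I" and t1: "1 \<le> t1" "t1 < t2"
    and \<gamma>: "(2 * (l + 1) * \<gamma>)^2 = (\<mu> - 1)^2 - 4 * nu2" and \<kappa>: "\<kappa> = (\<mu> - 1) / 2 + (l + 1) * \<gamma>"
    and data: "\<And>x. f x \<ge> 0" "\<And>x. g x + \<kappa> * f x \<ge> 0" and c: "c > 0" and C: "C > 0"
    and lower: "\<And>t. t \<ge> 1 \<Longrightarrow> ennreal (c * t powr e1)
     \<le> (\<integral>\<^sup>+k. ennreal (k powr \<beta> * ysol l \<mu> \<gamma> k t) * indicator {0<..1} k \<partial>lborel)"
    and upper: "\<And>t x::real^'n. t \<ge> 1 \<Longrightarrow> norm x \<le> R + t powr (l+1) / (l+1) \<Longrightarrow>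
    (\<integral>\<^sup>+k. ennreal (k powr \<beta> * ((ysol l \<mu> \<gamma> k t + t * \<bar>ysol1 l \<mu> \<gamma> k t\<bar>) * eigf k x)) * indicator {0<..1} k \<partial>lborel)
    \<le> ennreal (C * t powr e2 * (t powr (l+1) / (l+1) - norm x + R + 1) powr e3)"
  defines "d \<equiv> ln t2 - ln t1"
  shows "ennreal (c * Y (\<mu> + e1) t1) \<le> ennreal (6 * (\<bar>\<mu>\<bar> + 2) * (1/d + 1/d^2)) *
      (\<integral>\<^sup>+z. ennreal (um z * (C * fst z powr (\<mu> - 2 + e2) * (\<phi> (fst z) - norm (snd z) + R + 1) powr e3))
          * indicator ({t1..t2} \<times> UNIV) z \<partial>lborel)"
proof -
  let ?E = "ennreal (6 * (\<bar>\<mu>\<bar> + 2) * (1/d + 1/d^2))"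
  let ?L = "\<lambda>k z. (ennreal (k powr \<beta> * ysol l \<mu> \<gamma> k (fst z)) * indicator {0<..1} k) *
      (ennreal (fst z powr \<mu> * um z powr p) * indicator ({1..t1} \<times> UNIV) z)"
  let ?R = "\<lambda>k z. (ennreal (k powr \<beta> * ((ysol l \<mu> \<gamma> k (fst z) + fst z * \<bar>ysol1 l \<mu> \<gamma> k (fst z)\<bar>) * eigf k (snd z))) * indicator {0<..1} k)
      * (ennreal (um z * fst z powr (\<mu>-2)) * indicator ({t1..t2} \<times> UNIV) z)"
  have t1I: "t1 \<in> I" using I_down[OF t2] t1 by auto
  have each: "(\<integral>\<^sup>+z. ?L k z \<partial>lborel) \<le> ?E * (\<integral>\<^sup>+z. ?R k z \<partial>lborel)" for k :: real
  proof (cases "k \<in> {0<..1}")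
    case True
    hence k: "k > 0" by auto
    have w: "(\<integral>\<^sup>+z. ennreal (fst z powr \<mu> * ysol l \<mu> \<gamma> k (fst z) * um z powr p) * indicator ({1..t1} \<times> UNIV) z \<partial>lborel)
      \<le> ?E * (\<integral>\<^sup>+z. ennreal (um z * (fst z powr (\<mu>-2) * (ysol l \<mu> \<gamma> k (fst z) + fst z * \<bar>ysol1 l \<mu> \<gamma> k (fst z)\<bar>) * eigf k (snd z))) * indicator ({t1..t2} \<times> UNIV) z \<partial>lborel)"
    proof (rule order_trans[OF _ nn_integral_weak[OF t2 t1, folded d_def]])
      show "(\<integral>\<^sup>+z. ennreal (fst z powr \<mu> * ysol l \<mu> \<gamma> k (fst z) * um z powr p) * indicator ({1..t1} \<times> UNIV) z \<partial>lborel)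
        \<le> ennreal (ysol l \<mu> \<gamma> k 1 * (LINT x|lborel. g x + \<kappa> * f x)) + (\<integral>\<^sup>+z. ennreal (fst z powr \<mu> * ysol l \<mu> \<gamma> k (fst z) * um z powr p) * indicator ({1..t1} \<times> UNIV) z \<partial>lborel)"
        by (rule add_increasing) auto
      fix t :: real assume t: "t \<ge> 1"
      show "(ysol l \<mu> \<gamma> k has_real_derivative ysol1 l \<mu> \<gamma> k t) (at t)" by (rule DERIV_ysol[OF l k]) (use t in auto)
      show "(ysol1 l \<mu> \<gamma> k has_real_derivative - \<mu> / t * ysol1 l \<mu> \<gamma> k t - (nu2 / t^2 - k^2 * t powr (2*l)) * ysol l \<mu> \<gamma> k t) (at t)"
        by (rule DERIV_ysol1[OF l k _ \<gamma>]) (use t in auto)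
      show "0 \<le> ysol l \<mu> \<gamma> k t" using ysol_pos[OF l k, of t \<mu> \<gamma>] t by simp
    next
      show "\<kappa> * ysol l \<mu> \<gamma> k 1 \<le> - ysol1 l \<mu> \<gamma> k 1" unfolding \<kappa> by (rule ysol1_at_1[OF l k])
    qed (use data in auto)
    have "(\<integral>\<^sup>+z. ?L k z \<partial>lborel) = (\<integral>\<^sup>+z. ennreal (k powr \<beta>) * (ennreal (fst z powr \<mu> * ysol l \<mu> \<gamma> k (fst z) * um z powr p) * indicator ({1..t1} \<times> UNIV) z) \<partial>lborel)"
    proof (rule nn_integral_cong)
      fix z :: "real \<times> (real^'n)"
      show "?L k z = ennreal (k powr \<beta>) * (ennreal (fst z powr \<mu> * ysol l \<mu> \<gamma> k (fst z) * um z powr p) * indicator ({1..t1} \<times> UNIV) z)"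
      proof (cases "fst z \<in> {1..t1}")
        case True
        hence "ysol l \<mu> \<gamma> k (fst z) \<ge> 0" using ysol_pos[OF l k, of "fst z" \<mu> \<gamma>] by auto
        thus ?thesis using \<open>k \<in> {0<..1}\<close> by (simp add: ennreal_mult mult_ac)
      qed (auto simp: indicator_def)
    qed
    also have "\<dots> = ennreal (k powr \<beta>) * (\<integral>\<^sup>+z. ennreal (fst z powr \<mu> * ysol l \<mu> \<gamma> k (fst z) * um z powr p) * indicator ({1..t1} \<times> UNIV) z \<partial>lborel)"
      by (rule nn_integral_cmult) measurable
    also have "\<dots> \<le> ennreal (k powr \<beta>) * (?E * (\<integral>\<^sup>+z. ennreal (um z * (fst z powr (\<mu>-2) * (ysol l \<mu> \<gamma> k (fst z) + fst z * \<bar>ysol1 l \<mu> \<gamma> k (fst z)\<bar>) * eigf k (snd z))) * indicator ({t1..t2} \<times> UNIV) z \<partial>lborel))"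
      by (intro mult_left_mono w) auto
    also have "\<dots> = ?E * (\<integral>\<^sup>+z. ennreal (k powr \<beta>) * (ennreal (um z * (fst z powr (\<mu>-2) * (ysol l \<mu> \<gamma> k (fst z) + fst z * \<bar>ysol1 l \<mu> \<gamma> k (fst z)\<bar>) * eigf k (snd z))) * indicator ({t1..t2} \<times> UNIV) z) \<partial>lborel)"
      by (subst nn_integral_cmult) (measurable, simp add: mult_ac)
    also have "(\<integral>\<^sup>+z. ennreal (k powr \<beta>) * (ennreal (um z * (fst z powr (\<mu>-2) * (ysol l \<mu> \<gamma> k (fst z) + fst z * \<bar>ysol1 l \<mu> \<gamma> k (fst z)\<bar>) * eigf k (snd z))) * indicator ({t1..t2} \<times> UNIV) z) \<partial>lborel)
       = (\<integral>\<^sup>+z. ?R k z \<partial>lborel)"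
    proof (rule nn_integral_cong)
      fix z :: "real \<times> (real^'n)"
      show "ennreal (k powr \<beta>) * (ennreal (um z * (fst z powr (\<mu>-2) * (ysol l \<mu> \<gamma> k (fst z) + fst z * \<bar>ysol1 l \<mu> \<gamma> k (fst z)\<bar>) * eigf k (snd z))) * indicator ({t1..t2} \<times> UNIV) z)
        = ?R k z"
      proof (cases "fst z \<in> {t1..t2}")
        case True
        let ?N = "(ysol l \<mu> \<gamma> k (fst z) + fst z * \<bar>ysol1 l \<mu> \<gamma> k (fst z)\<bar>) * eigf k (snd z)"
        have "ysol l \<mu> \<gamma> k (fst z) \<ge> 0" using ysol_pos[OF l k, of "fst z" \<mu> \<gamma>] True t1 by auto
        hence N: "?N \<ge> 0" using True t1 by (intro mult_nonneg_nonneg add_nonneg_nonneg) auto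
        have "ennreal (k powr \<beta>) * ennreal (um z * (fst z powr (\<mu>-2) * (ysol l \<mu> \<gamma> k (fst z) + fst z * \<bar>ysol1 l \<mu> \<gamma> k (fst z)\<bar>) * eigf k (snd z)))
          = ennreal (k powr \<beta> * (um z * (fst z powr (\<mu>-2) * (ysol l \<mu> \<gamma> k (fst z) + fst z * \<bar>ysol1 l \<mu> \<gamma> k (fst z)\<bar>) * eigf k (snd z))))"
          by (rule ennreal_mult'[symmetric]) simp
        also have "k powr \<beta> * (um z * (fst z powr (\<mu>-2) * (ysol l \<mu> \<gamma> k (fst z) + fst z * \<bar>ysol1 l \<mu> \<gamma> k (fst z)\<bar>) * eigf k (snd z)))
          = (k powr \<beta> * ?N) * (um z * fst z powr (\<mu>-2))" by (simp add: mult_ac)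
        also have "ennreal \<dots> = ennreal (k powr \<beta> * ?N) * ennreal (um z * fst z powr (\<mu>-2))"
          using N by (intro ennreal_mult) auto
        finally show ?thesis using True \<open>k \<in> {0<..1}\<close> by (simp add: mem_Times_iff)
      qed (auto simp: indicator_def)
    qed
    finally show ?thesis .
  qed simp
  have "ennreal (c * Y (\<mu> + e1) t1) = ennreal c * (\<integral>\<^sup>+z. ennreal (fst z powr (\<mu> + e1) * um z powr p) * indicator ({1..t1} \<times> UNIV) z \<partial>lborel)"
    using nn_integral_Y(1)[OF t1I order_refl t1(1)] nn_integral_Y(3)[OF t1I order_refl t1(1)] c by (simp add: ennreal_mult')
  also have "\<dots> = (\<integral>\<^sup>+z. ennreal c * (ennreal (fst z powr (\<mu> + e1) * um z powr p) * indicator ({1..t1} \<times> UNIV) z) \<partial>lborel)"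
    by (rule nn_integral_cmult[symmetric]) measurable
  also have "\<dots> \<le> (\<integral>\<^sup>+z. \<integral>\<^sup>+k. ?L k z \<partial>lborel \<partial>lborel)"
  proof (rule nn_integral_mono)
    fix z :: "real \<times> (real^'n)"
    have "(\<integral>\<^sup>+k. ?L k z \<partial>lborel) = (\<integral>\<^sup>+k. ennreal (k powr \<beta> * ysol l \<mu> \<gamma> k (fst z)) * indicator {0<..1} k \<partial>lborel)
        * (ennreal (fst z powr \<mu> * um z powr p) * indicator ({1..t1} \<times> UNIV) z)"
      by (rule nn_integral_multc) measurable
    moreover have "ennreal c * (ennreal (fst z powr (\<mu> + e1) * um z powr p) * indicator ({1..t1} \<times> UNIV) z)
      \<le> (\<integral>\<^sup>+k. ennreal (k powr \<beta> * ysol l \<mu> \<gamma> k (fst z)) * indicator {0<..1} k \<partial>lborel)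
        * (ennreal (fst z powr \<mu> * um z powr p) * indicator ({1..t1} \<times> UNIV) z)"
    proof (cases "fst z \<in> {1..t1}")
      case True
      have "ennreal c * ennreal (fst z powr (\<mu> + e1) * um z powr p) = ennreal (c * fst z powr e1) * ennreal (fst z powr \<mu> * um z powr p)"
        using c by (simp add: ennreal_mult[symmetric] powr_add mult_ac)
      also have "\<dots> \<le> (\<integral>\<^sup>+k. ennreal (k powr \<beta> * ysol l \<mu> \<gamma> k (fst z)) * indicator {0<..1} k \<partial>lborel) * ennreal (fst z powr \<mu> * um z powr p)"
        using True by (intro mult_right_mono lower) auto
      finally show ?thesis using True by (simp add: mem_Times_iff)
    qed (auto simp: indicator_def)
    ultimately show "ennreal c * (ennreal (fst z powr (\<mu> + e1) * um z powr p) * indicator ({1..t1} \<times> UNIV) z) \<le> (\<integral>\<^sup>+k. ?L k z \<partial>lborel)"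
      by simp
  qed
  also have "\<dots> = (\<integral>\<^sup>+k. \<integral>\<^sup>+z. ?L k z \<partial>lborel \<partial>lborel)"
    by (rule lborel_pair.Fubini') measurable
  also have "\<dots> \<le> (\<integral>\<^sup>+k. ?E * (\<integral>\<^sup>+z. ?R k z \<partial>lborel) \<partial>lborel)" by (rule nn_integral_mono) (rule each)
  also have "\<dots> = ?E * (\<integral>\<^sup>+k. \<integral>\<^sup>+z. ?R k z \<partial>lborel \<partial>lborel)"
    by (rule nn_integral_cmult) measurable
  also have "(\<integral>\<^sup>+k. \<integral>\<^sup>+z. ?R k z \<partial>lborel \<partial>lborel) = (\<integral>\<^sup>+z. \<integral>\<^sup>+k. ?R k z \<partial>lborel \<partial>lborel)"
    by (rule lborel_pair.Fubini'[symmetric]) measurable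
  also have "\<dots> \<le> (\<integral>\<^sup>+z. ennreal (um z * (C * fst z powr (\<mu> - 2 + e2) * (\<phi> (fst z) - norm (snd z) + R + 1) powr e3))
          * indicator ({t1..t2} \<times> UNIV) z \<partial>lborel)"
  proof (rule nn_integral_mono)
    fix z :: "real \<times> (real^'n)"
    have eq: "(\<integral>\<^sup>+k. ?R k z \<partial>lborel) = (\<integral>\<^sup>+k. ennreal (k powr \<beta> * ((ysol l \<mu> \<gamma> k (fst z) + fst z * \<bar>ysol1 l \<mu> \<gamma> k (fst z)\<bar>) * eigf k (snd z))) * indicator {0<..1} k \<partial>lborel)
      * (ennreal (um z * fst z powr (\<mu>-2)) * indicator ({t1..t2} \<times> UNIV) z)"
      by (rule nn_integral_multc) measurable
    show "(\<integral>\<^sup>+k. ?R k z \<partial>lborel) \<le> ennreal (um z * (C * fst z powr (\<mu> - 2 + e2) * (\<phi> (fst z) - norm (snd z) + R + 1) powr e3))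
          * indicator ({t1..t2} \<times> UNIV) z"
    \<comment> \<open>The upper bound holds only inside the forward cone, which is where finite
      speed of propagation confines \<open>um\<close>.\<close>
    proof (cases "fst z \<in> {t1..t2} \<and> um z \<noteq> 0")
      case True
      hence x: "norm (snd z) \<le> R + fst z powr (l+1) / (l+1)" using um_outside[of z] unfolding \<phi>_def by force
      have "(\<integral>\<^sup>+k. ?R k z \<partial>lborel) \<le> ennreal (C * fst z powr e2 * (fst z powr (l+1) / (l+1) - norm (snd z) + R + 1) powr e3) * ennreal (um z * fst z powr (\<mu>-2))"
        unfolding eq using True t1 x by (simp add: mem_Times_iff) (intro mult_right_mono upper, auto)
      also have "\<dots> = ennreal (um z * (C * fst z powr (\<mu> - 2 + e2) * (\<phi> (fst z) - norm (snd z) + R + 1) powr e3))"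
        using C by (simp add: ennreal_mult[symmetric] powr_add \<phi>_def mult_ac)
      finally show ?thesis using True by (simp add: mem_Times_iff)
    next
      case False
      thus ?thesis unfolding eq by (auto simp: indicator_def)
    qed
  qed
  finally show ?thesis by (simp add: mult_left_mono)
qed

end

subsection \<open>Lifespan from integral inequalities\<close>

text \<open>If \<open>Z\<close> doubles at each step and the step lengths are summable, then
  \<open>Z\<close> is unbounded before \<open>s1\<close>, which is absurd. For short steps D the
  factor in \<open>step\<close> is of order D^(-(p+1)), while doubling gains 2^(p-1) on the left, so
  the lengths may shrink geometrically.\<close>

lemma blow_up_iteration:
  fixes Z :: "real \<Rightarrow> real"
  assumes p: "p > 1" and M: "M > 0" and z0: "z0 > 0" and B1: "z0 powr (p - 1) \<le> M"
    and le: "s0 \<le> s1" and Z0: "Z s0 \<ge> z0"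
    and step: "\<And>\<sigma> \<sigma>'. s0 \<le> \<sigma> \<Longrightarrow> \<sigma> < \<sigma>' \<Longrightarrow> \<sigma>' \<le> s1 \<Longrightarrow>
      Z \<sigma> powr p \<le> M * ((1/(\<sigma>'-\<sigma>) + 1/(\<sigma>'-\<sigma>)^2) powr p * (\<sigma>'-\<sigma>) powr (p-1)) * (Z \<sigma>' - Z \<sigma>)"
  shows "s1 - s0 \<le> 2 powr p * M * z0 powr (1 - p) / (1 - 2 powr (-(p-1)/(p+1)))"
proof (rule ccontr)
  \<comment> \<open>Ratio of successive steps, determined by q^(-(p+1)) = 2^(p-1).\<close>
  define q :: real where "q = 2 powr (-(p-1)/(p+1))"
  \<comment> \<open>First step length; the total length of all steps is A/(1-q), the claimed bound.
    The assumption \<open>B1\<close> serves to make A >= 1.\<close>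
  define A where "A = 2 powr p * M * z0 powr (1 - p)"
  assume "\<not> ?thesis"
  hence big: "s1 - s0 > A / (1 - q)" unfolding q_def A_def by simp
  have q0: "q > 0" unfolding q_def by simp
  have q1: "q < 1" unfolding q_def using p powr_less_mono[of "-(p-1)/(p+1)" 0 "2::real"]
    by (simp add: field_simps)
  have qp: "q powr (p+1) = 2 powr (-(p-1))" unfolding q_def using p by (simp add: powr_powr)
  have "z0 powr (p-1) * z0 powr (1-p) = 1" using z0 by (simp add: powr_add[symmetric])
  hence "1 \<le> M * z0 powr (1-p)" using mult_right_mono[OF B1, of "z0 powr (1-p)"] by simp
  moreover have "(1::real) \<le> 2 powr p" using p ge_one_powr_ge_zero[of 2 p] by simp
  ultimately have A1: "A \<ge> 1" unfolding A_def
    using mult_mono[of 1 "2 powr p" 1 "M * z0 powr (1-p)"] by (simp add: mult.assoc)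
  define \<sigma> where "\<sigma> k = s0 + A * (1 - q^k) / (1 - q)" for k :: nat
  have \<sigma>S: "\<sigma> (Suc k) - \<sigma> k = A * q^k" for k
  proof -
    have "\<sigma> (Suc k) - \<sigma> k = A * (q^k - q * q^k) / (1-q)"
      unfolding \<sigma>_def by (simp add: diff_divide_distrib[symmetric] algebra_simps)
    also have "\<dots> = A * q^k * (1 - q) / (1 - q)" by (simp add: algebra_simps)
    finally show ?thesis using q1 by simp
  qed
  have \<sigma>_less: "\<sigma> k < s1" for k
  proof -
    have "A * (1 - q^k) / (1 - q) \<le> A / (1 - q)" using A1 q0 q1
      by (intro divide_right_mono) (auto simp: mult_le_cancel_left1)
    thus ?thesis using big unfolding \<sigma>_def by simp
  qed
  have \<sigma>_ge: "s0 \<le> \<sigma> k" for k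
    unfolding \<sigma>_def using A1 q0 q1 by (simp add: power_le_one)
  have claim: "Z (\<sigma> k) \<ge> 2^k * z0" for k
  proof (induction k)
    case 0 thus ?case using Z0 by (simp add: \<sigma>_def)
  next
    case (Suc k)
    define D where "D = A * q^k"
    have D0: "D > 0" using A1 q0 by (simp add: D_def)
    define E where "E = (1/D + 1/D^2) powr p * D powr (p-1)"
    have "1/D + 1/D^2 > 0" using D0 by (simp add: add_pos_pos)
    hence E0: "E > 0" unfolding E_def using D0 by simp
    have qk: "(q^k) powr (-(p+1)) = 2 powr (k*(p-1))"
    proof -
      have "(q^k) powr (-(p+1)) = (q powr (p+1)) powr (- real k)"
        using q0 by (simp add: powr_realpow[symmetric] powr_powr algebra_simps)
      also have "\<dots> = 2 powr (k*(p-1))" by (subst qp, subst powr_powr) (simp add: algebra_simps)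
      finally show ?thesis .
    qed
    \<comment> \<open>Long steps have the smaller power D^(-1) and short ones D^(-(p+1)); A >= 1 and
      q^k <= 1 reduce both to one bound.\<close>
    have "E \<le> 2 powr p * (A powr (-1) * (q^k) powr (-(p+1)))"
    proof (cases "D \<ge> 1")
      case True
      have "1/D + 1/D^2 \<le> 2/D" using True D0 by (simp add: field_simps power2_eq_square)
      hence "E \<le> (2/D) powr p * D powr (p-1)" unfolding E_def
        using D0 p by (intro mult_right_mono powr_mono2) (auto intro!: add_nonneg_nonneg)
      also have "\<dots> = 2 powr p * (D powr (-p) * D powr (p-1))"
        using D0 by (simp add: powr_divide powr_minus_divide)
      also have "D powr (-p) * D powr (p-1) = D powr (-1)" by (simp add: powr_add[symmetric])
      also have "D powr (-1) = A powr (-1) * (q^k) powr (-1)"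
        unfolding D_def using A1 q0 by (simp add: powr_mult)
      also have "2 powr p * (A powr (-1) * (q^k) powr (-1)) \<le> 2 powr p * (A powr (-1) * (q^k) powr (-(p+1)))"
        using q0 q1 p by (intro mult_left_mono powr_mono') (auto simp: power_le_one)
      finally show ?thesis .
    next
      case False
      have "1/D + 1/D^2 \<le> 2/D^2" using False D0 by (simp add: field_simps power2_eq_square)
      hence "E \<le> (2/D^2) powr p * D powr (p-1)" unfolding E_def
        using D0 p by (intro mult_right_mono powr_mono2) (auto intro!: add_nonneg_nonneg)
      also have "\<dots> = 2 powr p * (D powr (-2*p) * D powr (p-1))"
      proof -
        have "D^2 = D powr 2" using D0 by simp
        hence "(2/D^2) powr p = 2 powr p * D powr (-2*p)"
          by (simp only: powr_divide powr_powr powr_minus_divide) (simp add: powr_minus_divide)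
        thus ?thesis by simp
      qed
      also have "D powr (-2*p) * D powr (p-1) = D powr (-(p+1))" by (simp add: powr_add[symmetric])
      also have "D powr (-(p+1)) = A powr (-(p+1)) * (q^k) powr (-(p+1))"
        unfolding D_def using A1 q0 by (simp add: powr_mult)
      also have "2 powr p * (A powr (-(p+1)) * (q^k) powr (-(p+1))) \<le> 2 powr p * (A powr (-1) * (q^k) powr (-(p+1)))"
        using A1 p by (intro mult_left_mono mult_right_mono powr_mono) auto
      finally show ?thesis .
    qed
    also have "\<dots> = z0 powr (p-1) / M * 2 powr (k*(p-1))"
      unfolding qk A_def using M z0
      by (simp add: powr_mult powr_minus_divide powr_diff field_simps)
    finally have "M * E \<le> z0 powr (p-1) * 2 powr (k*(p-1))" using M by (simp add: field_simps)
    also have "\<dots> = (2^k * z0) powr (p-1)"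
      using z0 by (simp add: powr_mult powr_realpow[symmetric] powr_powr)
    finally have ME: "M * E \<le> (2^k * z0) powr (p-1)" .
    have "(2^k*z0) * (M * E) \<le> (2^k*z0) * (2^k * z0) powr (p-1)"
      using ME z0 by (intro mult_left_mono) auto
    also have "\<dots> = (2^k*z0) powr p" using z0 by (simp add: powr_mult_base)
    also have "\<dots> \<le> Z (\<sigma> k) powr p" using Suc z0 p by (intro powr_mono2) auto
    also have "\<dots> \<le> M * E * (Z (\<sigma> (Suc k)) - Z (\<sigma> k))"
      using step[of "\<sigma> k" "\<sigma> (Suc k)"] \<sigma>_ge[of k] \<sigma>_less[of "Suc k"] \<sigma>S[of k] D0
      unfolding E_def D_def by simp
    finally have "(M * E) * (2^k*z0) \<le> (M * E) * (Z (\<sigma> (Suc k)) - Z (\<sigma> k))"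
      by (simp only: mult.commute)
    hence "2^k*z0 \<le> Z (\<sigma> (Suc k)) - Z (\<sigma> k)" using M E0 mult_le_cancel_left_pos by (metis mult_pos_pos)
    thus ?case using Suc by simp
  qed
  \<comment> \<open>Monotonicity is contained in \<open>step\<close>: its left side is nonnegative
    and the factor in front of the increment is positive.\<close>
  have mono: "Z \<sigma> \<le> Z s1" if "s0 \<le> \<sigma>" "\<sigma> < s1" for \<sigma>
  proof -
    define D where "D = s1 - \<sigma>"
    have "D > 0" using that by (simp add: D_def)
    moreover from this have "1/D + 1/D^2 > 0" by (simp add: add_pos_pos)
    ultimately have "M * ((1/D + 1/D^2) powr p * D powr (p-1)) > 0" using M by simp
    moreover have "0 \<le> M * ((1/D + 1/D^2) powr p * D powr (p-1)) * (Z s1 - Z \<sigma>)"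
      using step[of \<sigma> s1] that unfolding D_def by (smt (verit) powr_ge_zero)
    ultimately show ?thesis by (simp add: zero_le_mult_iff)
  qed
  obtain k :: nat where "Z s1 / z0 < 2^k" using real_arch_pow[of 2 "Z s1 / z0"] by auto
  hence "Z s1 < 2^k * z0" using z0 by (simp add: field_simps)
  thus False using claim[of k] mono[OF \<sigma>_ge[of k] \<sigma>_less[of k]] by simp
qed

text \<open>The unit increments give Z(S/2) at least of order \<epsilon>^p S, and on [S/2, S] the
  factor 1 + \<sigma>' is frozen at 1 + S. The iteration then bounds S/2 by a multiple of
  \<epsilon>^(-p(p-1)) that does not depend on S.\<close>

lemma lifespan_critical:
  fixes p M c :: real
  assumes p: "p > 1" and M: "M > 0" and c: "c > 0"
  shows "\<exists>E>0. \<forall>\<epsilon> Z. 0 < \<epsilon> \<longrightarrow> \<epsilon> \<le> 1 \<longrightarrow> Z 0 \<ge> 0 \<longrightarrow>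
    (\<forall>\<sigma> \<sigma>'. 0 \<le> \<sigma> \<longrightarrow> \<sigma> < \<sigma>' \<longrightarrow> \<sigma>' \<le> E * \<epsilon> powr (- p * (p - 1)) \<longrightarrow> Z \<sigma> \<le> Z \<sigma>' \<and>
      Z \<sigma> powr p \<le> M * (1 + \<sigma>') powr (p - 1) * ((1/(\<sigma>'-\<sigma>) + 1/(\<sigma>'-\<sigma>)^2) powr p * (\<sigma>'-\<sigma>) powr (p-1)) * (Z \<sigma>' - Z \<sigma>)) \<longrightarrow>
    \<not> (\<forall>\<sigma>. 0 \<le> \<sigma> \<longrightarrow> \<sigma> + 1 \<le> E * \<epsilon> powr (- p * (p - 1)) \<longrightarrow> Z (\<sigma> + 1) - Z \<sigma> \<ge> c * \<epsilon> powr p)"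
proof -
  \<comment> \<open>For S >= 4 the integer part of S/2 is at least S/4, which explains c/4; the
    other bound secures the smallness assumption of the iteration.\<close>
  define c1 where "c1 = min (c / 4) (M powr (1 / (p - 1)))"
  have c1: "c1 > 0" "c1 \<le> c / 4" "c1 \<le> M powr (1 / (p - 1))" using c M by (auto simp: c1_def)
  define K where "K = 2 powr p / (1 - 2 powr (-(p-1)/(p+1)))"
  have "2 powr (-(p-1)/(p+1)) < (1::real)" using p powr_less_mono[of "-(p-1)/(p+1)" 0 "2::real"]
    by (simp add: field_simps)
  hence K: "K > 0" unfolding K_def by simp
  define K2 where "K2 = K * M * 2 powr (p - 1) * c1 powr (1 - p)"
  have K2: "K2 > 0" unfolding K2_def using K M c1 by simp
  \<comment> \<open>The summand 4 ensures S >= 4 and makes the final inequality S <= 2 K2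
    \<epsilon>^(-p(p-1)) contradictory.\<close>
  define E where "E = 2 * K2 + 4"
  have False if \<epsilon>: "0 < \<epsilon>" "\<epsilon> \<le> 1" and Z0: "Z 0 \<ge> 0"
    and step: "\<And>\<sigma> \<sigma>'. 0 \<le> \<sigma> \<Longrightarrow> \<sigma> < \<sigma>' \<Longrightarrow> \<sigma>' \<le> E * \<epsilon> powr (- p * (p - 1)) \<Longrightarrow> Z \<sigma> \<le> Z \<sigma>' \<and>
      Z \<sigma> powr p \<le> M * (1 + \<sigma>') powr (p - 1) * ((1/(\<sigma>'-\<sigma>) + 1/(\<sigma>'-\<sigma>)^2) powr p * (\<sigma>'-\<sigma>) powr (p-1)) * (Z \<sigma>' - Z \<sigma>)"
    and conc: "\<And>\<sigma>. 0 \<le> \<sigma> \<Longrightarrow> \<sigma> + 1 \<le> E * \<epsilon> powr (- p * (p - 1)) \<Longrightarrow> Z (\<sigma> + 1) - Z \<sigma> \<ge> c * \<epsilon> powr p"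
    for \<epsilon> :: real and Z :: "real \<Rightarrow> real"
  proof -
    define e where "e = \<epsilon> powr (- p * (p - 1))"
    have "\<epsilon> powr 0 \<le> e" unfolding e_def using \<epsilon> p by (intro powr_mono') auto
    hence e1: "e \<ge> 1" using \<epsilon> by simp
    define S where "S = E * e"
    have S: "S \<ge> 4" unfolding S_def E_def using e1 K2 mult_mono[of 4 "2 * K2 + 4" 1 e] by simp
    have step': "Z \<sigma> \<le> Z \<sigma>'" "Z \<sigma> powr p \<le> M * (1 + \<sigma>') powr (p - 1) * ((1/(\<sigma>'-\<sigma>) + 1/(\<sigma>'-\<sigma>)^2) powr p * (\<sigma>'-\<sigma>) powr (p-1)) * (Z \<sigma>' - Z \<sigma>)"
      if "0 \<le> \<sigma>" "\<sigma> < \<sigma>'" "\<sigma>' \<le> S" for \<sigma> \<sigma>' using step[of \<sigma> \<sigma>'] that unfolding S_def e_def by auto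
    have lin: "real j * (c * \<epsilon> powr p) \<le> Z (real j)" if "real j \<le> S" for j :: nat using that
    proof (induction j)
      case (Suc j)
      thus ?case using conc[of "real j"] unfolding S_def e_def by (simp add: algebra_simps)
    qed (use Z0 in simp)
    define z0 where "z0 = c1 * \<epsilon> powr p * S"
    have z0: "z0 > 0" unfolding z0_def using c1 \<epsilon> S by simp
    have Zs0: "Z (S/2) \<ge> z0"
    proof -
      define j where "j = nat \<lfloor>S/2\<rfloor>"
      have j: "real j \<le> S/2" "S/2 < real j + 1" using S unfolding j_def by linarith+
      have "S/4 \<le> real j" using j S by linarith
      hence "S/4 * (c * \<epsilon> powr p) \<le> real j * (c * \<epsilon> powr p)" using c by (intro mult_right_mono) auto
      also have "\<dots> \<le> Z (real j)" using lin[of j] j S by simp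
      also have "\<dots> \<le> Z (S/2)"
      proof (cases "real j < S/2")
        case True
        thus ?thesis using step'(1)[of "real j" "S/2"] S by simp
      next
        case False
        hence "real j = S/2" using j by simp
        thus ?thesis by (simp only: order_refl)
      qed
      finally have "(c/4) * (\<epsilon> powr p * S) \<le> Z (S/2)" by (simp add: mult_ac)
      moreover have "z0 \<le> (c/4) * (\<epsilon> powr p * S)" unfolding z0_def mult.assoc using c1 S by (intro mult_right_mono) auto
      ultimately show ?thesis by simp
    qed
    define M' where "M' = M * (1 + S) powr (p - 1)"
    have M': "M' > 0" unfolding M'_def using M S by simp
    have B1: "z0 powr (p - 1) \<le> M'"
    proof -
      have "\<epsilon> powr p \<le> 1" using \<epsilon> p by (intro powr_le1) auto
      hence "c1 * \<epsilon> powr p \<le> c1 * 1" using c1 by (intro mult_left_mono) auto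
      hence "c1 * \<epsilon> powr p \<le> M powr (1 / (p - 1))" using c1 by linarith
      hence "z0 \<le> M powr (1 / (p - 1)) * (1 + S)" unfolding z0_def using S by (intro mult_mono) auto
      hence "z0 powr (p - 1) \<le> (M powr (1 / (p - 1)) * (1 + S)) powr (p - 1)" using z0 p by (intro powr_mono2) auto
      also have "\<dots> = M'" unfolding M'_def using M p by (simp add: powr_mult powr_powr)
      finally show ?thesis .
    qed
    have "S - S/2 \<le> 2 powr p * M' * z0 powr (1 - p) / (1 - 2 powr (-(p-1)/(p+1)))"
    proof (rule blow_up_iteration[OF p M' z0 B1, where Z=Z])
      fix \<sigma> \<sigma>' assume s: "S/2 \<le> \<sigma>" "\<sigma> < \<sigma>'" "\<sigma>' \<le> S"
      let ?D = "(1/(\<sigma>'-\<sigma>) + 1/(\<sigma>'-\<sigma>)^2) powr p * (\<sigma>'-\<sigma>) powr (p-1)"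
      have "Z \<sigma> powr p \<le> M * (1 + \<sigma>') powr (p - 1) * ?D * (Z \<sigma>' - Z \<sigma>)" using step'(2)[of \<sigma> \<sigma>'] s S by simp
      also have "\<dots> \<le> M' * ?D * (Z \<sigma>' - Z \<sigma>)"
        unfolding M'_def using step'(1)[of \<sigma> \<sigma>'] s S M p by (intro mult_right_mono mult_left_mono powr_mono2) auto
      finally show "Z \<sigma> powr p \<le> M' * ?D * (Z \<sigma>' - Z \<sigma>)" .
    qed (use Zs0 S in auto)
    hence "S/2 \<le> K * (M' * z0 powr (1 - p))" by (simp add: K_def mult_ac)
    also have "\<dots> \<le> K2 * e"
    proof -
      have "M' \<le> M * (2 * S) powr (p - 1)" unfolding M'_def using S M p by (intro mult_left_mono powr_mono2) auto
      hence "M' * z0 powr (1 - p) \<le> M * (2 * S) powr (p - 1) * z0 powr (1 - p)" by (intro mult_right_mono) auto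
      also have "M * (2 * S) powr (p - 1) * z0 powr (1 - p)
        = M * 2 powr (p - 1) * c1 powr (1 - p) * e * (S powr (p - 1) * S powr (1 - p))"
      proof -
        have "z0 powr (1 - p) = c1 powr (1 - p) * e * S powr (1 - p)"
          unfolding z0_def e_def by (simp add: powr_mult powr_powr algebra_simps)
        thus ?thesis by (simp add: powr_mult)
      qed
      also have "S powr (p - 1) * S powr (1 - p) = 1" using S by (simp add: powr_add[symmetric])
      finally have "K * (M' * z0 powr (1 - p)) \<le> K * (M * 2 powr (p - 1) * c1 powr (1 - p) * e * 1)"
        using K by (intro mult_left_mono) auto
      thus ?thesis by (simp add: K2_def mult_ac)
    qed
    finally have "S \<le> 2 * K2 * e" by simp
    thus False unfolding S_def E_def using e1 by (simp add: algebra_simps)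
  qed
  moreover have "E > 0" using K2 by (simp add: E_def)
  ultimately show ?thesis by (intro exI[of _ E]) blast
qed

text \<open>Without the growing factor and with Z(0) of order \<epsilon>, the iteration starts at
  once and takes a time of order \<epsilon>^(1-p), which is at most \<epsilon>^(-p(p-1)) for
  \<epsilon> <= 1.\<close>

lemma lifespan_subcritical:
  fixes p M c :: real
  assumes p: "p > 1" and M: "M > 0" and c: "c > 0"
  shows "\<exists>E>0. \<forall>\<epsilon> Z. 0 < \<epsilon> \<longrightarrow> \<epsilon> \<le> 1 \<longrightarrow> Z 0 \<ge> c * \<epsilon> \<longrightarrow>
    \<not> (\<forall>\<sigma> \<sigma>'. 0 \<le> \<sigma> \<longrightarrow> \<sigma> < \<sigma>' \<longrightarrow> \<sigma>' \<le> E * \<epsilon> powr (- p * (p - 1)) \<longrightarrow>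
      Z \<sigma> powr p \<le> M * ((1/(\<sigma>'-\<sigma>) + 1/(\<sigma>'-\<sigma>)^2) powr p * (\<sigma>'-\<sigma>) powr (p-1)) * (Z \<sigma>' - Z \<sigma>))"
proof -
  define c1 where "c1 = min c (M powr (1 / (p - 1)))"
  have c1: "c1 > 0" "c1 \<le> c" "c1 \<le> M powr (1 / (p - 1))" using c M by (auto simp: c1_def)
  define K where "K = 2 powr p / (1 - 2 powr (-(p-1)/(p+1)))"
  have "2 powr (-(p-1)/(p+1)) < (1::real)" using p powr_less_mono[of "-(p-1)/(p+1)" 0 "2::real"]
    by (simp add: field_simps)
  hence K: "K > 0" unfolding K_def by simp
  define E where "E = K * M * c1 powr (1 - p) + 1"
  have E: "E > 0" unfolding E_def using K M by (intro add_nonneg_pos) auto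
  have False if \<epsilon>: "0 < \<epsilon>" "\<epsilon> \<le> 1" and Z0: "Z 0 \<ge> c * \<epsilon>"
    and step: "\<And>\<sigma> \<sigma>'. 0 \<le> \<sigma> \<Longrightarrow> \<sigma> < \<sigma>' \<Longrightarrow> \<sigma>' \<le> E * \<epsilon> powr (- p * (p - 1)) \<Longrightarrow>
      Z \<sigma> powr p \<le> M * ((1/(\<sigma>'-\<sigma>) + 1/(\<sigma>'-\<sigma>)^2) powr p * (\<sigma>'-\<sigma>) powr (p-1)) * (Z \<sigma>' - Z \<sigma>)"
    for \<epsilon> :: real and Z :: "real \<Rightarrow> real"
  proof -
    define S where "S = E * \<epsilon> powr (- p * (p - 1))"
    have S: "S > 0" unfolding S_def using E \<epsilon> by simp
    define z0 where "z0 = c1 * \<epsilon>"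
    have "c1 * \<epsilon> \<le> c * \<epsilon>" using c1 \<epsilon> by (intro mult_right_mono) auto
    hence "z0 \<le> Z 0" unfolding z0_def using Z0 by linarith
    moreover have "z0 > 0" using c1 \<epsilon> by (simp add: z0_def)
    ultimately have z0: "z0 > 0" "z0 \<le> Z 0" by auto
    have "z0 \<le> M powr (1 / (p - 1)) * 1" unfolding z0_def using c1 \<epsilon> by (intro mult_mono) auto
    hence "z0 powr (p - 1) \<le> (M powr (1 / (p - 1))) powr (p - 1)" using z0 p by (intro powr_mono2) auto
    also have "\<dots> = M" using M p by (simp add: powr_powr)
    finally have B1: "z0 powr (p - 1) \<le> M" .
    have "S - 0 \<le> 2 powr p * M * z0 powr (1 - p) / (1 - 2 powr (-(p-1)/(p+1)))"
      by (rule blow_up_iteration[OF p M z0(1) B1, where Z=Z]) (use z0 S step in \<open>auto simp: S_def\<close>)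
    hence "S \<le> K * M * c1 powr (1 - p) * \<epsilon> powr (1 - p)"
      by (simp add: K_def z0_def powr_mult mult_ac)
    also have "\<dots> \<le> K * M * c1 powr (1 - p) * \<epsilon> powr (- p * (p - 1))"
    proof (intro mult_left_mono powr_mono')
      have "1 * (p - 1) \<le> p * (p - 1)" using p by (intro mult_right_mono) auto
      thus "- p * (p - 1) \<le> 1 - p" by simp
    qed (use \<epsilon> K M in auto)
    also have "\<dots> < S" unfolding S_def E_def using \<epsilon> by (simp add: algebra_simps)
    finally show False by simp
  qed
  thus ?thesis using E by (intro exI[of _ E]) blast
qed

subsection \<open>The critical exponent\<close>

text \<open>The quadratic equation divided by p, with m = (n-1)/2, solved for the terms with \<mu>;
  in this shape it cancels in the exponents below.\<close>

lemma critical_exponent_identity: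
  fixes l \<mu> p m :: real
  assumes p: "p > 1"
    and crit: "(m * (l+1) + (l + \<mu>)/2) * p^2 - ((m + 1) * (l+1) + (\<mu> - 3*l)/2) * p - (l+1) = 0"
  shows "(p - 1) * (\<mu> + 1) / 2 = p + 1 - (l+1) * ((p+1)/2 - 1/p + m * (p-1))"
proof -
  have "p * ((p - 1) * (\<mu> + 1) / 2) = p * (p + 1 - (l+1) * ((p+1)/2 - 1/p + m * (p-1)))"
  proof -
    have "p * (p + 1 - (l+1) * ((p+1)/2 - r + m * (p-1))) = p^2 + p - (l+1) * ((p^2+p)/2 - p * r + m * (p^2 - p))" for r
      by (simp add: field_simps power2_eq_square)
    hence "p * (p + 1 - (l+1) * ((p+1)/2 - 1/p + m * (p-1))) = p^2 + p - (l+1) * ((p^2+p)/2 - p * (1/p) + m * (p^2 - p))" .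
    also have "p * (1/p) = 1" using p by simp
    also have "p^2 + p - (l+1) * ((p^2+p)/2 - 1 + m * (p^2 - p)) = p * ((p - 1) * (\<mu> + 1) / 2)"
      using crit by (simp add: field_simps power2_eq_square)
    finally show ?thesis by (rule sym)
  qed
  thus ?thesis using p by simp
qed

text \<open>Here criticality of p is used: after Hoelder the time weight, together with t^((l+1) 2m)
  from the spheres, is exactly 1/t. For the averaged test function only the logarithm near the cone
  is left over.\<close>

lemma exponent_wave:
  fixes l \<mu> p m :: real
  assumes p: "p > 1" and q: "q = p / (p - 1)"
    and crit: "(p - 1) * (\<mu> + 1) / 2 = p + 1 - (l+1) * ((p+1)/2 - 1/p + m * (p-1))"
    and \<beta>: "\<beta> = m - 1/2 - 1/p" and \<theta>: "\<theta> = \<mu> + ((1-\<mu>)/2 - (l+1) * (\<beta>+1))"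
  shows "q * (- \<theta> / p + (\<mu> - 2 + ((1-\<mu>)/2 + (l+1) * (1/2-m)))) + (l+1) * (2 * m) = -1"
proof -
  define r where "r = 1 / p"
  have "(p - 1) * (q * (- \<theta> / p + (\<mu> - 2 + ((1-\<mu>)/2 + (l+1) * (1/2-m))))) = p * (- \<theta> / p + (\<mu> - 2 + ((1-\<mu>)/2 + (l+1) * (1/2-m))))"
    using p by (simp add: q)
  also have "\<dots> = p * (- \<theta> / p) + p * (\<mu> - 2 + ((1-\<mu>)/2 + (l+1) * (1/2-m)))" by (rule distrib_left)
  also have "p * (- \<theta> / p) = - \<theta>" using p by simp
  also have "- \<theta> + p * (\<mu> - 2 + ((1-\<mu>)/2 + (l+1) * (1/2-m)))
      = (p - 1) * (\<mu> + 1) / 2 - 2 * p + (l+1) * (p/2 - p * m + m + 1/2 - r)"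
    unfolding \<theta> \<beta> r_def[symmetric] by (simp add: field_simps)
  also have "\<dots> = (p - 1) * (-1 - (l+1) * (2 * m))"
    unfolding crit[folded r_def] by (simp add: field_simps)
  finally have "q * (- \<theta> / p + (\<mu> - 2 + ((1-\<mu>)/2 + (l+1) * (1/2-m)))) = -1 - (l+1) * (2 * m)"
    using p by (simp only: mult_cancel_left) auto
  thus ?thesis by simp
qed

text \<open>The deviation of the left side from -1 equals (l+1)(m + 1/2 - 1/p - \<gamma>), which is
  nonpositive precisely in the range of \<gamma> where the frequency average diverges at 0. The
  factor 2m + 1 is the dimension, since full balls are integrated.\<close>

lemma exponent_damped:
  fixes l \<mu> p m \<gamma> :: real
  assumes p: "p > 1" and q: "q = p / (p - 1)" and l: "l > -1"
    and crit: "(p - 1) * (\<mu> + 1) / 2 = p + 1 - (l+1) * ((p+1)/2 - 1/p + m * (p-1))"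
    and \<gamma>: "m + 1/2 - 1/p \<le> \<gamma>" and \<theta>: "\<theta> = (\<mu> + 1)/2 - (l+1) * \<gamma>"
  shows "q * (- \<theta> / p + (\<theta> - 2)) + (l+1) * (2 * m + 1) \<le> -1"
proof -
  have "q * (- \<theta> / p + (\<theta> - 2)) = \<theta> - 2 * q" unfolding q using p by (simp add: field_simps)
  moreover have "(p - 1) * (\<theta> - 2 * q + (l+1) * (2 * m + 1) + 1) = (p - 1) * ((l+1) * (m + 1/2 - 1/p - \<gamma>))"
  proof -
    have "(p - 1) * q = p" using p by (simp add: q)
    hence "(p - 1) * (\<theta> - 2 * q + (l+1) * (2 * m + 1) + 1) =
       (p - 1) * (\<mu> + 1) / 2 - (p - 1) * ((l+1) * \<gamma>) - 2 * p + (p - 1) * ((l+1) * (2 * m + 1) + 1)"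
      unfolding \<theta> by (simp add: algebra_simps)
    also have "\<dots> = (p - 1) * ((l+1) * (m + 1/2 - 1/p - \<gamma>))"
    proof -
      have pr: "p * (1/p) = 1" using p by simp
      \<comment> \<open>Keeping 1/p opaque makes the identity polynomial; the surplus (l+1)(p r - 1)
        then vanishes.\<close>
      define r where "r = 1 / p"
      have "p + 1 - (l+1) * ((p+1)/2 - r + m * (p-1)) - (p - 1) * ((l+1) * \<gamma>) - 2 * p + (p - 1) * ((l+1) * (2 * m + 1) + 1)
         = (p - 1) * ((l+1) * (m + 1/2 - r - \<gamma>)) + (l+1) * (p * r - 1)"
        by (simp add: field_simps)
      thus ?thesis unfolding crit r_def pr by simp
    qed
    finally show ?thesis .
  qed
  hence "\<theta> - 2 * q + (l+1) * (2 * m + 1) + 1 = (l+1) * (m + 1/2 - 1/p - \<gamma>)" using p by simp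
  moreover have "(l+1) * (m + 1/2 - 1/p - \<gamma>) \<le> 0" using l \<gamma> by (intro mult_nonneg_nonpos) auto
  ultimately show ?thesis by simp
qed

section \<open>Conjugate-power integrals of the three weights over the light cone\<close>

lemma cone_radius_le:
  fixes R l t :: real
  assumes "l > -1" "R > 0" "t \<ge> 1"
  shows "R + t powr (l+1) / (l+1) \<le> (R + 1 / (l+1)) * t powr (l+1)"
proof -
  have "t powr (l+1) \<ge> 1" using assms ge_one_powr_ge_zero[of t "l+1"] by simp
  hence "R * 1 \<le> R * t powr (l+1)" using assms by (intro mult_left_mono) auto
  thus ?thesis by (simp add: distrib_right)
qed

lemma cone_radius_power_le:
  fixes R l t :: real
  assumes "l > -1" "R > 0" "t \<ge> 1"
  shows "(R + t powr (l+1) / (l+1)) ^ j \<le> (R + 1 / (l+1)) ^ j * t powr ((l+1) * real j)"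
proof -
  have "(R + t powr (l+1) / (l+1)) ^ j \<le> ((R + 1 / (l+1)) * t powr (l+1)) ^ j"
    using cone_radius_le[OF assms] assms by (intro power_mono) auto
  also have "\<dots> = (R + 1 / (l+1)) ^ j * t powr ((l+1) * real j)"
    using assms by (simp add: power_mult_distrib powr_powr[symmetric] powr_realpow)
  finally show ?thesis .
qed

lemma real_DIM_diff: "real (DIM('a::euclidean_space) - 1) = real DIM('a) - 1"
  using DIM_positive[where 'a='a] by (simp add: of_nat_diff)

text \<open>Weight of the averaged test function. Its spatial part has the power -1 after raising to
  q, whence the factor 1 + ln t2.\<close>

lemma weight_bound_wave:
  fixes R l p q C e :: real
  assumes l: "l > -1" and R: "R > 0" and pq: "p > 1" "q = p / (p - 1)" and C: "C > 0"
    and e: "q * (- \<theta> / p + e) + (l+1) * (real DIM('a::euclidean_space) - 1) = -1"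
  shows "\<exists>B>0. \<forall>t1 t2. 1 \<le> t1 \<longrightarrow> t1 < t2 \<longrightarrow>
    (\<integral>\<^sup>+z. (ennreal ((fst z powr (-\<theta>/p) * (C * fst z powr e * (fst z powr (l+1) / (l+1) - norm (snd z) + R + 1) powr (1/p - 1))) powr q)
       * indicator {z. norm (snd z) \<le> R + fst z powr (l+1) / (l+1)} z) * indicator ({t1..t2} \<times> UNIV) z \<partial>(lborel :: (real \<times> 'a) measure))
    \<le> ennreal (B * (1 + ln t2) * (ln t2 - ln t1))"
proof -
  let ?n = "DIM('a)"
  define C4 where "C4 = R + 1 / (l+1)"
  have C4: "C4 > 0" unfolding C4_def using l R by (intro add_pos_pos) auto
  define V where "V = real ?n * unit_ball_vol ?n * C4 ^ (?n - 1)"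
  have V: "V > 0" unfolding V_def using C4 by simp
  define Lc where "Lc = ln (C4 + 1) + (l + 1)"
  have "ln (C4 + 1) \<ge> 0" using C4 by simp
  hence Lc: "Lc > 0" unfolding Lc_def using l by linarith
  define B where "B = C powr q * (V * Lc)"
  have B: "B > 0" unfolding B_def using C V Lc by simp
  have q1: "q * (1/p - 1) = -1" using pq by (simp add: field_simps)
  have "(\<integral>\<^sup>+z. (ennreal ((fst z powr (-\<theta>/p) * (C * fst z powr e * (fst z powr (l+1) / (l+1) - norm (snd z) + R + 1) powr (1/p - 1))) powr q)
       * indicator {z. norm (snd z) \<le> R + fst z powr (l+1) / (l+1)} z) * indicator ({t1..t2} \<times> UNIV) z \<partial>(lborel :: (real \<times> 'a) measure))
    \<le> ennreal (C powr q * (V * Lc * (1 + ln t2)) * (ln t2 - ln t1))" if t12: "1 \<le> t1" "t1 < t2" for t1 t2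
  proof (rule nn_integral_weighted_slab[where ?e0.0="-\<theta>/p + e" and s="(l+1) * (real ?n - 1)" and F="\<lambda>t. R + t powr (l+1) / (l+1)"
        and v="\<lambda>z. (fst z powr (l+1) / (l+1) - norm (snd z) + R + 1) powr (1/p - 1)"])
    fix t assume t: "t \<in> {t1..t2}"
    define \<rho> where "\<rho> = R + t powr (l+1) / (l+1)"
    have t1': "t \<ge> 1" using t t12 by auto
    have \<rho>: "\<rho> > 0" unfolding \<rho>_def using R l t1' by (intro add_pos_nonneg) auto
    have "(\<integral>\<^sup>+x. ennreal (((fst (t, x) powr (l+1) / (l+1) - norm (snd (t, x)) + R + 1) powr (1/p - 1)) powr q) * indicator {x. norm x \<le> R + t powr (l+1) / (l+1)} x \<partial>(lborel :: 'a measure))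
      = (\<integral>\<^sup>+x. ennreal ((\<rho> - norm x + 1) powr (-1)) * indicator {x. norm x \<le> \<rho>} x \<partial>(lborel :: 'a measure))"
    proof (intro nn_integral_cong)
      fix x :: 'a
      have "((fst (t, x) powr (l+1) / (l+1) - norm (snd (t, x)) + R + 1) powr (1/p - 1)) powr q = (\<rho> - norm x + 1) powr (-1)"
      proof -
        have "fst (t, x) powr (l+1) / (l+1) - norm (snd (t, x)) + R + 1 = \<rho> - norm x + 1" by (simp add: \<rho>_def)
        moreover have "(1/p - 1) * q = -1" using q1 by (simp only: mult.commute)
        ultimately show ?thesis by (simp only: powr_powr)
      qed
      thus "ennreal (((fst (t, x) powr (l+1) / (l+1) - norm (snd (t, x)) + R + 1) powr (1/p - 1)) powr q) * indicator {x. norm x \<le> R + t powr (l+1) / (l+1)} x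
        = ennreal ((\<rho> - norm x + 1) powr (-1)) * indicator {x. norm x \<le> \<rho>} x" by (simp add: \<rho>_def)
    qed
    also have "\<dots> \<le> ennreal (real ?n * unit_ball_vol ?n * \<rho> ^ (?n - 1) * ln (\<rho> + 1))"
      by (rule nn_integral_cone_log[OF \<rho>])
    also have "\<dots> \<le> ennreal (V * Lc * (1 + ln t2) * t powr ((l+1) * (real ?n - 1)))"
    proof (rule ennreal_leI)
      have tL: "t powr (l+1) \<ge> 1" using t1' l ge_one_powr_ge_zero[of t "l+1"] by simp
      have "\<rho> + 1 \<le> C4 * t powr (l+1) + t powr (l+1)"
        unfolding \<rho>_def C4_def using cone_radius_le[OF l R t1'] tL by simp
      hence "\<rho> + 1 \<le> (C4 + 1) * t powr (l+1)" by (simp add: distrib_right)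
      hence "ln (\<rho> + 1) \<le> ln ((C4 + 1) * t powr (l+1))" using \<rho> by simp
      also have "\<dots> = ln (C4 + 1) + (l+1) * ln t" using C4 t1' by (simp add: ln_mult ln_powr)
      also have "\<dots> \<le> ln (C4 + 1) * (1 + ln t2) + (l+1) * (1 + ln t2)"
      proof (intro add_mono)
        have "ln t \<le> ln t2" using t t12 by simp
        moreover have "0 \<le> ln t" using t1' by simp
        ultimately have "0 \<le> ln t2" "ln t \<le> 1 + ln t2" by linarith+
        thus "ln (C4 + 1) \<le> ln (C4 + 1) * (1 + ln t2)" "(l+1) * ln t \<le> (l+1) * (1 + ln t2)"
          using C4 l by (auto simp: mult_le_cancel_left1 intro!: mult_left_mono)
      qed
      also have "\<dots> = Lc * (1 + ln t2)" by (simp add: Lc_def distrib_right)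
      finally have lnle: "ln (\<rho> + 1) \<le> Lc * (1 + ln t2)" .
      have "\<rho> ^ (?n - 1) \<le> C4 ^ (?n - 1) * t powr ((l+1) * real (?n - 1))"
        unfolding \<rho>_def C4_def by (rule cone_radius_power_le[OF l R t1'])
      hence "real ?n * unit_ball_vol ?n * \<rho> ^ (?n - 1) * ln (\<rho> + 1)
         \<le> real ?n * unit_ball_vol ?n * (C4 ^ (?n - 1) * t powr ((l+1) * real (?n - 1))) * (Lc * (1 + ln t2))"
        using lnle \<rho> C4 by (intro mult_mono mult_left_mono) auto
      thus "real ?n * unit_ball_vol ?n * \<rho> ^ (?n - 1) * ln (\<rho> + 1) \<le> V * Lc * (1 + ln t2) * t powr ((l+1) * (real ?n - 1))"
        unfolding V_def real_DIM_diff by (simp add: mult_ac)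
    qed
    finally show "(\<integral>\<^sup>+x. ennreal (((fst (t, x) powr (l+1) / (l+1) - norm (snd (t, x)) + R + 1) powr (1/p - 1)) powr q) * indicator {x. norm x \<le> R + t powr (l+1) / (l+1)} x \<partial>(lborel :: 'a measure))
      \<le> ennreal (V * Lc * (1 + ln t2) * t powr ((l+1) * (real ?n - 1)))" .
  next
    fix z :: "real \<times> 'a" assume "z \<in> {t1..t2} \<times> UNIV"
    show "fst z powr (-\<theta>/p) * (C * fst z powr e * (fst z powr (l+1) / (l+1) - norm (snd z) + R + 1) powr (1/p - 1))
      = C * fst z powr (-\<theta>/p + e) * (fst z powr (l+1) / (l+1) - norm (snd z) + R + 1) powr (1/p - 1)"
      by (simp only: powr_add mult_ac)
  next
    have "0 \<le> ln t2" using t12 by simp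
    thus "0 \<le> V * Lc * (1 + ln t2)" using V Lc by simp
  qed (use t12 C e in auto)
  thus ?thesis using B by (intro exI[of _ B]) (auto simp: B_def mult_ac)
qed

text \<open>Weight of the test function of one fixed frequency; it has the same time exponent as the
  averaged weight but no logarithmic loss.\<close>

lemma weight_bound_concentrated:
  fixes R l p q C e b :: real
  assumes l: "l > -1" and R: "R > 0" and q: "q > 0" and C: "C > 0" and b: "b > 0"
    and e: "q * (- \<theta> / p + e) + (l+1) * (real DIM('a::euclidean_space) - 1) = -1"
  shows "\<exists>B>0. \<forall>t1 t2. 1 \<le> t1 \<longrightarrow> t1 < t2 \<longrightarrow>
    (\<integral>\<^sup>+z. (ennreal ((fst z powr (-\<theta>/p) * (C * fst z powr e * exp (- b * (fst z powr (l+1) / (l+1) - norm (snd z))))) powr q)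
       * indicator {z. norm (snd z) \<le> R + fst z powr (l+1) / (l+1)} z) * indicator ({t1..t2} \<times> UNIV) z \<partial>(lborel :: (real \<times> 'a) measure))
    \<le> ennreal (B * (ln t2 - ln t1))"
proof -
  let ?n = "DIM('a)"
  define C4 where "C4 = R + 1 / (l+1)"
  have C4: "C4 > 0" unfolding C4_def using l R by (intro add_pos_pos) auto
  define V where "V = real ?n * unit_ball_vol ?n * C4 ^ (?n - 1) * (exp (q * b * R) / (q * b))"
  have V: "V > 0" unfolding V_def using C4 q b by simp
  define B where "B = C powr q * V"
  have B: "B > 0" unfolding B_def using C V by simp
  have "(\<integral>\<^sup>+z. (ennreal ((fst z powr (-\<theta>/p) * (C * fst z powr e * exp (- b * (fst z powr (l+1) / (l+1) - norm (snd z))))) powr q)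
       * indicator {z. norm (snd z) \<le> R + fst z powr (l+1) / (l+1)} z) * indicator ({t1..t2} \<times> UNIV) z \<partial>(lborel :: (real \<times> 'a) measure))
    \<le> ennreal (C powr q * V * (ln t2 - ln t1))" if t12: "1 \<le> t1" "t1 < t2" for t1 t2
  proof (rule nn_integral_weighted_slab[where ?e0.0="-\<theta>/p + e" and s="(l+1) * (real ?n - 1)" and F="\<lambda>t. R + t powr (l+1) / (l+1)"
        and v="\<lambda>z. exp (- b * (fst z powr (l+1) / (l+1) - norm (snd z)))"])
    fix t assume t: "t \<in> {t1..t2}"
    define F where "F = t powr (l+1) / (l+1)"
    have t1': "t \<ge> 1" using t t12 by auto
    have F: "F > 0" unfolding F_def using l t1' by simp
    have "(\<integral>\<^sup>+x. ennreal ((exp (- b * (fst (t, x) powr (l+1) / (l+1) - norm (snd (t, x))))) powr q) * indicator {x. norm x \<le> R + t powr (l+1) / (l+1)} x \<partial>(lborel :: 'a measure))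
      = (\<integral>\<^sup>+x. ennreal (exp (- (q * b) * (F - norm x))) * indicator {x. norm x \<le> R + F} x \<partial>(lborel :: 'a measure))"
      by (intro nn_integral_cong) (simp add: F_def powr_def mult_ac)
    also have "\<dots> \<le> ennreal (real ?n * unit_ball_vol ?n * (R + F) ^ (?n - 1) * (exp (q * b * R) / (q * b)))"
      using nn_integral_cone_exp[OF F, of R "q * b", where 'a='a] R q b by simp
    also have "\<dots> \<le> ennreal (V * t powr ((l+1) * (real ?n - 1)))"
    proof (rule ennreal_leI)
      have "(R + F) ^ (?n - 1) \<le> C4 ^ (?n - 1) * t powr ((l+1) * real (?n - 1))"
        unfolding F_def C4_def by (rule cone_radius_power_le[OF l R t1'])
      hence "real ?n * unit_ball_vol ?n * (R + F) ^ (?n - 1) * (exp (q * b * R) / (q * b))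
         \<le> real ?n * unit_ball_vol ?n * (C4 ^ (?n - 1) * t powr ((l+1) * real (?n - 1))) * (exp (q * b * R) / (q * b))"
        using q b by (intro mult_right_mono mult_left_mono) auto
      thus "real ?n * unit_ball_vol ?n * (R + F) ^ (?n - 1) * (exp (q * b * R) / (q * b)) \<le> V * t powr ((l+1) * (real ?n - 1))"
        unfolding V_def real_DIM_diff by (simp add: mult_ac)
    qed
    finally show "(\<integral>\<^sup>+x. ennreal ((exp (- b * (fst (t, x) powr (l+1) / (l+1) - norm (snd (t, x))))) powr q) * indicator {x. norm x \<le> R + t powr (l+1) / (l+1)} x \<partial>(lborel :: 'a measure))
      \<le> ennreal (V * t powr ((l+1) * (real ?n - 1)))" .
  next
    fix z :: "real \<times> 'a" assume "z \<in> {t1..t2} \<times> UNIV"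
    show "fst z powr (-\<theta>/p) * (C * fst z powr e * exp (- b * (fst z powr (l+1) / (l+1) - norm (snd z))))
      = C * fst z powr (-\<theta>/p + e) * exp (- b * (fst z powr (l+1) / (l+1) - norm (snd z)))"
      by (simp only: powr_add mult_ac)
  qed (use t12 C e V in auto)
  thus ?thesis using B by (intro exI[of _ B]) (auto simp: B_def mult_ac)
qed

text \<open>Weight of the test function that is constant in space.\<close>

lemma weight_bound_constant:
  fixes R l p q C e :: real
  assumes l: "l > -1" and R: "R > 0" and q: "q > 0" and C: "C > 0"
    and e: "q * (- \<theta> / p + e) + (l+1) * real DIM('a::euclidean_space) \<le> -1"
  shows "\<exists>B>0. \<forall>t1 t2. 1 \<le> t1 \<longrightarrow> t1 < t2 \<longrightarrow>
    (\<integral>\<^sup>+z. (ennreal ((fst z powr (-\<theta>/p) * (C * fst z powr e)) powr q)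
       * indicator {z. norm (snd z) \<le> R + fst z powr (l+1) / (l+1)} z) * indicator ({t1..t2} \<times> UNIV) z \<partial>(lborel :: (real \<times> 'a) measure))
    \<le> ennreal (B * (ln t2 - ln t1))"
proof -
  let ?n = "DIM('a)"
  define C4 where "C4 = R + 1 / (l+1)"
  have C4: "C4 > 0" unfolding C4_def using l R by (intro add_pos_pos) auto
  define V where "V = unit_ball_vol ?n * C4 ^ ?n"
  have V: "V > 0" unfolding V_def using C4 by simp
  define B where "B = C powr q * V"
  have B: "B > 0" unfolding B_def using C V by simp
  \<comment> \<open>The exponent condition is only an inequality here; \<open>s\<close> is the exact
    complement, and t^((l+1) n) <= t^s because t >= 1.\<close>
  define s where "s = - 1 - q * (- \<theta> / p + e)"
  have "(\<integral>\<^sup>+z. (ennreal ((fst z powr (-\<theta>/p) * (C * fst z powr e)) powr q)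
       * indicator {z. norm (snd z) \<le> R + fst z powr (l+1) / (l+1)} z) * indicator ({t1..t2} \<times> UNIV) z \<partial>(lborel :: (real \<times> 'a) measure))
    \<le> ennreal (C powr q * V * (ln t2 - ln t1))" if t12: "1 \<le> t1" "t1 < t2" for t1 t2
  proof (rule nn_integral_weighted_slab[where ?e0.0="-\<theta>/p + e" and s=s and F="\<lambda>t. R + t powr (l+1) / (l+1)" and v="\<lambda>z. 1"])
    fix t assume t: "t \<in> {t1..t2}"
    define F where "F = t powr (l+1) / (l+1)"
    have t1': "t \<ge> 1" using t t12 by auto
    have F: "F > 0" unfolding F_def using l t1' by simp
    have "(\<integral>\<^sup>+x. ennreal (1 powr q) * indicator {x. norm x \<le> R + t powr (l+1) / (l+1)} x \<partial>(lborel :: 'a measure))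
      = (\<integral>\<^sup>+x. indicator (cball 0 (R + F)) x \<partial>(lborel :: 'a measure))"
      by (intro nn_integral_cong) (auto simp: F_def indicator_def)
    also have "\<dots> = ennreal (unit_ball_vol ?n * (R + F) ^ ?n)" using R F by (simp add: emeasure_cball)
    also have "\<dots> \<le> ennreal (V * t powr s)"
    proof (rule ennreal_leI)
      have "(R + F) ^ ?n \<le> C4 ^ ?n * t powr ((l+1) * real ?n)"
        unfolding F_def C4_def by (rule cone_radius_power_le[OF l R t1'])
      also have "\<dots> \<le> C4 ^ ?n * t powr s" using e t1' C4 by (intro mult_left_mono powr_mono) (auto simp: s_def)
      finally show "unit_ball_vol ?n * (R + F) ^ ?n \<le> V * t powr s"
        unfolding V_def by (simp add: mult.assoc mult_left_mono)
    qed
    finally show "(\<integral>\<^sup>+x. ennreal (1 powr q) * indicator {x. norm x \<le> R + t powr (l+1) / (l+1)} x \<partial>(lborel :: 'a measure))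
      \<le> ennreal (V * t powr s)" .
  next
    fix z :: "real \<times> 'a" assume "z \<in> {t1..t2} \<times> UNIV"
    show "fst z powr (-\<theta>/p) * (C * fst z powr e) = C * fst z powr (-\<theta>/p + e) * 1"
      by (simp only: powr_add mult_ac mult_1_right mult_1_left)
  qed (use t12 C e V in \<open>auto simp: s_def\<close>)
  thus ?thesis using B by (intro exI[of _ B]) (auto simp: B_def mult_ac)
qed

text \<open>The choice of k gives k \<phi>(t) >= 1 for every t >= 1, so the large-argument bounds
  apply on the whole time interval.\<close>

lemma concentrated_weight_le:
  fixes R l \<mu> \<gamma> :: real
  assumes l: "l > -1" and m: "m = (real DIM('a::euclidean_space) - 1) / 2" and R: "R > 0"
  defines "k \<equiv> max 1 (l+1)"
  shows "\<exists>C>0. \<forall>t\<ge>1. \<forall>x::'a. norm x \<le> R + t powr (l+1) / (l+1) \<longrightarrow>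
    (ysol l \<mu> \<gamma> k t + t * \<bar>ysol1 l \<mu> \<gamma> k t\<bar>) * eigf k x
    \<le> C * t powr ((1-\<mu>)/2 + (l+1)*(1/2-m)) * exp (- (k/2) * (t powr (l+1) / (l+1) - norm x))"
proof -
  have k: "k > 0" "k \<ge> l + 1" by (auto simp: k_def)
  obtain C2 where C2: "C2 > 0" "\<And>x F. 0 < F \<Longrightarrow> norm x \<le> R + F \<Longrightarrow> 1 \<le> k * F \<Longrightarrow>
     macdonald_sum \<gamma> (k * F) * eigf k (x::'a) \<le> C2 * (k * F) powr (1/2 - m) * exp (- k * (F - norm x) / 2)"
    using macdonald_sum_eigf_le[OF m, of k R \<gamma>] R k by (metis less_imp_le order_refl)
  define C where "C = (\<bar>1-\<mu>\<bar> + l + 2) * C2 * (k / (l+1)) powr (1/2 - m)"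
  have D: "\<bar>1-\<mu>\<bar> + l + 2 > 0" using l abs_ge_zero[of "1-\<mu>"] by simp
  have C: "C > 0" unfolding C_def using D C2 k l by simp
  have "(ysol l \<mu> \<gamma> k t + t * \<bar>ysol1 l \<mu> \<gamma> k t\<bar>) * eigf k x
    \<le> C * t powr ((1-\<mu>)/2 + (l+1)*(1/2-m)) * exp (- (k/2) * (t powr (l+1) / (l+1) - norm x))"
    if t: "t \<ge> 1" and x: "norm x \<le> R + t powr (l+1) / (l+1)" for t and x :: 'a
  proof -
    define F where "F = t powr (l+1) / (l+1)"
    have tL: "t powr (l+1) \<ge> 1" using t l ge_one_powr_ge_zero[of t "l+1"] by simp
    have F: "F > 0" using l t by (simp add: F_def)
    have "(l+1) * 1 \<le> k * t powr (l+1)" using k tL l by (intro mult_mono) auto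
    hence kF: "1 \<le> k * F" using l by (simp add: F_def field_simps)
    have "(ysol l \<mu> \<gamma> k t + t * \<bar>ysol1 l \<mu> \<gamma> k t\<bar>) * eigf k x
       \<le> ((\<bar>1-\<mu>\<bar> + l + 2) * t powr ((1-\<mu>)/2) * macdonald_sum \<gamma> (k * F)) * eigf k x"
      unfolding F_def using ysol_weight_le[OF l k(1), of t \<mu> \<gamma>] t by (intro mult_right_mono) auto
    also have "\<dots> = (\<bar>1-\<mu>\<bar> + l + 2) * t powr ((1-\<mu>)/2) * (macdonald_sum \<gamma> (k * F) * eigf k x)" by simp
    also have "\<dots> \<le> (\<bar>1-\<mu>\<bar> + l + 2) * t powr ((1-\<mu>)/2) * (C2 * (k * F) powr (1/2 - m) * exp (- k * (F - norm x) / 2))"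
      using D C2(2)[OF F _ kF, of x] x unfolding F_def by (intro mult_left_mono) auto
    also have "(k * F) powr (1/2 - m) = (k / (l+1)) powr (1/2 - m) * t powr ((l+1) * (1/2 - m))"
    proof -
      have "k * F = k / (l+1) * t powr (l+1)" by (simp add: F_def)
      thus ?thesis by (simp only: powr_mult powr_powr)
    qed
    also have "exp (- k * (F - norm x) / 2) = exp (- (k/2) * (F - norm x))" by simp
    finally show ?thesis unfolding F_def C_def powr_add by (simp only: mult_ac)
  qed
  thus ?thesis using C by blast
qed

subsection \<open>The two cases\<close>

lemma power_quotient_bound:
  fixes c A E X Q p q :: real
  assumes p: "p > 1" and pq: "1/p + 1/q = 1" and nn: "c \<ge> 0" "A \<ge> 0" "E \<ge> 0" "X \<ge> 0" "Q > 0"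
    and le: "c * A \<le> E * (X powr (1/p) * Q powr (1/q))"
  shows "(c * A) powr p \<le> E powr p * Q powr (p - 1) * X"
proof -
  have "1/q = 1 - 1/p" using pq by simp
  hence "1/q * p = p - 1" using p by (simp add: left_diff_distrib)
  hence q: "p / q = p - 1" by simp
  have "(c * A) powr p \<le> (E * (X powr (1/p) * Q powr (1/q))) powr p"
    using p nn by (intro powr_mono2 le) auto
  also have "\<dots> = E powr p * (X * Q powr (p - 1))" using p nn by (simp add: powr_mult powr_powr q)
  finally show ?thesis by (simp add: mult_ac)
qed

lemma Holder_conclusion:
  fixes c A E X Q p q :: real
  assumes p: "p > 1" and pq: "1/p + 1/q = 1" and nn: "c \<ge> 0" "A \<ge> 0" "E \<ge> 0" "X \<ge> 0" "Q > 0"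
    and le: "ennreal (c * A) \<le> ennreal E * N" "N \<le> ennreal (X powr (1/p) * Q powr (1/q))"
  shows "(c * A) powr p \<le> E powr p * Q powr (p - 1) * X"
proof (rule power_quotient_bound[OF p pq nn])
  have "ennreal (c * A) \<le> ennreal E * ennreal (X powr (1/p) * Q powr (1/q))"
    by (rule order_trans[OF le(1)]) (intro mult_left_mono le(2), simp)
  also have "\<dots> = ennreal (E * (X powr (1/p) * Q powr (1/q)))" using nn by (intro ennreal_mult[symmetric]) auto
  finally show "c * A \<le> E * (X powr (1/p) * Q powr (1/q))" using nn by (subst (asm) ennreal_le_iff) auto
qed

text \<open>The constant \<open>E\<close> is fixed before \<epsilon>, the solution and its data; the
  data influence it only through \<open>I0\<close>, \<open>R\<close> and the parameters.\<close>

lemma blow_up_wave_case: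
  fixes l \<mu> nu2 p R \<gamma> I0 :: real
  defines "m \<equiv> (real CARD('n) - 1) / 2"
  assumes l: "l > -1" and p: "p > 1" and R: "R > 0"
    and crit: "(p - 1) * (\<mu> + 1) / 2 = p + 1 - (l+1) * ((p+1)/2 - 1/p + m * (p-1))"
    and \<gamma>: "0 \<le> \<gamma>" "\<gamma> < m + 1/2 - 1/p" "(2 * (l + 1) * \<gamma>)^2 = (\<mu> - 1)^2 - 4 * nu2"
    and \<kappa>: "\<kappa> = (\<mu> - 1) / 2 + (l + 1) * \<gamma>" and I0: "I0 > 0"
  shows "\<exists>E>0. \<forall>\<epsilon> T u ut utt ud udt udd (f :: real^'n \<Rightarrow> real) g. 0 < \<epsilon> \<longrightarrow> \<epsilon> \<le> 1 \<longrightarrow>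
     damped_wave l \<mu> nu2 p R T u ut utt ud udt udd f g \<longrightarrow> (\<forall>x. f x \<ge> 0) \<longrightarrow> (\<forall>x. g x + \<kappa> * f x \<ge> 0) \<longrightarrow>
     (LINT x|lborel. g x + \<kappa> * f x) = \<epsilon> * I0 \<longrightarrow> \<not> ereal (exp (E * \<epsilon> powr (- p * (p - 1)))) < T"
proof -
  have m: "m = (real DIM(real^'n) - 1) / 2" by (simp add: m_def)
  define \<beta> where "\<beta> = m - 1/2 - 1/p"
  define q where "q = p / (p - 1)"
  have q: "q > 0" "1/p + 1/q = 1" using p by (simp_all add: q_def field_simps)
  define e1 where "e1 = (1-\<mu>)/2 - (l+1)*(\<beta>+1)"
  define e2 where "e2 = (1-\<mu>)/2 + (l+1)*(1/2-m)"
  define \<theta> where "\<theta> = \<mu> + e1"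
  have \<beta>1: "\<bar>\<gamma>\<bar> < \<beta> + 1" "\<beta> > -1" using \<gamma> by (auto simp: \<beta>_def)
  have ex: "q * (- \<theta> / p + (\<mu> - 2 + e2)) + (l+1) * (real DIM(real^'n) - 1) = -1"
  proof -
    have mm: "real DIM(real^'n) - 1 = 2 * m" by (simp add: m_def)
    show ?thesis unfolding mm e2_def by (rule exponent_wave[OF p q_def crit \<beta>_def]) (simp only: \<theta>_def e1_def)
  qed
  obtain c where c: "c > 0" "\<And>t. t \<ge> 1 \<Longrightarrow> ennreal (c * t powr e1)
     \<le> (\<integral>\<^sup>+k. ennreal (k powr \<beta> * ysol l \<mu> \<gamma> k t) * indicator {0<..1} k \<partial>lborel)"
    using frequency_integral_lower[OF l \<beta>1(2)] unfolding e1_def by blast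
  obtain C where C: "C > 0" "\<And>t x::real^'n. t \<ge> 1 \<Longrightarrow> norm x \<le> R + t powr (l+1) / (l+1) \<Longrightarrow>
    (\<integral>\<^sup>+k. ennreal (k powr \<beta> * ((ysol l \<mu> \<gamma> k t + t * \<bar>ysol1 l \<mu> \<gamma> k t\<bar>) * eigf k x)) * indicator {0<..1} k \<partial>lborel)
    \<le> ennreal (C * t powr e2 * (t powr (l+1) / (l+1) - norm x + R + 1) powr (1/p - 1))"
    using frequency_integral_upper[OF l m p \<beta>_def \<beta>1(1) R] unfolding e2_def by blast
  obtain B where B: "B > 0" "\<And>t1 t2. 1 \<le> t1 \<Longrightarrow> t1 < t2 \<Longrightarrow>
    (\<integral>\<^sup>+z. (ennreal ((fst z powr (-\<theta>/p) * (C * fst z powr (\<mu> - 2 + e2) * (fst z powr (l+1) / (l+1) - norm (snd z) + R + 1) powr (1/p - 1))) powr q)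
       * indicator {z. norm (snd z) \<le> R + fst z powr (l+1) / (l+1)} z) * indicator ({t1..t2} \<times> UNIV) z \<partial>(lborel :: (real \<times> (real^'n)) measure))
    \<le> ennreal (B * (1 + ln t2) * (ln t2 - ln t1))"
    using weight_bound_wave[OF l R p q_def C(1) ex] by blast
  define k where "k = max 1 (l+1)"
  have k: "k > 0" by (simp add: k_def)
  obtain C' where C': "C' > 0" "\<And>t x::real^'n. t \<ge> 1 \<Longrightarrow> norm x \<le> R + t powr (l+1) / (l+1) \<Longrightarrow>
    (ysol l \<mu> \<gamma> k t + t * \<bar>ysol1 l \<mu> \<gamma> k t\<bar>) * eigf k x
    \<le> C' * t powr e2 * exp (- (k/2) * (t powr (l+1) / (l+1) - norm x))"
    using concentrated_weight_le[OF l m R, of \<mu> \<gamma>] unfolding e2_def k_def by blast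
  obtain B' where B': "B' > 0" "\<And>t1 t2. 1 \<le> t1 \<Longrightarrow> t1 < t2 \<Longrightarrow>
    (\<integral>\<^sup>+z. (ennreal ((fst z powr (-\<theta>/p) * (C' * fst z powr (\<mu> - 2 + e2) * exp (- (k/2) * (fst z powr (l+1) / (l+1) - norm (snd z))))) powr q)
       * indicator {z. norm (snd z) \<le> R + fst z powr (l+1) / (l+1)} z) * indicator ({t1..t2} \<times> UNIV) z \<partial>(lborel :: (real \<times> (real^'n)) measure))
    \<le> ennreal (B' * (ln t2 - ln t1))"
    using weight_bound_concentrated[OF l R q(1) C'(1) _ ex, of "k/2"] k by auto
  define C0 where "C0 = 6 * (\<bar>\<mu>\<bar> + 2)"
  have C0: "C0 > 0" by (simp add: C0_def)
  define M0 where "M0 = (C0 / c) powr p * B powr (p - 1)"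
  have M0: "M0 > 0" using C0 c B by (simp add: M0_def)
  have y1: "ysol l \<mu> \<gamma> k 1 > 0" by (rule ysol_pos[OF l k]) simp
  \<comment> \<open>Increment of \<open>Y\<close> over a unit of logarithmic time at fixed
    frequency; the 2 is 1/d + 1/d^2 for d = 1.\<close>
  define cc where "cc = (ysol l \<mu> \<gamma> k 1 * I0) powr p / ((C0 * 2) powr p * B' powr (p - 1))"
  have cc: "cc > 0" unfolding cc_def using y1 I0 C0 B' by simp
  obtain E where E: "E > 0" and life: "\<And>\<epsilon> Z. 0 < \<epsilon> \<Longrightarrow> \<epsilon> \<le> 1 \<Longrightarrow> Z 0 \<ge> 0 \<Longrightarrow>
    (\<And>\<sigma> \<sigma>'. 0 \<le> \<sigma> \<Longrightarrow> \<sigma> < \<sigma>' \<Longrightarrow> \<sigma>' \<le> E * \<epsilon> powr (- p * (p - 1)) \<Longrightarrow> Z \<sigma> \<le> Z \<sigma>' \<and>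
      Z \<sigma> powr p \<le> M0 * (1 + \<sigma>') powr (p - 1) * ((1/(\<sigma>'-\<sigma>) + 1/(\<sigma>'-\<sigma>)^2) powr p * (\<sigma>'-\<sigma>) powr (p-1)) * (Z \<sigma>' - Z \<sigma>)) \<Longrightarrow>
    (\<And>\<sigma>. 0 \<le> \<sigma> \<Longrightarrow> \<sigma> + 1 \<le> E * \<epsilon> powr (- p * (p - 1)) \<Longrightarrow> Z (\<sigma> + 1) - Z \<sigma> \<ge> cc * \<epsilon> powr p) \<Longrightarrow> False"
  proof -
    obtain E where E: "E > 0" and life: "\<forall>\<epsilon> Z. 0 < \<epsilon> \<longrightarrow> \<epsilon> \<le> 1 \<longrightarrow> Z 0 \<ge> 0 \<longrightarrow>
      (\<forall>\<sigma> \<sigma>'. 0 \<le> \<sigma> \<longrightarrow> \<sigma> < \<sigma>' \<longrightarrow> \<sigma>' \<le> E * \<epsilon> powr (- p * (p - 1)) \<longrightarrow> Z \<sigma> \<le> Z \<sigma>' \<and>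
        Z \<sigma> powr p \<le> M0 * (1 + \<sigma>') powr (p - 1) * ((1/(\<sigma>'-\<sigma>) + 1/(\<sigma>'-\<sigma>)^2) powr p * (\<sigma>'-\<sigma>) powr (p-1)) * (Z \<sigma>' - Z \<sigma>)) \<longrightarrow>
      \<not> (\<forall>\<sigma>. 0 \<le> \<sigma> \<longrightarrow> \<sigma> + 1 \<le> E * \<epsilon> powr (- p * (p - 1)) \<longrightarrow> Z (\<sigma> + 1) - Z \<sigma> \<ge> cc * \<epsilon> powr p)"
      using lifespan_critical[OF p M0 cc] by blast
    show thesis by (rule that[OF E]) (use life in blast)
  qed
  have main: False if \<epsilon>: "0 < \<epsilon>" "\<epsilon> \<le> 1" and dw: "damped_wave l \<mu> nu2 p R T u ut utt ud udt udd f g"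
    and data: "\<And>x. f x \<ge> 0" "\<And>x. g x + \<kappa> * f x \<ge> 0" and J: "(LINT x|lborel. g x + \<kappa> * f x) = \<epsilon> * I0"
    and bT: "ereal (exp (E * \<epsilon> powr (- p * (p - 1)))) < T"
    for \<epsilon> T u ut utt ud udt udd and f g :: "real^'n \<Rightarrow> real"
  proof -
    interpret damped_wave l \<mu> nu2 p R T u ut utt ud udt udd f g by (rule dw)
    have inI: "exp \<sigma> \<in> time_interval T" if "0 \<le> \<sigma>" "\<sigma> \<le> E * \<epsilon> powr (- p * (p - 1))" for \<sigma>
      using that ereal_le_less_trans[OF _ bT, of "exp \<sigma>"] by (simp add: time_interval_def)
    show False
    \<comment> \<open>The lifespan lemma works in the variable \<sigma> = ln t, which turns the
      bound for \<sigma> into an exponential bound for t.\<close>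
    proof (rule life[OF \<epsilon>, of "\<lambda>\<sigma>. Y \<theta> (exp \<sigma>)"])
      show "0 \<le> Y \<theta> (exp 0)" by (simp add: Y_def)
    next
      fix \<sigma> \<sigma>' assume s: "0 \<le> \<sigma>" "\<sigma> < \<sigma>'" "\<sigma>' \<le> E * \<epsilon> powr (- p * (p - 1))"
      have t2: "exp \<sigma>' \<in> time_interval T" and t1: "1 \<le> exp \<sigma>" "exp \<sigma> < exp \<sigma>'" using inI s by auto
      define d where "d = \<sigma>' - \<sigma>"
      have d: "d > 0" using s by (simp add: d_def)
      let ?X = "Y \<theta> (exp \<sigma>') - Y \<theta> (exp \<sigma>)" and ?Q = "B * (1 + \<sigma>') * d" and ?E = "C0 * (1/d + 1/d^2)"
      have X: "Y \<theta> (exp \<sigma>) \<le> Y \<theta> (exp \<sigma>')" using nn_integral_Y(2)[OF t2 t1(1), of \<theta>] t1 by simp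
      have Y0: "Y \<theta> (exp \<sigma>) \<ge> 0"
        using nn_integral_Y(2)[of "exp \<sigma>" 1 \<theta>] nn_integral_Y(3)[of "exp \<sigma>" "exp \<sigma>" \<theta>] inI[of \<sigma>] s by simp
      have Q: "?Q > 0" using B d s by simp
      let ?\<Gamma> = "\<lambda>z :: real \<times> (real^'n). C * fst z powr (\<mu> - 2 + e2) * (\<phi> (fst z) - norm (snd z) + R + 1) powr (1/p - 1)"
      have N: "(\<integral>\<^sup>+z. ennreal (um z * ?\<Gamma> z) * indicator ({exp \<sigma>..exp \<sigma>'} \<times> UNIV) z \<partial>lborel) \<le> ennreal (?X powr (1/p) * ?Q powr (1/q))"
      proof (rule nn_integral_um_Holder[OF t2 t1(1) _ q(2) _ _ Q])
        show "?\<Gamma> \<in> borel_measurable borel" unfolding \<phi>_def borel_prod[symmetric] by measurable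
        show "(\<integral>\<^sup>+z. (ennreal ((fst z powr (-\<theta>/p) * ?\<Gamma> z) powr q) * indicator {z. norm (snd z) \<le> R + \<phi> (fst z)} z)
          * indicator ({exp \<sigma>..exp \<sigma>'} \<times> UNIV) z \<partial>lborel) \<le> ennreal ?Q"
          using B(2)[OF t1] unfolding \<phi>_def d_def by simp
      qed (use t1 C in auto)
      have F: "ennreal (c * Y \<theta> (exp \<sigma>)) \<le> ennreal ?E * (\<integral>\<^sup>+z. ennreal (um z * ?\<Gamma> z) * indicator ({exp \<sigma>..exp \<sigma>'} \<times> UNIV) z \<partial>lborel)"
        using frequency_averaged_weak[OF t2 t1 \<gamma>(3) \<kappa> data c(1) C(1) c(2) C(2)] unfolding \<theta>_def C0_def d_def by simp
      have "(c * Y \<theta> (exp \<sigma>)) powr p \<le> ?E powr p * ?Q powr (p - 1) * ?X"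
        by (rule Holder_conclusion[OF p q(2) _ _ _ _ Q F N]) (use c Y0 X C0 d in auto)
      hence "c powr p * Y \<theta> (exp \<sigma>) powr p \<le> C0 powr p * B powr (p-1) * (1 + \<sigma>') powr (p-1) * ((1/d + 1/d^2) powr p * d powr (p-1)) * ?X"
        by (simp only: powr_mult mult_ac)
      hence "Y \<theta> (exp \<sigma>) powr p \<le> (C0 powr p * B powr (p-1) * (1 + \<sigma>') powr (p-1) * ((1/d + 1/d^2) powr p * d powr (p-1)) * ?X) / c powr p"
        using c by (simp add: pos_le_divide_eq mult.commute)
      also have "\<dots> = M0 * (1 + \<sigma>') powr (p-1) * ((1/d + 1/d^2) powr p * d powr (p-1)) * ?X"
        by (simp add: M0_def powr_divide)
      finally show "Y \<theta> (exp \<sigma>) \<le> Y \<theta> (exp \<sigma>') \<and>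
        Y \<theta> (exp \<sigma>) powr p \<le> M0 * (1 + \<sigma>') powr (p - 1) * ((1/(\<sigma>'-\<sigma>) + 1/(\<sigma>'-\<sigma>)^2) powr p * (\<sigma>'-\<sigma>) powr (p-1)) * (Y \<theta> (exp \<sigma>') - Y \<theta> (exp \<sigma>))"
        using X unfolding d_def by simp
    next
      fix \<sigma> assume s: "0 \<le> \<sigma>" "\<sigma> + 1 \<le> E * \<epsilon> powr (- p * (p - 1))"
      have t2: "exp (\<sigma> + 1) \<in> time_interval T" and t1: "1 \<le> exp \<sigma>" "exp \<sigma> < exp (\<sigma> + 1)" using inI s by auto
      let ?X = "Y \<theta> (exp (\<sigma> + 1)) - Y \<theta> (exp \<sigma>)"
      have X: "?X \<ge> 0" using nn_integral_Y(2)[OF t2 t1(1), of \<theta>] t1 by simp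
      let ?\<Gamma> = "\<lambda>z :: real \<times> (real^'n). C' * fst z powr (\<mu> - 2 + e2) * exp (- (k/2) * (\<phi> (fst z) - norm (snd z)))"
      have N: "(\<integral>\<^sup>+z. ennreal (um z * ?\<Gamma> z) * indicator ({exp \<sigma>..exp (\<sigma> + 1)} \<times> UNIV) z \<partial>lborel) \<le> ennreal (?X powr (1/p) * B' powr (1/q))"
      proof (rule nn_integral_um_Holder[OF t2 t1(1) _ q(2) _ _ B'(1)])
        show "?\<Gamma> \<in> borel_measurable borel" unfolding \<phi>_def borel_prod[symmetric] by measurable
        show "(\<integral>\<^sup>+z. (ennreal ((fst z powr (-\<theta>/p) * ?\<Gamma> z) powr q) * indicator {z. norm (snd z) \<le> R + \<phi> (fst z)} z)
          * indicator ({exp \<sigma>..exp (\<sigma> + 1)} \<times> UNIV) z \<partial>lborel) \<le> ennreal B'"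
          using B'(2)[OF t1] unfolding \<phi>_def by simp
      qed (use t1 C' in auto)
      \<comment> \<open>At fixed frequency the nonlinear term on the left is dropped and the data
        term kept, the opposite of what is done for the average.\<close>
      have "ennreal (ysol l \<mu> \<gamma> k 1 * (\<epsilon> * I0)) \<le> ennreal (ysol l \<mu> \<gamma> k 1 * (LINT x|lborel. g x + \<kappa> * f x))
         + (\<integral>\<^sup>+z. ennreal (fst z powr \<mu> * ysol l \<mu> \<gamma> k (fst z) * um z powr p) * indicator ({1..exp \<sigma>} \<times> UNIV) z \<partial>lborel)"
        unfolding J by (rule add_increasing2) auto
      also have "\<dots> \<le> ennreal (6 * (\<bar>\<mu>\<bar> + 2) * (1/(ln (exp (\<sigma> + 1)) - ln (exp \<sigma>)) + 1/(ln (exp (\<sigma> + 1)) - ln (exp \<sigma>))^2)) *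
         (\<integral>\<^sup>+z. ennreal (um z * (fst z powr (\<mu>-2) * (ysol l \<mu> \<gamma> k (fst z) + fst z * \<bar>ysol1 l \<mu> \<gamma> k (fst z)\<bar>) * eigf k (snd z))) * indicator ({exp \<sigma>..exp (\<sigma> + 1)} \<times> UNIV) z \<partial>lborel)"
      proof (rule nn_integral_weak[OF t2 t1])
        fix t :: real assume t: "t \<ge> 1"
        show "(ysol l \<mu> \<gamma> k has_real_derivative ysol1 l \<mu> \<gamma> k t) (at t)" by (rule DERIV_ysol[OF l k]) (use t in auto)
        show "(ysol1 l \<mu> \<gamma> k has_real_derivative - \<mu> / t * ysol1 l \<mu> \<gamma> k t - (nu2 / t^2 - k^2 * t powr (2*l)) * ysol l \<mu> \<gamma> k t) (at t)"
          by (rule DERIV_ysol1[OF l k _ \<gamma>(3)]) (use t in auto)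
        show "0 \<le> ysol l \<mu> \<gamma> k t" using ysol_pos[OF l k, of t \<mu> \<gamma>] t by simp
      next
        show "\<kappa> * ysol l \<mu> \<gamma> k 1 \<le> - ysol1 l \<mu> \<gamma> k 1" unfolding \<kappa> by (rule ysol1_at_1[OF l k])
      qed (use data in auto)
      also have "\<dots> \<le> ennreal (6 * (\<bar>\<mu>\<bar> + 2) * (1/(ln (exp (\<sigma> + 1)) - ln (exp \<sigma>)) + 1/(ln (exp (\<sigma> + 1)) - ln (exp \<sigma>))^2)) *
         (\<integral>\<^sup>+z. ennreal (um z * ?\<Gamma> z) * indicator ({exp \<sigma>..exp (\<sigma> + 1)} \<times> UNIV) z \<partial>lborel)"
      proof (intro mult_left_mono nn_integral_mono)
        fix z :: "real \<times> (real^'n)"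
        show "ennreal (um z * (fst z powr (\<mu>-2) * (ysol l \<mu> \<gamma> k (fst z) + fst z * \<bar>ysol1 l \<mu> \<gamma> k (fst z)\<bar>) * eigf k (snd z))) * indicator ({exp \<sigma>..exp (\<sigma> + 1)} \<times> UNIV) z
          \<le> ennreal (um z * ?\<Gamma> z) * indicator ({exp \<sigma>..exp (\<sigma> + 1)} \<times> UNIV) z"
        proof (cases "fst z \<in> {exp \<sigma>..exp (\<sigma> + 1)} \<and> um z \<noteq> 0")
          case True
          hence x: "norm (snd z) \<le> R + fst z powr (l+1) / (l+1)" using um_outside[of z] unfolding \<phi>_def by force
          have "fst z powr (\<mu>-2) * ((ysol l \<mu> \<gamma> k (fst z) + fst z * \<bar>ysol1 l \<mu> \<gamma> k (fst z)\<bar>) * eigf k (snd z))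
            \<le> fst z powr (\<mu>-2) * (C' * fst z powr e2 * exp (- (k/2) * (fst z powr (l+1) / (l+1) - norm (snd z))))"
            using order_trans[OF t1(1), of "fst z"] True x by (intro mult_left_mono C'(2)) auto
          also have "\<dots> = ?\<Gamma> z" by (simp add: powr_add \<phi>_def)
          finally have "um z * (fst z powr (\<mu>-2) * (ysol l \<mu> \<gamma> k (fst z) + fst z * \<bar>ysol1 l \<mu> \<gamma> k (fst z)\<bar>) * eigf k (snd z)) \<le> um z * ?\<Gamma> z"
            by (intro mult_left_mono) (simp_all add: mult.assoc)
          thus ?thesis by (intro mult_right_mono ennreal_leI) auto
        next
          case False
          thus ?thesis by (auto simp: indicator_def)
        qed
      qed simp
      finally have F: "ennreal (ysol l \<mu> \<gamma> k 1 * (\<epsilon> * I0)) \<le> ennreal (C0 * 2) * (\<integral>\<^sup>+z. ennreal (um z * ?\<Gamma> z) * indicator ({exp \<sigma>..exp (\<sigma> + 1)} \<times> UNIV) z \<partial>lborel)"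
        by (simp add: C0_def mult.commute)
      have "(ysol l \<mu> \<gamma> k 1 * (\<epsilon> * I0)) powr p \<le> (C0 * 2) powr p * B' powr (p - 1) * ?X"
        by (rule Holder_conclusion[OF p q(2) _ _ _ X B'(1) F N]) (use y1 \<epsilon> I0 C0 in auto)
      moreover have "(ysol l \<mu> \<gamma> k 1 * (\<epsilon> * I0)) powr p = (ysol l \<mu> \<gamma> k 1 * I0) powr p * \<epsilon> powr p"
        by (simp add: powr_mult mult_ac)
      moreover have "(C0 * 2) powr p * B' powr (p - 1) > 0" using C0 B' by simp
      ultimately show "cc * \<epsilon> powr p \<le> ?X" unfolding cc_def by (simp add: pos_divide_le_eq mult.commute)
    qed
  qed
  show ?thesis
  proof (intro exI[of _ E] conjI allI impI E notI)
    fix \<epsilon> T u ut utt ud udt udd and f g :: "real^'n \<Rightarrow> real"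
    assume "0 < \<epsilon>" "\<epsilon> \<le> 1" "damped_wave l \<mu> nu2 p R T u ut utt ud udt udd f g" "\<forall>x. 0 \<le> f x"
      "\<forall>x. 0 \<le> g x + \<kappa> * f x" "(LINT x|lborel. g x + \<kappa> * f x) = \<epsilon> * I0" "ereal (exp (E * \<epsilon> powr (- p * (p - 1)))) < T"
    thus False using main by blast
  qed
qed

text \<open>The test function has frequency 0, so both the data term and the nonlinear term can be
  kept in one functional that starts at size \<epsilon>.\<close>

lemma blow_up_damped_case:
  fixes l \<mu> nu2 p R \<gamma> I0 :: real
  defines "m \<equiv> (real CARD('n) - 1) / 2"
  assumes l: "l > -1" and p: "p > 1" and R: "R > 0"
    and crit: "(p - 1) * (\<mu> + 1) / 2 = p + 1 - (l+1) * ((p+1)/2 - 1/p + m * (p-1))"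
    and \<gamma>: "m + 1/2 - 1/p \<le> \<gamma>" "(2 * (l + 1) * \<gamma>)^2 = (\<mu> - 1)^2 - 4 * nu2"
    and \<kappa>: "\<kappa> = (\<mu> - 1) / 2 + (l + 1) * \<gamma>" and I0: "I0 > 0"
  shows "\<exists>E>0. \<forall>\<epsilon> T u ut utt ud udt udd (f :: real^'n \<Rightarrow> real) g. 0 < \<epsilon> \<longrightarrow> \<epsilon> \<le> 1 \<longrightarrow>
     damped_wave l \<mu> nu2 p R T u ut utt ud udt udd f g \<longrightarrow> (\<forall>x. f x \<ge> 0) \<longrightarrow> (\<forall>x. g x + \<kappa> * f x \<ge> 0) \<longrightarrow>
     (LINT x|lborel. g x + \<kappa> * f x) = \<epsilon> * I0 \<longrightarrow> \<not> ereal (exp (E * \<epsilon> powr (- p * (p - 1)))) < T"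
proof -
  define q where "q = p / (p - 1)"
  have q: "q > 0" "1/p + 1/q = 1" using p by (simp_all add: q_def field_simps)
  define \<theta> where "\<theta> = (\<mu> + 1)/2 - (l+1) * \<gamma>"
  have \<theta>\<kappa>: "\<theta> = \<mu> - \<kappa>" by (simp add: \<theta>_def \<kappa> field_simps)
  have ex: "q * (- \<theta> / p + (\<theta> - 2)) + (l+1) * real DIM(real^'n) \<le> -1"
  proof -
    have mm: "real DIM(real^'n) = 2 * m + 1" by (simp add: m_def diff_divide_distrib)
    show ?thesis unfolding mm by (rule exponent_damped[OF p q_def l crit \<gamma>(1) \<theta>_def])
  qed
  define C where "C = 1 + \<bar>\<kappa>\<bar>"
  have C: "C > 0" by (simp add: C_def)
  obtain B where B: "B > 0" "\<And>t1 t2. 1 \<le> t1 \<Longrightarrow> t1 < t2 \<Longrightarrow>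
    (\<integral>\<^sup>+z. (ennreal ((fst z powr (-\<theta>/p) * (C * fst z powr (\<theta> - 2))) powr q)
       * indicator {z. norm (snd z) \<le> R + fst z powr (l+1) / (l+1)} z) * indicator ({t1..t2} \<times> UNIV) z \<partial>(lborel :: (real \<times> (real^'n)) measure))
    \<le> ennreal (B * (ln t2 - ln t1))"
    using weight_bound_constant[OF l R q(1) C ex] by blast
  define C0 where "C0 = 6 * (\<bar>\<mu>\<bar> + 2)"
  have C0: "C0 > 0" by (simp add: C0_def)
  define M0 where "M0 = C0 powr p * B powr (p - 1)"
  have M0: "M0 > 0" using C0 B by (simp add: M0_def)
  obtain E where E: "E > 0" and life: "\<forall>\<epsilon> Z. 0 < \<epsilon> \<longrightarrow> \<epsilon> \<le> 1 \<longrightarrow> Z 0 \<ge> I0 * \<epsilon> \<longrightarrow>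
    \<not> (\<forall>\<sigma> \<sigma>'. 0 \<le> \<sigma> \<longrightarrow> \<sigma> < \<sigma>' \<longrightarrow> \<sigma>' \<le> E * \<epsilon> powr (- p * (p - 1)) \<longrightarrow>
      Z \<sigma> powr p \<le> M0 * ((1/(\<sigma>'-\<sigma>) + 1/(\<sigma>'-\<sigma>)^2) powr p * (\<sigma>'-\<sigma>) powr (p-1)) * (Z \<sigma>' - Z \<sigma>))"
    using lifespan_subcritical[OF p M0 I0] by blast
  \<comment> \<open>For k = 0 the time equation is of Euler type, and t^(-\<kappa>) solves it
    because \<kappa>^2 - (\<mu> - 1) \<kappa> + nu2 = 0. At t = 1 the data condition -y' = \<kappa>
    y holds with equality.\<close>
  let ?y = "\<lambda>t::real. t powr (-\<kappa>)" and ?y' = "\<lambda>t::real. -\<kappa> * t powr (-\<kappa> - 1)"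
  have y: "(?y has_real_derivative ?y' t) (at t)" if "t \<ge> 1" for t using that by (auto intro!: derivative_eq_intros)
  have y': "(?y' has_real_derivative - \<mu> / t * ?y' t - (nu2 / t^2 - 0^2 * t powr (2*l)) * ?y t) (at t)" if t: "t \<ge> 1" for t
  proof -
    have "(?y' has_real_derivative -\<kappa> * ((-\<kappa> - 1) * t powr (-\<kappa> - 1 - 1))) (at t)"
      using t by (auto intro!: derivative_eq_intros)
    moreover have "-\<kappa> * ((-\<kappa> - 1) * t powr (-\<kappa> - 1 - 1)) = - \<mu> / t * ?y' t - (nu2 / t^2 - 0^2 * t powr (2*l)) * ?y t"
    proof -
      have pw: "t powr (-\<kappa> - 1) = ?y t / t" "t powr (-\<kappa> - 1 - 1) = ?y t / t^2"
        using t by (simp_all only: powr_diff) (simp_all add: power2_eq_square)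
      have "\<kappa> * (\<kappa> + 1) = \<mu> * \<kappa> - nu2"
        using \<gamma>(2) unfolding \<kappa> by (simp add: power2_eq_square field_simps)
      hence "-\<kappa> * (-\<kappa> - 1) = \<mu> * \<kappa> - nu2" by (simp add: algebra_simps)
      hence "-\<kappa> * (-\<kappa> - 1) * (?y t / t^2) = (\<mu> * \<kappa> - nu2) * (?y t / t^2)" by simp
      thus ?thesis unfolding pw by (simp add: algebra_simps power2_eq_square diff_divide_distrib add_divide_distrib)
    qed
    ultimately show ?thesis by simp
  qed
  have main: False if \<epsilon>: "0 < \<epsilon>" "\<epsilon> \<le> 1" and dw: "damped_wave l \<mu> nu2 p R T u ut utt ud udt udd f g"
    and data: "\<And>x. f x \<ge> 0" "\<And>x. g x + \<kappa> * f x \<ge> 0" and J: "(LINT x|lborel. g x + \<kappa> * f x) = \<epsilon> * I0"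
    and bT: "ereal (exp (E * \<epsilon> powr (- p * (p - 1)))) < T"
    for \<epsilon> T u ut utt ud udt udd and f g :: "real^'n \<Rightarrow> real"
  proof -
    interpret damped_wave l \<mu> nu2 p R T u ut utt ud udt udd f g by (rule dw)
    have inI: "exp \<sigma> \<in> time_interval T" if "0 \<le> \<sigma>" "\<sigma> \<le> E * \<epsilon> powr (- p * (p - 1))" for \<sigma>
      using that ereal_le_less_trans[OF _ bT, of "exp \<sigma>"] by (simp add: time_interval_def)
    have "(I0 * \<epsilon> + Y \<theta> (exp \<sigma>)) powr p \<le> M0 * ((1/(\<sigma>'-\<sigma>) + 1/(\<sigma>'-\<sigma>)^2) powr p * (\<sigma>'-\<sigma>) powr (p-1))
       * ((I0 * \<epsilon> + Y \<theta> (exp \<sigma>')) - (I0 * \<epsilon> + Y \<theta> (exp \<sigma>)))"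
      if s: "0 \<le> \<sigma>" "\<sigma> < \<sigma>'" "\<sigma>' \<le> E * \<epsilon> powr (- p * (p - 1))" for \<sigma> \<sigma>'
    proof -
      have t2: "exp \<sigma>' \<in> time_interval T" and t1: "1 \<le> exp \<sigma>" "exp \<sigma> < exp \<sigma>'" using inI s by auto
      have t1I: "exp \<sigma> \<in> time_interval T" using inI s by auto
      define d where "d = \<sigma>' - \<sigma>"
      have d: "d > 0" using s by (simp add: d_def)
      let ?X = "Y \<theta> (exp \<sigma>') - Y \<theta> (exp \<sigma>)" and ?Q = "B * d" and ?E = "C0 * (1/d + 1/d^2)"
      have X: "?X \<ge> 0" using nn_integral_Y(2)[OF t2 t1(1), of \<theta>] t1 by simp
      have Y1: "Y \<theta> 1 = 0" by (simp add: Y_def)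
      have Y0: "Y \<theta> (exp \<sigma>) \<ge> 0" using nn_integral_Y(2)[OF t1I order_refl t1(1), of \<theta>] Y1 by simp
      have Q: "?Q > 0" using B d by simp
      let ?\<Gamma> = "\<lambda>z :: real \<times> (real^'n). C * fst z powr (\<theta> - 2)"
      have N: "(\<integral>\<^sup>+z. ennreal (um z * ?\<Gamma> z) * indicator ({exp \<sigma>..exp \<sigma>'} \<times> UNIV) z \<partial>lborel) \<le> ennreal (?X powr (1/p) * ?Q powr (1/q))"
      proof (rule nn_integral_um_Holder[OF t2 t1(1) _ q(2) _ _ Q])
        show "(\<integral>\<^sup>+z. (ennreal ((fst z powr (-\<theta>/p) * ?\<Gamma> z) powr q) * indicator {z. norm (snd z) \<le> R + \<phi> (fst z)} z)
          * indicator ({exp \<sigma>..exp \<sigma>'} \<times> UNIV) z \<partial>lborel) \<le> ennreal ?Q"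
          using B(2)[OF t1] unfolding \<phi>_def d_def by simp
      qed (use t1 C in auto)
      have e0: "eigf 0 x = 1" for x :: "real^'n"
        using powser_zero[of "rad_coeff (real CARD('n))"] by (simp add: eigf_def rad_def rad_coeff_def)
      have W: "ennreal (?y 1 * (LINT x|lborel. g x + \<kappa> * f x)) +
          (\<integral>\<^sup>+z. ennreal (fst z powr \<mu> * ?y (fst z) * um z powr p) * indicator ({1..exp \<sigma>} \<times> UNIV) z \<partial>lborel)
         \<le> ennreal (6 * (\<bar>\<mu>\<bar> + 2) * (1/(ln (exp \<sigma>') - ln (exp \<sigma>)) + 1/(ln (exp \<sigma>') - ln (exp \<sigma>))^2)) *
         (\<integral>\<^sup>+z. ennreal (um z * (fst z powr (\<mu>-2) * (?y (fst z) + fst z * \<bar>?y' (fst z)\<bar>) * eigf 0 (snd z))) * indicator ({exp \<sigma>..exp \<sigma>'} \<times> UNIV) z \<partial>lborel)"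
        by (rule nn_integral_weak[OF t2 t1 y y']) (use data in auto)
      have "(\<integral>\<^sup>+z. ennreal (fst z powr \<mu> * ?y (fst z) * um z powr p) * indicator ({1..exp \<sigma>} \<times> UNIV) z \<partial>lborel)
         = (\<integral>\<^sup>+z. ennreal (fst z powr \<theta> * um z powr p) * indicator ({1..exp \<sigma>} \<times> UNIV) z \<partial>lborel)"
        by (simp add: \<theta>\<kappa> powr_add[symmetric])
      also have "\<dots> = ennreal (Y \<theta> (exp \<sigma>))"
        using nn_integral_Y(1)[OF t1I order_refl t1(1), of \<theta>] Y1 by simp
      finally have L: "(\<integral>\<^sup>+z. ennreal (fst z powr \<mu> * ?y (fst z) * um z powr p) * indicator ({1..exp \<sigma>} \<times> UNIV) z \<partial>lborel) = ennreal (Y \<theta> (exp \<sigma>))" .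
      have Rr: "(\<integral>\<^sup>+z. ennreal (um z * (fst z powr (\<mu>-2) * (?y (fst z) + fst z * \<bar>?y' (fst z)\<bar>) * eigf 0 (snd z))) * indicator ({exp \<sigma>..exp \<sigma>'} \<times> UNIV) z \<partial>lborel)
        = (\<integral>\<^sup>+z. ennreal (um z * ?\<Gamma> z) * indicator ({exp \<sigma>..exp \<sigma>'} \<times> UNIV) z \<partial>lborel)"
      proof (rule nn_integral_cong)
        fix z :: "real \<times> (real^'n)"
        show "ennreal (um z * (fst z powr (\<mu>-2) * (?y (fst z) + fst z * \<bar>?y' (fst z)\<bar>) * eigf 0 (snd z))) * indicator ({exp \<sigma>..exp \<sigma>'} \<times> UNIV) z
          = ennreal (um z * ?\<Gamma> z) * indicator ({exp \<sigma>..exp \<sigma>'} \<times> UNIV) z"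
        proof (cases "fst z \<in> {exp \<sigma>..exp \<sigma>'}")
          case True
          hence t: "fst z > 0" using less_le_trans[OF exp_gt_zero[of \<sigma>], of "fst z"] by auto
          have "fst z * \<bar>?y' (fst z)\<bar> = \<bar>\<kappa>\<bar> * ?y (fst z)" using t by (simp add: abs_mult powr_diff)
          hence "fst z powr (\<mu>-2) * (?y (fst z) + fst z * \<bar>?y' (fst z)\<bar>) = C * (fst z powr (\<mu>-2) * ?y (fst z))"
            by (simp add: C_def algebra_simps)
          also have "fst z powr (\<mu>-2) * ?y (fst z) = fst z powr (\<theta> - 2)"
            unfolding powr_add[symmetric] \<theta>\<kappa> by (simp add: algebra_simps)
          finally show ?thesis by (simp add: e0)
        qed (auto simp: indicator_def)
      qed
      have "ennreal (1 * (I0 * \<epsilon> + Y \<theta> (exp \<sigma>))) = ennreal (?y 1 * (LINT x|lborel. g x + \<kappa> * f x)) +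
          (\<integral>\<^sup>+z. ennreal (fst z powr \<mu> * ?y (fst z) * um z powr p) * indicator ({1..exp \<sigma>} \<times> UNIV) z \<partial>lborel)"
        unfolding L J using Y0 I0 \<epsilon> by (simp add: ennreal_plus mult.commute)
      also have "\<dots> \<le> ennreal ?E * (\<integral>\<^sup>+z. ennreal (um z * ?\<Gamma> z) * indicator ({exp \<sigma>..exp \<sigma>'} \<times> UNIV) z \<partial>lborel)"
        using W unfolding Rr C0_def d_def by simp
      finally have F: "ennreal (1 * (I0 * \<epsilon> + Y \<theta> (exp \<sigma>))) \<le> ennreal ?E * (\<integral>\<^sup>+z. ennreal (um z * ?\<Gamma> z) * indicator ({exp \<sigma>..exp \<sigma>'} \<times> UNIV) z \<partial>lborel)" .
      have "(1 * (I0 * \<epsilon> + Y \<theta> (exp \<sigma>))) powr p \<le> ?E powr p * ?Q powr (p - 1) * ?X"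
        by (rule Holder_conclusion[OF p q(2) _ _ _ X Q F N]) (use Y0 I0 \<epsilon> C0 d in auto)
      also have "?E powr p * ?Q powr (p - 1) * ?X = M0 * ((1/d + 1/d^2) powr p * d powr (p-1)) * ?X"
        by (simp only: M0_def powr_mult mult_ac)
      finally show ?thesis unfolding d_def by simp
    qed
    moreover have "I0 * \<epsilon> + Y \<theta> (exp 0) \<ge> I0 * \<epsilon>" by (simp add: Y_def)
    ultimately show False using life[rule_format, OF \<epsilon>, of "\<lambda>\<sigma>. I0 * \<epsilon> + Y \<theta> (exp \<sigma>)"] by blast
  qed
  show ?thesis
  proof (intro exI[of _ E] conjI allI impI E notI)
    fix \<epsilon> T u ut utt ud udt udd and f g :: "real^'n \<Rightarrow> real"
    assume "0 < \<epsilon>" "\<epsilon> \<le> 1" "damped_wave l \<mu> nu2 p R T u ut utt ud udt udd f g" "\<forall>x. 0 \<le> f x"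
      "\<forall>x. 0 \<le> g x + \<kappa> * f x" "(LINT x|lborel. g x + \<kappa> * f x) = \<epsilon> * I0" "ereal (exp (E * \<epsilon> powr (- p * (p - 1)))) < T"
    thus False using main by blast
  qed
qed

lemma Ck_on_imp_continuous: "Ck_on k S f \<Longrightarrow> continuous_on S f"
  by (cases k) (auto intro: has_derivative_continuous_on)

lemma supp_zero: "supp f \<subseteq> ball 0 R \<Longrightarrow> norm x \<ge> R \<Longrightarrow> f x = 0"
  unfolding supp_def using closure_subset[of "{x. f x \<noteq> 0}"] by force

theorem theorem1p2:
  fixes l \<mu> nu2 \<delta> p R :: real
    and u0 u1 :: "real^'n \<Rightarrow> real"
  assumes "l > -1" and "\<mu> \<ge> 0" and "nu2 \<ge> 0"
    and "\<delta> = (\<mu> - 1)^2 - 4 * nu2" and "\<delta> \<ge> 0"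
    and "p > 1" and "is_p_Str (real CARD('n) + \<mu> / (l + 1)) l p"
    and "Ck0 2 u0" and "Ck0 1 u1"
    and "\<And>x. u0 x \<ge> 0" and "\<And>x. u1 x \<ge> 0"
    and "\<exists>x. u0 x \<noteq> 0 \<or> u1 x \<noteq> 0"
    and "R > 0" and "supp u0 \<subseteq> ball 0 R" and "supp u1 \<subseteq> ball 0 R"
    and "\<And>x. u1 x + (\<mu> - 1 - sqrt \<delta>) / 2 * u0 x \<ge> 0"
    and "(\<integral>x. u1 x + (\<mu> - 1 + sqrt \<delta>) / 2 * u0 x \<partial>lborel) > 0"
  shows "\<exists>\<epsilon>0>0. \<exists>E>0. \<forall>\<epsilon>. 0 < \<epsilon> \<and> \<epsilon> \<le> \<epsilon>0 \<longrightarrow>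
    (\<forall>T u. solution_with_lifespan l \<mu> nu2 p (\<lambda>x. \<epsilon> * u0 x) (\<lambda>x. \<epsilon> * u1 x) T u \<longrightarrow>
       T < \<infinity> \<and> T \<le> ereal (exp (E * \<epsilon> powr (- p * (p - 1)))))"
proof -
  define \<gamma> where "\<gamma> = sqrt \<delta> / (2 * (l + 1))"
  define \<kappa> where "\<kappa> = (\<mu> - 1 + sqrt \<delta>) / 2"
  define m where "m = (real CARD('n) - 1) / 2"
  define I0 where "I0 = (\<integral>x. u1 x + \<kappa> * u0 x \<partial>lborel)"
  have "l + 1 \<noteq> 0" using assms(1) by simp
  hence lg: "(l + 1) * \<gamma> = sqrt \<delta> / 2" unfolding \<gamma>_def by (metis mult.commute nonzero_mult_divide_mult_cancel_left times_divide_eq_right)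
  have \<gamma>: "0 \<le> \<gamma>" "(2 * (l + 1) * \<gamma>)^2 = (\<mu> - 1)^2 - 4 * nu2"
  proof -
    show "0 \<le> \<gamma>" using assms(1,5) by (simp add: \<gamma>_def)
    have "2 * (l + 1) * \<gamma> = sqrt \<delta>" using lg by (simp only: mult.assoc)
    thus "(2 * (l + 1) * \<gamma>)^2 = (\<mu> - 1)^2 - 4 * nu2" using assms(4,5) by simp
  qed
  have \<kappa>: "\<kappa> = (\<mu> - 1) / 2 + (l + 1) * \<gamma>" unfolding \<kappa>_def lg by (simp add: add_divide_distrib)
  have I0: "I0 > 0" using assms(17) by (simp add: I0_def \<kappa>_def)
  have "(m * (l+1) + (l + \<mu>)/2) * p^2 - ((m + 1) * (l+1) + (\<mu> - 3*l)/2) * p - (l+1) = 0"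
  proof -
    have m1: "m + 1 = (real CARD('n) + 1) / 2" by (simp add: m_def diff_divide_distrib add_divide_distrib)
    show ?thesis using assms(7) unfolding is_p_Str_shifted_iff[OF assms(1)] m1 by (simp add: m_def)
  qed
  hence crit: "(p - 1) * (\<mu> + 1) / 2 = p + 1 - (l+1) * ((p+1)/2 - 1/p + m * (p-1))"
    by (rule critical_exponent_identity[OF assms(6)])
  have "\<exists>E>0. \<forall>\<epsilon> T u ut utt ud udt udd (f :: real^'n \<Rightarrow> real) g. 0 < \<epsilon> \<longrightarrow> \<epsilon> \<le> 1 \<longrightarrow>
     damped_wave l \<mu> nu2 p R T u ut utt ud udt udd f g \<longrightarrow> (\<forall>x. f x \<ge> 0) \<longrightarrow> (\<forall>x. g x + \<kappa> * f x \<ge> 0) \<longrightarrow>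
     (LINT x|lborel. g x + \<kappa> * f x) = \<epsilon> * I0 \<longrightarrow> \<not> ereal (exp (E * \<epsilon> powr (- p * (p - 1)))) < T"
  \<comment> \<open>The threshold is \<beta> + 1, up to which k^(\<beta> - \<gamma>) is integrable
    at k = 0.\<close>
  proof (cases "\<gamma> < m + 1/2 - 1/p")
    case True
    thus ?thesis using blow_up_wave_case[OF assms(1,6,13) crit[unfolded m_def] \<gamma>(1) _ \<gamma>(2) \<kappa> I0] unfolding m_def by blast
  next
    case False
    hence "m + 1/2 - 1/p \<le> \<gamma>" by simp
    thus ?thesis using blow_up_damped_case[OF assms(1,6,13) crit[unfolded m_def] _ \<gamma>(2) \<kappa> I0] unfolding m_def by blast
  qed
  then obtain E where E: "E > 0" and blow: "\<And>\<epsilon> T u ut utt ud udt udd (f :: real^'n \<Rightarrow> real) g. 0 < \<epsilon> \<Longrightarrow> \<epsilon> \<le> 1 \<Longrightarrow>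
     damped_wave l \<mu> nu2 p R T u ut utt ud udt udd f g \<Longrightarrow> (\<forall>x. f x \<ge> 0) \<Longrightarrow> (\<forall>x. g x + \<kappa> * f x \<ge> 0) \<Longrightarrow>
     (LINT x|lborel. g x + \<kappa> * f x) = \<epsilon> * I0 \<Longrightarrow> \<not> ereal (exp (E * \<epsilon> powr (- p * (p - 1)))) < T"
    by blast
  have le: "T \<le> ereal (exp (E * \<epsilon> powr (- p * (p - 1))))"
    if \<epsilon>: "0 < \<epsilon>" "\<epsilon> \<le> 1" and sol: "solution_with_lifespan l \<mu> nu2 p (\<lambda>x. \<epsilon> * u0 x) (\<lambda>x. \<epsilon> * u1 x) T u" for \<epsilon> T u
  proof -
    have c: "continuous_on UNIV u0" "continuous_on UNIV u1"
      using Ck_on_imp_continuous assms(8,9) unfolding Ck0_def by blast+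
    have sol': "classical_solution l \<mu> nu2 p (\<lambda>x. \<epsilon> * u0 x) (\<lambda>x. \<epsilon> * u1 x) T u"
      using sol by (simp add: solution_with_lifespan_def)
    obtain ut utt ud udt udd where dw: "damped_wave l \<mu> nu2 p R T u ut utt ud udt udd (\<lambda>x. \<epsilon> * u0 x) (\<lambda>x. \<epsilon> * u1 x)"
      using classical_solution_damped_wave[OF sol' assms(1,6,13)] supp_zero[OF assms(14)] supp_zero[OF assms(15)]
        c[THEN continuous_on_mult_left] by auto
    have "\<not> ereal (exp (E * \<epsilon> powr (- p * (p - 1)))) < T"
    proof (rule blow[OF \<epsilon> dw])
      show "\<forall>x. 0 \<le> \<epsilon> * u0 x" using \<epsilon> assms(10) by simp
      show "\<forall>x. 0 \<le> \<epsilon> * u1 x + \<kappa> * (\<epsilon> * u0 x)"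
      proof
        fix x
        \<comment> \<open>The pointwise hypothesis concerns the smaller root; since u0 >= 0, it
          implies the sign condition with the larger root \<kappa>.\<close>
        have "(\<mu> - 1 - sqrt \<delta>) / 2 * u0 x \<le> \<kappa> * u0 x"
          unfolding \<kappa>_def using assms(5,10) by (intro mult_right_mono divide_right_mono) auto
        hence "0 \<le> u1 x + \<kappa> * u0 x" using assms(16)[of x] by linarith
        hence "0 \<le> \<epsilon> * (u1 x + \<kappa> * u0 x)" using \<epsilon> by simp
        thus "0 \<le> \<epsilon> * u1 x + \<kappa> * (\<epsilon> * u0 x)" by (simp add: algebra_simps)
      qed
      have "(\<lambda>x. \<epsilon> * u1 x + \<kappa> * (\<epsilon> * u0 x)) = (\<lambda>x. \<epsilon> * (u1 x + \<kappa> * u0 x))" by (simp add: algebra_simps)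
      thus "(LINT x|lborel. \<epsilon> * u1 x + \<kappa> * (\<epsilon> * u0 x)) = \<epsilon> * I0" by (simp add: I0_def)
    qed
    thus ?thesis by simp
  qed
  show ?thesis
  \<comment> \<open>The threshold 1 suffices: smallness of \<epsilon> is used only to compare its
    powers, while \<open>E\<close> takes up the dependence on the data.\<close>
  proof (rule exI[of _ "1::real"], intro conjI zero_less_one, rule exI[of _ E], intro conjI E allI impI)
    fix \<epsilon> T u assume "0 < \<epsilon> \<and> \<epsilon> \<le> 1" "solution_with_lifespan l \<mu> nu2 p (\<lambda>x. \<epsilon> * u0 x) (\<lambda>x. \<epsilon> * u1 x) T u"
    hence T: "T \<le> ereal (exp (E * \<epsilon> powr (- p * (p - 1))))" using le by blast
    show "T \<le> ereal (exp (E * \<epsilon> powr (- p * (p - 1))))" by (rule T)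
    show "T < \<infinity>" by (rule le_less_trans[OF T]) simp
  qed
qed

end
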